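(* Work in $\mathsf{ZF}_2$ and assume there is a proper class of weak Löwenheim–Skolem cardinals. Let $\kappa$ be an ordinal. Then the following are equivalent: (1) $\kappa$ is $V$-critical; (2) there is a $V$-criticality pre-witness $(\kappa,\delta,N,j)$ with $\mathrm{cof}(\delta)>\omega$; (3) there is a $V$-criticality pre-witness $(\kappa,\delta,N,j)$ such that $\mathrm{Ult}_0(V,E_j)$ is wellfounded, where $E_j$ is the extender derived from $j$. In particular, $V$-criticality is first-order definable over $V$.
   Context: $\mathsf{ZF}_2$ is the two-sorted theory of models $(V,\in,P)$ with $(V,\in)\models\mathsf{ZF}$ and $P$ a collection of classes, with Separation and Collection for sets and Separation for classes, for all formulas of the two-sorted language. $\kappa$ is $V$-critical iff there is a (class) elementary $j:V\to M$ with $M\subseteq V$ transitive and critical point $\kappa$. A cardinal $\delta$ is weak Löwenheim–Skolem (wLS) iff for every $\gamma<\delta$, every ordinal $\alpha\ge\delta$ and every $x\in V_\alpha$ there is $X\preccurlyeq V_\alpha$ with $V_\gamma\subseteq X$, $x\in X$ and the transitive collapse of $X$ in $V_\delta$. A $V$-criticality pre-witness is a tuple $(\kappa,\delta,N,j)$ with $\delta$ wLS, $N$ a transitive model of $\mathsf{RL}$ (the theory: Empty Set, Extensionality, Foundation, Pairing, Union, Power Set, Separation, "$\alpha+1$, $V_\alpha$ and $\langle V_\beta\rangle_{\beta<\alpha}$ exist for each ordinal $\alpha$", "every set is in some $V_\alpha$"), and $j:V_\delta\to N$ $\in$-cofinal (each $y\in N$ lies in some $j(x)$), $\Sigma_1$-elementary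 with critical point $\kappa$. Extenders and ultrapowers: An index is a finite rank-extensional set $r$ (distinct $x,y\in r$ of equal rank are separated by some $z\in r$). For indices $a,b$, $a\approx b$ iff $(a,\in,\approx_{\mathrm{rank}})\cong(b,\in,\approx_{\mathrm{rank}})$ (where $x\approx_{\mathrm{rank}}y$ iff equal rank), via a unique isomorphism $\pi^{ab}$. $\langle X\rangle^{<\omega}$ is the set of indices $\subseteq X$. For indices $a\subseteq c$ and $u\approx c$, $u^{ca}=\pi^{cu}[a]$. The extender $E_j$ derived from $j:V_\delta\to N$ is the set of pairs $(A,a)$ with $a\in\langle N\rangle^{<\omega}$, $A\subseteq V_\delta$ and $a\in\bigcup_{\alpha<\delta}j(A\cap V_\alpha)$; $E_a=\{A:(A,a)\in E_j\}$. For $f$ with domain $\langle V_\delta\rangle^{<\omega}$ and $a\subseteq c$ in $\langle N\rangle^{<\omega}$, $f^{ac}(u)=f(u^{ca})$ if $u\approx c$, else $\emptyset$. $\mathrm{Ult}_0(V,E_j)$ has as elements the classes $[a,f]$ of pairs with $a\in\langle N\rangle^{<\omega}$ and $f:\langle V_\delta\rangle^{<\omega}\to V$, where $(a,f)\sim(b,g)$ iff for some/all $c\supseteq a\cup b$ in $\langle N\rangle^{<\omega}$, $\{u:f^{ac}(u)=g^{bc}(u)\}\in E_c$, and $[a,f]\in[b,g]$ iff $\{u:f^{ac}(u)\in g^{bc}(u)\}\in E_c$.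
   Formalization: Index isomorphisms preserve ∈ and comparison of ranks, not just equality of rank; otherwise π^{ab} is not unique (swap {∅} and {{{∅}}}) and Ult_0 is undefined. The formula defining V-criticality is uniform over all models with a given underlying domain. *)

theory Defs
  imports Main
begin

text \<open>
  A structure for the two-sorted language consists of the universe of a type \<open>'v\<close>, a binary
  relation \<open>E\<close> on it, and a collection \<open>P\<close> of subsets of it (the classes).  The set theory below is
  carried out \<^emph>\<open>inside\<close> such a structure: apart from the schemas of the theory and the final
  definability claim, quantifiers range over elements of \<open>'v\<close> (or over \<open>P\<close>), never over arbitrary
  HOL subsets of \<open>'v\<close>.  In particular natural numbers, finiteness, formulas, satisfaction and
  wellfoundedness are those of the structure, which may be ill-founded or \<open>\<omega>\<close>-nonstandard.
\<close>

section \<open>The two-sorted language and the theory\<close>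

text \<open>Variables of both sorts are numbered.  Equality of classes is left out, being definable by
  extensionality.\<close>

datatype fm2 =
    Mem nat nat
  | Eq nat nat
  | MemC nat nat
  | Neg fm2
  | And fm2 fm2
  | Ex nat fm2
  | ExC nat fm2

primrec sat2 ::
  "('v \<Rightarrow> 'v \<Rightarrow> bool) \<Rightarrow> 'v set set \<Rightarrow> (nat \<Rightarrow> 'v) \<Rightarrow> (nat \<Rightarrow> 'v set) \<Rightarrow> fm2 \<Rightarrow> bool" where
  "sat2 E P e C (Mem i k) \<longleftrightarrow> E (e i) (e k)"
| "sat2 E P e C (Eq i k) \<longleftrightarrow> e i = e k"
| "sat2 E P e C (MemC i k) \<longleftrightarrow> e i \<in> C k"
| "sat2 E P e C (Neg \<phi>) \<longleftrightarrow> \<not> sat2 E P e C \<phi>"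
| "sat2 E P e C (And \<phi> \<psi>) \<longleftrightarrow> sat2 E P e C \<phi> \<and> sat2 E P e C \<psi>"
| "sat2 E P e C (Ex i \<phi>) \<longleftrightarrow> (\<exists>x. sat2 E P (e(i := x)) C \<phi>)"
| "sat2 E P e C (ExC i \<phi>) \<longleftrightarrow> (\<exists>X\<in>P. sat2 E P e (C(i := X)) \<phi>)"

primrec first_order :: "fm2 \<Rightarrow> bool" where
  "first_order (Mem i k) \<longleftrightarrow> True"
| "first_order (Eq i k) \<longleftrightarrow> True"
| "first_order (MemC i k) \<longleftrightarrow> False"
| "first_order (Neg \<phi>) \<longleftrightarrow> first_order \<phi>"
| "first_order (And \<phi> \<psi>) \<longleftrightarrow> first_order \<phi> \<and> first_order \<psi>"
| "first_order (Ex i \<phi>) \<longleftrightarrow> first_order \<phi>"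
| "first_order (ExC i \<phi>) \<longleftrightarrow> False"

context
  fixes E :: "'v \<Rightarrow> 'v \<Rightarrow> bool"  (infix \<open>\<epsilon>\<close> 50)
begin

subsection \<open>Notions relativized to a domain\<close>

text \<open>The parameter \<open>D\<close> bounds all quantifiers, so that \<open>D = UNIV\<close> gives the notion in the sense of
  the whole structure and \<open>D = elts N\<close> the notion in the sense of the substructure \<open>N\<close>.\<close>

definition elts :: "'v \<Rightarrow> 'v set" where
  "elts a = {x. x \<epsilon> a}"

definition sub_in :: "'v set \<Rightarrow> 'v \<Rightarrow> 'v \<Rightarrow> bool" where
  "sub_in D x y \<longleftrightarrow> (\<forall>z\<in>D. z \<epsilon> x \<longrightarrow> z \<epsilon> y)"

definition is_empty_in :: "'v set \<Rightarrow> 'v \<Rightarrow> bool" where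
  "is_empty_in D z \<longleftrightarrow> (\<forall>x\<in>D. \<not> x \<epsilon> z)"

definition is_upair_in :: "'v set \<Rightarrow> 'v \<Rightarrow> 'v \<Rightarrow> 'v \<Rightarrow> bool" where
  "is_upair_in D a b z \<longleftrightarrow> (\<forall>x\<in>D. x \<epsilon> z \<longleftrightarrow> x = a \<or> x = b)"

definition is_opair_in :: "'v set \<Rightarrow> 'v \<Rightarrow> 'v \<Rightarrow> 'v \<Rightarrow> bool" where
  "is_opair_in D a b p \<longleftrightarrow>
     (\<exists>s\<in>D. \<exists>t\<in>D. is_upair_in D a a s \<and> is_upair_in D a b t \<and> is_upair_in D s t p)"

definition is_succ_in :: "'v set \<Rightarrow> 'v \<Rightarrow> 'v \<Rightarrow> bool" where
  "is_succ_in D a s \<longleftrightarrow> (\<forall>x\<in>D. x \<epsilon> s \<longleftrightarrow> x \<epsilon> a \<or> x = a)"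

definition maps_to_in :: "'v set \<Rightarrow> 'v \<Rightarrow> 'v \<Rightarrow> 'v \<Rightarrow> bool" where
  "maps_to_in D f x y \<longleftrightarrow> (\<exists>p\<in>D. p \<epsilon> f \<and> is_opair_in D x y p)"

definition is_function_in :: "'v set \<Rightarrow> 'v \<Rightarrow> 'v \<Rightarrow> bool" where
  "is_function_in D f A \<longleftrightarrow>
     (\<forall>p\<in>D. p \<epsilon> f \<longrightarrow> (\<exists>x\<in>D. \<exists>y\<in>D. x \<epsilon> A \<and> is_opair_in D x y p)) \<and>
     (\<forall>x\<in>D. x \<epsilon> A \<longrightarrow> (\<exists>!y. y \<in> D \<and> maps_to_in D f x y))"

definition is_ordinal_in :: "'v set \<Rightarrow> 'v \<Rightarrow> bool" where
  "is_ordinal_in D a \<longleftrightarrow>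
     (\<forall>x\<in>D. x \<epsilon> a \<longrightarrow> sub_in D x a) \<and>
     (\<forall>x\<in>D. \<forall>y\<in>D. x \<epsilon> a \<and> y \<epsilon> a \<longrightarrow> x \<epsilon> y \<or> x = y \<or> y \<epsilon> x)"

text \<open>\<open>f = \<langle>V\<^sub>\<beta>\<rangle>\<^bsub>\<beta> < \<alpha>\<^esub>\<close> and \<open>v = V\<^sub>\<alpha>\<close>, where \<open>V\<^sub>\<beta>\<close> is the union of the power sets of the \<open>V\<^sub>\<gamma>\<close>,
  \<open>\<gamma> < \<beta>\<close>.\<close>

definition is_Vstage_in :: "'v set \<Rightarrow> 'v \<Rightarrow> 'v \<Rightarrow> 'v \<Rightarrow> bool" where
  "is_Vstage_in D f \<beta> v \<longleftrightarrow>
     (\<forall>x\<in>D. x \<epsilon> v \<longleftrightarrow> (\<exists>\<gamma>\<in>D. \<gamma> \<epsilon> \<beta> \<and> (\<exists>w\<in>D. maps_to_in D f \<gamma> w \<and> sub_in D x w)))"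

definition is_Vseq_in :: "'v set \<Rightarrow> 'v \<Rightarrow> 'v \<Rightarrow> bool" where
  "is_Vseq_in D \<alpha> f \<longleftrightarrow>
     is_function_in D f \<alpha> \<and>
     (\<forall>\<beta>\<in>D. \<beta> \<epsilon> \<alpha> \<longrightarrow> (\<forall>v\<in>D. maps_to_in D f \<beta> v \<longrightarrow> is_Vstage_in D f \<beta> v))"

definition is_V_in :: "'v set \<Rightarrow> 'v \<Rightarrow> 'v \<Rightarrow> bool" where
  "is_V_in D \<alpha> v \<longleftrightarrow> (\<exists>f\<in>D. is_Vseq_in D \<alpha> f \<and> is_Vstage_in D f \<alpha> v)"

definition is_inductive_in :: "'v set \<Rightarrow> 'v \<Rightarrow> bool" where
  "is_inductive_in D I \<longleftrightarrow>
     (\<exists>z\<in>D. z \<epsilon> I \<and> is_empty_in D z) \<and>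
     (\<forall>x\<in>D. x \<epsilon> I \<longrightarrow> (\<exists>s\<in>D. s \<epsilon> I \<and> is_succ_in D x s))"

definition extensionality_in :: "'v set \<Rightarrow> bool" where
  "extensionality_in D \<longleftrightarrow> (\<forall>x\<in>D. \<forall>y\<in>D. (\<forall>z\<in>D. z \<epsilon> x \<longleftrightarrow> z \<epsilon> y) \<longrightarrow> x = y)"

definition foundation_in :: "'v set \<Rightarrow> bool" where
  "foundation_in D \<longleftrightarrow>
     (\<forall>x\<in>D. (\<exists>y\<in>D. y \<epsilon> x) \<longrightarrow> (\<exists>y\<in>D. y \<epsilon> x \<and> (\<forall>z\<in>D. z \<epsilon> y \<longrightarrow> \<not> z \<epsilon> x)))"

definition pairing_in :: "'v set \<Rightarrow> bool" where
  "pairing_in D \<longleftrightarrow> (\<forall>x\<in>D. \<forall>y\<in>D. \<exists>z\<in>D. is_upair_in D x y z)"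

definition union_in :: "'v set \<Rightarrow> bool" where
  "union_in D \<longleftrightarrow> (\<forall>x\<in>D. \<exists>u\<in>D. \<forall>z\<in>D. z \<epsilon> u \<longleftrightarrow> (\<exists>y\<in>D. y \<epsilon> x \<and> z \<epsilon> y))"

definition power_set_in :: "'v set \<Rightarrow> bool" where
  "power_set_in D \<longleftrightarrow> (\<forall>x\<in>D. \<exists>p\<in>D. \<forall>z\<in>D. z \<epsilon> p \<longleftrightarrow> sub_in D z x)"

subsection \<open>The theory of sets and classes\<close>

definition ZF2 :: "'v set set \<Rightarrow> bool" where
  "ZF2 P \<longleftrightarrow>
     extensionality_in UNIV \<and> foundation_in UNIV \<and> pairing_in UNIV \<and> union_in UNIV \<and>
     power_set_in UNIV \<and> (\<exists>I. is_inductive_in UNIV I) \<and>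
     (\<forall>\<phi> e C a. (\<forall>i. C i \<in> P) \<longrightarrow>
        (\<exists>b. \<forall>x. x \<epsilon> b \<longleftrightarrow> x \<epsilon> a \<and> sat2 E P (e(0 := x)) C \<phi>)) \<and>
     (\<forall>\<phi> e C a. (\<forall>i. C i \<in> P) \<longrightarrow>
        (\<forall>x. x \<epsilon> a \<longrightarrow> (\<exists>y. sat2 E P (e(0 := x, 1 := y)) C \<phi>)) \<longrightarrow>
        (\<exists>b. \<forall>x. x \<epsilon> a \<longrightarrow> (\<exists>y. y \<epsilon> b \<and> sat2 E P (e(0 := x, 1 := y)) C \<phi>))) \<and>
     UNIV \<in> P \<and>
     (\<forall>\<phi> e C. \<forall>A\<in>P. (\<forall>i. C i \<in> P) \<longrightarrow> {x \<in> A. sat2 E P (e(0 := x)) C \<phi>} \<in> P)"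

section \<open>Set theory inside the structure\<close>

text \<open>The definite descriptions below denote under the axioms of set theory wherever they are used.\<close>

definition setof :: "('v \<Rightarrow> bool) \<Rightarrow> 'v" where
  "setof Q = (THE z. \<forall>x. x \<epsilon> z \<longleftrightarrow> Q x)"

definition subset :: "'v \<Rightarrow> 'v \<Rightarrow> bool" where
  "subset x y \<longleftrightarrow> sub_in UNIV x y"

definition empty_set :: 'v where
  "empty_set = setof (\<lambda>x. False)"

definition succ_set :: "'v \<Rightarrow> 'v" where
  "succ_set a = setof (\<lambda>x. x \<epsilon> a \<or> x = a)"

definition omega :: 'v where
  "omega = setof (\<lambda>n. \<forall>I. is_inductive_in UNIV I \<longrightarrow> n \<epsilon> I)"

definition opair :: "'v \<Rightarrow> 'v \<Rightarrow> 'v" where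
  "opair a b = (THE p. is_opair_in UNIV a b p)"

definition app :: "'v \<Rightarrow> 'v \<Rightarrow> 'v" where
  "app f x = (THE y. maps_to_in UNIV f x y)"

definition maps :: "'v \<Rightarrow> 'v \<Rightarrow> 'v \<Rightarrow> bool" where
  "maps f A B \<longleftrightarrow> is_function_in UNIV f A \<and> (\<forall>x\<in>elts A. app f x \<epsilon> B)"

definition bijection :: "'v \<Rightarrow> 'v \<Rightarrow> 'v \<Rightarrow> bool" where
  "bijection f A B \<longleftrightarrow> maps f A B \<and> (\<forall>y\<in>elts B. \<exists>!x. x \<epsilon> A \<and> app f x = y)"

definition ordinal :: "'v \<Rightarrow> bool" where
  "ordinal a \<longleftrightarrow> is_ordinal_in UNIV a"

definition ord_le :: "'v \<Rightarrow> 'v \<Rightarrow> bool" where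
  "ord_le a b \<longleftrightarrow> a \<epsilon> b \<or> a = b"

definition cardinal :: "'v \<Rightarrow> bool" where
  "cardinal a \<longleftrightarrow> ordinal a \<and> \<not> (\<exists>b f. b \<epsilon> a \<and> bijection f b a)"

definition cof :: "'v \<Rightarrow> 'v" where
  "cof a = (THE b. ordinal b \<and>
     (\<exists>f. maps f b a \<and> (\<forall>x\<in>elts a. \<exists>y\<in>elts b. ord_le x (app f y))) \<and>
     (\<forall>c. ordinal c \<and> (\<exists>f. maps f c a \<and> (\<forall>x\<in>elts a. \<exists>y\<in>elts c. ord_le x (app f y)))
        \<longrightarrow> ord_le b c))"

definition Vset :: "'v \<Rightarrow> 'v" where
  "Vset a = (THE v. is_V_in UNIV a v)"

definition rank :: "'v \<Rightarrow> 'v" where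
  "rank x = (THE a. ordinal a \<and> subset x (Vset a) \<and>
     (\<forall>b. ordinal b \<and> subset x (Vset b) \<longrightarrow> ord_le a b))"

definition transitive_class :: "'v set \<Rightarrow> bool" where
  "transitive_class D \<longleftrightarrow> (\<forall>x\<in>D. elts x \<subseteq> D)"

definition is_collapse :: "'v \<Rightarrow> 'v \<Rightarrow> bool" where
  "is_collapse X c \<longleftrightarrow>
     (\<exists>p. is_function_in UNIV p X \<and>
        (\<forall>x\<in>elts X. \<forall>z. z \<epsilon> app p x \<longleftrightarrow> (\<exists>y\<in>elts X. y \<epsilon> x \<and> z = app p y)) \<and>
        (\<forall>z. z \<epsilon> c \<longleftrightarrow> (\<exists>x\<in>elts X. z = app p x)))"

subsection \<open>Formulas and satisfaction\<close>

text \<open>Codes of first-order formulas are elements of the structure; being a code means lying in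
  every set that is closed under the formation rules.\<close>

definition cMem :: "'v \<Rightarrow> 'v \<Rightarrow> 'v" where
  "cMem i k = opair empty_set (opair i k)"

definition cEq :: "'v \<Rightarrow> 'v \<Rightarrow> 'v" where
  "cEq i k = opair (succ_set empty_set) (opair i k)"

definition cNeg :: "'v \<Rightarrow> 'v" where
  "cNeg \<phi> = opair (succ_set (succ_set empty_set)) \<phi>"

definition cAnd :: "'v \<Rightarrow> 'v \<Rightarrow> 'v" where
  "cAnd \<phi> \<psi> = opair (succ_set (succ_set (succ_set empty_set))) (opair \<phi> \<psi>)"

definition cEx :: "'v \<Rightarrow> 'v \<Rightarrow> 'v" where
  "cEx i \<phi> = opair (succ_set (succ_set (succ_set (succ_set empty_set)))) (opair i \<phi>)"

definition is_fm :: "'v \<Rightarrow> bool" where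
  "is_fm \<phi> \<longleftrightarrow> (\<forall>F.
     (\<forall>i\<in>elts omega. \<forall>k\<in>elts omega. cMem i k \<epsilon> F \<and> cEq i k \<epsilon> F) \<and>
     (\<forall>\<psi>\<in>elts F. cNeg \<psi> \<epsilon> F) \<and>
     (\<forall>\<psi>\<in>elts F. \<forall>\<chi>\<in>elts F. cAnd \<psi> \<chi> \<epsilon> F) \<and>
     (\<forall>i\<in>elts omega. \<forall>\<psi>\<in>elts F. cEx i \<psi> \<epsilon> F)
     \<longrightarrow> \<phi> \<epsilon> F)"

definition is_Delta0 :: "'v \<Rightarrow> bool" where
  "is_Delta0 \<phi> \<longleftrightarrow> (\<forall>F.
     (\<forall>i\<in>elts omega. \<forall>k\<in>elts omega. cMem i k \<epsilon> F \<and> cEq i k \<epsilon> F) \<and>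
     (\<forall>\<psi>\<in>elts F. cNeg \<psi> \<epsilon> F) \<and>
     (\<forall>\<psi>\<in>elts F. \<forall>\<chi>\<in>elts F. cAnd \<psi> \<chi> \<epsilon> F) \<and>
     (\<forall>i\<in>elts omega. \<forall>k\<in>elts omega. \<forall>\<psi>\<in>elts F. i \<noteq> k \<longrightarrow> cEx i (cAnd (cMem i k) \<psi>) \<epsilon> F)
     \<longrightarrow> \<phi> \<epsilon> F)"

definition is_Sigma1 :: "'v \<Rightarrow> bool" where
  "is_Sigma1 \<phi> \<longleftrightarrow> (\<forall>F.
     (\<forall>\<psi>. is_Delta0 \<psi> \<longrightarrow> \<psi> \<epsilon> F) \<and>
     (\<forall>i\<in>elts omega. \<forall>\<psi>\<in>elts F. cEx i \<psi> \<epsilon> F)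
     \<longrightarrow> \<phi> \<epsilon> F)"

definition assignment :: "'v set \<Rightarrow> 'v \<Rightarrow> bool" where
  "assignment D s \<longleftrightarrow> is_function_in UNIV s omega \<and> (\<forall>n\<in>elts omega. app s n \<in> D)"

definition variant :: "'v \<Rightarrow> 'v \<Rightarrow> 'v \<Rightarrow> bool" where
  "variant i s t \<longleftrightarrow> (\<forall>n\<in>elts omega. n \<noteq> i \<longrightarrow> app t n = app s n)"

text \<open>\<open>T\<close> satisfies the Tarski clauses for \<open>(D, \<in>)\<close>.  Below, \<open>T\<close> is always a set or a class of the
  structure, hence determined on pairs of a code and an assignment by induction in the structure.\<close>

definition truth_relation :: "'v set \<Rightarrow> 'v set \<Rightarrow> bool" where
  "truth_relation D T \<longleftrightarrow> (\<forall>s. assignment D s \<longrightarrow>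
     (\<forall>i\<in>elts omega. \<forall>k\<in>elts omega. opair (cMem i k) s \<in> T \<longleftrightarrow> app s i \<epsilon> app s k) \<and>
     (\<forall>i\<in>elts omega. \<forall>k\<in>elts omega. opair (cEq i k) s \<in> T \<longleftrightarrow> app s i = app s k) \<and>
     (\<forall>\<phi>. is_fm \<phi> \<longrightarrow> (opair (cNeg \<phi>) s \<in> T \<longleftrightarrow> opair \<phi> s \<notin> T)) \<and>
     (\<forall>\<phi> \<psi>. is_fm \<phi> \<and> is_fm \<psi> \<longrightarrow>
        (opair (cAnd \<phi> \<psi>) s \<in> T \<longleftrightarrow> opair \<phi> s \<in> T \<and> opair \<psi> s \<in> T)) \<and>
     (\<forall>i\<in>elts omega. \<forall>\<phi>. is_fm \<phi> \<longrightarrow>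
        (opair (cEx i \<phi>) s \<in> T \<longleftrightarrow>
           (\<exists>t. assignment D t \<and> variant i s t \<and> opair \<phi> t \<in> T))))"

definition models :: "'v \<Rightarrow> 'v \<Rightarrow> 'v \<Rightarrow> bool" where
  "models M \<phi> s \<longleftrightarrow> (\<exists>T. truth_relation (elts M) (elts T) \<and> opair \<phi> s \<epsilon> T)"

definition elementary_sub :: "'v \<Rightarrow> 'v \<Rightarrow> bool" where
  "elementary_sub X Y \<longleftrightarrow> subset X Y \<and>
     (\<forall>\<phi> s. is_fm \<phi> \<and> assignment (elts X) s \<longrightarrow> (models X \<phi> s \<longleftrightarrow> models Y \<phi> s))"

definition pointwise_image :: "('v \<Rightarrow> 'v) \<Rightarrow> 'v \<Rightarrow> 'v \<Rightarrow> bool" where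
  "pointwise_image h s t \<longleftrightarrow> (\<forall>n\<in>elts omega. app t n = h (app s n))"

definition Sigma1_elementary :: "'v \<Rightarrow> 'v \<Rightarrow> 'v \<Rightarrow> bool" where
  "Sigma1_elementary j M N \<longleftrightarrow> maps j M N \<and>
     (\<forall>\<phi> s t. is_Sigma1 \<phi> \<and> assignment (elts M) s \<and> assignment (elts N) t \<and>
        pointwise_image (app j) s t \<longrightarrow> (models M \<phi> s \<longleftrightarrow> models N \<phi> t))"

definition critical_point :: "('v \<Rightarrow> 'v) \<Rightarrow> 'v set \<Rightarrow> 'v \<Rightarrow> bool" where
  "critical_point h D \<kappa> \<longleftrightarrow>
     ordinal \<kappa> \<and> \<kappa> \<in> D \<and> h \<kappa> \<noteq> \<kappa> \<and> (\<forall>\<alpha>\<in>elts \<kappa>. h \<alpha> = \<alpha>)"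

section \<open>Critical cardinals, weak Loewenheim-Skolem cardinals, pre-witnesses\<close>

definition class_app :: "'v set \<Rightarrow> 'v \<Rightarrow> 'v" where
  "class_app J x = (THE y. opair x y \<in> J)"

definition class_maps :: "'v set \<Rightarrow> 'v set \<Rightarrow> bool" where
  "class_maps J M \<longleftrightarrow>
     (\<forall>p\<in>J. \<exists>x y. p = opair x y) \<and> (\<forall>x. (\<exists>!y. opair x y \<in> J) \<and> class_app J x \<in> M)"

text \<open>First-order truth over a class is definable in the two-sorted theory, through classes that
  satisfy the Tarski clauses.\<close>

definition class_elementary :: "'v set set \<Rightarrow> 'v set \<Rightarrow> 'v set \<Rightarrow> bool" where
  "class_elementary P J M \<longleftrightarrow> class_maps J M \<and>
     (\<exists>S\<in>P. \<exists>T\<in>P. truth_relation UNIV S \<and> truth_relation M T \<and>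
        (\<forall>\<phi> s t. is_fm \<phi> \<and> assignment UNIV s \<and> assignment M t \<and>
           pointwise_image (class_app J) s t \<longrightarrow> (opair \<phi> s \<in> S \<longleftrightarrow> opair \<phi> t \<in> T)))"

definition V_critical :: "'v set set \<Rightarrow> 'v \<Rightarrow> bool" where
  "V_critical P \<kappa> \<longleftrightarrow> (\<exists>M\<in>P. \<exists>J\<in>P. transitive_class M \<and> class_elementary P J M \<and>
     critical_point (class_app J) UNIV \<kappa>)"

definition wLS :: "'v \<Rightarrow> bool" where
  "wLS \<delta> \<longleftrightarrow> cardinal \<delta> \<and>
     (\<forall>\<gamma>\<in>elts \<delta>. \<forall>\<alpha>. ordinal \<alpha> \<and> ord_le \<delta> \<alpha> \<longrightarrow> (\<forall>x\<in>elts (Vset \<alpha>).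
        \<exists>X. elementary_sub X (Vset \<alpha>) \<and> subset (Vset \<gamma>) X \<and> x \<epsilon> X \<and>
            (\<exists>c. is_collapse X c \<and> c \<epsilon> Vset \<delta>)))"

definition proper_class_wLS :: bool where
  "proper_class_wLS \<longleftrightarrow> (\<forall>\<alpha>. ordinal \<alpha> \<longrightarrow> (\<exists>\<delta>. \<alpha> \<epsilon> \<delta> \<and> wLS \<delta>))"

definition RL_model :: "'v \<Rightarrow> bool" where
  "RL_model N \<longleftrightarrow>
     (\<exists>z\<in>elts N. is_empty_in (elts N) z) \<and>
     extensionality_in (elts N) \<and> foundation_in (elts N) \<and> pairing_in (elts N) \<and>
     union_in (elts N) \<and> power_set_in (elts N) \<and>
     (\<forall>\<phi> s. \<forall>i\<in>elts omega. \<forall>a\<in>elts N. is_fm \<phi> \<and> assignment (elts N) s \<longrightarrow>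
        (\<exists>b\<in>elts N. \<forall>x\<in>elts N. x \<epsilon> b \<longleftrightarrow> x \<epsilon> a \<and>
           (\<exists>t. assignment (elts N) t \<and> variant i s t \<and> app t i = x \<and> models N \<phi> t))) \<and>
     (\<forall>\<alpha>\<in>elts N. is_ordinal_in (elts N) \<alpha> \<longrightarrow>
        (\<exists>s\<in>elts N. is_succ_in (elts N) \<alpha> s) \<and>
        (\<exists>v\<in>elts N. is_V_in (elts N) \<alpha> v) \<and>
        (\<exists>f\<in>elts N. is_Vseq_in (elts N) \<alpha> f)) \<and>
     (\<forall>x\<in>elts N. \<exists>\<alpha>\<in>elts N. \<exists>v\<in>elts N.
        is_ordinal_in (elts N) \<alpha> \<and> is_V_in (elts N) \<alpha> v \<and> x \<epsilon> v)"

definition pre_witness :: "'v \<Rightarrow> 'v \<Rightarrow> 'v \<Rightarrow> 'v \<Rightarrow> bool" where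
  "pre_witness \<kappa> \<delta> N j \<longleftrightarrow>
     wLS \<delta> \<and> transitive_class (elts N) \<and> RL_model N \<and>
     (\<forall>y\<in>elts N. \<exists>x\<in>elts (Vset \<delta>). y \<epsilon> app j x) \<and>
     Sigma1_elementary j (Vset \<delta>) N \<and> critical_point (app j) (elts (Vset \<delta>)) \<kappa>"

section \<open>Extenders and ultrapowers\<close>

definition finite_set :: "'v \<Rightarrow> bool" where
  "finite_set x \<longleftrightarrow> (\<exists>n\<in>elts omega. \<exists>f. bijection f n x)"

definition is_index :: "'v \<Rightarrow> bool" where
  "is_index r \<longleftrightarrow> finite_set r \<and>
     (\<forall>x\<in>elts r. \<forall>y\<in>elts r. x \<noteq> y \<and> rank x = rank y \<longrightarrow> (\<exists>z\<in>elts r. \<not> (z \<epsilon> x \<longleftrightarrow> z \<epsilon> y)))"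

definition indices :: "'v \<Rightarrow> 'v" where
  "indices X = setof (\<lambda>r. is_index r \<and> subset r X)"

text \<open>Isomorphisms are required to preserve the comparison of ranks, not merely their equality.
  Otherwise they need not be unique: with \<open>x = {\<emptyset>}\<close> and \<open>y = {{{\<emptyset>}}}\<close>, exchanging \<open>x\<close> and \<open>y\<close> in the
  index \<open>{x, y}\<close> preserves membership and equality of rank in both directions.\<close>

definition index_iso :: "'v \<Rightarrow> 'v \<Rightarrow> 'v \<Rightarrow> bool" where
  "index_iso a b p \<longleftrightarrow> bijection p a b \<and>
     (\<forall>x\<in>elts a. \<forall>y\<in>elts a.
        (x \<epsilon> y \<longleftrightarrow> app p x \<epsilon> app p y) \<and>
        (ord_le (rank x) (rank y) \<longleftrightarrow> ord_le (rank (app p x)) (rank (app p y))))"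

definition index_equiv :: "'v \<Rightarrow> 'v \<Rightarrow> bool" where
  "index_equiv a b \<longleftrightarrow> (\<exists>p. index_iso a b p)"

definition index_map :: "'v \<Rightarrow> 'v \<Rightarrow> 'v" where
  "index_map a b = (THE p. index_iso a b p)"

text \<open>The index \<open>u\<^bsup>ca\<^esup>\<close>, and the value \<open>f\<^bsup>ac\<^esup>(u)\<close>.\<close>

definition index_proj :: "'v \<Rightarrow> 'v \<Rightarrow> 'v \<Rightarrow> 'v" where
  "index_proj u c a = setof (\<lambda>y. \<exists>x\<in>elts a. y = app (index_map c u) x)"

definition lift_val :: "'v \<Rightarrow> 'v \<Rightarrow> 'v \<Rightarrow> 'v \<Rightarrow> 'v" where
  "lift_val f a c u = (if index_equiv u c then app f (index_proj u c a) else empty_set)"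

definition derived_extender :: "'v \<Rightarrow> 'v \<Rightarrow> 'v \<Rightarrow> 'v" where
  "derived_extender \<delta> N j = setof (\<lambda>p. \<exists>A a. p = opair A a \<and>
     a \<epsilon> indices N \<and> subset A (Vset \<delta>) \<and>
     (\<exists>\<alpha>\<in>elts \<delta>. a \<epsilon> app j (setof (\<lambda>x. x \<epsilon> A \<and> x \<epsilon> Vset \<alpha>))))"

text \<open>In the following \<open>X\<close> is an extender over \<open>V\<^sub>\<delta>\<close> with indices contained in \<open>N\<close>.  For \<open>R\<close> equality
  and membership, \<open>ult_holds\<close> gives \<open>(a, f) \<sim> (b, g)\<close> and \<open>[a, f] \<in> [b, g]\<close>.\<close>

definition ult_pair :: "'v \<Rightarrow> 'v \<Rightarrow> 'v \<Rightarrow> 'v \<Rightarrow> bool" where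
  "ult_pair \<delta> N a f \<longleftrightarrow> a \<epsilon> indices N \<and> is_function_in UNIV f (indices (Vset \<delta>))"

definition ult_holds ::
  "('v \<Rightarrow> 'v \<Rightarrow> bool) \<Rightarrow> 'v \<Rightarrow> 'v \<Rightarrow> 'v \<Rightarrow> 'v \<Rightarrow> 'v \<Rightarrow> 'v \<Rightarrow> 'v \<Rightarrow> bool" where
  "ult_holds R \<delta> N X a f b g \<longleftrightarrow>
     (\<exists>c. c \<epsilon> indices N \<and> subset a c \<and> subset b c \<and>
        opair (setof (\<lambda>u. u \<epsilon> indices (Vset \<delta>) \<and> R (lift_val f a c u) (lift_val g b c u))) c \<epsilon> X)"

text \<open>The equivalence classes are proper classes; as usual \<open>[a, f]\<close> is represented by the set of its
  members of minimal rank.\<close>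

definition ult_class :: "'v \<Rightarrow> 'v \<Rightarrow> 'v \<Rightarrow> 'v \<Rightarrow> 'v \<Rightarrow> 'v" where
  "ult_class \<delta> N X a f = setof (\<lambda>p.
     (\<exists>b g. p = opair b g \<and> ult_pair \<delta> N b g \<and> ult_holds (=) \<delta> N X a f b g) \<and>
     (\<forall>b g. ult_pair \<delta> N b g \<and> ult_holds (=) \<delta> N X a f b g \<longrightarrow> ord_le (rank p) (rank (opair b g))))"

definition Ult0 :: "'v \<Rightarrow> 'v \<Rightarrow> 'v \<Rightarrow> 'v set" where
  "Ult0 \<delta> N X = {w. \<exists>a f. ult_pair \<delta> N a f \<and> w = ult_class \<delta> N X a f}"

definition Ult0_mem :: "'v \<Rightarrow> 'v \<Rightarrow> 'v \<Rightarrow> 'v \<Rightarrow> 'v \<Rightarrow> bool" where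
  "Ult0_mem \<delta> N X w w' \<longleftrightarrow> (\<exists>a f b g. ult_pair \<delta> N a f \<and> ult_pair \<delta> N b g \<and>
     w = ult_class \<delta> N X a f \<and> w' = ult_class \<delta> N X b g \<and> ult_holds (\<epsilon>) \<delta> N X a f b g)"

definition Ult0_wellfounded :: "'v \<Rightarrow> 'v \<Rightarrow> 'v \<Rightarrow> bool" where
  "Ult0_wellfounded \<delta> N X \<longleftrightarrow>
     (\<forall>B. elts B \<noteq> {} \<and> elts B \<subseteq> Ult0 \<delta> N X \<longrightarrow>
        (\<exists>w\<in>elts B. \<forall>w'\<in>elts B. \<not> Ult0_mem \<delta> N X w' w))"

end

end

theory Submission
  imports Defs
begin

text \<open>
  (1) implies (2): given \<open>j : V \<rightarrow> M\<close>, limits of wLS cardinals are wLS, so there is a wLS limit \<open>\<delta> > \<kappa>\<close> of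
  uncountable cofinality, and \<open>j\<close> restricts to \<open>V\<^sub>\<delta> \<rightarrow> V\<^sub>\<eta>\<^sup>M\<close> with \<open>\<eta> = sup j[\<delta>]\<close>.

  The ultrapower is handled through pairs \<open>(y, F)\<close> of a seed \<open>y \<in> N\<close> and a function \<open>F\<close> on \<open>V\<^sub>\<delta>\<close>: a relation
  holds between \<open>(y, F)\<close> and \<open>(z, G)\<close> iff \<open>(y, z) \<in> j(A)\<close> for the set \<open>A\<close> of those \<open>(u, v)\<close> for which it holds
  between \<open>F(u)\<close> and \<open>G(v)\<close>.  Every seed can be coded by an index, so this gives the same structure.

  (2) implies (3): otherwise uncountable cofinality yields a \<open>\<beta> < \<delta>\<close> and a descending family whose seeds all
  lie in \<open>j(V\<^sub>\<beta>)\<close>.  By the wLS property the functions may be taken in a hull whose collapse lies in \<open>V\<^sub>\<delta>\<close>;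
  the ranks of all their values on \<open>V\<^sub>\<beta>\<close> then have order type below \<open>\<delta>\<close>, and \<open>j\<close> maps the family to a
  descending family of ordinals.

  (3) implies (1): the wLS property replaces choice in Los' theorem for bounded formulas, hence the
  ultrapower collapses to a transitive class and the canonical map is cofinal, preserves bounded formulas and
  extends \<open>j\<close>.  Since the universe satisfies collection it is fully elementary.
\<close>

section \<open>Definable predicates\<close>

text \<open>The structure may be ill-founded and need not satisfy choice. Hence every comprehension,
  induction and recursion has to be about a predicate definable in it; the rules \<open>dfn\<close>
  reduce this to syntax, and \<open>d0\<close> does the same for bounded predicates, which are the
  ones carried along an embedding. Without choice even \<omega>_1 may have countable cofinality, so
  a limit of uncountable cofinality must be produced: \<kappa> is one below its own image, and
  reflection yields such a \<mu> below \<kappa>. A sequence of wLS cardinals of length \<mu> is not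
  stretched by the embedding, which is therefore continuous at its supremum \<delta>. Dependent
  choice is missing as well. Ill-foundedness is a nonempty set without minimal element, not a
  descending sequence. Comparing ranks of values instead of membership makes the order total up to
  ties, and a function on levels takes over from a choice of witnesses. Truth over the universe and
  over the target is a class, obtained by impredicative comprehension.\<close>

definition gdf :: "(fm2 => bool) => (('v => 'v => bool) \<times> 'v set set) set =>
    (('v => 'v => bool) \<times> 'v set set => (nat => 'v) => bool) => bool" where
  "gdf \<Phi> W Q \<longleftrightarrow> (EX k. (ALL w:W. ALL e e'. (ALL n<k. e n = e' n) --> Q w e = Q w e') &
     (ALL r. EX \<phi>. \<Phi> \<phi> & (ALL w:W. ALL e C. sat2 (fst w) (snd w) e C \<phi> \<longleftrightarrow> Q w (%n. e (r n)))))"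

text \<open>\<open>gdf\<close> is uniform over a family of structures and has no parameters;
  \<open>ldf\<close> lives in one structure and allows set and class parameters, as the schemas of
  \<open>ZF2\<close> do. In both, the quantification over renamings builds substitution of variables
  into the notion, and the finite support \<open>k\<close> leaves fresh variables for
  quantifiers.\<close>

definition ldf :: "('v => 'v => bool) => 'v set set => ((nat => 'v set) => (nat => 'v) => bool) => bool" where
  "ldf E P Q \<longleftrightarrow> (EX k.
     (ALL C C' e e'. (ALL l. C l \<in> P & C' l \<in> P) --> (ALL n<k. e n = e' n & C n = C' n) --> Q C e = Q C' e') &
     (ALL r rc m. (ALL n<k. r n < m & rc n < m) -->
        (EX \<phi> q qc m'. m \<le> m' & (ALL l. qc l \<in> P) &
           (ALL e C. (ALL l. m \<le> l & l < m' --> e l = q l & C l = qc l) & (ALL l. C l \<in> P) -->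
              (sat2 E P e C \<phi> \<longleftrightarrow> Q (%n. C (rc n)) (%n. e (r n)))))))"

lemma gdf_cong:
  assumes "gdf \<Phi> W Q" "!!w e. w \<in> W ==> Q w e = Q' w e"
  shows "gdf \<Phi> W Q'"
  using assms unfolding gdf_def by (metis (mono_tags, lifting))

lemma gdf_Mem: "(!!i k. \<Phi> (Mem i k)) ==> gdf \<Phi> W (%w e. fst w (e a) (e b))"
  unfolding gdf_def by (rule exI[of _ "Suc (a + b)"]) (auto intro!: exI[of _ "Mem _ _"])

lemma gdf_Eq: "(!!i k. \<Phi> (Eq i k)) ==> gdf \<Phi> W (%w e. e a = e b)"
  unfolding gdf_def by (rule exI[of _ "Suc (a + b)"]) (auto intro!: exI[of _ "Eq _ _"])

lemma gdf_not:
  assumes "!!\<phi>. \<Phi> \<phi> ==> \<Phi> (Neg \<phi>)" "gdf \<Phi> W Q"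
  shows "gdf \<Phi> W (%w e. ~ Q w e)"
proof -
  from assms(2) obtain k where k: "ALL w:W. ALL e e'. (ALL n<k. e n = e' n) --> Q w e = Q w e'"
    and f: "ALL r. EX \<phi>. \<Phi> \<phi> & (ALL w:W. ALL e C. sat2 (fst w) (snd w) e C \<phi> \<longleftrightarrow> Q w (%n. e (r n)))"
    unfolding gdf_def by blast
  show ?thesis unfolding gdf_def
  proof (rule exI[of _ k], intro conjI allI)
    show "ALL w:W. ALL e e'. (ALL n<k. e n = e' n) --> (~ Q w e) = (~ Q w e')" using k by blast
    fix r
    obtain \<phi> where "\<Phi> \<phi>" "ALL w:W. ALL e C. sat2 (fst w) (snd w) e C \<phi> \<longleftrightarrow> Q w (%n. e (r n))" using f by blast
    then show "EX \<phi>. \<Phi> \<phi> & (ALL w:W. ALL e C. sat2 (fst w) (snd w) e C \<phi> \<longleftrightarrow> ~ Q w (%n. e (r n)))"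
      using assms(1) by (intro exI[of _ "Neg \<phi>"]) auto
  qed
qed

lemma gdf_and:
  assumes "!!\<phi> \<psi>. \<Phi> \<phi> ==> \<Phi> \<psi> ==> \<Phi> (And \<phi> \<psi>)" "gdf \<Phi> W Q" "gdf \<Phi> W R"
  shows "gdf \<Phi> W (%w e. Q w e & R w e)"
proof -
  from assms(2) obtain k where k: "ALL w:W. ALL e e'. (ALL n<k. e n = e' n) --> Q w e = Q w e'"
    and f: "ALL r. EX \<phi>. \<Phi> \<phi> & (ALL w:W. ALL e C. sat2 (fst w) (snd w) e C \<phi> \<longleftrightarrow> Q w (%n. e (r n)))"
    unfolding gdf_def by blast
  from assms(3) obtain l where l: "ALL w:W. ALL e e'. (ALL n<l. e n = e' n) --> R w e = R w e'"
    and g: "ALL r. EX \<phi>. \<Phi> \<phi> & (ALL w:W. ALL e C. sat2 (fst w) (snd w) e C \<phi> \<longleftrightarrow> R w (%n. e (r n)))"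
    unfolding gdf_def by blast
  show ?thesis unfolding gdf_def
  proof (rule exI[of _ "max k l"], intro conjI allI ballI impI)
    fix w e e' assume "w \<in> W" "ALL n<max k l. (e n :: 'a) = e' n"
    then have "Q w e = Q w e'" "R w e = R w e'" using k l by auto
    then show "(Q w e & R w e) = (Q w e' & R w e')" by simp
  next
    fix r
    obtain \<phi> where "\<Phi> \<phi>" "ALL w:W. ALL e C. sat2 (fst w) (snd w) e C \<phi> \<longleftrightarrow> Q w (%n. e (r n))" using f by blast
    moreover obtain \<psi> where "\<Phi> \<psi>" "ALL w:W. ALL e C. sat2 (fst w) (snd w) e C \<psi> \<longleftrightarrow> R w (%n. e (r n))"
      using g by blast
    ultimately show "EX \<phi>. \<Phi> \<phi> & (ALL w:W. ALL e C. sat2 (fst w) (snd w) e C \<phi> \<longleftrightarrow>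
        Q w (%n. e (r n)) & R w (%n. e (r n)))"
      using assms(1) by (intro exI[of _ "And \<phi> \<psi>"]) auto
  qed
qed

lemma gdf_ren:
  assumes "gdf \<Phi> W Q"
  shows "gdf \<Phi> W (%w e. Q w (%n. e (\<rho> n)))"
proof -
  from assms obtain k where k: "ALL w:W. ALL e e'. (ALL n<k. e n = e' n) --> Q w e = Q w e'"
    and f: "ALL r. EX \<phi>. \<Phi> \<phi> & (ALL w:W. ALL e C. sat2 (fst w) (snd w) e C \<phi> \<longleftrightarrow> Q w (%n. e (r n)))"
    unfolding gdf_def by blast
  have b: "\<rho> n < Suc (Max (\<rho> ` {..k}))" if "n < k" for n
    using that by (simp add: less_Suc_eq_le)
  show ?thesis unfolding gdf_def
  proof (rule exI[of _ "Suc (Max (\<rho> ` {..k}))"], intro conjI allI ballI impI)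
    fix w e e' assume "w \<in> W" "ALL n<Suc (Max (\<rho> ` {..k})). (e n :: 'a) = e' n"
    then have "ALL n<k. e (\<rho> n) = e' (\<rho> n)" using b by simp
    then show "Q w (%n. e (\<rho> n)) = Q w (%n. e' (\<rho> n))"
      using k \<open>w \<in> W\<close> by simp
  next
    fix r
    show "EX \<phi>. \<Phi> \<phi> & (ALL w:W. ALL e C. sat2 (fst w) (snd w) e C \<phi> \<longleftrightarrow> Q w (%n. e (r (\<rho> n))))"
      using f[rule_format, of "%n. r (\<rho> n)"] by blast
  qed
qed

lemma gdf_ex:
  assumes "!!i \<phi>. \<Phi> \<phi> ==> \<Phi> (Ex i \<phi>)" "gdf \<Phi> W (%w e. Q w (%n. e (Suc n)) (e 0))"
  shows "gdf \<Phi> W (%w e. EX y. Q w e y)"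
proof -
  from assms(2) obtain k where
      k: "ALL w:W. ALL e e'. (ALL n<k. e n = e' n) --> Q w (%n. e (Suc n)) (e 0) = Q w (%n. e' (Suc n)) (e' 0)"
    and f: "ALL r. EX \<phi>. \<Phi> \<phi> & (ALL w:W. ALL e C. sat2 (fst w) (snd w) e C \<phi> \<longleftrightarrow>
        Q w (%n. e (r (Suc n))) (e (r 0)))"
    unfolding gdf_def by blast
  have k': "Q w e y = Q w e' y" if "w \<in> W" "ALL n<k. e n = e' n" for w e e' y
    using k[rule_format, of w "case_nat y e" "case_nat y e'"] that by (auto split: nat.splits)
  show ?thesis unfolding gdf_def
  proof (rule exI[of _ k], intro conjI allI ballI impI)
    fix w e e' assume "w \<in> W" "ALL n<k. (e n :: 'a) = e' n"
    then show "(EX y. Q w e y) = (EX y. Q w e' y)" using k' by blast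
  next
    fix r :: "nat => nat"
    \<comment> \<open>The bound variable is fresh: it exceeds \<open>r n\<close> for all
      \<open>n < k\<close>, so updating it leaves the other arguments alone.\<close>
    let ?m = "Suc (Max (r ` {..k}))"
    have m: "r n ~= ?m" if "n < k" for n
    proof -
      have "r n \<le> Max (r ` {..k})" using that by simp
      then show ?thesis by simp
    qed
    obtain \<phi> where \<phi>: "\<Phi> \<phi>" "ALL w:W. ALL e C. sat2 (fst w) (snd w) e C \<phi> \<longleftrightarrow>
        Q w (%n. e ((case_nat ?m r) (Suc n))) (e ((case_nat ?m r) 0))" using f by blast
    have "sat2 (fst w) (snd w) (e(?m := y)) C \<phi> = Q w (%n. e (r n)) y" if "w \<in> W" for w e y C
    proof -
      have "sat2 (fst w) (snd w) (e(?m := y)) C \<phi> = Q w (%n. (e(?m := y)) (r n)) y"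
        using \<phi>(2) that by simp
      also have "\<dots> = Q w (%n. e (r n)) y" using k'[OF that] m by simp
      finally show ?thesis .
    qed
    then show "EX \<phi>. \<Phi> \<phi> & (ALL w:W. ALL e C. sat2 (fst w) (snd w) e C \<phi> \<longleftrightarrow> (EX y. Q w (%n. e (r n)) y))"
      using \<phi>(1) assms(1) by (intro exI[of _ "Ex ?m \<phi>"]) auto
  qed
qed

lemma gdf_bex:
  assumes "!!i k \<phi>. i ~= k ==> \<Phi> \<phi> ==> \<Phi> (Ex i (And (Mem i k) \<phi>))"
    "gdf \<Phi> W (%w e. Q w (%n. e (Suc n)) (e 0))"
  shows "gdf \<Phi> W (%w e. EX y. fst w y (e b) & Q w e y)"
proof -
  from assms(2) obtain k where
      k: "ALL w:W. ALL e e'. (ALL n<k. e n = e' n) --> Q w (%n. e (Suc n)) (e 0) = Q w (%n. e' (Suc n)) (e' 0)"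
    and f: "ALL r. EX \<phi>. \<Phi> \<phi> & (ALL w:W. ALL e C. sat2 (fst w) (snd w) e C \<phi> \<longleftrightarrow>
        Q w (%n. e (r (Suc n))) (e (r 0)))"
    unfolding gdf_def by blast
  have k': "Q w e y = Q w e' y" if "w \<in> W" "ALL n<k. e n = e' n" for w e e' y
    using k[rule_format, of w "case_nat y e" "case_nat y e'"] that by (auto split: nat.splits)
  show ?thesis unfolding gdf_def
  proof (rule exI[of _ "max k (Suc b)"], intro conjI allI ballI impI)
    fix w e e' assume "w \<in> W" "ALL n<max k (Suc b). (e n :: 'a) = e' n"
    then have "e b = e' b" "Q w e y = Q w e' y" for y using k'[of w e e'] by auto
    then show "(EX y. fst w y (e b) & Q w e y) = (EX y. fst w y (e' b) & Q w e' y)" by simp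
  next
    fix r :: "nat => nat"
    \<comment> \<open>Taking \<open>b\<close> into the range makes \<open>?m\<close> differ from
      \<open>r b\<close> as well, which is the side condition of a bounded quantifier.\<close>
    let ?m = "Suc (Max (r ` {..k + b}))"
    have m: "r n ~= ?m" if "n < k | n = b" for n
    proof -
      have "r n \<le> Max (r ` {..k + b})" using that by (intro Max_ge) auto
      then show ?thesis by simp
    qed
    obtain \<phi> where \<phi>: "\<Phi> \<phi>" "ALL w:W. ALL e C. sat2 (fst w) (snd w) e C \<phi> \<longleftrightarrow>
        Q w (%n. e ((case_nat ?m r) (Suc n))) (e ((case_nat ?m r) 0))" using f by blast
    have "sat2 (fst w) (snd w) (e(?m := y)) C \<phi> = Q w (%n. e (r n)) y" if "w \<in> W" for w e y C
    proof -
      have "sat2 (fst w) (snd w) (e(?m := y)) C \<phi> = Q w (%n. (e(?m := y)) (r n)) y"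
        using \<phi>(2) that by simp
      also have "\<dots> = Q w (%n. e (r n)) y" using k'[OF that] m by simp
      finally show ?thesis .
    qed
    then show "EX \<phi>. \<Phi> \<phi> & (ALL w:W. ALL e C. sat2 (fst w) (snd w) e C \<phi> \<longleftrightarrow>
        (EX y. fst w y (e (r b)) & Q w (%n. e (r n)) y))"
      using \<phi>(1) assms(1)[of ?m "r b" \<phi>] m[of b] by (intro exI[of _ "Ex ?m (And (Mem ?m (r b)) \<phi>)"]) auto
  qed
qed

text \<open>In \<^const>\<open>ldf\<close> the parameters sit at positions from \<open>m\<close> on, so that positions below \<open>m\<close> stay
  free for the arguments.\<close>

lemma ldf_cong:
  assumes "ldf E P Q" "!!C e. (ALL l. C l \<in> P) ==> Q C e = Q' C e"
  shows "ldf E P Q'"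
proof -
  from assms(1) obtain k where
    k: "ALL C C' e e'. (ALL l. C l \<in> P & C' l \<in> P) --> (ALL n<k. e n = e' n & C n = C' n) --> Q C e = Q C' e'"
    and f: "ALL r rc m. (ALL n<k. r n < m & rc n < m) -->
        (EX \<phi> q qc m'. m \<le> m' & (ALL l. qc l \<in> P) &
           (ALL e C. (ALL l. m \<le> l & l < m' --> e l = q l & C l = qc l) & (ALL l. C l \<in> P) -->
              (sat2 E P e C \<phi> \<longleftrightarrow> Q (%n. C (rc n)) (%n. e (r n)))))" unfolding ldf_def by blast
  show ?thesis unfolding ldf_def
  proof (rule exI[of _ k], intro conjI allI impI)
    fix C C' :: "nat => 'a set" and e e' :: "nat => 'a"
    assume 1: "ALL l. C l \<in> P & C' l \<in> P" and 2: "ALL n<k. e n = e' n & C n = C' n"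
    then have "Q C e = Q C' e'" using k by blast
    then show "Q' C e = Q' C' e'" using assms(2) 1 by simp
  next
    fix r rc :: "nat => nat" and m assume m: "ALL n<k. r n < m & rc n < m"
    from f[THEN spec, THEN spec, THEN spec, THEN mp, OF this] obtain \<phi> q qc m' where 1: "m \<le> m'" "ALL l. qc l \<in> P" "ALL e C. (ALL l. m \<le> l & l < m' --> e l = q l & C l = qc l) &
       (ALL l. C l \<in> P) --> (sat2 E P e C \<phi> \<longleftrightarrow> Q (%n. C (rc n)) (%n. e (r n)))" by (elim exE conjE)
    show "EX \<phi> q qc m'. m \<le> m' & (ALL l. qc l \<in> P) &
           (ALL e C. (ALL l. m \<le> l & l < m' --> e l = q l & C l = qc l) & (ALL l. C l \<in> P) -->
              (sat2 E P e C \<phi> \<longleftrightarrow> Q' (%n. C (rc n)) (%n. e (r n))))"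
      using 1 assms(2) by (intro exI[of _ \<phi>] exI[of _ q] exI[of _ qc] exI[of _ m']) simp
  qed
qed

lemma ldf_Mem: "C0 \<in> P ==> ldf E P (%C e. E (e a) (e b))"
  unfolding ldf_def
  by (rule exI[of _ "Suc (a + b)"], auto)
    (rule exI[of _ "Mem _ _"], rule exI, rule exI[of _ "%_. C0"], auto)

lemma ldf_Eq: "C0 \<in> P ==> ldf E P (%C e. e a = e b)"
  unfolding ldf_def
  by (rule exI[of _ "Suc (a + b)"], auto)
    (rule exI[of _ "Eq _ _"], rule exI, rule exI[of _ "%_. C0"], auto)

lemma ldf_MemCvar: "C0 \<in> P ==> ldf E P (%C e. e a \<in> C b)"
  unfolding ldf_def
  by (rule exI[of _ "Suc (a + b)"], auto)
    (rule exI[of _ "MemC _ _"], rule exI, rule exI[of _ "%_. C0"], auto)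

lemma ldf_MemC: "X \<in> P ==> ldf E P (%C e. e a \<in> X)"
  unfolding ldf_def
proof (rule exI[of _ "Suc a"], intro conjI allI impI, goal_cases)
  case (2 r rc m)
  then show ?case
    by (intro exI[of _ "MemC (r a) m"] exI[of _ "%_. _"] exI[of _ "%_. X"] exI[of _ "Suc m"]) auto
qed auto

lemma ldf_const: "C0 \<in> P ==> ldf E P (%C e. e a = x)"
  unfolding ldf_def
proof (rule exI[of _ "Suc a"], intro conjI allI impI, goal_cases)
  case (2 r rc m)
  then show ?case
    by (intro exI[of _ "Eq (r a) m"] exI[of _ "%_. x"] exI[of _ "%_. C0"] exI[of _ "Suc m"]) auto
qed auto

lemma ldf_not:
  assumes "ldf E P Q"
  shows "ldf E P (%C e. ~ Q C e)"
  using assms unfolding ldf_def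
proof (elim exE conjE, goal_cases)
  case (1 k)
  show ?case
  proof (rule exI[of _ k], intro conjI allI impI)
    fix r rc :: "nat => nat" and m assume "ALL n<k. r n < m & rc n < m"
    from 1(2)[THEN spec, THEN spec, THEN spec, THEN mp, OF this] obtain \<phi> q qc m' where "m \<le> m'" "ALL l. qc l \<in> P" "ALL e C. (ALL l. m \<le> l & l < m' --> e l = q l & C l = qc l) &
       (ALL l. C l \<in> P) --> (sat2 E P e C \<phi> \<longleftrightarrow> Q (%n. C (rc n)) (%n. e (r n)))" by (elim exE conjE)
    then show "EX \<phi> q qc m'. m \<le> m' & (ALL l. qc l \<in> P) &
           (ALL e C. (ALL l. m \<le> l & l < m' --> e l = q l & C l = qc l) & (ALL l. C l \<in> P) -->
              (sat2 E P e C \<phi> \<longleftrightarrow> ~ Q (%n. C (rc n)) (%n. e (r n))))"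
      by (intro exI[of _ "Neg \<phi>"] exI[of _ q] exI[of _ qc] exI[of _ m']) auto
  qed (use 1(1) in blast)
qed

lemma ldf_and:
  assumes "ldf E P Q" "ldf E P R"
  shows "ldf E P (%C e. Q C e & R C e)"
proof -
  from assms(1) obtain k where
    k: "ALL C C' e e'. (ALL l. C l \<in> P & C' l \<in> P) --> (ALL n<k. e n = e' n & C n = C' n) --> Q C e = Q C' e'"
    and f: "ALL r rc m. (ALL n<k. r n < m & rc n < m) -->
        (EX \<phi> q qc m'. m \<le> m' & (ALL l. qc l \<in> P) &
           (ALL e C. (ALL l. m \<le> l & l < m' --> e l = q l & C l = qc l) & (ALL l. C l \<in> P) -->
              (sat2 E P e C \<phi> \<longleftrightarrow> Q (%n. C (rc n)) (%n. e (r n)))))" unfolding ldf_def by blast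
  from assms(2) obtain k' where
    k': "ALL C C' e e'. (ALL l. C l \<in> P & C' l \<in> P) --> (ALL n<k'. e n = e' n & C n = C' n) --> R C e = R C' e'"
    and g: "ALL r rc m. (ALL n<k'. r n < m & rc n < m) -->
        (EX \<phi> q qc m'. m \<le> m' & (ALL l. qc l \<in> P) &
           (ALL e C. (ALL l. m \<le> l & l < m' --> e l = q l & C l = qc l) & (ALL l. C l \<in> P) -->
              (sat2 E P e C \<phi> \<longleftrightarrow> R (%n. C (rc n)) (%n. e (r n)))))" unfolding ldf_def by blast
  show ?thesis unfolding ldf_def
  proof (rule exI[of _ "max k k'"], intro conjI allI impI)
    fix C C' :: "nat => 'a set" and e e' :: "nat => 'a"
    assume 1: "ALL l. C l \<in> P & C' l \<in> P" and 2: "ALL n<max k k'. e n = e' n & C n = C' n"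
    have "Q C e = Q C' e'" by (rule k[rule_format]) (use 1 2 in auto)
    moreover have "R C e = R C' e'" by (rule k'[rule_format]) (use 1 2 in auto)
    ultimately show "(Q C e & R C e) = (Q C' e' & R C' e')" by simp
  next
    fix r rc :: "nat => nat" and m assume m: "ALL n<max k k'. r n < m & rc n < m"
    then have "ALL n<k. r n < m & rc n < m" by simp
    from f[THEN spec, THEN spec, THEN spec, THEN mp, OF this] obtain \<phi> q qc m1 where 1: "m \<le> m1" "ALL l. qc l \<in> P" "ALL e C. (ALL l. m \<le> l & l < m1 --> e l = q l & C l = qc l) &
       (ALL l. C l \<in> P) --> (sat2 E P e C \<phi> \<longleftrightarrow> Q (%n. C (rc n)) (%n. e (r n)))" by (elim exE conjE)
    have "ALL n<k'. r n < m1 & rc n < m1"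
    proof (intro allI impI)
      fix n assume "n < k'"
      then have "r n < m & rc n < m" using m by simp
      then show "r n < m1 & rc n < m1" using 1(1) by linarith
    qed
    \<comment> \<open>The parameters of the second formula start at \<open>m1\<close>, behind those
      of the first.\<close>
    from g[THEN spec, THEN spec, THEN spec, THEN mp, OF this] obtain \<phi>' q' qc' m2 where 2: "m1 \<le> m2" "ALL l. qc' l \<in> P" "ALL e C. (ALL l. m1 \<le> l & l < m2 --> e l = q' l & C l = qc' l) &
       (ALL l. C l \<in> P) --> (sat2 E P e C \<phi>' \<longleftrightarrow> R (%n. C (rc n)) (%n. e (r n)))" by (elim exE conjE)
    show "EX \<phi> q qc m'. m \<le> m' & (ALL l. qc l \<in> P) &
           (ALL e C. (ALL l. m \<le> l & l < m' --> e l = q l & C l = qc l) & (ALL l. C l \<in> P) -->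
              (sat2 E P e C \<phi> \<longleftrightarrow> Q (%n. C (rc n)) (%n. e (r n)) & R (%n. C (rc n)) (%n. e (r n))))"
    proof (intro exI[of _ "And \<phi> \<phi>'"] exI[of _ "%l. if l < m1 then q l else q' l"]
        exI[of _ "%l. if l < m1 then qc l else qc' l"] exI[of _ m2] conjI allI impI)
      fix e C assume A: "(ALL l. m \<le> l & l < m2 -->
          e l = (if l < m1 then q l else q' l) & C l = (if l < m1 then qc l else qc' l)) & (ALL l. C l \<in> P)"
      have "sat2 E P e C \<phi> \<longleftrightarrow> Q (%n. C (rc n)) (%n. e (r n))"
        by (rule 1(3)[rule_format]) (use A 1(1) 2(1) in auto)
      moreover have "sat2 E P e C \<phi>' \<longleftrightarrow> R (%n. C (rc n)) (%n. e (r n))"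
        by (rule 2(3)[rule_format]) (use A 1(1) 2(1) in auto)
      ultimately show "sat2 E P e C (And \<phi> \<phi>') \<longleftrightarrow>
        Q (%n. C (rc n)) (%n. e (r n)) & R (%n. C (rc n)) (%n. e (r n))" by simp
    qed (use 1(1,2) 2(1,2) in auto)
  qed
qed

lemma ldf_ren:
  assumes "ldf E P Q"
  shows "ldf E P (%C e. Q (%n. C (\<sigma> n)) (%n. e (\<rho> n)))"
proof -
  from assms obtain k where
    k: "ALL C C' e e'. (ALL l. C l \<in> P & C' l \<in> P) --> (ALL n<k. e n = e' n & C n = C' n) --> Q C e = Q C' e'"
    and f: "ALL r rc m. (ALL n<k. r n < m & rc n < m) -->
        (EX \<phi> q qc m'. m \<le> m' & (ALL l. qc l \<in> P) &
           (ALL e C. (ALL l. m \<le> l & l < m' --> e l = q l & C l = qc l) & (ALL l. C l \<in> P) -->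
              (sat2 E P e C \<phi> \<longleftrightarrow> Q (%n. C (rc n)) (%n. e (r n)))))" unfolding ldf_def by blast
  let ?K = "Suc (Max (\<rho> ` {..k}) + Max (\<sigma> ` {..k}))"
  have b: "\<rho> n < ?K & \<sigma> n < ?K" if "n < k" for n
  proof -
    have "\<rho> n \<le> Max (\<rho> ` {..k})" "\<sigma> n \<le> Max (\<sigma> ` {..k})" using that by auto
    then show ?thesis by simp
  qed
  show ?thesis unfolding ldf_def
  proof (rule exI[of _ ?K], intro conjI allI impI)
    fix C C' :: "nat => 'a set" and e e' :: "nat => 'a"
    assume 1: "ALL l. C l \<in> P & C' l \<in> P" and 2: "ALL n<?K. e n = e' n & C n = C' n"
    show "Q (%n. C (\<sigma> n)) (%n. e (\<rho> n)) = Q (%n. C' (\<sigma> n)) (%n. e' (\<rho> n))"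
      by (rule k[rule_format]) (use 1 2 b in auto)
  next
    fix r rc :: "nat => nat" and m assume m: "ALL n<?K. r n < m & rc n < m"
    have "ALL n<k. r (\<rho> n) < m & rc (\<sigma> n) < m" using m b by blast
    then show "EX \<phi> q qc m'. m \<le> m' & (ALL l. qc l \<in> P) &
           (ALL e C. (ALL l. m \<le> l & l < m' --> e l = q l & C l = qc l) & (ALL l. C l \<in> P) -->
              (sat2 E P e C \<phi> \<longleftrightarrow> Q (%n. C (rc (\<sigma> n))) (%n. e (r (\<rho> n)))))"
      by (rule f[THEN spec, THEN spec, THEN spec, THEN mp])
  qed
qed

lemma ldf_ex:
  assumes "ldf E P (%C e. Q C (%n. e (Suc n)) (e 0))"
  shows "ldf E P (%C e. EX y. Q C e y)"
proof -
  from assms obtain k where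
    k: "ALL C C' e e'. (ALL l. C l \<in> P & C' l \<in> P) --> (ALL n<k. e n = e' n & C n = C' n) -->
       Q C (%n. e (Suc n)) (e 0) = Q C' (%n. e' (Suc n)) (e' 0)"
    and f: "ALL r rc m. (ALL n<k. r n < m & rc n < m) -->
        (EX \<phi> q qc m'. m \<le> m' & (ALL l. qc l \<in> P) &
           (ALL e C. (ALL l. m \<le> l & l < m' --> e l = q l & C l = qc l) & (ALL l. C l \<in> P) -->
              (sat2 E P e C \<phi> \<longleftrightarrow> Q (%n. C (rc n)) (%n. e (r (Suc n))) (e (r 0)))))" unfolding ldf_def by blast
  have k': "Q C e y = Q C' e' y" if "ALL l. C l \<in> P & C' l \<in> P" "ALL n<k. e n = e' n & C n = C' n" for C C' e e' y
    using k[rule_format, of C C' "case_nat y e" "case_nat y e'"] that by (auto split: nat.splits)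
  show ?thesis unfolding ldf_def
  proof (rule exI[of _ k], intro conjI allI impI)
    fix C C' :: "nat => 'a set" and e e' :: "nat => 'a"
    assume "ALL l. C l \<in> P & C' l \<in> P" "ALL n<k. e n = e' n & C n = C' n"
    then show "(EX y. Q C e y) = (EX y. Q C' e' y)" using k' by blast
  next
    fix r rc :: "nat => nat" and m assume m: "ALL n<k. r n < m & rc n < m"
    \<comment> \<open>Position \<open>m\<close> becomes the bound variable; the parameters start one
      later.\<close>
    then have "ALL n<k. (case_nat m r) n < Suc m & rc n < Suc m" by (auto split: nat.splits simp: less_Suc_eq)
    from f[THEN spec, THEN spec, THEN spec, THEN mp, OF this] obtain \<phi> q qc m' where
      1: "Suc m \<le> m'" "ALL l. qc l \<in> P" "ALL e C. (ALL l. Suc m \<le> l & l < m' --> e l = q l & C l = qc l) &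
       (ALL l. C l \<in> P) --> (sat2 E P e C \<phi> \<longleftrightarrow> Q (%n. C (rc n)) (%n. e (r n)) (e m))" by auto
    show "EX \<phi> q qc m'. m \<le> m' & (ALL l. qc l \<in> P) &
           (ALL e C. (ALL l. m \<le> l & l < m' --> e l = q l & C l = qc l) & (ALL l. C l \<in> P) -->
              (sat2 E P e C \<phi> \<longleftrightarrow> (EX y. Q (%n. C (rc n)) (%n. e (r n)) y)))"
    proof (intro exI[of _ "Ex m \<phi>"] exI[of _ q] exI[of _ qc] exI[of _ m'] conjI allI impI)
      fix e C assume A: "(ALL l. m \<le> l & l < m' --> e l = q l & C l = qc l) & (ALL l. C l \<in> P)"
      have "sat2 E P (e(m := y)) C \<phi> \<longleftrightarrow> Q (%n. C (rc n)) (%n. e (r n)) y" for y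
      proof -
        have "sat2 E P (e(m := y)) C \<phi> \<longleftrightarrow> Q (%n. C (rc n)) (%n. (e(m := y)) (r n)) ((e(m := y)) m)"
          by (rule 1(3)[rule_format]) (use A in auto)
        also have "\<dots> = Q (%n. C (rc n)) (%n. e (r n)) y"
          unfolding fun_upd_same by (rule k') (use A m in auto)
        finally show ?thesis .
      qed
      then show "sat2 E P e C (Ex m \<phi>) \<longleftrightarrow> (EX y. Q (%n. C (rc n)) (%n. e (r n)) y)" by simp
    qed (use 1 in auto)
  qed
qed

lemma ldf_exC:
  assumes "ldf E P (%C e. Q (%n. C (Suc n)) e (C 0))"
  shows "ldf E P (%C e. EX Y:P. Q C e Y)"
proof -
  from assms obtain k where
    k: "ALL C C' e e'. (ALL l. C l \<in> P & C' l \<in> P) --> (ALL n<k. e n = e' n & C n = C' n) -->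
       Q (%n. C (Suc n)) e (C 0) = Q (%n. C' (Suc n)) e' (C' 0)"
    and f: "ALL r rc m. (ALL n<k. r n < m & rc n < m) -->
        (EX \<phi> q qc m'. m \<le> m' & (ALL l. qc l \<in> P) &
           (ALL e C. (ALL l. m \<le> l & l < m' --> e l = q l & C l = qc l) & (ALL l. C l \<in> P) -->
              (sat2 E P e C \<phi> \<longleftrightarrow> Q (%n. C (rc (Suc n))) (%n. e (r n)) (C (rc 0)))))" unfolding ldf_def by blast
  have k': "Q C e Y = Q C' e' Y"
    if "ALL l. C l \<in> P & C' l \<in> P" "Y \<in> P" "ALL n<k. e n = e' n & C n = C' n" for C C' e e' Y
    using k[rule_format, of "case_nat Y C" "case_nat Y C'" e e'] that by (auto split: nat.splits)
  show ?thesis unfolding ldf_def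
  proof (rule exI[of _ k], intro conjI allI impI)
    fix C C' :: "nat => 'a set" and e e' :: "nat => 'a"
    assume "ALL l. C l \<in> P & C' l \<in> P" "ALL n<k. e n = e' n & C n = C' n"
    then show "(EX y:P. Q C e y) = (EX y:P. Q C' e' y)" using k' by blast
  next
    fix r rc :: "nat => nat" and m assume m: "ALL n<k. r n < m & rc n < m"
    then have "ALL n<k. r n < Suc m & (case_nat m rc) n < Suc m" by (auto split: nat.splits simp: less_Suc_eq)
    from f[THEN spec, THEN spec, THEN spec, THEN mp, OF this] obtain \<phi> q qc m' where
      1: "Suc m \<le> m'" "ALL l. qc l \<in> P" "ALL e C. (ALL l. Suc m \<le> l & l < m' --> e l = q l & C l = qc l) &
       (ALL l. C l \<in> P) --> (sat2 E P e C \<phi> \<longleftrightarrow> Q (%n. C (rc n)) (%n. e (r n)) (C m))" by auto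
    show "EX \<phi> q qc m'. m \<le> m' & (ALL l. qc l \<in> P) &
           (ALL e C. (ALL l. m \<le> l & l < m' --> e l = q l & C l = qc l) & (ALL l. C l \<in> P) -->
              (sat2 E P e C \<phi> \<longleftrightarrow> (EX y:P. Q (%n. C (rc n)) (%n. e (r n)) y)))"
    proof (intro exI[of _ "ExC m \<phi>"] exI[of _ q] exI[of _ qc] exI[of _ m'] conjI allI impI)
      fix e C assume A: "(ALL l. m \<le> l & l < m' --> e l = q l & C l = qc l) & (ALL l. C l \<in> P)"
      have "sat2 E P e (C(m := Y)) \<phi> \<longleftrightarrow> Q (%n. C (rc n)) (%n. e (r n)) Y" if "Y \<in> P" for Y
      proof -
        have "sat2 E P e (C(m := Y)) \<phi> \<longleftrightarrow> Q (%n. (C(m := Y)) (rc n)) (%n. e (r n)) ((C(m := Y)) m)"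
          by (rule 1(3)[rule_format]) (use A that in auto)
        also have "\<dots> = Q (%n. C (rc n)) (%n. e (r n)) Y"
          unfolding fun_upd_same by (rule k') (use A m that in auto)
        finally show ?thesis .
      qed
      then show "sat2 E P e C (ExC m \<phi>) \<longleftrightarrow> (EX y:P. Q (%n. C (rc n)) (%n. e (r n)) y)" by simp
    qed (use 1 in auto)
  qed
qed

text \<open>The form in which the schemas of \<open>ZF2\<close> consume a predicate. Parameters
  start at \<open>k + 2\<close>, off the argument positions 0 and 1.\<close>

lemma ldf_sat2:
  assumes "ldf E P (%C e. Q (e 0) (e 1))"
  obtains \<phi> q C where "ALL l. C l \<in> P" "!!x y. sat2 E P (q(0 := x, 1 := y)) C \<phi> \<longleftrightarrow> Q x y"
proof -
  from assms obtain k where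
    f: "ALL (r :: nat => nat) (rc :: nat => nat) m. (ALL n<k. r n < m & rc n < m) -->
        (EX \<phi> q qc m'. m \<le> m' & (ALL l. qc l \<in> P) &
           (ALL e C. (ALL l. m \<le> l & l < m' --> e l = q l & C l = qc l) & (ALL l. C l \<in> P) -->
              (sat2 E P e C \<phi> \<longleftrightarrow> Q (e (r 0)) (e (r 1)))))"
    unfolding ldf_def by blast
  have "ALL n<k. n < k + 2 & n < k + 2" by auto
  from f[THEN spec[of _ "%n. n"], THEN spec[of _ "%n. n"], THEN spec[of _ "k + 2"], THEN mp, OF this]
  obtain \<phi> q qc m' where
     1: "k + 2 \<le> m'" "ALL l. qc l \<in> P" "ALL e C. (ALL l. k + 2 \<le> l & l < m' --> e l = q l & C l = qc l) &
       (ALL l. C l \<in> P) --> (sat2 E P e C \<phi> \<longleftrightarrow> Q (e 0) (e 1))" by (elim exE conjE)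
  show thesis
  proof (rule that[of qc q \<phi>])
    fix x y
    have "sat2 E P (q(0 := x, 1 := y)) qc \<phi> \<longleftrightarrow> Q ((q(0 := x, 1 := y)) 0) ((q(0 := x, 1 := y)) 1)"
      by (rule 1(3)[THEN spec, THEN spec, THEN mp]) (use 1(2) in auto)
    then show "sat2 E P (q(0 := x, 1 := y)) qc \<phi> \<longleftrightarrow> Q x y" by simp
  qed (rule 1(2))
qed

section \<open>Closure rules common to both notions of definability\<close>

named_theorems dfn

text \<open>A point of \<open>W\<close> is a class assignment in the local instance and a whole
  structure in the global one, so the rules are proved once for both.\<close>

locale dlogic =
  fixes W :: "'w set" and EE :: "'w => 'v => 'v => bool" and D :: "('w => (nat => 'v) => bool) => bool"
  assumes D_cong: "!!Q Q'. D Q ==> (!!w e. w \<in> W ==> Q w e = Q' w e) ==> D Q'"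
    and D_Mem_var: "!!a b. D (%w e. EE w (e a) (e b))"
    and D_Eq_var: "!!a b. D (%w e. e a = e b)"
    and D_not [dfn]: "!!Q. D Q ==> D (%w e. ~ Q w e)"
    and D_and [dfn]: "!!Q R. D Q ==> D R ==> D (%w e. Q w e & R w e)"
    and D_ex [dfn]: "!!Q. D (%w e. Q w (%n. e (Suc n)) (e 0)) ==> D (%w e. EX y. Q w e y)"
    and D_ren: "!!Q r. D Q ==> D (%w e. Q w (%n. e (r n)))"
begin

definition Df :: "('w => (nat => 'v) => 'v) => bool" where
  "Df t \<longleftrightarrow> D (%w e. e 0 = t w (%n. e (Suc n)))"

definition DS :: "('w => (nat => 'v) => 'v set) => bool" where
  "DS X \<longleftrightarrow> D (%w e. e 0 \<in> X w (%n. e (Suc n)))"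

lemma D_or [dfn]: assumes "D Q" "D R" shows "D (%w e. Q w e | R w e)"
proof -
  have "D (%w e. ~ (~ Q w e & ~ R w e))"
    by (rule D_not, rule D_and; rule D_not, rule assms)
  then show ?thesis by simp
qed

lemma D_imp [dfn]: assumes "D Q" "D R" shows "D (%w e. Q w e --> R w e)"
  unfolding imp_conv_disj by (rule D_or, rule D_not, rule assms, rule assms)

lemma D_iff [dfn]: assumes "D Q" "D R" shows "D (%w e. Q w e \<longleftrightarrow> R w e)"
  unfolding iff_conv_conj_imp by (rule D_and; rule D_imp, rule assms, rule assms)

lemma D_all [dfn]:
  assumes "D (%w e. Q w (%n. e (Suc n)) (e 0))" shows "D (%w e. ALL y. Q w e y)"
proof -
  have "D (%w e. ~ (EX y. ~ Q w e y))"
    by (rule D_not, rule D_ex, rule D_not, rule assms)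
  then show ?thesis by simp
qed

lemma D_const [dfn]: "D (%w e. b)"
proof (cases b)
  case True then show ?thesis using D_Eq_var[of 0 0] by simp
next
  case False then show ?thesis using D_not[OF D_Eq_var[of 0 0]] by simp
qed

lemma Df_ren: "Df t ==> Df (%w e. t w (%n. e (r n)))"
  unfolding Df_def by (drule D_ren[of _ "case_nat 0 (%n. Suc (r n))"]) simp

lemma DS_ren: "DS X ==> DS (%w e. X w (%n. e (r n)))"
  unfolding DS_def by (drule D_ren[of _ "case_nat 0 (%n. Suc (r n))"]) simp

text \<open>A term is substituted by binding its value with an existential quantifier; formulas thus
  need no function symbols.\<close>

lemma D_sub:
  assumes "Df s" "D (%w e. Q w (%n. e (Suc n)) (e 0))"
  shows "D (%w e. Q w e (s w e))"
proof -
  have "D (%w e. EX y. y = s w e & Q w e y)"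
    by (rule D_ex, rule D_and[OF assms(1)[unfolded Df_def] assms(2)])
  then show ?thesis by simp
qed

lemma Df_var [dfn]: "Df (%w e. e n)"
  unfolding Df_def by (rule D_Eq_var)

lemma D_mem [dfn]: assumes "Df s" "Df t" shows "D (%w e. EE w (s w e) (t w e))"
  by (rule D_sub[OF assms(1)], rule D_sub[OF Df_ren[OF assms(2)]], rule D_Mem_var)

lemma D_eq [dfn]: assumes "Df s" "Df t" shows "D (%w e. s w e = t w e)"
  by (rule D_sub[OF assms(1)], rule D_sub[OF Df_ren[OF assms(2)]], rule D_Eq_var)

lemma D_in [dfn]: assumes "Df s" "DS X" shows "D (%w e. s w e \<in> X w e)"
  by (rule D_sub[OF assms(1)]) (use assms(2) in \<open>simp add: DS_def\<close>)

lemma D_ball [dfn]: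
  assumes "DS X" "D (%w e. Q w (%n. e (Suc n)) (e 0))" shows "D (%w e. ALL x:X w e. Q w e x)"
  unfolding Ball_def by (rule D_all, rule D_imp[OF assms(1)[unfolded DS_def] assms(2)])

lemma D_bex [dfn]:
  assumes "DS X" "D (%w e. Q w (%n. e (Suc n)) (e 0))" shows "D (%w e. EX x:X w e. Q w e x)"
  unfolding Bex_def by (rule D_ex, rule D_and[OF assms(1)[unfolded DS_def] assms(2)])

lemma D_ex1 [dfn]:
  assumes "D (%w e. Q w (%n. e (Suc n)) (e 0))" shows "D (%w e. EX! y. Q w e y)"
  unfolding Ex1_def
  by (rule D_ex, rule D_and[OF assms], rule D_all, rule D_imp)
    (use D_ren[OF assms, of "case_nat 0 (%n. Suc (Suc n))"] in \<open>simp_all add: D_Eq_var\<close>)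

lemma DS_UNIV [dfn]: "DS (%w e. UNIV)"
  unfolding DS_def by (simp add: D_const)

lemma DS_elts [dfn]: assumes "Df t" shows "DS (%w e. elts (EE w) (t w e))"
  unfolding DS_def elts_def mem_Collect_eq by (rule D_mem[OF Df_var Df_ren[OF assms]])

lemma DS_Collect [dfn]: "D (%w e. Q w (%n. e (Suc n)) (e 0)) ==> DS (%w e. Collect (Q w e))"
  unfolding DS_def by simp

text \<open>Exhibiting the graph is how descriptions and recursively defined functions become
  definable terms.\<close>

lemma Df_rel:
  assumes "D (%w e. R w (%n. e (Suc n)) (e 0))" "!!w e y. w \<in> W ==> R w e y \<longleftrightarrow> y = t w e"
  shows "Df t"
  unfolding Df_def by (rule D_cong[OF assms(1)]) (simp add: assms(2))

lemma Df_comp1: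
  assumes "!!a. Df (%w e. F w (e a))" "Df s" shows "Df (%w e. F w (s w e))"
  unfolding Df_def
  by (rule D_sub[OF Df_ren[OF assms(2)]], rule D_eq[OF Df_var assms(1)])

lemma Df_if [dfn]:
  assumes "D Q" "Df s" "Df t" shows "Df (%w e. if Q w e then s w e else t w e)"
proof (rule Df_rel)
  show "D (%w e. Q w (%n. e (Suc n)) & e 0 = s w (%n. e (Suc n)) |
      ~ Q w (%n. e (Suc n)) & e 0 = t w (%n. e (Suc n)))"
    by (intro dfn D_ren[OF assms(1)] assms(2,3)[THEN Df_ren])
qed auto

text \<open>Unique existence must be supplied, because without it the HOL description is an
  unspecified value.\<close>

lemma Df_setof:
  assumes "D (%w e. Q w (%n. e (Suc n)) (e 0))"
    "!!w e. w \<in> W ==> EX! z. ALL x. EE w x z \<longleftrightarrow> Q w e x"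
  shows "Df (%w e. setof (EE w) (Q w e))"
proof (rule Df_rel)
  show "D (%w e. ALL x. EE w x (e 0) \<longleftrightarrow> Q w (%n. e (Suc n)) x)"
    by (rule D_all, rule D_iff, intro dfn)
      (use D_ren[OF assms(1), of "case_nat 0 (%n. Suc (Suc n))"] in simp)
  show "(ALL x. EE w x y \<longleftrightarrow> Q w e x) \<longleftrightarrow> y = setof (EE w) (Q w e)" if "w \<in> W" for w e y
    unfolding setof_def using theI'[OF assms(2)[OF that, of e]] assms(2)[OF that, of e] by blast
qed

end

text \<open>Total variant of \<open>app\<close>; the default value makes its graph definable without
  side conditions (\<open>Df_tapp\<close>).\<close>

definition tapp :: "('v => 'v => bool) => 'v => 'v => 'v" where
  "tapp E f x = (if EX! y. maps_to_in E UNIV f x y then app E f x else empty_set E)"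

locale definability = dlogic +
  assumes zf: "!!w. w \<in> W ==> EX P. ZF2 (EE w) P"

section \<open>Elementary set theory inside a structure\<close>

locale zf2 =
  fixes E :: "'v => 'v => bool" (infix \<open>\<E>\<close> 50) and P
  assumes zf2: "ZF2 E P"
begin

lemma UNIV_P: "UNIV \<in> P" using zf2 by (simp add: ZF2_def)

sublocale definability "{C. ALL l. C l \<in> P}" "%_. E" "ldf E P"
proof unfold_locales
  show "ldf E P (%w e. Q w (%n. e (r n)))" if "ldf E P Q" for Q r
    using ldf_ren[OF that, of "%n. n"] .
  show "ldf E P Q'" if "ldf E P Q" "!!w e. w \<in> {C. ALL l. C l \<in> P} ==> Q w e = Q' w e" for Q Q'
    by (rule ldf_cong[OF that(1)]) (use that(2) in simp)
  show "ldf E P (%w e. EX y. Q w e y)" if "ldf E P (%w e. Q w (%n. e (Suc n)) (e 0))" for Q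
    by (rule ldf_ex[OF that])
qed (use zf2 in \<open>auto intro: ldf_Mem[OF UNIV_P] ldf_Eq[OF UNIV_P] ldf_not ldf_and\<close>)

abbreviation "D \<equiv> ldf E P"
abbreviation "el \<equiv> elts E"
abbreviation "pr \<equiv> opair E"
abbreviation "ap \<equiv> tapp E"
abbreviation "Sub \<equiv> subset E"
abbreviation "emp \<equiv> empty_set E"
abbreviation "sc \<equiv> succ_set E"
abbreviation "om \<equiv> omega E"
abbreviation "Ord \<equiv> ordinal E"
abbreviation "fnc \<equiv> is_function_in E UNIV"
abbreviation "VV \<equiv> Vset E"
abbreviation "rk \<equiv> rank E"
abbreviation "so \<equiv> setof E"

lemma Df_param [dfn]: "Df (%C e. x)"
  unfolding Df_def by (rule ldf_const[OF UNIV_P])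

lemma DS_param [dfn]: "X \<in> P ==> DS (%C e. X)"
  unfolding DS_def by (rule ldf_MemC)

lemma el_iff [simp]: "x \<in> el a \<longleftrightarrow> x \<E> a"
  by (simp add: elts_def)

lemma ext: "(!!z. z \<E> x \<longleftrightarrow> z \<E> y) ==> x = y"
  using zf2 by (auto simp: ZF2_def extensionality_in_def)

lemma foundation: "y \<E> x ==> EX y. y \<E> x & (ALL z. z \<E> y --> ~ z \<E> x)"
  using zf2 by (auto simp: ZF2_def foundation_in_def)

lemma separation:
  assumes "D (%C e. Q (e 0))"
  shows "EX b. ALL x. x \<E> b \<longleftrightarrow> x \<E> a & Q x"
proof -
  \<comment> \<open>The predicate has a single argument, so position 1 is filled
    arbitrarily.\<close>
  obtain \<phi> q C where "ALL l. C l \<in> P" "!!x y. sat2 E P (q(0 := x, 1 := y)) C \<phi> = Q x"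
    by (rule ldf_sat2[of E P "%x y. Q x", OF assms]) blast
  then show ?thesis
    using zf2[unfolded ZF2_def, THEN conjunct2, THEN conjunct2, THEN conjunct2, THEN conjunct2,
        THEN conjunct2, THEN conjunct2, THEN conjunct1, THEN spec[of _ \<phi>], THEN spec[of _ "q(1 := undefined)"], THEN spec[of _ C], THEN spec[of _ a]]
    by (simp add: fun_upd_twist)
qed

lemma collection:
  assumes "D (%C e. Q (e 0) (e 1))" "!!x. x \<E> a ==> EX y. Q x y"
  shows "EX b. ALL x. x \<E> a --> (EX y. y \<E> b & Q x y)"
proof -
  obtain \<phi> q C where "ALL l. C l \<in> P" "!!x y. sat2 E P (q(0 := x, 1 := y)) C \<phi> \<longleftrightarrow> Q x y"
    by (rule ldf_sat2[of E P Q, OF assms(1)]) blast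
  then show ?thesis
    using zf2[unfolded ZF2_def, THEN conjunct2, THEN conjunct2, THEN conjunct2, THEN conjunct2,
        THEN conjunct2, THEN conjunct2, THEN conjunct2, THEN conjunct1, THEN spec[of _ \<phi>], THEN spec[of _ q], THEN spec[of _ C], THEN spec[of _ a]]
      assms(2)
    by simp
qed

lemma class_comp:
  assumes "D (%C e. Q (e 0))"
  shows "{x. Q x} \<in> P"
proof -
  obtain \<phi> q C where 1: "ALL l. C l \<in> P" "!!x y. sat2 E P (q(0 := x, 1 := y)) C \<phi> \<longleftrightarrow> Q x"
    by (rule ldf_sat2[of E P "%x y. Q x", OF assms]) blast
  have "{x \<in> UNIV. sat2 E P ((q(1 := undefined))(0 := x)) C \<phi>} \<in> P"
    using zf2[unfolded ZF2_def, THEN conjunct2, THEN conjunct2, THEN conjunct2, THEN conjunct2,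
        THEN conjunct2, THEN conjunct2, THEN conjunct2, THEN conjunct2, THEN conjunct2,
        THEN spec[of _ \<phi>], THEN spec[of _ "q(1 := undefined)"], THEN spec[of _ C], THEN bspec, OF UNIV_P]
      1(1) by simp
  then show ?thesis using 1(2) by (simp add: fun_upd_twist)
qed

lemma set_ex1: "EX z. ALL x. x \<E> z \<longleftrightarrow> Q x ==> EX! z. ALL x. x \<E> z \<longleftrightarrow> Q x"
  by (erule exE, rule ex1I, assumption, rule ext, simp)

lemma setof_mem: "EX z. ALL x. x \<E> z \<longleftrightarrow> Q x ==> x \<E> so Q \<longleftrightarrow> Q x"
  unfolding setof_def by (drule set_ex1, drule theI') simp

lemma setof_eq: "(!!x. x \<E> z \<longleftrightarrow> Q x) ==> so Q = z"
  by (rule ext) (subst setof_mem, auto)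

lemma comp_ex:
  assumes "D (%C e. Q (e 0))" "!!x. Q x ==> x \<E> a"
  shows "EX z. ALL x. x \<E> z \<longleftrightarrow> Q x"
  using separation[OF assms(1), of a] assms(2) by auto

lemmas mem_comp = setof_mem[OF comp_ex]

lemma pairing: "EX z. ALL w. w \<E> z \<longleftrightarrow> w = x | w = y"
  using zf2 by (auto simp: ZF2_def pairing_in_def is_upair_in_def)

lemma union: "EX z. ALL w. w \<E> z \<longleftrightarrow> (EX y. y \<E> x & w \<E> y)"
  using zf2 by (auto simp: ZF2_def union_in_def)

lemma power: "EX z. ALL w. w \<E> z \<longleftrightarrow> Sub w x"
  using zf2 by (auto simp: ZF2_def power_set_in_def subset_def)

lemma replacement:
  assumes "Df (%C e. t (e 0))"
  shows "EX b. ALL y. y \<E> b \<longleftrightarrow> (EX x. x \<E> a & y = t x)"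
proof -
  have "D (%C e. e 1 = t (e 0))"
    by (rule D_eq[OF Df_var assms])
  from collection[of "%x y. y = t x", OF this] obtain b where
    b: "ALL x. x \<E> a --> t x \<E> b" by auto
  have "EX z. ALL y. y \<E> z \<longleftrightarrow> (EX x. x \<E> a & y = t x)"
    by (rule comp_ex[of _ b], intro dfn assms) (use b in auto)
  then show ?thesis .
qed

definition img where "img t a = so (%y. EX x. x \<E> a & y = t x)"
definition upair where "upair a b = so (%x. x = a | x = b)"
definition Uni where "Uni a = so (%x. EX y. y \<E> a & x \<E> y)"
definition un2 where "un2 a b = so (%x. x \<E> a | x \<E> b)"
definition Pw where "Pw a = so (%x. Sub x a)"

lemma mem_img: "Df (%C e. t (e 0)) ==> y \<E> img t a \<longleftrightarrow> (EX x. x \<E> a & y = t x)"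
  unfolding img_def by (rule setof_mem[OF replacement])

lemma mem_upair [simp]: "x \<E> upair a b \<longleftrightarrow> x = a | x = b"
  unfolding upair_def by (rule setof_mem[OF pairing])

lemma mem_Uni [simp]: "x \<E> Uni a \<longleftrightarrow> (EX y. y \<E> a & x \<E> y)"
  unfolding Uni_def by (rule setof_mem[OF union])

lemma mem_un2 [simp]: "x \<E> un2 a b \<longleftrightarrow> x \<E> a | x \<E> b"
  unfolding un2_def by (rule setof_mem, rule exI[of _ "Uni (upair a b)"]) auto

lemma Sub_iff: "Sub x y \<longleftrightarrow> (ALL z. z \<E> x --> z \<E> y)"
  by (simp add: subset_def sub_in_def)

lemma mem_Pw [simp]: "x \<E> Pw a \<longleftrightarrow> Sub x a"
  unfolding Pw_def by (rule setof_mem[OF power])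

lemma mem_emp [simp]: "~ x \<E> emp"
  unfolding empty_set_def by (subst mem_comp[of _ undefined]) (auto intro!: dfn)

lemma emp_iff: "x = emp \<longleftrightarrow> (ALL y. ~ y \<E> x)"
  by (auto intro: ext)

lemma mem_sc [simp]: "x \<E> sc a \<longleftrightarrow> x \<E> a | x = a"
  unfolding succ_set_def by (rule setof_mem, rule exI[of _ "un2 a (upair a a)"]) auto

lemma upair_iff: "is_upair_in E UNIV a b z \<longleftrightarrow> z = upair a b"
  unfolding is_upair_in_def by (auto intro: ext)

lemma upair_inject: "upair a b = upair c d \<longleftrightarrow> a = c & b = d | a = d & b = c"
proof
  assume "upair a b = upair c d"
  then have "x \<E> upair a b \<longleftrightarrow> x \<E> upair c d" for x by simp
  then show "a = c & b = d | a = d & b = c" by (metis mem_upair)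
qed (auto intro: ext)

lemma pr_eq: "pr a b = upair (upair a a) (upair a b)"
  unfolding opair_def is_opair_in_def upair_iff by auto

lemma opair_iff: "is_opair_in E UNIV a b p \<longleftrightarrow> p = pr a b"
  unfolding pr_eq is_opair_in_def upair_iff by auto

lemma pr_inject [simp]: "pr a b = pr c d \<longleftrightarrow> a = c & b = d"
  unfolding pr_eq upair_inject by auto

lemma maps_to_iff: "maps_to_in E UNIV f x y \<longleftrightarrow> pr x y \<E> f"
  by (simp add: maps_to_in_def opair_iff)

lemma fnc_iff: "fnc f A \<longleftrightarrow> (ALL p. p \<E> f --> (EX x y. x \<E> A & p = pr x y)) & (ALL x. x \<E> A --> (EX! y. pr x y \<E> f))"
  by (simp add: is_function_in_def opair_iff maps_to_iff)

lemma ap_app: "fnc f A ==> x \<E> A ==> app E f x = ap f x"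
  by (simp add: tapp_def maps_to_iff fnc_iff)

lemma ap_eq: "fnc f A ==> pr x y \<E> f ==> ap f x = y"
  unfolding tapp_def app_def maps_to_iff fnc_iff by (metis (mono_tags, lifting) pr_inject the1_equality)

lemma fnc_ap: "fnc f A ==> x \<E> A ==> pr x (ap f x) \<E> f"
  using ap_eq fnc_iff by blast

lemma fnc_pr: "fnc f A ==> pr x y \<E> f \<longleftrightarrow> x \<E> A & y = ap f x"
  by (metis ap_eq fnc_ap fnc_iff pr_inject)

lemma fnc_mem: "fnc f A ==> p \<E> f \<longleftrightarrow> (EX x. x \<E> A & p = pr x (ap f x))"
  by (metis fnc_iff fnc_pr)

lemma fnc_ext: "fnc f A ==> fnc g A ==> (!!x. x \<E> A ==> ap f x = ap g x) ==> f = g"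
  by (rule ext) (auto simp: fnc_mem)

end

text \<open>The left-hand side is free of descriptions; this is how graphs of functions with a
  default value are shown definable.\<close>

lemma if_The_iff: "(if EX! y. Q y then Q z else z = d) \<longleftrightarrow> z = (if EX! y. Q y then The Q else d)"
  using theI'[of Q] the1_equality[of Q] by auto

context definability
begin

lemma D_sub_in [dfn]:
  assumes "DS X" "Df s" "Df t" shows "D (%w e. sub_in (EE w) (X w e) (s w e) (t w e))"
  unfolding sub_in_def by (intro dfn assms(1)[THEN DS_ren] assms(2-)[THEN Df_ren])

lemma D_is_empty_in [dfn]:
  assumes "DS X" "Df s" shows "D (%w e. is_empty_in (EE w) (X w e) (s w e))"
  unfolding is_empty_in_def by (intro dfn assms(1)[THEN DS_ren] assms(2-)[THEN Df_ren])

lemma D_is_upair_in [dfn]: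
  assumes "DS X" "Df s" "Df t" "Df u" shows "D (%w e. is_upair_in (EE w) (X w e) (s w e) (t w e) (u w e))"
  unfolding is_upair_in_def by (intro dfn assms(1)[THEN DS_ren] assms(2-)[THEN Df_ren])

lemma D_is_opair_in [dfn]:
  assumes "DS X" "Df s" "Df t" "Df u" shows "D (%w e. is_opair_in (EE w) (X w e) (s w e) (t w e) (u w e))"
  unfolding is_opair_in_def by (intro dfn assms(1)[THEN DS_ren] assms(2-)[THEN Df_ren])

lemma D_is_succ_in [dfn]:
  assumes "DS X" "Df s" "Df t" shows "D (%w e. is_succ_in (EE w) (X w e) (s w e) (t w e))"
  unfolding is_succ_in_def by (intro dfn assms(1)[THEN DS_ren] assms(2-)[THEN Df_ren])

lemma D_maps_to_in [dfn]:
  assumes "DS X" "Df s" "Df t" "Df u" shows "D (%w e. maps_to_in (EE w) (X w e) (s w e) (t w e) (u w e))"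
  unfolding maps_to_in_def by (intro dfn assms(1)[THEN DS_ren] assms(2-)[THEN Df_ren])

lemma D_is_function_in [dfn]:
  assumes "DS X" "Df s" "Df t" shows "D (%w e. is_function_in (EE w) (X w e) (s w e) (t w e))"
  unfolding is_function_in_def by (intro dfn assms(1)[THEN DS_ren] assms(2-)[THEN Df_ren])

lemma D_is_ordinal_in [dfn]:
  assumes "DS X" "Df s" shows "D (%w e. is_ordinal_in (EE w) (X w e) (s w e))"
  unfolding is_ordinal_in_def by (intro dfn assms(1)[THEN DS_ren] assms(2-)[THEN Df_ren])

lemma D_is_Vstage_in [dfn]:
  assumes "DS X" "Df s" "Df t" "Df u" shows "D (%w e. is_Vstage_in (EE w) (X w e) (s w e) (t w e) (u w e))"
  unfolding is_Vstage_in_def by (intro dfn assms(1)[THEN DS_ren] assms(2-)[THEN Df_ren])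

lemma D_is_Vseq_in [dfn]:
  assumes "DS X" "Df s" "Df t" shows "D (%w e. is_Vseq_in (EE w) (X w e) (s w e) (t w e))"
  unfolding is_Vseq_in_def by (intro dfn assms(1)[THEN DS_ren] assms(2-)[THEN Df_ren])

lemma D_is_V_in [dfn]:
  assumes "DS X" "Df s" "Df t" shows "D (%w e. is_V_in (EE w) (X w e) (s w e) (t w e))"
  unfolding is_V_in_def by (intro dfn assms(1)[THEN DS_ren] assms(2-)[THEN Df_ren])

lemma D_is_inductive_in [dfn]:
  assumes "DS X" "Df s" shows "D (%w e. is_inductive_in (EE w) (X w e) (s w e))"
  unfolding is_inductive_in_def by (intro dfn assms(1)[THEN DS_ren] assms(2-)[THEN Df_ren])

lemma D_extensionality_in [dfn]:
  assumes "DS X" shows "D (%w e. extensionality_in (EE w) (X w e) )"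
  unfolding extensionality_in_def by (intro dfn assms[THEN DS_ren])

lemma D_foundation_in [dfn]:
  assumes "DS X" shows "D (%w e. foundation_in (EE w) (X w e) )"
  unfolding foundation_in_def by (intro dfn assms[THEN DS_ren])

lemma D_pairing_in [dfn]:
  assumes "DS X" shows "D (%w e. pairing_in (EE w) (X w e) )"
  unfolding pairing_in_def by (intro dfn assms[THEN DS_ren])

lemma D_union_in [dfn]:
  assumes "DS X" shows "D (%w e. union_in (EE w) (X w e) )"
  unfolding union_in_def by (intro dfn assms[THEN DS_ren])

lemma D_power_set_in [dfn]:
  assumes "DS X" shows "D (%w e. power_set_in (EE w) (X w e) )"
  unfolding power_set_in_def by (intro dfn assms[THEN DS_ren])

lemma D_subset [dfn]:
  assumes "Df s" "Df t" shows "D (%w e. subset (EE w) (s w e) (t w e))"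
  unfolding subset_def by (intro dfn assms[THEN Df_ren])

lemma D_ordinal [dfn]:
  assumes "Df s" shows "D (%w e. ordinal (EE w) (s w e))"
  unfolding ordinal_def by (intro dfn assms[THEN Df_ren])

lemma D_ord_le [dfn]:
  assumes "Df s" "Df t" shows "D (%w e. ord_le (EE w) (s w e) (t w e))"
  unfolding ord_le_def by (intro dfn assms[THEN Df_ren])

lemma Df_fun1: assumes "Df (%w e. t (e 0))" "Df s" shows "Df (%w e. t (s w e))"
  by (rule Df_comp1[of "%w. t", OF Df_ren[OF assms(1)] assms(2)])

lemma D_pred1: assumes "D (%w e. R (e 0))" "Df s" shows "D (%w e. R (s w e))"
  by (rule D_sub[OF assms(2)]) (rule assms(1))

lemma D_pred2:
  assumes "D (%w e. R (e 0) (e 1))" "Df s" "Df t" shows "D (%w e. R (s w e) (t w e))"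
  by (rule D_sub[OF assms(2)], rule D_sub[OF Df_ren[OF assms(3)]])
    (use D_ren[OF assms(1), of "case_nat 1 (%_. 0)"] in simp)

lemma Df_fun2:
  assumes "Df (%w e. t (e 0) (e 1))" "Df s" "Df u" shows "Df (%w e. t (s w e) (u w e))"
  unfolding Df_def
  by (rule D_sub[OF Df_ren[OF assms(2)]], rule D_sub[OF Df_ren[OF Df_ren[OF assms(3)]]])
    (use D_ren[OF assms(1)[unfolded Df_def], of "case_nat 2 (case_nat 1 (%_. 0))"] in
      \<open>simp add: numeral_2_eq_2\<close>)

lemma zfw: "w \<in> W ==> EX P. zf2 (EE w) P"
  using zf by (simp add: zf2_def)

lemma Df_emp [dfn]: "Df (%w e. empty_set (EE w))"
proof (rule Df_rel)
  show "D (%w e. ALL x. ~ EE w x (e 0))" by (intro dfn)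
qed (use zfw zf2.emp_iff in metis)

lemma Df_sc [dfn]: assumes "Df s" shows "Df (%w e. succ_set (EE w) (s w e))"
proof (rule Df_rel)
  show "D (%w e. ALL x. EE w x (e 0) \<longleftrightarrow> EE w x (s w (%n. e (Suc n))) | x = s w (%n. e (Suc n)))"
    by (intro dfn assms[THEN Df_ren])
  show "(ALL x. EE w x y \<longleftrightarrow> EE w x (s w e) | x = s w e) \<longleftrightarrow> y = succ_set (EE w) (s w e)" if w: "w \<in> W" for w e y
  proof -
    obtain P where "zf2 (EE w) P" using zfw[OF w] by blast
    then interpret z: zf2 "EE w" P .
    show ?thesis by (auto intro: z.ext)
  qed
qed

lemma Df_opair [dfn]: assumes "Df s" "Df t" shows "Df (%w e. opair (EE w) (s w e) (t w e))"
proof (rule Df_rel)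
  show "D (%w e. is_opair_in (EE w) UNIV (s w (%n. e (Suc n))) (t w (%n. e (Suc n))) (e 0))"
    by (intro dfn assms[THEN Df_ren])
qed (use zfw zf2.opair_iff in metis)

lemma Df_tapp [dfn]: assumes "Df s" "Df t" shows "Df (%w e. tapp (EE w) (s w e) (t w e))"
proof (rule Df_rel)
  let ?M = "%w e y. maps_to_in (EE w) UNIV (s w e) (t w e) y"
  show "D (%w e. if (EX! y. ?M w (%n. e (Suc n)) y) then ?M w (%n. e (Suc n)) (e 0) else e 0 = empty_set (EE w))"
    unfolding if_bool_eq_conj by (intro dfn assms[THEN Df_ren])
  show "(if (EX! y. ?M w e y) then ?M w e y else y = empty_set (EE w)) \<longleftrightarrow> y = tapp (EE w) (s w e) (t w e)" for w e y
    unfolding tapp_def app_def by (rule if_The_iff)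
qed

end

section \<open>Functions given by terms, and the natural numbers of the structure\<close>

context zf2
begin

lemma D_exC [dfn]: "D (%C e. Q (%n. C (Suc n)) e (C 0)) ==> D (%C e. EX Y:P. Q C e Y)"
  by (rule ldf_exC)

lemma D_allC [dfn]: assumes "D (%C e. Q (%n. C (Suc n)) e (C 0))" shows "D (%C e. ALL Y:P. Q C e Y)"
proof -
  have "D (%C e. ~ (EX Y:P. ~ Q C e Y))" by (rule D_not, rule D_exC, rule D_not, rule assms)
  then show ?thesis by simp
qed

lemma DS_Cvar [dfn]: "DS (%C e. C k)"
  unfolding DS_def by (rule ldf_MemCvar[OF UNIV_P])

lemma Df_upair [dfn]: assumes "Df s" "Df t" shows "Df (%w e. upair (s w e) (t w e))"
proof (rule Df_rel)
  show "D (%w e. is_upair_in E UNIV (s w (%n. e (Suc n))) (t w (%n. e (Suc n))) (e 0))"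
    by (intro dfn assms[THEN Df_ren])
qed (simp add: upair_iff)

lemma Df_Uni [dfn]: assumes "Df s" shows "Df (%w e. Uni (s w e))"
  unfolding Uni_def by (rule Df_setof, intro dfn assms[THEN Df_ren], rule set_ex1[OF union])

lemma Df_un2 [dfn]: assumes "Df s" "Df t" shows "Df (%w e. un2 (s w e) (t w e))"
  unfolding un2_def 
  by (rule Df_setof, intro dfn assms[THEN Df_ren], rule set_ex1)
    (use mem_un2 in blast)

lemma Df_Pw [dfn]: assumes "Df s" shows "Df (%w e. Pw (s w e))"
  unfolding Pw_def by (rule Df_setof, intro dfn assms[THEN Df_ren], rule set_ex1[OF power])

lemma Df_img [dfn]:
  assumes "Df (%C e. t (e 0))" "Df s" shows "Df (%w e. img t (s w e))"
  unfolding img_def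
  by (rule Df_setof, intro dfn Df_ren[OF assms(2)] Df_fun1[OF assms(1)])
    (rule set_ex1[OF replacement[OF assms(1)]])

lemma mem_irrefl [simp]: "~ x \<E> x"
  using foundation[of x "upair x x"] by auto

lemma mem_asym: "x \<E> y ==> ~ y \<E> x"
  using foundation[of x "upair x y"] by auto

definition lam where "lam A t = so (%p. EX x. x \<E> A & p = pr x (t x))"

lemma mem_lam: assumes "Df (%C e. t (e 0))" shows "p \<E> lam A t \<longleftrightarrow> (EX x. x \<E> A & p = pr x (t x))"
  unfolding lam_def by (rule setof_mem, rule replacement, intro dfn assms)

lemma fnc_lam: assumes "Df (%C e. t (e 0))" shows "fnc (lam A t) A"
  by (auto simp: fnc_iff mem_lam[OF assms])

lemma ap_lam: assumes "Df (%C e. t (e 0))" "x \<E> A" shows "ap (lam A t) x = t x"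
  using ap_eq[OF fnc_lam[OF assms(1)], of x "t x" A] assms by (simp add: mem_lam)

lemma inductive_iff: "is_inductive_in E UNIV I \<longleftrightarrow> emp \<E> I & (ALL x. x \<E> I --> sc x \<E> I)"
proof -
  have "is_empty_in E UNIV z \<longleftrightarrow> z = emp" for z by (auto simp: is_empty_in_def emp_iff)
  moreover have "is_succ_in E UNIV x s \<longleftrightarrow> s = sc x" for x s
    unfolding is_succ_in_def by (auto intro: ext)
  ultimately show ?thesis by (simp add: is_inductive_in_def)
qed

lemma om_ex: "EX z. ALL n. n \<E> z \<longleftrightarrow> (ALL I. is_inductive_in E UNIV I --> n \<E> I)"
proof -
  obtain I where "is_inductive_in E UNIV I" using zf2 by (auto simp: ZF2_def)
  then show ?thesis by (intro comp_ex[of _ I]) (intro dfn, blast)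
qed

lemma mem_om: "n \<E> om \<longleftrightarrow> (ALL I. emp \<E> I & (ALL x. x \<E> I --> sc x \<E> I) --> n \<E> I)"
  unfolding omega_def by (subst setof_mem[OF om_ex]) (simp add: inductive_iff)

lemma om_0 [simp]: "emp \<E> om" by (simp add: mem_om)

lemma om_sc [simp]: "n \<E> om ==> sc n \<E> om" by (simp add: mem_om)

text \<open>Restricted to definable predicates, since \<open>om\<close> may contain nonstandard
  numbers: leastness of \<open>om\<close> is applied to the subset that Separation provides.\<close>

lemma om_induct [consumes 2, case_names 0 sc]:
  assumes "D (%C e. Q (e 0))" "n \<E> om" "Q emp" "!!n. n \<E> om ==> Q n ==> Q (sc n)"
  shows "Q n"
proof -
  obtain b where b: "ALL x. x \<E> b \<longleftrightarrow> x \<E> om & Q x" using separation[OF assms(1)] by blast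
  have "emp \<E> b" "ALL x. x \<E> b --> sc x \<E> b" using b assms(3,4) by simp_all
  then have "n \<E> b" using assms(2) unfolding mem_om[of n] by blast
  then show ?thesis using b by simp
qed

lemma om_transitive: "n \<E> om ==> ALL x y. x \<E> n --> y \<E> x --> y \<E> n"
  by (rule om_induct[of "%n. ALL x y. x \<E> n --> y \<E> x --> y \<E> n"], intro dfn) auto

lemma om_elem: "n \<E> om ==> ALL x. x \<E> n --> x \<E> om"
  by (rule om_induct[of "%n. ALL x. x \<E> n --> x \<E> om"], intro dfn) auto

lemma Uni_sc: "n \<E> om ==> Uni (sc n) = n"
  using om_transitive[of n] by (intro ext) auto

lemma sc_ne: "sc n ~= emp" "emp ~= sc n"
  by (metis mem_emp mem_sc)+

lemma om_cases: "n \<E> om ==> n = emp | (EX k. k \<E> om & n = sc k)"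
  by (rule om_induct[of "%n. n = emp | (EX k. k \<E> om & n = sc k)"], intro dfn) auto

end

section \<open>Recursion along a definable set-like relation\<close>

locale wf_rec = zf2 E P for E :: "'v => 'v => bool" (infix \<open>\<E>\<close> 50) and P +
  fixes R :: "'v => 'v => bool" and H :: "'v => 'v => 'v"
  assumes DR: "D (%C e. R (e 0) (e 1))" and DH: "Df (%C e. H (e 0) (e 1))"
    and setlike: "!!x. EX z. ALL y. y \<E> z \<longleftrightarrow> R y x"
    and ind: "!!Q x. D (%C e. Q (e 0)) ==> (!!x. (!!y. R y x ==> Q y) ==> Q x) ==> Q x"
begin

definition pd where "pd x = so (%y. R y x)"

lemma mem_pd [simp]: "y \<E> pd x \<longleftrightarrow> R y x"
  unfolding pd_def by (rule setof_mem[OF setlike])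

lemmas [dfn] = D_pred2[OF DR] Df_fun2[OF DH]

lemma Df_pd [dfn]: assumes "Df s" shows "Df (%C e. pd (s C e))"
  unfolding pd_def by (rule Df_setof, intro dfn assms[THEN Df_ren], rule set_ex1[OF setlike])

definition cl :: "'v set => bool" where
  "cl X \<longleftrightarrow> (ALL x f. fnc f (pd x) & (ALL z. R z x --> pr z (ap f z) \<in> X) --> pr x (H x f) \<in> X)"

text \<open>The graph of the recursive function is the least class closed under the recursion step.
  Quantifying over classes is legitimate, since the schemas admit two-sorted formulas, and no
  partial approximations have to be glued together.\<close>

definition G where "G x y \<longleftrightarrow> (ALL X:P. cl X --> pr x y \<in> X)"

lemma DG [dfn]: assumes "Df s" "Df t" shows "D (%C e. G (s C e) (t C e))"
  by (rule D_sub[OF assms(1)], rule D_sub[OF Df_ren[OF assms(2)]])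
    (unfold G_def cl_def, intro dfn)

lemma G_intro: "fnc f (pd x) ==> (!!z. R z x ==> G z (ap f z)) ==> G x (H x f)"
  unfolding G_def by (auto simp: cl_def)

text \<open>Inversion for a least closed class: the pairs of the asserted form already make up a
  closed class, so all pairs of \<open>G\<close> are among them.\<close>

lemma G_elim:
  assumes "G x y"
  obtains f where "fnc f (pd x)" "!!z. R z x ==> G z (ap f z)" "y = H x f"
proof -
  let ?Q = "%p. EX x f. p = pr x (H x f) & fnc f (pd x) & (ALL z. R z x --> G z (ap f z))"
  have "{p. ?Q p} \<in> P" by (rule class_comp, intro dfn)
  moreover have "cl {p. ?Q p}"
    unfolding cl_def
  proof (intro allI impI, elim conjE, rule CollectI, intro exI conjI allI impI)
    fix x f z assume 1: "ALL z. R z x --> pr z (ap f z) \<in> {p. ?Q p}" and "R z x"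
    then obtain f' where "ap f z = H z f'" "fnc f' (pd z)" "ALL y. R y z --> G y (ap f' y)" by auto
    then show "G z (ap f z)" using G_intro by simp
  qed auto
  ultimately have "pr x y \<in> {p. ?Q p}" by (rule assms[unfolded G_def, THEN bspec, THEN mp])
  then show thesis using that by auto
qed

definition F where "F x = (if EX! y. G x y then THE y. G x y else emp)"

lemma Df_F: "Df (%C e. F (e 0))"
proof (rule Df_rel)
  show "D (%C e. if (EX! y. G (e (Suc 0)) y) then G (e (Suc 0)) (e 0) else e 0 = emp)"
    unfolding if_bool_eq_conj by (intro dfn)
  show "(if (EX! y. G (e 0) y) then G (e 0) y else y = emp) \<longleftrightarrow> y = F (e 0)" for e y
    unfolding F_def by (rule if_The_iff)
qed

lemma G_ex1: "EX! y. G x y"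
proof (rule ind[of "%x. EX! y. G x y"])
  show "D (%C e. EX! y. G (e 0) y)" by (intro dfn)
  fix x assume IH: "!!y. R y x ==> EX! z. G y z"
  have F: "G y (F y)" if "R y x" for y
    using IH[OF that] theI'[OF IH[OF that]] by (simp add: F_def)
  show "EX! y. G x y"
  proof (rule ex1I)
    show "G x (H x (lam (pd x) F))"
      by (rule G_intro[OF fnc_lam[OF Df_F]]) (simp add: ap_lam[OF Df_F] F)
    fix y assume "G x y"
    then obtain f where f: "fnc f (pd x)" "!!z. R z x ==> G z (ap f z)" "y = H x f" by (rule G_elim) blast
    have "ap f z = F z" if "R z x" for z
      using f(2)[OF that] F[OF that] IH[OF that] by blast
    then have "f = lam (pd x) F"
      by (intro fnc_ext[OF f(1) fnc_lam[OF Df_F]]) (simp add: ap_lam[OF Df_F])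
    then show "y = H x (lam (pd x) F)" using f(3) by simp
  qed
qed

lemma F_eq: "F x = H x (lam (pd x) F)"
proof -
  have F: "G y (F y)" for y
    using G_ex1 theI'[OF G_ex1] by (simp add: F_def)
  have "G x (H x (lam (pd x) F))"
    by (rule G_intro[OF fnc_lam[OF Df_F]]) (simp add: ap_lam[OF Df_F] F)
  then show ?thesis using F G_ex1 by blast
qed

end

definition tV :: "('v => 'v => bool) => 'v => 'v" where
  "tV E a = (if EX! v. is_V_in E UNIV a v then Vset E a else empty_set E)"

lemma (in definability) Df_tV [dfn]: assumes "Df s" shows "Df (%w e. tV (EE w) (s w e))"
proof (rule Df_rel)
  let ?M = "%w e y. is_V_in (EE w) UNIV (s w e) y"
  show "D (%w e. if (EX! y. ?M w (%n. e (Suc n)) y) then ?M w (%n. e (Suc n)) (e 0) else e 0 = empty_set (EE w))"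
    unfolding if_bool_eq_conj by (intro dfn assms[THEN Df_ren])
  show "(if (EX! y. ?M w e y) then ?M w e y else y = empty_set (EE w)) \<longleftrightarrow> y = tV (EE w) (s w e)" for w e y
    unfolding tV_def Vset_def by (rule if_The_iff)
qed

context zf2
begin

abbreviation "V \<equiv> tV E"

lemma wf_recursion:
  assumes "D (%C e. R (e 0) (e 1))" "Df (%C e. H (e 0) (e 1))" "!!x. EX z. ALL y. y \<E> z \<longleftrightarrow> R y x"
    "!!Q x. D (%C e. Q (e 0)) ==> (!!x. (!!y. R y x ==> Q y) ==> Q x) ==> Q x"
  obtains F where "Df (%C e. F (e 0))" "!!x. F x = H x (lam (so (%y. R y x)) F)"
proof -
  interpret wf_rec E P R H
    by unfold_locales (fact assms)+
  show thesis using that[OF Df_F] F_eq unfolding pd_def by blast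
qed

lemma om_recursion:
  assumes "Df (%C e. st (e 0))"
  obtains F where "Df (%C e. F (e 0))" "F emp = a" "!!n. n \<E> om ==> F (sc n) = st (F n)"
proof -
  \<comment> \<open>\<open>Uni\<close> is the predecessor on natural numbers
    (\<open>Uni_sc\<close>). Each nonzero number has exactly one predecessor under this relation,
    and nothing else has any.\<close>
  let ?R = "%k n. n \<E> om & n ~= emp & k = Uni n"
  have ex: "EX z. ALL y. y \<E> z \<longleftrightarrow> ?R y x" for x
    by (rule comp_ex[of _ "upair (Uni x) (Uni x)"], intro dfn) simp
  have ind: "Q x" if Q: "D (%C e. Q (e 0))" and step: "!!x. (!!y. ?R y x ==> Q y) ==> Q x" for Q x
  proof (cases "x \<E> om")
    case True
    show ?thesis using Q True
      by (induction x rule: om_induct) (rule step, simp, rule step, simp add: Uni_sc)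
  qed (rule step, simp)
  show thesis
  proof (rule wf_recursion[of ?R "%x f. if x = emp then a else st (ap f (Uni x))"])
    show "D (%C e. e 1 \<E> om & e 1 ~= emp & e 0 = Uni (e 1))" by (intro dfn)
    show "Df (%C e. if e 0 = emp then a else st (ap (e 1) (Uni (e 0))))"
      by (intro dfn Df_fun1[OF assms])
    fix F assume F: "Df (%C e. F (e 0))"
      "!!x. F x = (if x = emp then a else st (ap (lam (so (%y. ?R y x)) F) (Uni x)))"
    show thesis
    proof (rule that[OF F(1)])
      show "F emp = a" by (subst F(2)) simp
      fix n assume n: "n \<E> om"
      have "n \<E> so (%y. ?R y (sc n))" unfolding setof_mem[OF ex] using n by (simp add: sc_ne Uni_sc)
      then show "F (sc n) = st (F n)" using n by (subst F(2)) (simp add: sc_ne Uni_sc ap_lam[OF F(1)])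
    qed
  qed (fact ex, fact ind)
qed

text \<open>The set is the union of \<omega> stages, each adding all predecessors of the one before;
  set-likeness keeps the stages sets.\<close>

lemma closure_ex:
  assumes R: "D (%C e. R (e 0) (e 1))" and sl: "!!x. EX z. ALL y. y \<E> z \<longleftrightarrow> R y x"
  obtains d where "x \<E> d" "!!u v. u \<E> d ==> R v u ==> v \<E> d"
proof -
  let ?pd = "%x. so (%y. R y x)"
  have pd: "y \<E> ?pd x \<longleftrightarrow> R y x" for x y by (rule setof_mem[OF sl])
  have Dpd: "Df (%C e. ?pd (e 0))"
    by (rule Df_setof, intro dfn D_pred2[OF R], rule set_ex1[OF sl])
  have "Df (%C e. un2 (e 0) (Uni (img ?pd (e 0))))"
    by (intro dfn Dpd)
  then obtain F where F: "Df (%C e. F (e 0))" "F emp = upair x x"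
    "!!n. n \<E> om ==> F (sc n) = un2 (F n) (Uni (img ?pd (F n)))"
    by (rule om_recursion[of "%a. un2 a (Uni (img ?pd a))" "upair x x"]) blast
  let ?d = "Uni (img F om)"
  have d: "u \<E> ?d \<longleftrightarrow> (EX n. n \<E> om & u \<E> F n)" for u by (auto simp: mem_img[OF F(1)])
  show thesis
  proof (rule that[of ?d])
    show "x \<E> ?d" unfolding d using F(2) by (intro exI[of _ emp]) simp
    fix u v assume "u \<E> ?d" "R v u"
    then obtain n where n: "n \<E> om" "u \<E> F n" unfolding d by blast
    then have "v \<E> F (sc n)" using \<open>R v u\<close> pd by (auto simp: F(3) mem_img[OF Dpd])
    then show "v \<E> ?d" unfolding d using n om_sc by blast
  qed
qed

text \<open>Minimal elements are available for sets only. The counterexamples are therefore cut down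
  to the closure of one of them under predecessors, which is a set by
  \<open>closure_ex\<close>.\<close>

lemma wf_class_induct:
  assumes R: "D (%C e. R (e 0) (e 1))" and sl: "!!x. EX z. ALL y. y \<E> z \<longleftrightarrow> R y x"
    and wf: "!!B x. x \<E> B ==> EX x. x \<E> B & (ALL y. y \<E> B --> ~ R y x)"
    and Q: "D (%C e. Q (e 0))" and step: "!!x. (!!y. R y x ==> Q y) ==> Q x"
  shows "Q x"
proof (rule ccontr)
  assume "~ Q x"
  obtain d where d: "x \<E> d" "!!u v. u \<E> d ==> R v u ==> v \<E> d" using closure_ex[OF R sl] by blast
  obtain B where B: "ALL u. u \<E> B \<longleftrightarrow> u \<E> d & ~ Q u" using separation[OF D_not[OF Q]] by blast
  then have "x \<E> B" using d(1) \<open>~ Q x\<close> by simp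
  then obtain u where u: "u \<E> B" "ALL y. y \<E> B --> ~ R y u" using wf by blast
  have "Q u" by (rule step) (use u B d(2) in blast)
  then show False using u B by blast
qed

lemma elem_ex: "EX z. ALL y. y \<E> z \<longleftrightarrow> y \<E> x" by blast

lemma eps_induct:
  assumes "D (%C e. Q (e 0))" "!!x. (!!y. y \<E> x ==> Q y) ==> Q x"
  shows "Q x"
  by (rule wf_class_induct[of "%y x. y \<E> x", OF _ elem_ex _ assms(1)])
    (intro dfn, use foundation in blast, use assms(2) in blast)

lemma so_mem [simp]: "so (%y. y \<E> x) = x"
  by (rule setof_eq) simp

lemma eps_recursion:
  assumes "Df (%C e. H (e 0) (e 1))"
  obtains F where "Df (%C e. F (e 0))" "!!x. F x = H x (lam x F)"
proof -
  show thesis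
  proof (rule wf_recursion[of "%y x. y \<E> x" H])
    show "D (%C e. e 0 \<E> e 1)" by (intro dfn)
    fix F assume "Df (%C e. F (e 0))" "!!x. F x = H x (lam (so (%y. y \<E> x)) F)"
    then show thesis using that by simp
  qed (fact assms, fact elem_ex, fact eps_induct)
qed

lemma eps_least:
  assumes "D (%C e. Q (e 0))" "Q x"
  obtains m where "Q m" "!!y. y \<E> m ==> ~ Q y"
proof -
  have "EX m. Q m & (ALL y. y \<E> m --> ~ Q y)"
  proof (rule ccontr)
    assume "~ ?thesis"
    then have "~ Q x" using eps_induct[of "%x. ~ Q x", OF D_not[OF assms(1)]] by blast
    then show False using assms(2) by simp
  qed
  then show thesis using that by blast
qed

section \<open>Ordinals and the cumulative hierarchy\<close>

lemma Ord_iff: "Ord a \<longleftrightarrow> (ALL x y. x \<E> a & y \<E> x --> y \<E> a) &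
    (ALL x y. x \<E> a & y \<E> a --> x \<E> y | x = y | y \<E> x)"
  unfolding ordinal_def is_ordinal_in_def sub_in_def by auto

lemma Ord_trans: "Ord a ==> x \<E> a ==> y \<E> x ==> y \<E> a" unfolding Ord_iff by blast

lemma mem_cycle3: "x \<E> y ==> y \<E> z ==> ~ z \<E> x"
  using foundation[of x "un2 (upair x y) (upair z z)"] by auto

lemma Ord_elem: assumes "Ord a" "x \<E> a" shows "Ord x"
  unfolding Ord_iff
proof (intro conjI allI impI)
  fix y z assume "y \<E> x & z \<E> y"
  moreover from this have "z \<E> a" using assms unfolding Ord_iff by blast
  ultimately show "z \<E> x" using assms mem_asym mem_cycle3 unfolding Ord_iff by blast
qed (use assms in \<open>unfold Ord_iff, blast\<close>)

text \<open>The membership-minimal element of \<open>a\<close> outside \<open>i\<close> turns out to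
  have the same elements as \<open>i\<close>.\<close>

lemma Ord_sub_elem:
  assumes "Ord a" "!!x. x \<E> i ==> x \<E> a" "!!x y. x \<E> i ==> y \<E> x ==> y \<E> i" "i ~= a"
  shows "i \<E> a"
proof -
  have "EX b. ALL x. x \<E> b \<longleftrightarrow> x \<E> a & ~ x \<E> i" by (rule separation, intro dfn)
  then obtain b where b: "ALL x. x \<E> b \<longleftrightarrow> x \<E> a & ~ x \<E> i" by blast
  have "EX x. x \<E> b" using assms(2,4) b ext[of i a] by blast
  then obtain m where m: "m \<E> b" "ALL z. z \<E> m --> ~ z \<E> b" using foundation by blast
  have "x \<E> m \<longleftrightarrow> x \<E> i" for x
    using m b assms unfolding Ord_iff by metis
  then have "m = i" by (rule ext)
  then show ?thesis using m b by simp
qed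

text \<open>The intersection is an initial segment of both ordinals; were it proper in both, it
  would be an element of itself.\<close>

lemma Ord_linear: assumes "Ord a" "Ord b" shows "a \<E> b | a = b | b \<E> a"
proof -
  have "EX i. ALL x. x \<E> i \<longleftrightarrow> x \<E> a & x \<E> b" by (rule separation, intro dfn)
  then obtain i where i: "ALL x. x \<E> i \<longleftrightarrow> x \<E> a & x \<E> b" by blast
  have "i = a | i \<E> a"
    using Ord_sub_elem[OF assms(1), of i] i assms unfolding Ord_iff by blast
  moreover have "i = b | i \<E> b"
    using Ord_sub_elem[OF assms(2), of i] i assms unfolding Ord_iff by blast
  ultimately show ?thesis using i mem_irrefl by blast
qed

lemma Ord_sub_le: "Ord a ==> Ord b ==> Sub a b \<longleftrightarrow> a \<E> b | a = b"
  using Ord_linear[of a b] by (auto simp: Sub_iff intro: Ord_trans)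

lemma ord_le_iff: "ord_le E a b \<longleftrightarrow> a \<E> b | a = b"
  by (simp add: ord_le_def)

lemma Ord_not_mem: "Ord a ==> Ord b ==> ~ a \<E> b \<longleftrightarrow> b \<E> a | b = a"
  using Ord_linear[of a b] mem_asym by auto

lemma Ord_emp [simp]: "Ord emp" by (simp add: Ord_iff)

lemma Ord_sc [simp]: "Ord a ==> Ord (sc a)" unfolding Ord_iff by auto

lemma Ord_Uni: assumes "!!x. x \<E> A ==> Ord x" shows "Ord (Uni A)"
  unfolding Ord_iff
proof (intro conjI allI impI)
  fix x y assume "x \<E> Uni A & y \<E> Uni A"
  then have "Ord x" "Ord y" using assms Ord_elem by auto
  then show "x \<E> y | x = y | y \<E> x" by (rule Ord_linear)
qed (use assms Ord_trans in \<open>simp add: Bex_def; metis\<close>)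

lemma Ord_transI: "(!!x. x \<E> A ==> Ord x) ==> (!!x y. x \<E> A ==> y \<E> x ==> y \<E> A) ==> Ord A"
  unfolding Ord_iff[of A] using Ord_linear by blast

lemma om_Ord: "n \<E> om ==> Ord n"
  by (rule om_induct[of "%n. Ord n"], intro dfn) auto

lemma Ord_om [simp]: "Ord om"
  using om_Ord om_elem by (blast intro: Ord_transI)

lemma Ord_induct:
  assumes "D (%C e. Q (e 0))" "Ord a" "!!a. Ord a ==> (!!b. b \<E> a ==> Q b) ==> Q a"
  shows "Q a"
proof -
  have "Ord a --> Q a"
    by (rule eps_induct[of "%a. Ord a --> Q a"], intro dfn assms(1)) (use assms(3) Ord_elem in blast)
  then show ?thesis using assms(2) by blast
qed

lemma Ord_least:
  assumes "D (%C e. Q (e 0))" "Ord a" "Q a"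
  obtains b where "Ord b" "Q b" "!!c. c \<E> b ==> ~ Q c" "b \<E> a | b = a"
proof -
  have "D (%C e. Ord (e 0) & Q (e 0))" by (intro dfn assms(1))
  then obtain b where b: "Ord b & Q b" "!!c. c \<E> b ==> ~ (Ord c & Q c)"
    using eps_least[of "%x. Ord x & Q x" a] assms by blast
  have "b \<E> a | b = a" using b assms Ord_linear[of b a] by blast
  then show thesis using that b Ord_elem by blast
qed

lemma Vf_ex: "EX z. ALL y. y \<E> z \<longleftrightarrow> (EX u. u \<E> x & Sub y (ap f u))"
proof -
  have 1: "Df (%C e. Pw (ap f (e 0)))" by (intro dfn)
  show ?thesis by (rule exI[of _ "Uni (img (%u. Pw (ap f u)) x)"]) (auto simp: mem_img[OF 1])
qed

text \<open>The clause for the levels is iterated over all sets, so that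
  \<open>eps_recursion\<close> applies as it stands; the values at ordinals are the ones of
  interest.\<close>

lemma Vf: obtains F where "Df (%C e. F (e 0))" "!!x z. z \<E> F x \<longleftrightarrow> (EX u. u \<E> x & Sub z (F u))"
proof -
  have "Df (%C e. so (%y. EX u. u \<E> e 0 & Sub y (ap (e 1) u)))"
    by (rule Df_setof, intro dfn, rule set_ex1[OF Vf_ex])
  then obtain F where F: "Df (%C e. F (e 0))" "!!x. F x = so (%y. EX u. u \<E> x & Sub y (ap (lam x F) u))"
    by (rule eps_recursion[of "%x f. so (%y. EX u. u \<E> x & Sub y (ap f u))"]) blast
  show thesis
  proof (rule that[OF F(1)])
    fix x z
    show "z \<E> F x \<longleftrightarrow> (EX u. u \<E> x & Sub z (F u))"
      by (subst F(2), subst setof_mem[OF Vf_ex]) (auto simp: ap_lam[OF F(1)])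
  qed
qed

text \<open>Induction along membership shows that every sequence as in \<open>is_Vseq_in\<close>
  agrees with the function from \<open>Vf\<close>, which in turn restricts to such a
  sequence.\<close>

lemma V_ex1: assumes "Ord a" shows "EX! v. is_V_in E UNIV a v"
    and "Ord a ==> z \<E> VV a \<longleftrightarrow> (EX b. b \<E> a & Sub z (VV b))"
proof -
  obtain F where F: "Df (%C e. F (e 0))" "!!x z. z \<E> F x \<longleftrightarrow> (EX u. u \<E> x & Sub z (F u))" by (rule Vf) blast
  have st: "is_Vstage_in E UNIV f b v \<longleftrightarrow> (ALL x. x \<E> v \<longleftrightarrow> (EX c. c \<E> b & Sub x (ap f c)))"
    if "fnc f a" "b \<E> a | b = a" "Ord a" for a b f v
  proof -
    have "c \<E> b ==> c \<E> a" for c using that Ord_trans by blast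
    then have "c \<E> b & (EX w. pr c w \<E> f & sub_in E UNIV x w) \<longleftrightarrow> c \<E> b & Sub x (ap f c)" for c x
      using fnc_pr[OF that(1)] by (auto simp: subset_def)
    then show ?thesis by (simp add: is_Vstage_in_def maps_to_iff)
  qed
  have "is_V_in E UNIV a v \<longleftrightarrow> v = F a" if a: "Ord a" for a v
  proof
    assume "is_V_in E UNIV a v"
    then obtain f where f: "fnc f a" "ALL b v. b \<E> a --> maps_to_in E UNIV f b v --> is_Vstage_in E UNIV f b v"
      "is_Vstage_in E UNIV f a v" by (auto simp: is_V_in_def is_Vseq_in_def)
    have "b \<E> a --> ap f b = F b" for b
    proof (rule eps_induct[of "%b. b \<E> a --> ap f b = F b"], intro dfn Df_fun1[OF F(1)], intro impI)
      fix b assume IH: "!!c. c \<E> b ==> c \<E> a --> ap f c = F c" and b: "b \<E> a"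
      have "is_Vstage_in E UNIV f b (ap f b)" using f b fnc_ap by (simp add: maps_to_iff)
      then have "z \<E> ap f b \<longleftrightarrow> (EX c. c \<E> b & Sub z (ap f c))" for z using st[OF f(1) _ a] b by blast
      then show "ap f b = F b"
        using IH Ord_trans[OF a b] by (intro ext) (auto simp: F(2))
    qed
    moreover have "z \<E> v \<longleftrightarrow> (EX c. c \<E> a & Sub z (ap f c))" for z using st[OF f(1) _ a] f(3) by blast
    ultimately show "v = F a" by (intro ext) (auto simp: F(2)[of _ a])
  next
    assume v: "v = F a"
    have L: "fnc (lam a F) a" "!!b. b \<E> a ==> ap (lam a F) b = F b"
      using fnc_lam[OF F(1)] ap_lam[OF F(1)] by auto
    have "is_Vstage_in E UNIV (lam a F) b (F b)" if "b \<E> a | b = a" for b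
      unfolding st[OF L(1) that a] F(2)[of _ b] using that L(2) Ord_trans[OF a] by auto
    then show "is_V_in E UNIV a v"
      unfolding is_V_in_def is_Vseq_in_def maps_to_iff using v L
      by (intro bexI[of _ "lam a F"]) (auto simp: fnc_pr[OF L(1)])
  qed
  then have *: "EX! v. is_V_in E UNIV a v" "VV a = F a" if "Ord a" for a
    using that by (simp_all add: Vset_def)
  show "EX! v. is_V_in E UNIV a v" using * assms by blast
  show "Ord a ==> z \<E> VV a \<longleftrightarrow> (EX b. b \<E> a & Sub z (VV b))"
    using F(2)[of z a] * Ord_elem by metis
qed

lemma VV_eq: "Ord a ==> VV a = V a"
  by (simp add: tV_def V_ex1)

lemma mem_V: "Ord a ==> z \<E> V a \<longleftrightarrow> (EX b. b \<E> a & Sub z (V b))"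
  using V_ex1(2)[of a z] VV_eq Ord_elem by metis

lemma V_mono: assumes "Ord b" "a \<E> b | a = b" "z \<E> V a" shows "z \<E> V b"
proof (cases "a = b")
  case False
  then have a: "a \<E> b" "Ord a" using assms Ord_elem by auto
  then obtain c where "c \<E> a" "Sub z (V c)" using mem_V[of a z] assms(3) by blast
  then show ?thesis using mem_V[OF assms(1), of z] Ord_trans[OF assms(1) a(1)] by blast
qed (use assms in simp)

lemma V_trans: assumes "Ord a" "x \<E> V a" "y \<E> x" shows "y \<E> V a"
proof -
  obtain b where "b \<E> a" "Sub x (V b)" using mem_V[OF assms(1), of x] assms(2) by blast
  then show ?thesis using V_mono[OF assms(1), of b y] assms(3) unfolding Sub_iff by blast
qed

lemma V_sub: assumes "Ord a" "x \<E> V a" "Sub y x" shows "y \<E> V a"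
proof -
  obtain b where b: "b \<E> a" "Sub x (V b)" using mem_V[OF assms(1), of x] assms(2) by blast
  then have "Sub y (V b)" using assms(3) unfolding Sub_iff by blast
  then show ?thesis using mem_V[OF assms(1), of y] b by blast
qed

lemma V_sc: assumes "Ord a" shows "x \<E> V (sc a) \<longleftrightarrow> Sub x (V a)"
proof
  assume "x \<E> V (sc a)"
  then obtain b where b: "b \<E> a | b = a" "Sub x (V b)" using mem_V[of "sc a" x] assms by auto
  then show "Sub x (V a)" using V_mono[OF assms b(1)] unfolding Sub_iff by blast
next
  assume "Sub x (V a)"
  then show "x \<E> V (sc a)" using mem_V[of "sc a" x] assms by auto
qed

lemma V_mem_V: assumes "Ord b" "a \<E> b" shows "V a \<E> V b"
proof -
  have "Sub (V a) (V a)" by (simp add: Sub_iff)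
  then show ?thesis using mem_V[OF assms(1), of "V a"] assms(2) by blast
qed

text \<open>Collection bounds levels for the elements of \<open>x\<close>, and their supremum
  provides a level for \<open>x\<close>.\<close>

lemma in_V: "EX a. Ord a & x \<E> V a"
proof (rule eps_induct[of "%x. EX a. Ord a & x \<E> V a"], intro dfn)
  fix x assume IH: "!!y. y \<E> x ==> EX a. Ord a & y \<E> V a"
  have "D (%C e. Ord (e 1) & e 0 \<E> V (e 1))" by (intro dfn)
  then obtain b where b: "ALL y. y \<E> x --> (EX a. a \<E> b & Ord a & y \<E> V a)"
    using collection[of "%y a. Ord a & y \<E> V a" x] IH by blast
  have "EX c. ALL a. a \<E> c \<longleftrightarrow> a \<E> b & Ord a" by (rule separation, intro dfn)
  then obtain c where c: "ALL a. a \<E> c \<longleftrightarrow> a \<E> b & Ord a" by blast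
  let ?a = "sc (Uni c)"
  have o: "Ord (Uni c)" using c by (intro Ord_Uni) simp
  have "y \<E> V ?a" if y: "y \<E> x" for y
  proof -
    obtain a where a: "a \<E> c" "Ord a" "y \<E> V a" using b c y by blast
    have "Sub a (Uni c)" using a by (auto simp: Sub_iff)
    then have "a \<E> Uni c | a = Uni c" using Ord_sub_le[OF a(2) o] by simp
    then show ?thesis using V_mono[of ?a a y] o a by auto
  qed
  then have "x \<E> V (sc ?a)" using V_sc[of ?a x] o by (simp add: Sub_iff)
  then show "EX a. Ord a & x \<E> V a" using o Ord_sc by blast
qed

lemma rk_ex1: "EX! a. Ord a & Sub x (V a) & (ALL b. Ord b & Sub x (V b) --> ord_le E a b)"
proof -
  have 1: "D (%C e. Sub x (V (e 0)))" by (intro dfn)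
  obtain a where "Ord a" "x \<E> V a" using in_V by blast
  then have "Sub x (V a)" using V_trans by (auto simp: Sub_iff)
  then obtain b where b: "Ord b" "Sub x (V b)" "!!c. c \<E> b ==> ~ Sub x (V c)"
    using Ord_least[OF 1 \<open>Ord a\<close>] by blast
  show ?thesis
  proof (rule ex1I[of _ b])
    show "Ord b & Sub x (V b) & (ALL c. Ord c & Sub x (V c) --> ord_le E b c)"
      using b Ord_linear[of b] by (auto simp: ord_le_iff)
  qed (use b mem_asym in \<open>auto simp: ord_le_iff\<close>)
qed

lemma rk_cond: "Ord a & Sub x (VV a) & (ALL b. Ord b & Sub x (VV b) --> ord_le E a b) \<longleftrightarrow>
    Ord a & Sub x (V a) & (ALL b. Ord b & Sub x (V b) --> ord_le E a b)"
  by (auto simp: VV_eq)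

lemma rk_iff: "y = rk x \<longleftrightarrow> Ord y & Sub x (V y) & (ALL b. Ord b & Sub x (V b) --> ord_le E y b)"
  unfolding rank_def rk_cond using theI'[OF rk_ex1[of x]] rk_ex1[of x] by blast

lemma Ord_rk [simp]: "Ord (rk x)" and rk_sub: "Sub x (V (rk x))"
    and rk_least: "Ord b ==> Sub x (V b) ==> rk x \<E> b | rk x = b"
  using rk_iff[of "rk x" x] by (auto simp: ord_le_iff)

lemma mem_V_rk: assumes "Ord a" shows "x \<E> V a \<longleftrightarrow> rk x \<E> a"
proof
  assume "x \<E> V a"
  then obtain b where b: "b \<E> a" "Sub x (V b)" using mem_V assms by blast
  then show "rk x \<E> a" using rk_least[of b x] Ord_elem[OF assms] Ord_trans[OF assms] by blast
next
  assume "rk x \<E> a"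
  then show "x \<E> V a" using mem_V[OF assms] rk_sub by blast
qed

lemma rk_mem: "y \<E> x ==> rk y \<E> rk x"
  using mem_V_rk[OF Ord_rk, of y x] rk_sub[of x] by (simp add: Sub_iff)

lemma rk_le: "Ord a ==> (!!y. y \<E> x ==> rk y \<E> a) ==> rk x \<E> a | rk x = a"
  by (rule rk_least) (auto simp: Sub_iff mem_V_rk)

lemma rk_Ord: assumes "Ord a" shows "rk a = a"
proof -
  have "D (%C e. rk (e 0) = e 0)"
  proof -
    have "D (%C e. e 0 = rk (e 0))" unfolding rk_iff by (intro dfn)
    then show ?thesis by (simp add: eq_commute)
  qed
  then show ?thesis using assms
  proof (rule Ord_induct[of "%a. rk a = a"])
    fix a assume a: "Ord a" and IH: "!!b. b \<E> a ==> rk b = b"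
    have "rk a \<E> a | rk a = a" by (rule rk_le[OF a]) (simp add: IH)
    moreover have "~ rk a \<E> a" using rk_mem[of "rk a" a] IH[of "rk a"] by auto
    ultimately show "rk a = a" by blast
  qed
qed

lemma Ord_V: "Ord a ==> Ord b ==> b \<E> V a \<longleftrightarrow> b \<E> a"
  by (simp add: mem_V_rk rk_Ord)

definition Lim where "Lim a \<longleftrightarrow> Ord a & emp \<E> a & (ALL x. x \<E> a --> sc x \<E> a)"

lemma Lim_Ord: "Lim a ==> Ord a" by (simp add: Lim_def)

text \<open>Each of the two layers of a Kuratowski pair costs one level.\<close>

lemma pr_rank: assumes "Ord a" "x \<E> V a" "y \<E> V a" shows "pr x y \<E> V (sc (sc a))"
proof -
  have "upair u v \<E> V (sc b)" if "Ord b" "u \<E> V b" "v \<E> V b" for b u v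
    using that by (subst V_sc) (auto simp: Sub_iff)
  then show ?thesis using assms by (simp add: pr_eq)
qed

lemma Ord_max: assumes "Ord a" "b \<E> a" "c \<E> a" shows "EX d. d \<E> a & Sub b d & Sub c d"
proof -
  have "Ord b" "Ord c" using assms Ord_elem by auto
  then show ?thesis using Ord_linear[of b c] assms Ord_sub_le[of b c] Ord_sub_le[of c b]
    by (metis Sub_iff)
qed

lemma V_mono_Sub: "Ord a ==> Ord b ==> Sub a b ==> z \<E> V a ==> z \<E> V b"
  using Ord_sub_le V_mono by blast

lemma V_max: assumes "Ord a" "x \<E> V a" "y \<E> V a" "Lim a"
  obtains b where "b \<E> a" "x \<E> V b" "y \<E> V b"
proof -
  have "sc (rk x) \<E> a" "sc (rk y) \<E> a" using assms by (auto simp: mem_V_rk Lim_def)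
  then obtain d where d: "d \<E> a" "Sub (sc (rk x)) d" "Sub (sc (rk y)) d" using Ord_max assms by blast
  then have "Ord d" using Ord_elem assms by blast
  then show thesis using that[of d] d by (simp add: mem_V_rk Sub_iff)
qed

lemma Lim_V_ex: "Lim a ==> x \<E> V a ==> EX b. b \<E> a & x \<E> V b"
  using V_max Lim_Ord by metis

lemma Lim_pr: assumes "Lim a" shows "pr x y \<E> V a \<longleftrightarrow> x \<E> V a & y \<E> V a"
proof
  have a: "Ord a" using assms Lim_Ord by blast
  assume "x \<E> V a & y \<E> V a"
  then obtain b where "b \<E> a" "x \<E> V b" "y \<E> V b" using V_max assms a by metis
  then have "pr x y \<E> V (sc (sc b))" using pr_rank[OF Ord_elem[OF a]] by blast
  moreover have "sc (sc b) \<E> a" using \<open>b \<E> a\<close> assms unfolding Lim_def by blast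
  ultimately show "pr x y \<E> V a" using V_mono[OF a, of "sc (sc b)"] by blast
next
  have a: "Ord a" using assms Lim_Ord by blast
  assume p: "pr x y \<E> V a"
  have u: "upair x y \<E> V a" by (rule V_trans[OF a p]) (simp add: pr_eq)
  show "x \<E> V a & y \<E> V a" using V_trans[OF a u, of x] V_trans[OF a u, of y] by simp
qed

end

lemma (in definability) Df_rank [dfn]: assumes "Df s" shows "Df (%w e. rank (EE w) (s w e))"
proof (rule Df_rel)
  show "D (%w e. ordinal (EE w) (e 0) & subset (EE w) (s w (%n. e (Suc n))) (tV (EE w) (e 0)) &
     (ALL b. ordinal (EE w) b & subset (EE w) (s w (%n. e (Suc n))) (tV (EE w) b) --> ord_le (EE w) (e 0) b))"
    by (intro dfn assms[THEN Df_ren])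
qed (use zfw zf2.rk_iff in metis)

lemma (in definability) Df_omega [dfn]: "Df (%w e. omega (EE w))"
  unfolding omega_def
proof (rule Df_setof, intro dfn)
  fix w e assume "w \<in> W"
  then obtain P where "zf2 (EE w) P" using zfw by blast
  then show "EX! z. ALL x. EE w x z \<longleftrightarrow> (ALL I. is_inductive_in (EE w) UNIV I --> EE w x I)"
    using zf2.set_ex1[OF _ zf2.om_ex] by blast
qed

section \<open>Bounded formulas\<close>

inductive delta0 :: "fm2 => bool" where
  delta0_Mem: "delta0 (Mem i k)"
| delta0_Eq: "delta0 (Eq i k)"
| delta0_Neg: "delta0 \<phi> ==> delta0 (Neg \<phi>)"
| delta0_And: "delta0 \<phi> ==> delta0 \<psi> ==> delta0 (And \<phi> \<psi>)"
| delta0_Bex: "i ~= k ==> delta0 \<phi> ==> delta0 (Ex i (And (Mem i k) \<phi>))"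

text \<open>Meta-level satisfaction over a class, the counterpart of internal truth in
  \<open>truth_code\<close>. The clauses for class formulas are dummies, as only first-order
  formulas are evaluated.\<close>

primrec satr :: "('v => 'v => bool) => 'v set => (nat => 'v) => fm2 => bool" where
  "satr E A e (Mem i k) \<longleftrightarrow> E (e i) (e k)"
| "satr E A e (Eq i k) \<longleftrightarrow> e i = e k"
| "satr E A e (MemC i k) \<longleftrightarrow> False"
| "satr E A e (Neg \<phi>) \<longleftrightarrow> ~ satr E A e \<phi>"
| "satr E A e (And \<phi> \<psi>) \<longleftrightarrow> satr E A e \<phi> & satr E A e \<psi>"
| "satr E A e (Ex i \<phi>) \<longleftrightarrow> (EX x:A. satr E A (e(i := x)) \<phi>)"
| "satr E A e (ExC i \<phi>) \<longleftrightarrow> False"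

lemma satr_UNIV: "first_order \<phi> ==> satr E UNIV e \<phi> \<longleftrightarrow> sat2 E P e C \<phi>"
  by (induction \<phi> arbitrary: e) auto

lemma delta0_first_order: "delta0 \<phi> ==> first_order \<phi>"
  by (induction rule: delta0.induct) auto

lemma satr_vars: "EX k. ALL e e'. (ALL n<k. e n = e' n) --> satr E A e \<phi> = satr E A e' \<phi>"
proof (induction \<phi>)
  case (Mem i k) show ?case by (rule exI[of _ "Suc (i + k)"]) auto
next
  case (Eq i k) show ?case by (rule exI[of _ "Suc (i + k)"]) auto
next
  case (And \<phi> \<psi>)
  then obtain k l where "ALL e e'. (ALL n<k. e n = e' n) --> satr E A e \<phi> = satr E A e' \<phi>"
    "ALL e e'. (ALL n<l. e n = e' n) --> satr E A e \<psi> = satr E A e' \<psi>" by blast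
  then have "satr E A e \<phi> = satr E A e' \<phi>" "satr E A e \<psi> = satr E A e' \<psi>" if "ALL n<k+l. e n = e' n" for e e'
    using that by simp_all
  then show ?case by (intro exI[of _ "k + l"]) (simp, blast)
next
  case (Ex i \<phi>)
  then obtain k where k: "ALL e e'. (ALL n<k. e n = e' n) --> satr E A e \<phi> = satr E A e' \<phi>" by blast
  have "satr E A (e(i := x)) \<phi> = satr E A (e'(i := x)) \<phi>" if "ALL n<k. e n = e' n" for e e' x
    using k that by simp
  then show ?case by (intro exI[of _ k]) (simp, blast)
qed simp_all

lemma delta0_absolute:
  assumes "delta0 \<phi>" "transitive_class E A" "ALL n. e n \<in> A"
  shows "satr E A e \<phi> \<longleftrightarrow> satr E UNIV e \<phi>"
  using assms(1,3)
proof (induction arbitrary: e rule: delta0.induct)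
  case (delta0_Bex i k \<phi>)
  have "x \<in> A" if "E x (e k)" for x
    using that delta0_Bex.prems assms(2) unfolding transitive_class_def elts_def by blast
  moreover have "satr E A (e(i := x)) \<phi> = satr E UNIV (e(i := x)) \<phi>" if "x \<in> A" for x
  proof -
    have "ALL n. (e(i := x)) n \<in> A" using that delta0_Bex.prems by simp
    then show ?thesis by (rule delta0_Bex.IH)
  qed
  ultimately show ?case using delta0_Bex(1) by auto
qed auto

named_theorems d0

section \<open>Bounded predicates and the maps that preserve them\<close>

context zf2
begin

text \<open>Only standard formulas, the elements of \<open>fm2\<close>, are meant, although
  elementarity is about codes inside the structure. Standard ones suffice, because codes and truth
  sets can themselves occur as arguments of a bounded predicate.\<close>

definition D0 :: "((nat => 'v) => bool) => bool" where
  "D0 Q \<longleftrightarrow> gdf delta0 {(E, P)} (%_. Q)"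

lemma D0_cong: "D0 Q ==> (!!e. Q e = Q' e) ==> D0 Q'"
  unfolding D0_def by (erule gdf_cong) simp

lemma D0_mem [d0]: "D0 (%e. e a \<E> e b)"
  unfolding D0_def by (rule gdf_cong[OF gdf_Mem[of delta0 _ a b, OF delta0_Mem]]) simp

lemma D0_eq [d0]: "D0 (%e. e a = e b)"
  unfolding D0_def by (rule gdf_Eq, rule delta0_Eq)

lemma D0_not [d0]: "D0 Q ==> D0 (%e. ~ Q e)"
  unfolding D0_def by (rule gdf_not, rule delta0_Neg)

lemma D0_and [d0]: "D0 Q ==> D0 R ==> D0 (%e. Q e & R e)"
  unfolding D0_def by (rule gdf_and, rule delta0_And)

lemma D0_or [d0]: assumes "D0 Q" "D0 R" shows "D0 (%e. Q e | R e)"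
proof -
  have "D0 (%e. ~ (~ Q e & ~ R e))" by (rule D0_not, rule D0_and; rule D0_not, rule assms)
  then show ?thesis by simp
qed

lemma D0_imp [d0]: assumes "D0 Q" "D0 R" shows "D0 (%e. Q e --> R e)"
  unfolding imp_conv_disj by (rule D0_or, rule D0_not, rule assms, rule assms)

lemma D0_iff [d0]: assumes "D0 Q" "D0 R" shows "D0 (%e. Q e \<longleftrightarrow> R e)"
  unfolding iff_conv_conj_imp by (rule D0_and; rule D0_imp, rule assms, rule assms)

lemma D0_bex [d0]:
  assumes "D0 (%e. Q (%n. e (Suc n)) (e 0))" shows "D0 (%e. EX y:el (e b). Q e y)"
  unfolding D0_def
  by (rule gdf_cong[OF gdf_bex[of delta0 "{(E, P)}" "%_. Q" b, OF delta0_Bex]])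
    (use assms in \<open>auto simp: D0_def\<close>)

lemma D0_ball [d0]:
  assumes "D0 (%e. Q (%n. e (Suc n)) (e 0))" shows "D0 (%e. ALL y:el (e b). Q e y)"
proof -
  have "D0 (%e. ~ (EX y:el (e b). ~ Q e y))" by (rule D0_not, rule D0_bex, rule D0_not, rule assms)
  then show ?thesis by simp
qed

lemma D0_ren: "D0 Q ==> D0 (%e. Q (%n. e (r n)))"
  unfolding D0_def by (rule gdf_ren)

lemma D0_const [d0]: "D0 (%e. b)"
  using D0_eq[of 0 0] D0_not[OF D0_eq[of 0 0]] by (cases b) simp_all

lemma el_ball: "(ALL x:el a. Q x) \<longleftrightarrow> (ALL x. x \<E> a --> Q x)"
  and el_bex: "(EX x:el a. Q x) \<longleftrightarrow> (EX x. x \<E> a & Q x)"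
  by (auto simp: Ball_def Bex_def)

lemma D0_Sub [d0]: "D0 (%e. Sub (e a) (e b))"
proof -
  have "D0 (%e. ALL x:el (e a). x \<E> e b)" by (intro d0)
  then show ?thesis by (rule D0_cong) (simp add: Sub_iff el_ball)
qed

lemma D0_empty [d0]: "D0 (%e. e a = emp)"
proof -
  have "D0 (%e. ALL x:el (e a). False)" by (intro d0)
  then show ?thesis by (rule D0_cong) (simp add: emp_iff)
qed

lemma sc_iff: "y = sc x \<longleftrightarrow> (ALL z. z \<E> y \<longleftrightarrow> z \<E> x | z = x)"
  by (rule iffI, simp, rule ext, simp)

lemma D0_sc [d0]: "D0 (%e. e b = sc (e a))"
proof -
  have "D0 (%e. e a \<E> e b & Sub (e a) (e b) & (ALL x:el (e b). x \<E> e a | x = e a))" by (intro d0)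
  then show ?thesis by (rule D0_cong, unfold sc_iff Sub_iff el_ball) blast
qed

lemma D0_pr [d0]: "D0 (%e. e p = pr (e a) (e b))"
proof -
  have u: "D0 (%e. e s = upair (e a) (e b))" for s a b
  proof -
    have "D0 (%e. e a \<E> e s & e b \<E> e s & (ALL x:el (e s). x = e a | x = e b))" by (intro d0)
    then show ?thesis by (rule D0_cong) (auto intro: ext)
  qed
  have "D0 (%e. EX s:el (e p). EX t:el (e p). s = upair (e a) (e a) & t = upair (e a) (e b) & e p = upair s t)"
    by (intro d0 u)
  then show ?thesis by (rule D0_cong) (auto simp: pr_eq)
qed

lemma D0_pr_sym [d0]: "D0 (%e. pr (e a) (e b) = e p)"
  using D0_pr by (simp add: eq_commute)

lemma D0_pr_mem [d0]: "D0 (%e. pr (e a) (e b) \<E> e f)"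
proof -
  have "D0 (%e. EX p:el (e f). p = pr (e a) (e b))" by (intro d0)
  then show ?thesis by (rule D0_cong) auto
qed

text \<open>Both components of a pair are elements of \<open>upair x y\<close>, itself an element of
  the pair; this bounds quantifiers over the pairs in \<open>f\<close>.\<close>

lemma ex_pr_bounded:
  "(EX p:el f. EX t:el p. EX y:el t. p = pr a y & Q y) \<longleftrightarrow> (EX y. pr a y \<E> f & Q y)"
  "(EX p:el f. EX t:el p. EX x:el t. EX y:el t. p = pr x y & R x y) \<longleftrightarrow> (EX x y. pr x y \<E> f & R x y)"
proof -
  have u: "upair x y \<E> pr x y" for x y by (simp add: pr_eq)
  show "(EX p:el f. EX t:el p. EX y:el t. p = pr a y & Q y) \<longleftrightarrow> (EX y. pr a y \<E> f & Q y)" (is "?L \<longleftrightarrow> ?R")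
  proof
    assume ?R
    then obtain y where "pr a y \<E> f" "Q y" by blast
    then show ?L unfolding el_bex using u[of a y]
      by (intro exI[of _ "pr a y"] conjI exI[of _ "upair a y"] exI[of _ y]) simp_all
  qed auto
  show "(EX p:el f. EX t:el p. EX x:el t. EX y:el t. p = pr x y & R x y) \<longleftrightarrow> (EX x y. pr x y \<E> f & R x y)"
    (is "?L \<longleftrightarrow> ?R")
  proof
    assume ?R
    then obtain x y where "pr x y \<E> f" "R x y" by blast
    then show ?L unfolding el_bex using u[of x y]
      by (intro exI[of _ "pr x y"] conjI exI[of _ "upair x y"] exI[of _ x] exI[of _ y]) simp_all
  qed (auto, blast)
qed

lemma D0_ex_pr [d0]:
  assumes "D0 (%e. Q (%n. e (Suc n)) (e 0))" shows "D0 (%e. EX y. pr (e a) y \<E> e f & Q e y)"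
proof -
  have "D0 (%e. EX p:el (e f). EX t:el p. EX y:el t. p = pr (e a) y & Q e y)"
    using D0_ren[OF assms, of "case_nat 0 (%n. Suc (Suc (Suc n)))"] by (intro d0) simp
  then show ?thesis by (rule D0_cong) (rule ex_pr_bounded)
qed

lemma D0_all_pr [d0]:
  assumes "D0 (%e. Q (%n. e (Suc n)) (e 0))" shows "D0 (%e. ALL y. pr (e a) y \<E> e f --> Q e y)"
proof -
  have "D0 (%e. ~ (EX y. pr (e a) y \<E> e f & ~ Q e y))" by (rule D0_not, rule D0_ex_pr, rule D0_not, rule assms)
  then show ?thesis by simp
qed

lemma D0_ex_pr2 [d0]:
  assumes "D0 (%e. Q (%n. e (Suc (Suc n))) (e 1) (e 0))"
  shows "D0 (%e. EX x y. pr x y \<E> e f & Q e x y)"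
proof -
  have "D0 (%e. EX p:el (e f). EX t:el p. EX x:el t. EX y:el t. p = pr x y & Q e x y)"
    using D0_ren[OF assms, of "case_nat 0 (case_nat 1 (%n. n + 4))"]
    by (intro d0) (simp add: numeral_eq_Suc)
  then show ?thesis by (rule D0_cong) (rule ex_pr_bounded)
qed

lemma D0_all_pr2 [d0]:
  assumes "D0 (%e. Q (%n. e (Suc (Suc n))) (e 1) (e 0))"
  shows "D0 (%e. ALL x y. pr x y \<E> e f --> Q e x y)"
proof -
  have "D0 (%e. ~ (EX x y. pr x y \<E> e f & ~ Q e x y))" by (rule D0_not, rule D0_ex_pr2, rule D0_not, rule assms)
  then show ?thesis by simp
qed

lemma D0_fnc [d0]: "D0 (%e. fnc (e f) (e a))"
proof -
  have "D0 (%e. (ALL p:el (e f). EX x:el (e a). EX y. pr x y \<E> e f & p = pr x y) &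
      (ALL x:el (e a). (EX y. pr x y \<E> e f & (ALL z. pr x z \<E> e f --> z = y))))" by (intro d0)
  then show ?thesis by (rule D0_cong) (unfold fnc_iff el_ball el_bex Ex1_def, metis)
qed

lemma D0_Ord [d0]: "D0 (%e. Ord (e a))"
proof -
  have "D0 (%e. (ALL x:el (e a). Sub x (e a)) & (ALL x:el (e a). ALL y:el (e a). x \<E> y | x = y | y \<E> x))"
    by (intro d0)
  then show ?thesis by (rule D0_cong) (unfold Ord_iff Sub_iff el_ball, blast)
qed

text \<open>Stated for predicates rather than formulas: whatever is to be transported is written in
  HOL and checked with \<open>d0\<close>.\<close>

definition pres :: "('v => 'v) => 'v set => bool" where
  "pres h A \<longleftrightarrow> (ALL Q e. D0 Q --> (ALL n. e n \<in> A) --> Q e = Q (%n. h (e n)))"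

lemma pres_env: "pres h A ==> D0 Q ==> (!!n. e n \<in> A) ==> Q e = Q (%n. h (e n))"
  by (auto simp: pres_def)

text \<open>Forms of fixed arity. The environment repeats the last argument for ever, so that all
  its values lie in \<open>A\<close>.\<close>

lemma pres1:
  assumes "pres h A" "D0 (%e. Q (e 0))" "a \<in> A"
  shows "Q a \<longleftrightarrow> Q (h a)"
  using pres_env[OF assms(1,2), of "(%_. a)"] assms(3-)
  by (simp add: numeral_eq_Suc split: nat.split)

lemma pres2:
  assumes "pres h A" "D0 (%e. Q (e 0) (e 1))" "a \<in> A" "b \<in> A"
  shows "Q a b \<longleftrightarrow> Q (h a) (h b)"
  using pres_env[OF assms(1,2), of "(case_nat a (%_. b))"] assms(3-)
  by (simp add: numeral_eq_Suc split: nat.split)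

lemma pres3:
  assumes "pres h A" "D0 (%e. Q (e 0) (e 1) (e 2))" "a \<in> A" "b \<in> A" "c \<in> A"
  shows "Q a b c \<longleftrightarrow> Q (h a) (h b) (h c)"
  using pres_env[OF assms(1,2), of "(case_nat a (case_nat b (%_. c)))"] assms(3-)
  by (simp add: numeral_eq_Suc split: nat.split)

lemma pres4:
  assumes "pres h A" "D0 (%e. Q (e 0) (e 1) (e 2) (e 3))" "a \<in> A" "b \<in> A" "c \<in> A" "d \<in> A"
  shows "Q a b c d \<longleftrightarrow> Q (h a) (h b) (h c) (h d)"
  using pres_env[OF assms(1,2), of "(case_nat a (case_nat b (case_nat c (%_. d))))"] assms(3-)
  by (simp add: numeral_eq_Suc split: nat.split)

lemma pres5:
  assumes "pres h A" "D0 (%e. Q (e 0) (e 1) (e 2) (e 3) (e 4))" "a \<in> A" "b \<in> A" "c \<in> A" "d \<in> A" "f \<in> A"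
  shows "Q a b c d f \<longleftrightarrow> Q (h a) (h b) (h c) (h d) (h f)"
  using pres_env[OF assms(1,2), of "(case_nat a (case_nat b (case_nat c (case_nat d (%_. f)))))"] assms(3-)
  by (simp add: numeral_eq_Suc split: nat.split)

lemma pres6:
  assumes "pres h A" "D0 (%e. Q (e 0) (e 1) (e 2) (e 3) (e 4) (e 5))" "a \<in> A" "b \<in> A" "c \<in> A" "d \<in> A" "f \<in> A" "g \<in> A"
  shows "Q a b c d f g \<longleftrightarrow> Q (h a) (h b) (h c) (h d) (h f) (h g)"
  using pres_env[OF assms(1,2), of "(case_nat a (case_nat b (case_nat c (case_nat d (case_nat f (%_. g))))))"] assms(3-)
  by (simp add: numeral_eq_Suc split: nat.split)

lemma D0_fm:
  assumes "D0 Q"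
  obtains \<phi> where "delta0 \<phi>" "!!e. satr E UNIV e \<phi> \<longleftrightarrow> Q e"
proof -
  obtain \<phi> where "delta0 \<phi>" "ALL w:{(E, P)}. ALL e C. sat2 (fst w) (snd w) e C \<phi> \<longleftrightarrow> Q (%n. e n)"
    using assms unfolding D0_def gdf_def by (elim exE conjE) (drule spec[of _ "%n. n"], blast)
  then show thesis using that[of \<phi>] satr_UNIV[OF delta0_first_order, of \<phi> E _ P "%_. {}"] by simp
qed

end

section \<open>Formulas and satisfaction inside the structure\<close>

text \<open>\<open>vr\<close> and \<open>truth\<close> are \<open>variant\<close> and
  \<open>truth_relation\<close> with \<open>tapp\<close> in place of \<open>app\<close>, hence
  definable for all arguments.\<close>

definition vr :: "('v => 'v => bool) => 'v => 'v => 'v => bool" where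
  "vr E i s t \<longleftrightarrow> (ALL n:elts E (omega E). n ~= i --> tapp E t n = tapp E s n)"

definition truth :: "('v => 'v => bool) => 'v set => 'v set => bool" where
  "truth E A T \<longleftrightarrow> (ALL s. assignment E A s -->
     (ALL i:elts E (omega E). ALL k:elts E (omega E).
        (opair E (cMem E i k) s \<in> T \<longleftrightarrow> E (tapp E s i) (tapp E s k)) &
        (opair E (cEq E i k) s \<in> T \<longleftrightarrow> tapp E s i = tapp E s k)) &
     (ALL \<phi>. is_fm E \<phi> --> (opair E (cNeg E \<phi>) s \<in> T \<longleftrightarrow> opair E \<phi> s \<notin> T)) &
     (ALL \<phi> \<psi>. is_fm E \<phi> & is_fm E \<psi> -->
        (opair E (cAnd E \<phi> \<psi>) s \<in> T \<longleftrightarrow> opair E \<phi> s \<in> T & opair E \<psi> s \<in> T)) &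
     (ALL i:elts E (omega E). ALL \<phi>. is_fm E \<phi> -->
        (opair E (cEx E i \<phi>) s \<in> T \<longleftrightarrow>
           (EX t. assignment E A t & vr E i s t & opair E \<phi> t \<in> T))))"

context zf2
begin

lemma maps_iff: "maps E f A B \<longleftrightarrow> fnc f A & (ALL x:el A. ap f x \<E> B)"
  unfolding maps_def by (auto simp: ap_app)

lemma bijection_iff: "bijection E f A B \<longleftrightarrow> maps E f A B & (ALL y:el B. EX! x. x \<E> A & ap f x = y)"
proof (cases "fnc f A")
  case True
  then have "x \<E> A & app E f x = y \<longleftrightarrow> x \<E> A & ap f x = y" for x y using ap_app by auto
  then show ?thesis by (simp add: bijection_def)
qed (simp add: bijection_def maps_iff)

lemma assignment_iff: "assignment E A s \<longleftrightarrow> fnc s om & (ALL n:el om. ap s n \<in> A)"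
  unfolding assignment_def by (auto simp: ap_app)

lemma asgD: "assignment E A s ==> fnc s om" "assignment E A s ==> n \<E> om ==> ap s n \<in> A"
  by (auto simp: assignment_iff)

lemma variant_iff: "assignment E A s ==> assignment E B t ==> variant E i s t \<longleftrightarrow> vr E i s t"
  unfolding variant_def vr_def by (auto simp: ap_app[OF asgD(1)])

lemma truth_iff: "truth_relation E A T \<longleftrightarrow> truth E A T"
proof -
  have 1: "(EX t. assignment E A t & variant E i s t & Q t) \<longleftrightarrow> (EX t. assignment E A t & vr E i s t & Q t)"
    if "assignment E A s" for i s Q using variant_iff[OF that] by blast
  show ?thesis
    unfolding truth_relation_def truth_def
    by (rule all_cong1, rule imp_cong[OF refl]) (auto simp: 1 ap_app[OF asgD(1)])
qed

end

context definability
begin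

lemma zfE: assumes "w \<in> W" obtains P where "zf2 (EE w) P"
  using zfw[OF assms] by blast

lemma D_maps [dfn]: assumes "Df s" "Df t" "Df u" shows "D (%w e. maps (EE w) (s w e) (t w e) (u w e))"
proof (rule D_cong)
  show "D (%w e. is_function_in (EE w) UNIV (s w e) (t w e) &
      (ALL x:elts (EE w) (t w e). EE w (tapp (EE w) (s w e) x) (u w e)))"
    by (intro dfn assms[THEN Df_ren])
qed (erule zfE, rule sym, erule zf2.maps_iff)

lemma D_bijection [dfn]: assumes "Df s" "Df t" "Df u" shows "D (%w e. bijection (EE w) (s w e) (t w e) (u w e))"
proof (rule D_cong)
  show "D (%w e. maps (EE w) (s w e) (t w e) (u w e) &
      (ALL y:elts (EE w) (u w e). EX! x. EE w x (t w e) & tapp (EE w) (s w e) x = y))"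
    by (intro dfn assms[THEN Df_ren])
qed (erule zfE, rule sym, erule zf2.bijection_iff)

lemma D_assignment [dfn]: assumes "DS X" "Df s" shows "D (%w e. assignment (EE w) (X w e) (s w e))"
proof (rule D_cong)
  show "D (%w e. is_function_in (EE w) UNIV (s w e) (omega (EE w)) &
      (ALL n:elts (EE w) (omega (EE w)). tapp (EE w) (s w e) n \<in> X w e))"
    by (intro dfn assms(2)[THEN Df_ren] assms(1)[THEN DS_ren])
qed (erule zfE, rule sym, erule zf2.assignment_iff)

lemma D_vr [dfn]: assumes "Df s" "Df t" "Df u" shows "D (%w e. vr (EE w) (s w e) (t w e) (u w e))"
  unfolding vr_def by (intro dfn assms[THEN Df_ren])

lemma Df_cMem [dfn]: assumes "Df s" "Df t" shows "Df (%w e. cMem (EE w) (s w e) (t w e))"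
  unfolding cMem_def by (intro dfn assms)

lemma Df_cEq [dfn]: assumes "Df s" "Df t" shows "Df (%w e. cEq (EE w) (s w e) (t w e))"
  unfolding cEq_def by (intro dfn assms)

lemma Df_cNeg [dfn]: assumes "Df s" shows "Df (%w e. cNeg (EE w) (s w e))"
  unfolding cNeg_def by (intro dfn assms)

lemma Df_cAnd [dfn]: assumes "Df s" "Df t" shows "Df (%w e. cAnd (EE w) (s w e) (t w e))"
  unfolding cAnd_def by (intro dfn assms)

lemma Df_cEx [dfn]: assumes "Df s" "Df t" shows "Df (%w e. cEx (EE w) (s w e) (t w e))"
  unfolding cEx_def by (intro dfn assms)

lemma D_is_fm [dfn]: assumes "Df s" shows "D (%w e. is_fm (EE w) (s w e))"
  unfolding is_fm_def by (intro dfn assms[THEN Df_ren])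

lemma D_is_Delta0 [dfn]: assumes "Df s" shows "D (%w e. is_Delta0 (EE w) (s w e))"
  unfolding is_Delta0_def by (intro dfn assms[THEN Df_ren])

lemma D_is_Sigma1 [dfn]: assumes "Df s" shows "D (%w e. is_Sigma1 (EE w) (s w e))"
  unfolding is_Sigma1_def by (intro dfn assms[THEN Df_ren])

lemma D_truth [dfn]: assumes "DS X" "DS Y" shows "D (%w e. truth (EE w) (X w e) (Y w e))"
  unfolding truth_def by (intro dfn assms[THEN DS_ren])

lemma D_truth_relation [dfn]:
  assumes "DS X" "DS Y" shows "D (%w e. truth_relation (EE w) (X w e) (Y w e))"
  by (rule D_cong[OF D_truth[OF assms]]) (erule zfE, rule sym, erule zf2.truth_iff)

lemma D_models [dfn]:
  assumes "Df s" "Df t" "Df u" shows "D (%w e. models (EE w) (s w e) (t w e) (u w e))"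
  unfolding models_def by (intro dfn assms[THEN Df_ren])

lemma D_elementary_sub [dfn]:
  assumes "Df s" "Df t" shows "D (%w e. elementary_sub (EE w) (s w e) (t w e))"
  unfolding elementary_sub_def by (intro dfn assms[THEN Df_ren])

end

section \<open>Codes of formulas and truth relations\<close>

context zf2
begin

primrec num :: "nat => 'v" where
  "num 0 = emp" | "num (Suc n) = sc (num n)"

lemma num_om [simp]: "num n \<E> om" by (induction n) auto

lemma num_less: "m < n ==> num m \<E> num n" by (induction n) (auto simp: less_Suc_eq)

lemma num_inject [simp]: "num m = num n \<longleftrightarrow> m = n"
  using num_less[of m n] num_less[of n m] by (metis mem_irrefl linorder_neqE_nat)

lemma codes_num: "cMem E i k = pr (num 0) (pr i k)" "cEq E i k = pr (num 1) (pr i k)"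
    "cNeg E \<phi> = pr (num 2) \<phi>" "cAnd E \<phi> \<psi> = pr (num 3) (pr \<phi> \<psi>)" "cEx E i \<phi> = pr (num 4) (pr i \<phi>)"
  by (simp_all add: cMem_def cEq_def cNeg_def cAnd_def cEx_def numeral_eq_Suc)

lemma code_inject [simp]:
  "cMem E i k = cMem E i' k' \<longleftrightarrow> i = i' & k = k'" "cEq E i k = cEq E i' k' \<longleftrightarrow> i = i' & k = k'"
  "cNeg E \<phi> = cNeg E \<phi>' \<longleftrightarrow> \<phi> = \<phi>'" "cAnd E \<phi> \<psi> = cAnd E \<phi>' \<psi>' \<longleftrightarrow> \<phi> = \<phi>' & \<psi> = \<psi>'"
  "cEx E i \<phi> = cEx E i' \<phi>' \<longleftrightarrow> i = i' & \<phi> = \<phi>'"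
  "cMem E i k ~= cEq E i' k'" "cMem E i k ~= cNeg E \<phi>" "cMem E i k ~= cAnd E \<phi> \<psi>" "cMem E i k ~= cEx E i' \<phi>"
  "cEq E i k ~= cMem E i' k'" "cEq E i k ~= cNeg E \<phi>" "cEq E i k ~= cAnd E \<phi> \<psi>" "cEq E i k ~= cEx E i' \<phi>"
  "cNeg E \<phi> ~= cMem E i k" "cNeg E \<phi> ~= cEq E i k" "cNeg E \<phi> ~= cAnd E \<phi>' \<psi>'" "cNeg E \<phi> ~= cEx E i' \<phi>'"
  "cAnd E \<phi> \<psi> ~= cMem E i k" "cAnd E \<phi> \<psi> ~= cEq E i k" "cAnd E \<phi> \<psi> ~= cNeg E \<phi>'" "cAnd E \<phi> \<psi> ~= cEx E i' \<phi>'"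
  "cEx E j \<chi> ~= cMem E i k" "cEx E j \<chi> ~= cEq E i k" "cEx E j \<chi> ~= cNeg E \<phi>'" "cEx E j \<chi> ~= cAnd E \<phi>' \<psi>"
  by (simp_all only: codes_num pr_inject num_inject) simp_all

lemma Lim_om: "Lim om" by (simp add: Lim_def)

lemma om_V: "n \<E> om ==> n \<E> V om" using Ord_V[OF Ord_om om_Ord] by simp

lemma code_V:
  "i \<E> om ==> k \<E> om ==> cMem E i k \<E> V om" "i \<E> om ==> k \<E> om ==> cEq E i k \<E> V om"
  "\<phi> \<E> V om ==> cNeg E \<phi> \<E> V om" "\<phi> \<E> V om ==> \<psi> \<E> V om ==> cAnd E \<phi> \<psi> \<E> V om"
  "i \<E> om ==> \<phi> \<E> V om ==> cEx E i \<phi> \<E> V om"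
  by (simp_all add: codes_num Lim_pr[OF Lim_om] om_V)

lemma fm_intros:
  "i \<E> om ==> k \<E> om ==> is_fm E (cMem E i k)" "i \<E> om ==> k \<E> om ==> is_fm E (cEq E i k)"
  "is_fm E \<phi> ==> is_fm E (cNeg E \<phi>)" "is_fm E \<phi> ==> is_fm E \<psi> ==> is_fm E (cAnd E \<phi> \<psi>)"
  "i \<E> om ==> is_fm E \<phi> ==> is_fm E (cEx E i \<phi>)"
  unfolding is_fm_def by auto

text \<open>Being a code is defined through closed sets, so the codes with the property must be
  collected in a set; all codes lie in \<open>V om\<close>, from which Separation cuts it
  out.\<close>

lemma fm_induct [consumes 2, case_names Mem Eq Neg And Ex]:
  assumes Q: "D (%C e. Q (e 0))" and fm: "is_fm E \<phi>"
    and "!!i k. i \<E> om ==> k \<E> om ==> Q (cMem E i k)" "!!i k. i \<E> om ==> k \<E> om ==> Q (cEq E i k)"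
    and "!!\<phi>. is_fm E \<phi> ==> Q \<phi> ==> Q (cNeg E \<phi>)"
    and "!!\<phi> \<psi>. is_fm E \<phi> ==> Q \<phi> ==> is_fm E \<psi> ==> Q \<psi> ==> Q (cAnd E \<phi> \<psi>)"
    and "!!i \<phi>. i \<E> om ==> is_fm E \<phi> ==> Q \<phi> ==> Q (cEx E i \<phi>)"
  shows "Q \<phi>"
proof -
  have "D (%C e. is_fm E (e 0) & Q (e 0))" by (intro dfn Q)
  from separation[OF this, of "V om"]
  obtain F where F: "ALL x. x \<E> F \<longleftrightarrow> x \<E> V om & is_fm E x & Q x" by blast
  have "\<phi> \<E> F"
    by (rule fm[unfolded is_fm_def, rule_format]) (use F assms(3-) code_V fm_intros in auto)
  then show ?thesis using F by blast
qed

lemma fm_V: assumes "is_fm E \<phi>" shows "\<phi> \<E> V om"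
  by (rule fm_induct[of "%\<phi>. \<phi> \<E> V om", OF _ assms]) (intro dfn, simp_all add: code_V)

lemma Delta0_intros:
  "i \<E> om ==> k \<E> om ==> is_Delta0 E (cMem E i k)" "i \<E> om ==> k \<E> om ==> is_Delta0 E (cEq E i k)"
  "is_Delta0 E \<phi> ==> is_Delta0 E (cNeg E \<phi>)" "is_Delta0 E \<phi> ==> is_Delta0 E \<psi> ==> is_Delta0 E (cAnd E \<phi> \<psi>)"
  "i \<E> om ==> k \<E> om ==> i ~= k ==> is_Delta0 E \<phi> ==> is_Delta0 E (cEx E i (cAnd E (cMem E i k) \<phi>))"
  unfolding is_Delta0_def by auto

definition Fm where "Fm = so (%\<phi>. is_fm E \<phi>)"

lemma mem_Fm [simp]: "\<phi> \<E> Fm \<longleftrightarrow> is_fm E \<phi>"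
  unfolding Fm_def by (rule mem_comp[of _ "V om"], intro dfn) (rule fm_V)

lemma Sigma1_fm: assumes "is_Sigma1 E \<phi>" shows "is_fm E \<phi>"
proof -
  have "is_fm E \<psi>" if "is_Delta0 E \<psi>" for \<psi>
    using that[unfolded is_Delta0_def, THEN spec[of _ Fm]] fm_intros by auto
  then show ?thesis using assms[unfolded is_Sigma1_def, THEN spec[of _ Fm]] fm_intros by auto
qed

lemma Delta0_Sigma1: "is_Delta0 E \<phi> ==> is_Sigma1 E \<phi>"
  unfolding is_Sigma1_def by auto

primrec code :: "fm2 => 'v" where
  "code (Mem i k) = cMem E (num i) (num k)"
| "code (Eq i k) = cEq E (num i) (num k)"
| "code (MemC i k) = emp"
| "code (Neg \<phi>) = cNeg E (code \<phi>)"
| "code (And \<phi> \<psi>) = cAnd E (code \<phi>) (code \<psi>)"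
| "code (Ex i \<phi>) = cEx E (num i) (code \<phi>)"
| "code (ExC i \<phi>) = emp"

lemma code_fm: "first_order \<phi> ==> is_fm E (code \<phi>)"
  by (induction \<phi>) (auto intro: fm_intros)

lemma code_Delta0: "delta0 \<phi> ==> is_Delta0 E (code \<phi>)"
  by (induction rule: delta0.induct) (auto intro: Delta0_intros)

definition upd where "upd s i x = lam om (%n. if n = i then x else ap s n)"

lemma Df_upd1: "Df (%C e. if e 0 = i then x else ap s (e 0))" by (intro dfn)

lemma fnc_upd: "fnc (upd s i x) om"
  unfolding upd_def by (rule fnc_lam[OF Df_upd1])

lemma ap_upd: "n \<E> om ==> ap (upd s i x) n = (if n = i then x else ap s n)"
  unfolding upd_def by (rule ap_lam[OF Df_upd1])

lemma asg_upd: "assignment E A s ==> x \<in> A ==> assignment E A (upd s i x)"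
  by (simp add: assignment_iff fnc_upd ap_upd)

lemma vr_upd: "vr E i s (upd s i x)"
  by (simp add: vr_def ap_upd)

lemma vr_eq_upd: "assignment E A s ==> assignment E A t ==> i \<E> om ==> vr E i s t ==> t = upd s i (ap t i)"
  by (rule fnc_ext[OF asgD(1) fnc_upd]) (auto simp: ap_upd vr_def)

lemma ex_vr:
  assumes "assignment E A s" "i \<E> om"
  shows "(EX t. assignment E A t & vr E i s t & Q t) \<longleftrightarrow> (EX x:A. Q (upd s i x))"
proof
  assume "EX t. assignment E A t & vr E i s t & Q t"
  then obtain t where t: "assignment E A t" "vr E i s t" "Q t" by blast
  then show "EX x:A. Q (upd s i x)"
    using vr_eq_upd[OF assms(1) t(1) assms(2) t(2)] asgD(2)[OF t(1) assms(2)] by (intro bexI[of _ "ap t i"]) simp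
qed (use asg_upd[OF assms(1)] vr_upd in blast)

lemma truthD:
  assumes "truth E A T" "assignment E A s"
  shows "i \<E> om ==> k \<E> om ==> pr (cMem E i k) s \<in> T \<longleftrightarrow> ap s i \<E> ap s k"
    "i \<E> om ==> k \<E> om ==> pr (cEq E i k) s \<in> T \<longleftrightarrow> ap s i = ap s k"
    "is_fm E \<phi> ==> pr (cNeg E \<phi>) s \<in> T \<longleftrightarrow> pr \<phi> s \<notin> T"
    "is_fm E \<phi> ==> is_fm E \<psi> ==> pr (cAnd E \<phi> \<psi>) s \<in> T \<longleftrightarrow> pr \<phi> s \<in> T & pr \<psi> s \<in> T"
    "i \<E> om ==> is_fm E \<phi> ==> pr (cEx E i \<phi>) s \<in> T \<longleftrightarrow> (EX x:A. pr \<phi> (upd s i x) \<in> T)"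
  using assms(1)[unfolded truth_def, THEN spec, THEN mp, OF assms(2)] ex_vr[OF assms(2), of i "%t. pr \<phi> t \<in> T"]
  by auto

text \<open>The bridge between internal truth and the meta-level, by HOL induction on a standard
  formula.\<close>

lemma truth_code:
  assumes "truth E A T" "first_order \<phi>" "assignment E A s"
  shows "pr (code \<phi>) s \<in> T \<longleftrightarrow> satr E A (%n. ap s (num n)) \<phi>"
  using assms(2,3)
proof (induction \<phi> arbitrary: s)
  case (Ex i \<phi>)
  have "pr (code \<phi>) (upd s (num i) x) \<in> T \<longleftrightarrow> satr E A ((%n. ap s (num n))(i := x)) \<phi>" if "x \<in> A" for x
  proof -
    have "(%n. ap (upd s (num i) x) (num n)) = (%n. ap s (num n))(i := x)" by (auto simp: ap_upd)
    then show ?thesis using Ex.IH[OF _ asg_upd[OF Ex.prems(2) that]] Ex.prems(1) by simp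
  qed
  then show ?case using Ex.prems truthD(5)[OF assms(1) Ex.prems(2), of "num i" "code \<phi>"] code_fm by simp
qed (use truthD[OF assms(1)] code_fm in auto)

text \<open>A HOL sequence of values need not be represented inside the structure. Prescribing
  finitely many values at standard numerals is possible, and by \<open>satr_vars\<close> it is
  enough.\<close>

lemma env_assignments:
  assumes "ALL n. e n \<in> A" "ALL x:A. h x \<in> B"
  shows "EX s t. assignment E A s & assignment E B t & (ALL n:el om. ap t n = h (ap s n)) &
    (ALL n<k. ap s (num n) = e n)"
proof (induction k)
  case 0
  have c: "Df (%C e. x)" for x by (intro dfn)
  show ?case
    by (rule exI[of _ "lam om (%_. e 0)"], rule exI[of _ "lam om (%_. h (e 0))"])
      (use assms in \<open>simp add: assignment_iff fnc_lam[OF c] ap_lam[OF c]\<close>)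
next
  case (Suc k)
  then obtain s t where st: "assignment E A s" "assignment E B t" "ALL n:el om. ap t n = h (ap s n)"
    "ALL n<k. ap s (num n) = e n" by blast
  show ?case
    by (rule exI[of _ "upd s (num k) (e k)"], rule exI[of _ "upd t (num k) (h (e k))"])
      (use st assms in \<open>auto simp: asg_upd ap_upd less_Suc_eq\<close>)
qed

lemma satr_transfer:
  assumes "truth E A TA" "truth E B TB" "first_order \<phi>" "ALL x:A. h x \<in> B" "ALL n. e n \<in> A"
    and "!!s t. assignment E A s ==> assignment E B t ==> (ALL n:el om. ap t n = h (ap s n)) ==>
      pr (code \<phi>) s \<in> TA \<longleftrightarrow> pr (code \<phi>) t \<in> TB"
  shows "satr E A e \<phi> \<longleftrightarrow> satr E B (%n. h (e n)) \<phi>"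
proof -
  obtain k where k: "ALL e e'. (ALL n<k. e n = e' n) --> satr E A e \<phi> = satr E A e' \<phi>" using satr_vars by blast
  obtain l where l: "ALL e e'. (ALL n<l. e n = e' n) --> satr E B e \<phi> = satr E B e' \<phi>" using satr_vars by blast
  obtain s t where st: "assignment E A s" "assignment E B t" "ALL n:el om. ap t n = h (ap s n)"
    "ALL n<k+l. ap s (num n) = e n" using env_assignments[OF assms(5,4)] by blast
  have "satr E A e \<phi> = satr E A (%n. ap s (num n)) \<phi>" using k st(4) by simp
  also have "\<dots> \<longleftrightarrow> pr (code \<phi>) s \<in> TA" using truth_code assms st by simp
  also have "\<dots> \<longleftrightarrow> pr (code \<phi>) t \<in> TB" by (rule assms(6)[OF st(1-3)])
  also have "\<dots> \<longleftrightarrow> satr E B (%n. ap t (num n)) \<phi>" using truth_code assms st by simp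
  also have "\<dots> \<longleftrightarrow> satr E B (%n. h (e n)) \<phi>" using l st(3,4) by simp
  finally show ?thesis .
qed

text \<open>Elementarity concerns codes, \<open>pres\<close> concerns predicates of the structure. A
  standard bounded formula has a code, and transitivity of both classes makes it absolute.\<close>

lemma pres_truth:
  assumes "truth E A TA" "truth E B TB" "ALL x:A. h x \<in> B" "transitive_class E A" "transitive_class E B"
    and "!!\<phi> s t. is_Delta0 E \<phi> ==> assignment E A s ==> assignment E B t ==>
      (ALL n:el om. ap t n = h (ap s n)) ==> pr \<phi> s \<in> TA \<longleftrightarrow> pr \<phi> t \<in> TB"
  shows "pres h A"
  unfolding pres_def
proof (intro allI impI)
  fix Q and e :: "nat => 'v" assume Q: "D0 Q" and e: "ALL n. e n \<in> A"
  obtain \<phi> where \<phi>: "delta0 \<phi>" "!!e. satr E UNIV e \<phi> \<longleftrightarrow> Q e" by (rule D0_fm[OF Q]) blast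
  have "satr E A e \<phi> \<longleftrightarrow> satr E B (%n. h (e n)) \<phi>"
    by (rule satr_transfer[OF assms(1,2) delta0_first_order[OF \<phi>(1)] assms(3) e assms(6)])
      (use code_Delta0[OF \<phi>(1)] in simp_all)
  moreover have "ALL n. h (e n) \<in> B" using assms(3) e by blast
  ultimately show "Q e = Q (%n. h (e n))"
    using delta0_absolute[OF \<phi>(1) assms(4) e] delta0_absolute[OF \<phi>(1) assms(5)] \<phi>(2) by simp
qed

end

context zf2
begin

lemma Df_upd [dfn]: assumes "Df s" "Df t" "Df u" shows "Df (%w e. upd (s w e) (t w e) (u w e))"
proof (rule Df_rel)
  show "D (%w e. fnc (e 0) om & (ALL n:el om. ap (e 0) n =
      (if n = t w (%n. e (Suc n)) then u w (%n. e (Suc n)) else ap (s w (%n. e (Suc n))) n)))"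
    by (intro dfn assms[THEN Df_ren])
  show "(fnc y om & (ALL n:el om. ap y n = (if n = t w e then u w e else ap (s w e) n))) \<longleftrightarrow>
      y = upd (s w e) (t w e) (u w e)" for w e y
    using fnc_upd ap_upd by (auto intro!: fnc_ext[of y om])
qed

section \<open>Truth classes\<close>

text \<open>A truth value is assigned by the least class closed under the Tarski clauses for truth (second
  component \<^term>\<open>sc emp\<close>) and for falsity (second component \<^term>\<open>emp\<close>).\<close>

definition Stp :: "'v set => 'v set => 'v => 'v => 'v => bool" where
  "Stp A X \<phi> s b \<longleftrightarrow>
    (EX i k. i \<E> om & k \<E> om & \<phi> = cMem E i k & (b = sc emp & ap s i \<E> ap s k | b = emp & ~ ap s i \<E> ap s k)) |
    (EX i k. i \<E> om & k \<E> om & \<phi> = cEq E i k & (b = sc emp & ap s i = ap s k | b = emp & ap s i ~= ap s k)) |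
    (EX \<psi>. is_fm E \<psi> & \<phi> = cNeg E \<psi> &
       (b = sc emp & pr \<psi> (pr s emp) \<in> X | b = emp & pr \<psi> (pr s (sc emp)) \<in> X)) |
    (EX \<psi> \<chi>. is_fm E \<psi> & is_fm E \<chi> & \<phi> = cAnd E \<psi> \<chi> &
       (b = sc emp & pr \<psi> (pr s (sc emp)) \<in> X & pr \<chi> (pr s (sc emp)) \<in> X |
        b = emp & (pr \<psi> (pr s emp) \<in> X | pr \<chi> (pr s emp) \<in> X))) |
    (EX i \<psi>. i \<E> om & is_fm E \<psi> & \<phi> = cEx E i \<psi> &
       (b = sc emp & (EX x:A. pr \<psi> (pr (upd s i x) (sc emp)) \<in> X) |
        b = emp & (ALL x:A. pr \<psi> (pr (upd s i x) emp) \<in> X)))"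

definition Vx :: "'v set => 'v set" where
  "Vx A = {p. ALL X:P. (ALL \<phi> s b. Stp A X \<phi> s b --> pr \<phi> (pr s b) \<in> X) --> p \<in> X}"

text \<open>Truth and falsity are tracked side by side for the sake of this lemma: the clause for
  negation exchanges them instead of using non-membership in \<open>X\<close>.\<close>

lemma Stp_mono: assumes "X \<subseteq> Y" "Stp A X \<phi> s b" shows "Stp A Y \<phi> s b"
proof -
  have m: "p \<in> X ==> p \<in> Y" for p using assms(1) by blast
  show ?thesis using assms(2) unfolding Stp_def by (elim disj_forward ex_forward conj_forward) (auto intro: m)
qed

lemma D_Stp [dfn]: assumes "DS X" "DS Y" "Df s" "Df t" "Df u"
  shows "D (%w e. Stp (X w e) (Y w e) (s w e) (t w e) (u w e))"
  unfolding Stp_def by (intro dfn assms(1,2)[THEN DS_ren] assms(3-)[THEN Df_ren])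

lemma Vx_P: "A \<in> P ==> Vx A \<in> P"
  unfolding Vx_def by (rule class_comp, intro dfn)

text \<open>Fixed point property of a least closed class: by monotonicity, one application of the
  step to \<open>Vx A\<close> yields a class that is closed again.\<close>

lemma Vx_iff: assumes A: "A \<in> P" shows "pr \<phi> (pr s b) \<in> Vx A \<longleftrightarrow> Stp A (Vx A) \<phi> s b"
proof
  have cl: "pr \<phi> (pr s b) \<in> Vx A" if "Stp A (Vx A) \<phi> s b" for \<phi> s b
    unfolding Vx_def
  proof (intro CollectI ballI impI)
    fix X assume X: "X \<in> P" "ALL \<phi> s b. Stp A X \<phi> s b --> pr \<phi> (pr s b) \<in> X"
    have "Vx A \<subseteq> X" using X by (auto simp: Vx_def)
    then have "Stp A X \<phi> s b" using that by (rule Stp_mono)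
    then show "pr \<phi> (pr s b) \<in> X" using X(2) by blast
  qed
  then show "Stp A (Vx A) \<phi> s b ==> pr \<phi> (pr s b) \<in> Vx A" .
  let ?X = "{p. EX \<phi> s b. p = pr \<phi> (pr s b) & Stp A (Vx A) \<phi> s b}"
  have XP: "?X \<in> P" by (rule class_comp, intro dfn A Vx_P)
  have sub: "?X \<subseteq> Vx A" using cl by auto
  have X: "ALL \<phi> s b. Stp A ?X \<phi> s b --> pr \<phi> (pr s b) \<in> ?X"
  proof (intro allI impI)
    fix \<phi> s b assume "Stp A ?X \<phi> s b"
    then have "Stp A (Vx A) \<phi> s b" by (rule Stp_mono[OF sub])
    then show "pr \<phi> (pr s b) \<in> ?X" by auto
  qed
  assume "pr \<phi> (pr s b) \<in> Vx A"
  then have "ALL X:P. (ALL \<phi> s b. Stp A X \<phi> s b --> pr \<phi> (pr s b) \<in> X) --> pr \<phi> (pr s b) \<in> X"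
    by (simp add: Vx_def)
  from this[THEN bspec, OF XP, THEN mp, OF X] show "Stp A (Vx A) \<phi> s b" by auto
qed

lemma Vx_simps:
  assumes "A \<in> P"
  shows "i \<E> om ==> k \<E> om ==> pr (cMem E i k) (pr s (sc emp)) \<in> Vx A \<longleftrightarrow> ap s i \<E> ap s k"
    "i \<E> om ==> k \<E> om ==> pr (cMem E i k) (pr s emp) \<in> Vx A \<longleftrightarrow> ~ ap s i \<E> ap s k"
    "i \<E> om ==> k \<E> om ==> pr (cEq E i k) (pr s (sc emp)) \<in> Vx A \<longleftrightarrow> ap s i = ap s k"
    "i \<E> om ==> k \<E> om ==> pr (cEq E i k) (pr s emp) \<in> Vx A \<longleftrightarrow> ap s i ~= ap s k"
    "is_fm E \<phi> ==> pr (cNeg E \<phi>) (pr s (sc emp)) \<in> Vx A \<longleftrightarrow> pr \<phi> (pr s emp) \<in> Vx A"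
    "is_fm E \<phi> ==> pr (cNeg E \<phi>) (pr s emp) \<in> Vx A \<longleftrightarrow> pr \<phi> (pr s (sc emp)) \<in> Vx A"
    "is_fm E \<phi> ==> is_fm E \<psi> ==> pr (cAnd E \<phi> \<psi>) (pr s (sc emp)) \<in> Vx A \<longleftrightarrow>
       pr \<phi> (pr s (sc emp)) \<in> Vx A & pr \<psi> (pr s (sc emp)) \<in> Vx A"
    "is_fm E \<phi> ==> is_fm E \<psi> ==> pr (cAnd E \<phi> \<psi>) (pr s emp) \<in> Vx A \<longleftrightarrow>
       pr \<phi> (pr s emp) \<in> Vx A | pr \<psi> (pr s emp) \<in> Vx A"
    "i \<E> om ==> is_fm E \<phi> ==> pr (cEx E i \<phi>) (pr s (sc emp)) \<in> Vx A \<longleftrightarrow>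
       (EX x:A. pr \<phi> (pr (upd s i x) (sc emp)) \<in> Vx A)"
    "i \<E> om ==> is_fm E \<phi> ==> pr (cEx E i \<phi>) (pr s emp) \<in> Vx A \<longleftrightarrow>
       (ALL x:A. pr \<phi> (pr (upd s i x) emp) \<in> Vx A)"
  by (subst Vx_iff[OF assms], simp add: Stp_def sc_ne)+

lemma Vx_val:
  assumes "A \<in> P" "is_fm E \<phi>"
  shows "ALL s. assignment E A s --> (pr \<phi> (pr s (sc emp)) \<in> Vx A \<longleftrightarrow> pr \<phi> (pr s emp) \<notin> Vx A)"
proof (rule fm_induct[of "%\<phi>. ALL s. assignment E A s --> (pr \<phi> (pr s (sc emp)) \<in> Vx A \<longleftrightarrow> pr \<phi> (pr s emp) \<notin> Vx A)",
    OF _ assms(2)], goal_cases)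
  case 1 show ?case by (intro dfn Vx_P assms(1))
next
  case (6 i \<phi>)
  then show ?case using asg_upd by (simp add: Vx_simps[OF assms(1)])
qed (simp_all add: Vx_simps[OF assms(1)])

lemma truthI:
  assumes "!!s i k. assignment E A s ==> i \<E> om ==> k \<E> om ==> pr (cMem E i k) s \<in> T \<longleftrightarrow> ap s i \<E> ap s k"
    "!!s i k. assignment E A s ==> i \<E> om ==> k \<E> om ==> pr (cEq E i k) s \<in> T \<longleftrightarrow> ap s i = ap s k"
    "!!s \<phi>. assignment E A s ==> is_fm E \<phi> ==> pr (cNeg E \<phi>) s \<in> T \<longleftrightarrow> pr \<phi> s \<notin> T"
    "!!s \<phi> \<psi>. assignment E A s ==> is_fm E \<phi> ==> is_fm E \<psi> ==> pr (cAnd E \<phi> \<psi>) s \<in> T \<longleftrightarrow> pr \<phi> s \<in> T & pr \<psi> s \<in> T"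
    "!!s i \<phi>. assignment E A s ==> i \<E> om ==> is_fm E \<phi> ==> pr (cEx E i \<phi>) s \<in> T \<longleftrightarrow> (EX x:A. pr \<phi> (upd s i x) \<in> T)"
  shows "truth E A T"
  unfolding truth_def
proof (intro allI impI)
  fix s assume s: "assignment E A s"
  show "(ALL i:el om. ALL k:el om. (pr (cMem E i k) s \<in> T \<longleftrightarrow> ap s i \<E> ap s k) & (pr (cEq E i k) s \<in> T \<longleftrightarrow> ap s i = ap s k)) &
        (ALL \<phi>. is_fm E \<phi> --> (pr (cNeg E \<phi>) s \<in> T \<longleftrightarrow> pr \<phi> s \<notin> T)) &
        (ALL \<phi> \<psi>. is_fm E \<phi> & is_fm E \<psi> --> (pr (cAnd E \<phi> \<psi>) s \<in> T \<longleftrightarrow> pr \<phi> s \<in> T & pr \<psi> s \<in> T)) &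
        (ALL i:el om. ALL \<phi>. is_fm E \<phi> --> (pr (cEx E i \<phi>) s \<in> T \<longleftrightarrow> (EX t. assignment E A t & vr E i s t & pr \<phi> t \<in> T)))"
    using assms(1-4)[OF s] assms(5)[OF s] ex_vr[OF s] by simp
qed

lemma truth_class:
  assumes A: "A \<in> P"
  obtains T where "T \<in> P" "truth E A T"
proof -
  let ?T = "{p. EX \<phi> s. p = pr \<phi> s & pr \<phi> (pr s (sc emp)) \<in> Vx A}"
  have T: "pr \<phi> s \<in> ?T \<longleftrightarrow> pr \<phi> (pr s (sc emp)) \<in> Vx A" for \<phi> s by auto
  show thesis
  proof (rule that[of ?T])
    show "?T \<in> P" by (rule class_comp, intro dfn Vx_P A)
    show "truth E A ?T"
      by (rule truthI) (unfold T, use Vx_val[OF A] in \<open>simp_all add: Vx_simps[OF A]\<close>)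
  qed
qed

lemma truth_unique:
  assumes P: "A \<in> P" "T \<in> P" "T' \<in> P" and T: "truth E A T" "truth E A T'" and "is_fm E \<phi>" "assignment E A s"
  shows "pr \<phi> s \<in> T \<longleftrightarrow> pr \<phi> s \<in> T'"
proof -
  have "ALL s. assignment E A s --> (pr \<phi> s \<in> T \<longleftrightarrow> pr \<phi> s \<in> T')"
  proof (rule fm_induct[of "%\<phi>. ALL s. assignment E A s --> (pr \<phi> s \<in> T \<longleftrightarrow> pr \<phi> s \<in> T')", OF _ assms(6)], goal_cases)
    case 1 show ?case by (intro dfn P)
  next
    case (6 i \<phi>) then show ?case using asg_upd by (simp add: truthD(5)[OF T(1)] truthD(5)[OF T(2)])
  qed (simp_all add: truthD[OF T(1)] truthD[OF T(2)])
  then show ?thesis using assms(7) by blast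
qed

lemma el_P [simp]: "el M \<in> P"
  unfolding elts_def by (rule class_comp, intro dfn)

definition prod where "prod A B = so (%p. EX a b. a \<E> A & b \<E> B & p = pr a b)"

lemma mem_prod: "p \<E> prod A B \<longleftrightarrow> (EX a b. a \<E> A & b \<E> B & p = pr a b)"
  unfolding prod_def
  by (rule mem_comp[of _ "Pw (Pw (un2 A B))"], intro dfn) (auto simp: pr_eq Sub_iff)

definition asg where "asg M = so (%s. assignment E (el M) s)"

lemma mem_asg [simp]: "s \<E> asg M \<longleftrightarrow> assignment E (el M) s"
  unfolding asg_def
proof (rule mem_comp[of _ "Pw (prod om M)"], intro dfn)
  fix s assume "assignment E (el M) s"
  then show "s \<E> Pw (prod om M)"
    using fnc_mem[of s om] by (auto simp: Sub_iff mem_prod assignment_iff)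
qed

definition Tr where "Tr M = so (%p. EX \<phi> s. p = pr \<phi> s & is_fm E \<phi> & assignment E (el M) s & models E M \<phi> s)"

lemma mem_Tr: "p \<E> Tr M \<longleftrightarrow> (EX \<phi> s. p = pr \<phi> s & is_fm E \<phi> & assignment E (el M) s & models E M \<phi> s)"
  unfolding Tr_def by (rule mem_comp[of _ "prod Fm (asg M)"], intro dfn) (auto simp: mem_prod)

lemma models_Tr: "is_fm E \<phi> ==> assignment E (el M) s ==> models E M \<phi> s \<longleftrightarrow> pr \<phi> s \<E> Tr M"
  by (auto simp: mem_Tr)

text \<open>A truth class cut down to codes and assignments into \<open>M\<close> is a set. By
  \<open>truth_unique\<close> any other truth set agrees with it, so the existential quantifier in
  \<open>models\<close> is harmless.\<close>

lemma truth_Tr: "truth E (el M) (el (Tr M))"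
proof -
  obtain T where T: "T \<in> P" "truth E (el M) T" using truth_class[OF el_P] by blast
  have "EX b. ALL p. p \<E> b \<longleftrightarrow> p \<E> prod Fm (asg M) & p \<in> T" by (rule separation, intro dfn T(1))
  then obtain b where "ALL p. p \<E> b \<longleftrightarrow> p \<E> prod Fm (asg M) & p \<in> T" by blast
  then have b: "pr \<phi> s \<in> el b \<longleftrightarrow> pr \<phi> s \<in> T" if "is_fm E \<phi>" "assignment E (el M) s" for \<phi> s
    using that by (auto simp: mem_prod)
  have tb: "truth E (el M) (el b)"
    by (rule truthI) (use b fm_intros asg_upd in \<open>simp_all add: truthD[OF T(2)]\<close>)
  have "models E M \<phi> s \<longleftrightarrow> pr \<phi> s \<E> b" if "is_fm E \<phi>" "assignment E (el M) s" for \<phi> s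
  proof
    assume "models E M \<phi> s"
    then obtain T' where T': "truth E (el M) (el T')" "pr \<phi> s \<E> T'"
      unfolding models_def truth_iff by blast
    show "pr \<phi> s \<E> b" using truth_unique[OF el_P el_P el_P T'(1) tb that] T'(2) by simp
  qed (use tb in \<open>unfold models_def truth_iff, blast\<close>)
  then have "pr \<phi> s \<E> Tr M \<longleftrightarrow> pr \<phi> s \<E> b" if "is_fm E \<phi>" "assignment E (el M) s" for \<phi> s
    using that by (simp add: mem_Tr)
  moreover have "p \<E> b ==> EX \<phi> s. p = pr \<phi> s & is_fm E \<phi> & assignment E (el M) s" for p
    using \<open>ALL p. p \<E> b \<longleftrightarrow> p \<E> prod Fm (asg M) & p \<in> T\<close> by (auto simp: mem_prod)
  ultimately have "p \<E> Tr M \<longleftrightarrow> p \<E> b" for p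
    using mem_Tr by metis
  then have "Tr M = b" by (rule ext)
  then show ?thesis using tb by simp
qed

section \<open>Weak Loewenheim-Skolem cardinals\<close>

text \<open>One half of the Tarski-Vaught criterion. As \<open>Y\<close> is transitive, a bounded
  predicate means the same in \<open>Y\<close> as outside, so it need not be relativized.\<close>

lemma elementary_sub_D0:
  assumes XY: "elementary_sub E X Y" "transitive_class E (el Y)" and Q: "D0 Q"
    and e: "ALL n. e n \<E> X" and y: "y \<E> Y" "Q (e(i := y))"
  shows "EX y. y \<E> X & Q (e(i := y))"
proof -
  obtain \<phi> where \<phi>: "delta0 \<phi>" "!!e. satr E UNIV e \<phi> \<longleftrightarrow> Q e" by (rule D0_fm[OF Q]) blast
  have s: "x \<E> Y" if "x \<E> X" for x using XY(1) that by (auto simp: elementary_sub_def Sub_iff)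
  have tr: "satr E (el X) e \<psi> \<longleftrightarrow> satr E (el Y) (%n. e n) \<psi>" if "first_order \<psi>" "ALL n. e n \<in> el X" for e \<psi>
  proof (rule satr_transfer[of "el X" "el (Tr X)" "el Y" "el (Tr Y)" \<psi> "%x. x" e])
    fix s t assume st: "assignment E (el X) s" "assignment E (el Y) t" "ALL n:el om. ap t n = ap s n"
    then have "s = t" using fnc_ext[of s om t] asgD by auto
    then show "pr (code \<psi>) s \<in> el (Tr X) \<longleftrightarrow> pr (code \<psi>) t \<in> el (Tr Y)"
      using XY(1) st code_fm[OF that(1)] unfolding elementary_sub_def el_iff
      by (simp add: models_Tr[symmetric])
  qed (use that truth_Tr s in auto)
  have fo: "first_order \<phi>" using \<phi>(1) by (rule delta0_first_order)
  have eY: "ALL n. (e(i := y)) n \<in> el Y" if "y \<E> Y" for y using e s that by simp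
  have "satr E (el Y) e (Ex i \<phi>)"
    using delta0_absolute[OF \<phi>(1) XY(2) eY[OF y(1)]] \<phi>(2) y by (simp del: fun_upd_apply) (unfold el_bex, blast)
  then have "satr E (el X) e (Ex i \<phi>)" using tr[of "Ex i \<phi>" e] fo e by simp
  then obtain x where x: "x \<E> X" "satr E (el X) (e(i := x)) \<phi>" by auto
  then have "ALL n. (e(i := x)) n \<in> el X" using e by simp
  then have "satr E (el Y) (e(i := x)) \<phi>" using tr[OF fo] x(2) by blast
  then have "Q (e(i := x))" using delta0_absolute[OF \<phi>(1) XY(2) eY[OF s[OF x(1)]]] \<phi>(2) by blast
  then show ?thesis using x by blast
qed

lemma wLS_Ord: "wLS E \<delta> ==> Ord \<delta>"
  by (simp add: wLS_def cardinal_def)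

lemma V_transitive: "Ord a ==> transitive_class E (el (V a))"
  using V_trans by (auto simp: transitive_class_def)

text \<open>All that is used of the hulls. Closure under \<open>U\<close> replaces a Skolem
  function: a partner exists in \<open>X\<close>, though none is singled out. The collapsing map can
  be inverted because \<open>X\<close> is extensional.\<close>

lemma wLS_hull:
  assumes "wLS E \<delta>" "\<gamma> \<E> \<delta>"
  obtains X p c where "Sub (V \<gamma>) X" "!!u y. u \<E> X ==> pr u y \<E> U ==> EX y. y \<E> X & pr u y \<E> U"
    "fnc p X" "!!x z. x \<E> X ==> z \<E> ap p x \<longleftrightarrow> (EX y. y \<E> X & y \<E> x & z = ap p y)"
    "!!z. z \<E> c \<longleftrightarrow> (EX x. x \<E> X & z = ap p x)" "c \<E> V \<delta>"
    "!!x y. x \<E> X ==> y \<E> X ==> ap p x = ap p y ==> x = y"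
proof -
  have \<delta>: "Ord \<delta>" using assms(1) by (rule wLS_Ord)
  obtain a where a: "Ord a" "U \<E> V a" using in_V by blast
  \<comment> \<open>The level has to contain \<open>U\<close> and to be at least \<delta>, as the
    definition of \<open>wLS\<close> demands.\<close>
  obtain \<alpha> where \<alpha>: "Ord \<alpha>" "ord_le E \<delta> \<alpha>" "U \<E> V \<alpha>"
  proof (cases "a \<E> \<delta>")
    case True then show thesis using that[of \<delta>] V_mono[OF \<delta>, of a U] a \<delta> by (simp add: ord_le_iff)
  next
    case False then show thesis using that[of a] a Ord_linear[OF \<delta> a(1)] by (auto simp: ord_le_iff)
  qed
  obtain X c where X: "elementary_sub E X (V \<alpha>)" "Sub (V \<gamma>) X" "U \<E> X" "is_collapse E X c" "c \<E> V \<delta>"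
    using assms \<alpha> VV_eq[OF \<alpha>(1)] VV_eq[OF \<delta>] VV_eq[OF Ord_elem[OF \<delta> assms(2)]] unfolding wLS_def
    by (metis el_iff)
  have tV: "transitive_class E (el (V \<alpha>))" using V_transitive[OF \<alpha>(1)] .
  obtain p where p: "fnc p X" "ALL x:el X. ALL z. z \<E> app E p x \<longleftrightarrow> (EX y:el X. y \<E> x & z = app E p y)"
    "ALL z. z \<E> c \<longleftrightarrow> (EX x:el X. z = app E p x)" using X(4) by (auto simp: is_collapse_def)
  have p2: "z \<E> ap p x \<longleftrightarrow> (EX y. y \<E> X & y \<E> x & z = ap p y)" if "x \<E> X" for x z
    using p(2) that ap_app[OF p(1)] by (auto simp: Bex_def)
  have p3: "z \<E> c \<longleftrightarrow> (EX x. x \<E> X & z = ap p x)" for z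
    using p(3) ap_app[OF p(1)] by (auto simp: Bex_def)
  have "x \<E> X --> (ALL y. y \<E> X --> ap p x = ap p y --> x = y)" for x
  proof (rule eps_induct[of "%x. x \<E> X --> (ALL y. y \<E> X --> ap p x = ap p y --> x = y)"], intro dfn, intro impI allI)
    fix x y assume IH: "!!z. z \<E> x ==> z \<E> X --> (ALL y. y \<E> X --> ap p z = ap p y --> z = y)"
      and xy: "x \<E> X" "y \<E> X" "ap p x = ap p y"
    show "x = y"
    proof (rule ccontr)
      assume "x ~= y"
      then obtain z where z: "z \<E> x \<longleftrightarrow> ~ z \<E> y" using ext by blast
      then have zV: "z \<E> V \<alpha>" using xy X(1) V_trans[OF \<alpha>(1)] unfolding elementary_sub_def Sub_iff by blast
      \<comment> \<open>Two different elements of \<open>X\<close> differ by some element of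
        \<open>X\<close>, by elementarity.\<close>
      let ?e = "case_nat x (%_. y)"
      have d: "D0 (%e. e 2 \<E> e 0 \<longleftrightarrow> ~ e 2 \<E> e 1)" by (intro d0)
      have "ALL n. ?e n \<E> X" using xy by (simp split: nat.split)
      then have "EX z. z \<E> X & (z \<E> x \<longleftrightarrow> ~ z \<E> y)"
        using elementary_sub_D0[OF X(1) tV d, of ?e z 2] z zV by simp
      then obtain z where "z \<E> X" "z \<E> x \<longleftrightarrow> ~ z \<E> y" by blast
      then show False using p2[OF xy(1), of "ap p z"] p2[OF xy(2), of "ap p z"] xy IH by metis
    qed
  qed
  then have inj: "x = y" if "x \<E> X" "y \<E> X" "ap p x = ap p y" for x y using that by blast
  have "EX y. y \<E> X & pr u y \<E> U" if u: "u \<E> X" "pr u y \<E> U" for u y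
  proof -
    let ?e = "case_nat u (%_. U)"
    have d: "D0 (%e. pr (e 0) (e 2) \<E> e 1)" by (intro d0)
    have "y \<E> V \<alpha>"
    proof -
      have 1: "pr u y \<E> V \<alpha>" using V_trans[OF \<alpha>(1) \<alpha>(3) u(2)] .
      have "upair u y \<E> V \<alpha>" by (rule V_trans[OF \<alpha>(1) 1]) (simp add: pr_eq)
      then show ?thesis by (rule V_trans[OF \<alpha>(1)]) simp
    qed
    moreover have "ALL n. ?e n \<E> X" using u X(3) by (simp split: nat.split)
    ultimately show ?thesis using elementary_sub_D0[OF X(1) tV d, of ?e y 2] u by simp
  qed
  then show thesis using that[OF X(2) _ p(1) p2 p3 X(5) inj] by blast
qed

text \<open>A hull that contains \<open>V \<gamma>\<close> and is closed under the graph of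
  \<open>t\<close> contains every ordinal below \<delta>. The collapse fixes them, so
  \<open>c\<close> would contain its own rank.\<close>

lemma wLS_no_surj:
  assumes "wLS E \<delta>" "\<gamma> \<E> \<delta>" "Df (%C e. t (e 0))" "!!\<xi>. \<xi> \<E> \<delta> ==> EX x. x \<E> V \<gamma> & t x = \<xi>"
  shows False
proof -
  let ?U = "lam (V \<gamma>) t"
  obtain X p c where X: "Sub (V \<gamma>) X" "!!u y. u \<E> X ==> pr u y \<E> ?U ==> EX y. y \<E> X & pr u y \<E> ?U"
    "!!x z. x \<E> X ==> z \<E> ap p x \<longleftrightarrow> (EX y. y \<E> X & y \<E> x & z = ap p y)"
    "!!z. z \<E> c \<longleftrightarrow> (EX x. x \<E> X & z = ap p x)" "c \<E> V \<delta>"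
    by (rule wLS_hull[OF assms(1,2), of ?U]) blast
  have \<delta>: "Ord \<delta>" using assms(1) by (rule wLS_Ord)
  have sub: "\<xi> \<E> X" if xi: "\<xi> \<E> \<delta>" for \<xi>
  proof -
    obtain x where x: "x \<E> V \<gamma>" "t x = \<xi>" using assms(4)[OF xi] by blast
    then obtain y where "y \<E> X" "pr x y \<E> ?U"
      using X(1,2) mem_lam[OF assms(3), of "pr x (t x)"] unfolding Sub_iff by blast
    then show ?thesis using x by (auto simp: mem_lam[OF assms(3)])
  qed
  have "\<xi> \<E> \<delta> --> ap p \<xi> = \<xi>" for \<xi>
  proof (rule eps_induct[of "%\<xi>. \<xi> \<E> \<delta> --> ap p \<xi> = \<xi>"], intro dfn, intro impI)
    fix \<xi> assume IH: "!!y. y \<E> \<xi> ==> y \<E> \<delta> --> ap p y = y" and "\<xi> \<E> \<delta>"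
    then have "y \<E> \<delta>" "y \<E> X" "ap p y = y" if "y \<E> \<xi>" for y using that Ord_trans[OF \<delta>] sub by blast+
    then show "ap p \<xi> = \<xi>" using X(3)[OF sub[OF \<open>\<xi> \<E> \<delta>\<close>]] by (intro ext) metis
  qed
  then have "\<xi> \<E> c" if "\<xi> \<E> \<delta>" for \<xi> using that X(4) sub by metis
  moreover have "rk c \<E> \<delta>" using X(5) mem_V_rk[OF \<delta>] by simp
  ultimately have "rk c \<E> c" by blast
  then have "rk (rk c) \<E> rk c" by (rule rk_mem)
  then show False using rk_Ord[OF Ord_rk] by simp
qed

text \<open>Hulls are inherited from a wLS cardinal between \<gamma> and \<delta>. That \<delta> is
  a cardinal follows from \<open>wLS_no_surj\<close>, applied to such a cardinal above the domain of
  the supposed bijection.\<close>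

lemma wLS_limit:
  assumes \<delta>: "Ord \<delta>" and lim: "!!\<beta>. \<beta> \<E> \<delta> ==> EX d. \<beta> \<E> d & d \<E> \<delta> & wLS E d"
  shows "wLS E \<delta>"
  unfolding wLS_def
proof (intro conjI ballI allI impI)
  show "cardinal E \<delta>"
    unfolding cardinal_def
  proof (intro conjI notI \<delta>, elim exE conjE)
    fix b f assume b: "b \<E> \<delta>" "bijection E f b \<delta>"
    obtain d where d: "b \<E> d" "d \<E> \<delta>" "wLS E d" using lim[OF b(1)] by blast
    have "Ord b" using Ord_elem[OF \<delta> b(1)] .
    show False
    proof (rule wLS_no_surj[OF d(3,1), of "ap f"])
      show "Df (%C e. ap f (e 0))" by (intro dfn)
      fix \<xi> assume "\<xi> \<E> d"
      then have "\<xi> \<E> \<delta>" using Ord_trans[OF \<delta> d(2)] by blast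
      then obtain x where "x \<E> b" "ap f x = \<xi>" using b(2) unfolding bijection_iff el_ball by blast
      then show "EX x. x \<E> V b & ap f x = \<xi>" using Ord_V[OF \<open>Ord b\<close> Ord_elem[OF \<open>Ord b\<close>]] by blast
    qed
  qed
  fix \<gamma> \<alpha> x assume g: "\<gamma> \<in> el \<delta>" "Ord \<alpha> & ord_le E \<delta> \<alpha>" "x \<in> el (VV \<alpha>)"
  then obtain d where d: "\<gamma> \<E> d" "d \<E> \<delta>" "wLS E d" using lim by auto
  have "ord_le E d \<alpha>" using g(2) d(2) Ord_trans by (auto simp: ord_le_iff)
  then obtain X c where X: "elementary_sub E X (VV \<alpha>)" "Sub (VV \<gamma>) X" "x \<E> X" "is_collapse E X c" "c \<E> VV d"
    using d g unfolding wLS_def by (metis el_iff)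
  have "c \<E> VV \<delta>" using X(5) VV_eq \<delta> Ord_elem[OF \<delta> d(2)] V_mono[OF \<delta>, of d c] d(2) by simp
  then show "EX X. elementary_sub E X (VV \<alpha>) & Sub (VV \<gamma>) X & x \<E> X & (EX c. is_collapse E X c & c \<E> VV \<delta>)"
    using X by blast
qed

section \<open>Cofinality\<close>

definition cofmap where
  "cofmap f b a \<longleftrightarrow> maps E f b a & (ALL x:el a. EX y:el b. ord_le E x (ap f y))"

lemma cofmap_iff: "(EX f. maps E f b a & (ALL x:el a. EX y:el b. ord_le E x (app E f y))) \<longleftrightarrow> (EX f. cofmap f b a)"
  unfolding cofmap_def maps_iff by (rule ex_cong1) (auto simp: ap_app)

lemma D_cofmap [dfn]: assumes "Df s" "Df t" "Df u" shows "D (%w e. cofmap (s w e) (t w e) (u w e))"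
  unfolding cofmap_def by (intro dfn assms[THEN Df_ren])

lemma cof_ex1: assumes "Ord a"
  shows "EX! b. Ord b & (EX f. cofmap f b a) & (ALL c. Ord c & (EX f. cofmap f c a) --> ord_le E b c)"
proof -
  have i: "Df (%C e. e 0)" by (intro dfn)
  have "cofmap (lam a (%x. x)) a a"
    unfolding cofmap_def maps_iff by (auto simp: fnc_lam[OF i] ap_lam[OF i] ord_le_iff)
  moreover have "D (%C e. EX f. cofmap f (e 0) a)" by (intro dfn)
  ultimately obtain b where b: "Ord b" "EX f. cofmap f b a" "!!c. c \<E> b ==> ~ (EX f. cofmap f c a)"
    using Ord_least[of "%b. EX f. cofmap f b a", OF _ assms] by blast
  show ?thesis
  proof (rule ex1I[of _ b])
    show "Ord b & (EX f. cofmap f b a) & (ALL c. Ord c & (EX f. cofmap f c a) --> ord_le E b c)"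
      using b Ord_linear[OF b(1)] unfolding ord_le_iff by blast
  qed (use b mem_asym in \<open>auto simp: ord_le_iff\<close>)
qed

lemma cof_iff: assumes "Ord a"
  shows "b = cof E a \<longleftrightarrow> Ord b & (EX f. cofmap f b a) & (ALL c. Ord c & (EX f. cofmap f c a) --> ord_le E b c)"
  unfolding cof_def cofmap_iff using theI'[OF cof_ex1[OF assms]] cof_ex1[OF assms] by blast

lemma om_cof: assumes "Ord a" "emp \<E> a" shows "om \<E> cof E a \<longleftrightarrow> ~ (EX f. cofmap f om a)"
proof
  let ?b = "cof E a"
  have b: "Ord ?b" "EX f. cofmap f ?b a" "!!c. Ord c ==> EX f. cofmap f c a ==> ?b \<E> c | ?b = c"
    using cof_iff[OF assms(1), of ?b] by (auto simp: ord_le_iff)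
  show "~ (EX f. cofmap f om a)" if "om \<E> ?b"
    using b(3)[OF Ord_om] that mem_asym mem_irrefl by metis
  show "om \<E> ?b" if no: "~ (EX f. cofmap f om a)"
  proof (rule ccontr)
    assume "~ om \<E> ?b"
    then have "?b \<E> om" using Ord_not_mem[OF Ord_om b(1)] b(2) no by auto
    obtain f where f: "cofmap f ?b a" using b(2) by blast
    \<comment> \<open>A cofinal map with a smaller domain is extended to \<open>om\<close> by the
      value \<open>emp\<close>, which lies in \<open>a\<close>.\<close>
    let ?g = "%n. if n \<E> ?b then ap f n else emp"
    have g: "Df (%C e. ?g (e 0))" by (intro dfn)
    have "cofmap (lam om ?g) om a"
      unfolding cofmap_def maps_iff
    proof (intro conjI ballI fnc_lam[OF g])
      fix n assume "n \<in> el om"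
      then show "ap (lam om ?g) n \<E> a" using f assms(2) by (simp add: ap_lam[OF g] cofmap_def maps_iff)
    next
      fix x assume "x \<in> el a"
      then obtain y where y: "y \<E> ?b" "ord_le E x (ap f y)"
        using f unfolding cofmap_def el_ball el_bex el_iff by blast
      then have "y \<E> om" using Ord_trans[OF Ord_om \<open>?b \<E> om\<close>] by blast
      then show "EX y:el om. ord_le E x (ap (lam om ?g) y)" using y by (intro bexI[of _ y]) (simp_all add: ap_lam[OF g])
    qed
    then show False using no by blast
  qed
qed

end

lemma (in zf2) is_collapse_iff: "is_collapse E X c \<longleftrightarrow>
     (EX p. fnc p X & (ALL x:el X. ALL z. z \<E> ap p x \<longleftrightarrow> (EX y:el X. y \<E> x & z = ap p y)) &
        (ALL z. z \<E> c \<longleftrightarrow> (EX x:el X. z = ap p x)))"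
proof -
  have 1: "(EX y:el X. y \<E> x & z = app E p y) = (EX y:el X. y \<E> x & z = ap p y)"
    "(EX x:el X. z = app E p x) = (EX x:el X. z = ap p x)" if "fnc p X" for p x z
    using ap_app[OF that] by (auto intro!: bex_cong)
  have 2: "app E p x = ap p x" if "fnc p X" "x \<in> el X" for p x using ap_app[of p X x] that by simp
  show ?thesis
    unfolding is_collapse_def
    by (rule ex_cong1, rule conj_cong[OF refl]) (simp add: 1, rule conj_cong[OF ball_cong[OF refl] refl], simp add: 2)
qed

lemma (in zf2) wLS_iff: "wLS E \<delta> \<longleftrightarrow> cardinal E \<delta> &
     (ALL \<gamma>:el \<delta>. ALL \<alpha>. Ord \<alpha> & ord_le E \<delta> \<alpha> --> (ALL x:el (V \<alpha>).
        EX X. elementary_sub E X (V \<alpha>) & Sub (V \<gamma>) X & x \<E> X & (EX c. is_collapse E X c & c \<E> V \<delta>)))"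
proof (cases "cardinal E \<delta>")
  case True
  then have o: "Ord \<delta>" by (simp add: cardinal_def)
  have "VV \<gamma> = V \<gamma>" if "\<gamma> \<E> \<delta>" for \<gamma> using VV_eq Ord_elem[OF o that] by blast
  then show ?thesis using VV_eq[OF o] unfolding wLS_def el_ball by (simp add: VV_eq cong: imp_cong conj_cong)
qed (simp add: wLS_def)

context definability
begin

lemma D_cardinal [dfn]: assumes "Df s" shows "D (%w e. cardinal (EE w) (s w e))"
  unfolding cardinal_def by (intro dfn assms[THEN Df_ren])

lemma D_is_collapse [dfn]: assumes "Df s" "Df t" shows "D (%w e. is_collapse (EE w) (s w e) (t w e))"
proof (rule D_cong)
  show "D (%w e. EX p. is_function_in (EE w) UNIV p (s w e) &
        (ALL x:elts (EE w) (s w e). ALL z. EE w z (tapp (EE w) p x) \<longleftrightarrow>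
           (EX y:elts (EE w) (s w e). EE w y x & z = tapp (EE w) p y)) &
        (ALL z. EE w z (t w e) \<longleftrightarrow> (EX x:elts (EE w) (s w e). z = tapp (EE w) p x)))"
    by (intro dfn assms[THEN Df_ren])
qed (erule zfE, rule sym, erule zf2.is_collapse_iff)

lemma D_wLS [dfn]: assumes "Df s" shows "D (%w e. wLS (EE w) (s w e))"
proof (rule D_cong)
  show "D (%w e. cardinal (EE w) (s w e) &
     (ALL \<gamma>:elts (EE w) (s w e). ALL \<alpha>. ordinal (EE w) \<alpha> & ord_le (EE w) (s w e) \<alpha> -->
       (ALL x:elts (EE w) (tV (EE w) \<alpha>).
        EX X. elementary_sub (EE w) X (tV (EE w) \<alpha>) & subset (EE w) (tV (EE w) \<gamma>) X & EE w x X &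
          (EX c. is_collapse (EE w) X c & EE w c (tV (EE w) (s w e))))))"
    by (intro dfn assms[THEN Df_ren])
qed (erule zfE, rule sym, erule zf2.wLS_iff)

end

context zf2
begin

lemma D0_num [d0]: "D0 (%e. e a = num k)"
proof (induction k arbitrary: a)
  case 0 show ?case by (simp add: D0_empty)
next
  case (Suc k)
  have "D0 (%e. EX y:el (e a). y = num k & e a = sc y)" by (intro d0 Suc)
  then show ?case by (rule D0_cong) (auto simp: el_bex)
qed

lemma D0_pr_comp:
  assumes "D0 (%e. Q (%n. e (Suc (Suc n))) (e 1) (e 0))"
  shows "D0 (%e. EX x y. e p = pr x y & Q e x y)"
proof -
  have "D0 (%e. EX t:el (e p). EX x:el t. EX y:el t. e p = pr x y & Q e x y)"
    using D0_ren[OF assms, of "case_nat 0 (case_nat 1 (%n. n + 3))"]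
    by (intro d0) (simp add: numeral_eq_Suc)
  moreover have "(EX t:el p. EX x:el t. EX y:el t. p = pr x y & R x y) \<longleftrightarrow> (EX x y. p = pr x y & R x y)" for p R
    using ex_pr_bounded(2)[of "upair p p" "%x y. R x y"] unfolding el_bex mem_upair by auto
  ultimately show ?thesis by (rule D0_cong)
qed

lemma D0_codes [d0]:
  "D0 (%e. e c = cMem E (e i) (e k))" "D0 (%e. e c = cEq E (e i) (e k))" "D0 (%e. e c = cNeg E (e i))"
  "D0 (%e. e c = cAnd E (e i) (e k))" "D0 (%e. e c = cEx E (e i) (e k))"
proof -
  have 1: "D0 (%e. EX x y. e c = pr x y & x = num m & y = pr (e i) (e k))" for m i k
    by (intro D0_pr_comp d0)
  have 2: "D0 (%e. EX x y. e c = pr x y & x = num m & y = e i)" for m i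
    by (intro D0_pr_comp d0)
  show "D0 (%e. e c = cMem E (e i) (e k))" using 1[of 0 i k] unfolding codes_num by simp
  show "D0 (%e. e c = cEq E (e i) (e k))" using 1[of 1 i k] unfolding codes_num by simp
  show "D0 (%e. e c = cNeg E (e i))" using 2[of 2 i] unfolding codes_num by simp
  show "D0 (%e. e c = cAnd E (e i) (e k))" using 1[of 3 i k] unfolding codes_num by simp
  show "D0 (%e. e c = cEx E (e i) (e k))" using 1[of 4 i k] unfolding codes_num by simp
qed

end

text \<open>Computing with maps that preserve bounded predicates: \<open>A\<close> is the universe
  for class embeddings and \<open>el (V \<delta>)\<close> for the map of a pre-witness.\<close>

locale pres_map = zf2 E P for E :: "'v => 'v => bool" (infix \<open>\<E>\<close> 50) and P +
  fixes h :: "'v => 'v" and A :: "'v set"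
  assumes pres: "pres h A" and trA: "transitive_class E A" and omA: "om \<in> A" and VomA: "V om \<in> A"
    and Dh: "Df (%C e. h (e 0))"
begin

lemma A_elem: "x \<in> A ==> y \<E> x ==> y \<in> A"
  using trA by (auto simp: transitive_class_def elts_def)

lemma A_pr: assumes "pr x y \<in> A" shows "x \<in> A" "y \<in> A"
proof -
  have "upair x y \<in> A" by (rule A_elem[OF assms]) (simp add: pr_eq)
  then show "x \<in> A" "y \<in> A" using A_elem by auto
qed

lemma h_mem: "x \<in> A ==> y \<in> A ==> x \<E> y \<longleftrightarrow> h x \<E> h y"
  by (rule pres2[OF pres]) (intro d0)

lemma h_emp: "emp \<in> A ==> h emp = emp"
  using pres1[OF pres, of "%x. x = emp" emp] D0_empty by simp

lemma h_sc: "x \<in> A ==> sc x \<in> A ==> h (sc x) = sc (h x)"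
  using pres2[OF pres, of "%x y. y = sc x" x "sc x"] D0_sc by simp

lemma h_pr: "pr x y \<in> A ==> h (pr x y) = pr (h x) (h y)"
  using pres3[OF pres, of "%x y p. p = pr x y" x y "pr x y"] D0_pr A_pr by blast

lemma h_Ord: "x \<in> A ==> Ord x \<longleftrightarrow> Ord (h x)"
  by (rule pres1[OF pres]) (intro d0)

lemma h_om_elem: assumes "n \<E> om" shows "h n = n"
  using _ assms
proof (rule om_induct[of "%n. h n = n"])
  show "D (%C e. h (e 0) = e 0)" by (intro dfn Df_fun1[OF Dh])
  show "h emp = emp" using h_emp A_elem[OF omA om_0] .
  fix n assume "n \<E> om" "h n = n"
  then show "h (sc n) = sc n" using h_sc[of n] A_elem[OF omA] om_sc by auto
qed

text \<open>A bounded statement says that every element is empty or the successor of another one. It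
  holds of \<open>h om\<close> too, and induction along membership then admits no further
  elements.\<close>

lemma h_om: "h om = om"
proof -
  have "D0 (%e. ALL y:el (e 0). y = emp | (EX z:el (e 0). y = sc z))" by (intro d0)
  moreover have "ALL y:el om. y = emp | (EX z:el om. y = sc z)"
    using om_cases unfolding el_ball el_bex by blast
  ultimately have 1: "ALL y:el (h om). y = emp | (EX z:el (h om). y = sc z)"
    using pres1[OF pres, of "%x. ALL y:el x. y = emp | (EX z:el x. y = sc z)", OF _ omA] by blast
  have "y \<E> h om --> y \<E> om" for y
  proof (rule eps_induct[of "%y. y \<E> h om --> y \<E> om"], intro dfn, intro impI)
    fix y assume IH: "!!z. z \<E> y ==> z \<E> h om --> z \<E> om" and "y \<E> h om"
    then have "y = emp | (EX z. z \<E> h om & y = sc z)" using 1 unfolding el_ball el_bex by blast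
    then show "y \<E> om" using IH by auto
  qed
  moreover have "y \<E> h om" if "y \<E> om" for y
    using h_mem[OF A_elem[OF omA that] omA] that h_om_elem[OF that] by simp
  ultimately show ?thesis by (intro ext) blast
qed

text \<open>Codes are built by pairing from numbers, all of which are fixed.\<close>

lemma h_fm: assumes "is_fm E \<phi>" shows "h \<phi> = \<phi>"
proof -
  have V: "x \<in> A" if "x \<E> V om" for x using A_elem[OF VomA that] .
  have hp: "h (pr x y) = pr (h x) (h y)" if "pr x y \<E> V om" for x y using h_pr[OF V[OF that]] .
  have c: "h (num k) = num k" for k using h_om_elem by simp
  show ?thesis
  proof (rule fm_induct[of "%\<phi>. h \<phi> = \<phi>", OF _ assms])
    show "D (%C e. h (e 0) = e 0)" by (intro dfn Df_fun1[OF Dh])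
  qed (simp_all add: codes_num hp Lim_pr[OF Lim_om] om_V fm_V c h_om_elem)
qed

lemma h_fnc:
  assumes "fnc f a" "f \<in> A" "a \<in> A"
  shows "fnc (h f) (h a)" "!!x. x \<E> a ==> ap (h f) (h x) = h (ap f x)"
proof -
  show 1: "fnc (h f) (h a)" using pres2[OF pres, of "%f a. fnc f a" f a] assms D0_fnc by simp
  fix x assume x: "x \<E> a"
  have p: "pr x (ap f x) \<in> A" using A_elem[OF assms(2) fnc_ap[OF assms(1) x]] .
  have "pr (h x) (h (ap f x)) \<E> h f"
    using h_mem[OF p assms(2)] fnc_ap[OF assms(1) x] h_pr[OF p] by simp
  then show "ap (h f) (h x) = h (ap f x)" by (rule ap_eq[OF 1])
qed

end

section \<open>From an embedding of the universe to a pre-witness\<close>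

context zf2
begin

lemma Ex1_bounded: "(EX! y. y \<in> el d & Q y) \<longleftrightarrow> (EX y:el d. Q y & (ALL z:el d. Q z --> z = y))"
  by blast

lemma D0_sub_in [d0]: "D0 (%e. sub_in E (el (e d)) (e a) (e b))"
  unfolding sub_in_def by (intro d0)

lemma D0_is_empty_in [d0]: "D0 (%e. is_empty_in E (el (e d)) (e a))"
  unfolding is_empty_in_def by (intro d0)

lemma D0_is_upair_in [d0]: "D0 (%e. is_upair_in E (el (e d)) (e a) (e b) (e c))"
  unfolding is_upair_in_def by (intro d0)

lemma D0_is_opair_in [d0]: "D0 (%e. is_opair_in E (el (e d)) (e a) (e b) (e c))"
  unfolding is_opair_in_def by (intro d0)

lemma D0_is_succ_in [d0]: "D0 (%e. is_succ_in E (el (e d)) (e a) (e b))"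
  unfolding is_succ_in_def by (intro d0)

lemma D0_maps_to_in [d0]: "D0 (%e. maps_to_in E (el (e d)) (e a) (e b) (e c))"
  unfolding maps_to_in_def by (intro d0)

lemma D0_is_function_in [d0]: "D0 (%e. is_function_in E (el (e d)) (e a) (e b))"
  unfolding is_function_in_def Ex1_bounded by (intro d0)

lemma D0_is_ordinal_in [d0]: "D0 (%e. is_ordinal_in E (el (e d)) (e a))"
  unfolding is_ordinal_in_def by (intro d0)

lemma D0_is_Vstage_in [d0]: "D0 (%e. is_Vstage_in E (el (e d)) (e a) (e b) (e c))"
  unfolding is_Vstage_in_def by (intro d0)

lemma D0_is_Vseq_in [d0]: "D0 (%e. is_Vseq_in E (el (e d)) (e a) (e b))"
  unfolding is_Vseq_in_def by (intro d0)

lemma D0_is_V_in [d0]: "D0 (%e. is_V_in E (el (e d)) (e a) (e b))"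
  unfolding is_V_in_def by (intro d0)

lemma D0_extensionality_in [d0]: "D0 (%e. extensionality_in E (el (e d)) )"
  unfolding extensionality_in_def by (intro d0)

lemma D0_foundation_in [d0]: "D0 (%e. foundation_in E (el (e d)) )"
  unfolding foundation_in_def by (intro d0)

lemma D0_pairing_in [d0]: "D0 (%e. pairing_in E (el (e d)) )"
  unfolding pairing_in_def by (intro d0)

lemma D0_union_in [d0]: "D0 (%e. union_in E (el (e d)) )"
  unfolding union_in_def by (intro d0)

lemma D0_power_set_in [d0]: "D0 (%e. power_set_in E (el (e d)) )"
  unfolding power_set_in_def by (intro d0)

text \<open>A bounded description of a truth set \<open>T\<close> for \<open>v\<close> that can be
  moved by an embedding. The image of the set of all assignments may miss some, so \<open>A\<close>
  is merely required to be a nonempty set of assignments closed under changing one value.\<close>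

definition Tarski :: "'v => 'v => 'v => 'v => 'v => bool" where
  "Tarski v T A F w \<longleftrightarrow> (ALL s:el A. fnc s w & (ALL n:el w. EX u. pr n u \<E> s & u \<E> v) &
     (ALL i:el w. ALL x:el v. EX t:el A. pr i x \<E> t & (ALL n:el w. n ~= i --> (ALL u. pr n u \<E> s --> pr n u \<E> t)))) &
   (EX s:el A. True) &
   (ALL s:el A. ALL \<phi>:el F.
     (ALL i:el w. ALL k:el w. \<phi> = cMem E i k --> (pr \<phi> s \<E> T \<longleftrightarrow> (EX x. pr i x \<E> s & (EX y. pr k y \<E> s & x \<E> y)))) &
     (ALL i:el w. ALL k:el w. \<phi> = cEq E i k --> (pr \<phi> s \<E> T \<longleftrightarrow> (EX x. pr i x \<E> s & (EX y. pr k y \<E> s & x = y)))) &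
     (ALL \<psi>:el F. \<phi> = cNeg E \<psi> --> (pr \<phi> s \<E> T \<longleftrightarrow> ~ pr \<psi> s \<E> T)) &
     (ALL \<psi>:el F. ALL \<chi>:el F. \<phi> = cAnd E \<psi> \<chi> --> (pr \<phi> s \<E> T \<longleftrightarrow> pr \<psi> s \<E> T & pr \<chi> s \<E> T)) &
     (ALL i:el w. ALL \<psi>:el F. \<phi> = cEx E i \<psi> --> (pr \<phi> s \<E> T \<longleftrightarrow>
        (EX t:el A. (ALL n:el w. n ~= i --> (ALL u. pr n u \<E> s --> pr n u \<E> t)) & pr \<psi> t \<E> T))))"

lemma D0_Tarski [d0]: "D0 (%e. Tarski (e a) (e b) (e c) (e d) (e f))"
  unfolding Tarski_def by (intro d0)

lemma updr_upd: assumes "fnc s om" "fnc t om" "i \<E> om"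
  shows "(ALL n:el om. n ~= i --> (ALL u. pr n u \<E> s --> pr n u \<E> t)) \<longleftrightarrow> t = upd s i (ap t i)"
proof
  assume "ALL n:el om. n ~= i --> (ALL u. pr n u \<E> s --> pr n u \<E> t)"
  then have "ap t n = ap s n" if "n \<E> om" "n ~= i" for n
    using that fnc_ap[OF assms(1) that(1)] ap_eq[OF assms(2)] by auto
  then show "t = upd s i (ap t i)" by (intro fnc_ext[OF assms(2) fnc_upd]) (simp add: ap_upd)
next
  assume t: "t = upd s i (ap t i)"
  have "ap t n = ap s n" if "n \<E> om" "n ~= i" for n using that by (subst t) (simp add: ap_upd)
  then show "ALL n:el om. n ~= i --> (ALL u. pr n u \<E> s --> pr n u \<E> t)"
    by (simp add: fnc_pr[OF assms(1)] fnc_pr[OF assms(2)])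
qed

lemma Tarski_Tr: assumes "x0 \<E> v" shows "Tarski v (Tr v) (asg v) Fm om"
  unfolding Tarski_def
proof (intro conjI ballI allI impI, goal_cases)
  case (1 s) then show ?case by (simp add: assignment_iff)
next
  case (2 s n) then show ?case by (auto simp: assignment_iff fnc_pr)
next
  case (3 s i x)
  then have s: "assignment E (el v) s" by simp
  show ?case
    using 3 asg_upd[OF s, of x i] s
    by (intro bexI[of _ "upd s i x"]) (auto simp: fnc_pr[OF fnc_upd] ap_upd fnc_pr[OF asgD(1)])
next
  case 4
  have "Df (%C e. x0)" by (intro dfn)
  then have "assignment E (el v) (lam om (%_. x0))"
    unfolding assignment_iff using assms by (simp add: fnc_lam[of "%_. x0"] ap_lam[of "%_. x0"])
  then show ?case by auto
next
  case (5 s \<phi> i k) then show ?case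
    using truthD(1)[OF truth_Tr, of v s i k] by (auto simp: fnc_pr[OF asgD(1)])
next
  case (6 s \<phi> i k) then show ?case
    using truthD(2)[OF truth_Tr, of v s i k] by (auto simp: fnc_pr[OF asgD(1)])
next
  case (7 s \<phi> \<psi>) then show ?case using truthD(3)[OF truth_Tr, of v s \<psi>] by simp
next
  case (8 s \<phi> \<psi> \<chi>) then show ?case using truthD(4)[OF truth_Tr, of v s \<psi> \<chi>] by simp
next
  case (9 s \<phi> i \<psi>)
  then have s: "assignment E (el v) s" and i: "i \<E> om" by auto
  have "(EX t:el (asg v). (ALL n:el om. n ~= i --> (ALL u. pr n u \<E> s --> pr n u \<E> t)) & pr \<psi> t \<E> Tr v) \<longleftrightarrow>
      (EX x:el v. pr \<psi> (upd s i x) \<E> Tr v)"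
  proof
    assume "EX t:el (asg v). (ALL n:el om. n ~= i --> (ALL u. pr n u \<E> s --> pr n u \<E> t)) & pr \<psi> t \<E> Tr v"
    then obtain t where t: "assignment E (el v) t" "ALL n:el om. n ~= i --> (ALL u. pr n u \<E> s --> pr n u \<E> t)"
      "pr \<psi> t \<E> Tr v" by auto
    then have "t = upd s i (ap t i)" using updr_upd[OF asgD(1)[OF s] asgD(1)[OF t(1)] i] by blast
    then show "EX x:el v. pr \<psi> (upd s i x) \<E> Tr v" using t asgD(2)[OF t(1) i] by (intro bexI[of _ "ap t i"]) simp_all
  next
    assume "EX x:el v. pr \<psi> (upd s i x) \<E> Tr v"
    then obtain x where x: "x \<E> v" "pr \<psi> (upd s i x) \<E> Tr v" by auto
    then have a: "assignment E (el v) (upd s i x)" using asg_upd[OF s] by simp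
    have "ALL n:el om. n ~= i --> (ALL u. pr n u \<E> s --> pr n u \<E> upd s i x)"
      by (simp add: fnc_pr[OF asgD(1)[OF s]] fnc_pr[OF fnc_upd] ap_upd)
    then show "EX t:el (asg v). (ALL n:el om. n ~= i --> (ALL u. pr n u \<E> s --> pr n u \<E> t)) & pr \<psi> t \<E> Tr v"
      using a x by (intro bexI[of _ "upd s i x"]) simp_all
  qed
  then show ?case using 9 truthD(5)[OF truth_Tr s i, of \<psi>] by simp
qed

text \<open>The quantifier clause asks only for changes of one value, and \<open>A\<close> is closed
  under these. Hence \<open>T\<close> decides correctly for assignments in \<open>A\<close>, even if
  there are others.\<close>

lemma Tarski_models:
  assumes T: "Tarski v T A F om" and F: "!!\<phi>. is_fm E \<phi> ==> \<phi> \<E> F" and s: "s \<E> A" and \<phi>: "is_fm E \<phi>"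
  shows "assignment E (el v) s" "i \<E> om ==> x \<E> v ==> upd s i x \<E> A" "models E v \<phi> s \<longleftrightarrow> pr \<phi> s \<E> T"
proof -
  have T1: "fnc s om" "ALL n:el om. EX u. pr n u \<E> s & u \<E> v" "ALL i:el om. ALL x:el v. EX t:el A. pr i x \<E> t &
      (ALL n:el om. n ~= i --> (ALL u. pr n u \<E> s --> pr n u \<E> t))" if "s \<E> A" for s
    using T[unfolded Tarski_def, THEN conjunct1, THEN bspec, of s] that by simp_all
  have as: "assignment E (el v) s" if "s \<E> A" for s
    using T1(1,2)[OF that] by (auto simp: assignment_iff fnc_pr)
  then show "assignment E (el v) s" using s by blast
  have up: "upd s i x \<E> A" if s: "s \<E> A" and "i \<E> om" "x \<E> v" for s i x
  proof -
    obtain t where t: "t \<E> A" "pr i x \<E> t" "ALL n:el om. n ~= i --> (ALL u. pr n u \<E> s --> pr n u \<E> t)"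
      using T1(3)[OF s] \<open>i \<E> om\<close> \<open>x \<E> v\<close> unfolding el_ball el_bex by blast
    have "t = upd s i (ap t i)" using updr_upd[OF asgD(1)[OF as[OF s]] asgD(1)[OF as[OF t(1)]] \<open>i \<E> om\<close>] t(3) by blast
    then show ?thesis using t ap_eq[OF asgD(1)[OF as[OF t(1)]] t(2)] by simp
  qed
  then show "i \<E> om ==> x \<E> v ==> upd s i x \<E> A" using s by blast
  have cl: "(ALL i:el om. ALL k:el om. \<phi> = cMem E i k --> (pr \<phi> s \<E> T \<longleftrightarrow> (EX x. pr i x \<E> s & (EX y. pr k y \<E> s & x \<E> y)))) &
     (ALL i:el om. ALL k:el om. \<phi> = cEq E i k --> (pr \<phi> s \<E> T \<longleftrightarrow> (EX x. pr i x \<E> s & (EX y. pr k y \<E> s & x = y)))) &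
     (ALL \<psi>:el F. \<phi> = cNeg E \<psi> --> (pr \<phi> s \<E> T \<longleftrightarrow> ~ pr \<psi> s \<E> T)) &
     (ALL \<psi>:el F. ALL \<chi>:el F. \<phi> = cAnd E \<psi> \<chi> --> (pr \<phi> s \<E> T \<longleftrightarrow> pr \<psi> s \<E> T & pr \<chi> s \<E> T)) &
     (ALL i:el om. ALL \<psi>:el F. \<phi> = cEx E i \<psi> --> (pr \<phi> s \<E> T \<longleftrightarrow>
        (EX t:el A. (ALL n:el om. n ~= i --> (ALL u. pr n u \<E> s --> pr n u \<E> t)) & pr \<psi> t \<E> T)))"
    if "s \<E> A" "is_fm E \<phi>" for s \<phi>
    using T[unfolded Tarski_def, THEN conjunct2, THEN conjunct2, THEN bspec[of _ _ s], THEN bspec[of _ _ \<phi>]]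
      F[OF that(2)] that(1) by simp
  have "ALL s. s \<E> A --> (pr \<phi> s \<E> Tr v \<longleftrightarrow> pr \<phi> s \<E> T)"
  proof (rule fm_induct[of "%\<phi>. ALL s. s \<E> A --> (pr \<phi> s \<E> Tr v \<longleftrightarrow> pr \<phi> s \<E> T)", OF _ \<phi>], goal_cases)
    case 1 show ?case by (intro dfn)
  next
    case (2 i k)
    show ?case
    proof (intro allI impI)
      fix s assume "s \<E> A"
      then show "pr (cMem E i k) s \<E> Tr v \<longleftrightarrow> pr (cMem E i k) s \<E> T"
        using cl[OF \<open>s \<E> A\<close> fm_intros(1)[OF 2]] 2 truthD(1)[OF truth_Tr as[OF \<open>s \<E> A\<close>] 2]
        by (simp add: fnc_pr[OF asgD(1)[OF as[OF \<open>s \<E> A\<close>]]])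
    qed
  next
    case (3 i k)
    show ?case
    proof (intro allI impI)
      fix s assume "s \<E> A"
      then show "pr (cEq E i k) s \<E> Tr v \<longleftrightarrow> pr (cEq E i k) s \<E> T"
        using cl[OF \<open>s \<E> A\<close> fm_intros(2)[OF 3]] 3 truthD(2)[OF truth_Tr as[OF \<open>s \<E> A\<close>] 3]
        by (simp add: fnc_pr[OF asgD(1)[OF as[OF \<open>s \<E> A\<close>]]])
    qed
  next
    case (4 \<phi>) then show ?case
      using cl[OF _ fm_intros(3)[OF 4(1)]] F[OF 4(1)] truthD(3)[OF truth_Tr as 4(1)] by simp
  next
    case (5 \<phi> \<psi>) then show ?case
      using cl[OF _ fm_intros(4)[OF 5(1,3)]] F[OF 5(1)] F[OF 5(3)] truthD(4)[OF truth_Tr as 5(1,3)] by simp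
  next
    case (6 i \<phi>)
    show ?case
    proof (intro allI impI)
      fix s assume s: "s \<E> A"
      have "pr (cEx E i \<phi>) s \<E> T \<longleftrightarrow>
          (EX t:el A. (ALL n:el om. n ~= i --> (ALL u. pr n u \<E> s --> pr n u \<E> t)) & pr \<phi> t \<E> T)"
        using cl[OF s fm_intros(5)[OF 6(1,2)]] 6 F by simp
      also have "\<dots> \<longleftrightarrow> (EX x:el v. pr \<phi> (upd s i x) \<E> T)"
      proof
        assume "EX t:el A. (ALL n:el om. n ~= i --> (ALL u. pr n u \<E> s --> pr n u \<E> t)) & pr \<phi> t \<E> T"
        then obtain t where t: "t \<E> A" "ALL n:el om. n ~= i --> (ALL u. pr n u \<E> s --> pr n u \<E> t)" "pr \<phi> t \<E> T"
          unfolding el_bex by blast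
        then have "t = upd s i (ap t i)"
          using updr_upd[OF asgD(1)[OF as[OF s]] asgD(1)[OF as[OF t(1)]] 6(1)] by blast
        then show "EX x:el v. pr \<phi> (upd s i x) \<E> T"
          using t asgD(2)[OF as[OF t(1)] 6(1)] by (intro bexI[of _ "ap t i"]) simp_all
      next
        assume "EX x:el v. pr \<phi> (upd s i x) \<E> T"
        then obtain x where x: "x \<E> v" "pr \<phi> (upd s i x) \<E> T" unfolding el_bex by blast
        have "ALL n:el om. n ~= i --> (ALL u. pr n u \<E> s --> pr n u \<E> upd s i x)"
          by (simp add: fnc_pr[OF asgD(1)[OF as[OF s]]] fnc_pr[OF fnc_upd] ap_upd)
        then show "EX t:el A. (ALL n:el om. n ~= i --> (ALL u. pr n u \<E> s --> pr n u \<E> t)) & pr \<phi> t \<E> T"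
          using up[OF s 6(1) x(1)] x by (intro bexI[of _ "upd s i x"]) simp_all
      qed
      also have "\<dots> \<longleftrightarrow> (EX x:el v. pr \<phi> (upd s i x) \<E> Tr v)"
        using 6(3) up[OF s 6(1)] unfolding el_bex by blast
      also have "\<dots> \<longleftrightarrow> pr (cEx E i \<phi>) s \<E> Tr v" using truthD(5)[OF truth_Tr as[OF s] 6(1,2)] by simp
      finally show "pr (cEx E i \<phi>) s \<E> Tr v \<longleftrightarrow> pr (cEx E i \<phi>) s \<E> T" by simp
    qed
  qed
  then show "models E v \<phi> s \<longleftrightarrow> pr \<phi> s \<E> T" using models_Tr[OF \<phi> as[OF s]] s by simp
qed

text \<open>The internal analogue of \<open>satr_vars\<close>; the bound is a number of the
  structure and may be nonstandard. It serves to exchange an arbitrary assignment for one in the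
  image of \<open>asg\<close>.\<close>

lemma fm_support:
  assumes "is_fm E \<phi>"
  shows "EX n. n \<E> om & (ALL s s'. assignment E (el v) s & assignment E (el v) s' & (ALL k. k \<E> n --> ap s k = ap s' k) -->
    (pr \<phi> s \<E> Tr v \<longleftrightarrow> pr \<phi> s' \<E> Tr v))" (is "?Q \<phi>")
proof (rule fm_induct[of ?Q, OF _ assms], goal_cases)
  case 1 show ?case by (intro dfn)
next
  case (2 i k)
  then obtain n where n: "n \<E> om" "Sub (sc i) n" "Sub (sc k) n" using Ord_max[OF Ord_om om_sc om_sc] by blast
  then show ?case
    using 2 truthD(1)[OF truth_Tr, of v _ i k] by (intro exI[of _ n]) (auto simp: Sub_iff)
next
  case (3 i k)
  then obtain n where n: "n \<E> om" "Sub (sc i) n" "Sub (sc k) n" using Ord_max[OF Ord_om om_sc om_sc] by blast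
  then show ?case
    using 3 truthD(2)[OF truth_Tr, of v _ i k] by (intro exI[of _ n]) (auto simp: Sub_iff)
next
  case (4 \<phi>) then show ?case using truthD(3)[OF truth_Tr, of v _ \<phi>] unfolding el_iff by metis
next
  case (5 \<phi> \<psi>)
  then obtain m n where mn: "m \<E> om" "n \<E> om"
    "ALL s s'. assignment E (el v) s & assignment E (el v) s' & (ALL k. k \<E> m --> ap s k = ap s' k) --> (pr \<phi> s \<E> Tr v \<longleftrightarrow> pr \<phi> s' \<E> Tr v)"
    "ALL s s'. assignment E (el v) s & assignment E (el v) s' & (ALL k. k \<E> n --> ap s k = ap s' k) --> (pr \<psi> s \<E> Tr v \<longleftrightarrow> pr \<psi> s' \<E> Tr v)"
    by blast
  obtain l where l: "l \<E> om" "Sub m l" "Sub n l" using Ord_max[OF Ord_om mn(1,2)] by blast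
  have "pr (cAnd E \<phi> \<psi>) s \<E> Tr v \<longleftrightarrow> pr (cAnd E \<phi> \<psi>) s' \<E> Tr v"
    if "assignment E (el v) s" "assignment E (el v) s'" "ALL k. k \<E> l --> ap s k = ap s' k" for s s'
    using that mn(3,4)[rule_format, of s s'] l(2,3) truthD(4)[OF truth_Tr that(1) 5(1,3)]
      truthD(4)[OF truth_Tr that(2) 5(1,3)] by (simp add: Sub_iff)
  then show ?case using l(1) by blast
next
  case (6 i \<phi>)
  then obtain n where n: "n \<E> om"
    "ALL s s'. assignment E (el v) s & assignment E (el v) s' & (ALL k. k \<E> n --> ap s k = ap s' k) --> (pr \<phi> s \<E> Tr v \<longleftrightarrow> pr \<phi> s' \<E> Tr v)"
    by blast
  have "pr (cEx E i \<phi>) s \<E> Tr v \<longleftrightarrow> pr (cEx E i \<phi>) s' \<E> Tr v"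
    if a: "assignment E (el v) s" "assignment E (el v) s'" "ALL k. k \<E> n --> ap s k = ap s' k" for s s'
  proof -
    have "pr \<phi> (upd s i x) \<E> Tr v \<longleftrightarrow> pr \<phi> (upd s' i x) \<E> Tr v" if "x \<E> v" for x
      using n(2)[rule_format, of "upd s i x" "upd s' i x"] asg_upd[OF a(1), of x i] asg_upd[OF a(2), of x i] that a(3)
        om_elem[OF n(1)] by (simp add: ap_upd)
    then show ?thesis
      using truthD(5)[OF truth_Tr a(1) 6(1,2)] truthD(5)[OF truth_Tr a(2) 6(1,2)] by (auto simp: el_bex)
  qed
  then show ?case using n(1) by blast
qed

end

context zf2
begin

text \<open>\<open>RL_model\<close> without Separation, which mentions satisfaction and is
  transported separately with the help of \<open>Tarski\<close>.\<close>

definition RLb :: "'v => bool" where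
  "RLb v \<longleftrightarrow> (EX z:el v. is_empty_in E (el v) z) &
     extensionality_in E (el v) & foundation_in E (el v) & pairing_in E (el v) &
     union_in E (el v) & power_set_in E (el v) &
     (ALL \<alpha>:el v. is_ordinal_in E (el v) \<alpha> -->
        (EX s:el v. is_succ_in E (el v) \<alpha> s) & (EX x:el v. is_V_in E (el v) \<alpha> x) &
        (EX f:el v. is_Vseq_in E (el v) \<alpha> f)) &
     (ALL x:el v. EX \<alpha>:el v. EX y:el v. is_ordinal_in E (el v) \<alpha> & is_V_in E (el v) \<alpha> y & x \<E> y)"

lemma D0_RLb [d0]: "D0 (%e. RLb (e a))"
  unfolding RLb_def by (intro d0)

text \<open>In a limit level the relativized notions agree with the true ones, and each set that an
  axiom asks for has rank below \<delta>.\<close>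

lemma RLb_V:
  assumes lim: "Lim \<delta>" shows "RLb (V \<delta>)"
proof -
  let ?D = "el (V \<delta>)"
  have \<delta>: "Ord \<delta>" using lim by (rule Lim_Ord)
  have tr: "y \<E> V \<delta>" if "x \<E> V \<delta>" "y \<E> x" for x y using V_trans[OF \<delta> that] .
  have st: "sc a \<E> \<delta>" if "a \<E> \<delta>" for a using lim that by (simp add: Lim_def)
  have bd: "x \<E> V \<delta>" if "a \<E> \<delta>" "Sub x (V a)" for x a using mem_V[OF \<delta>] that by blast
  have lv: "EX a. a \<E> \<delta> & x \<E> V a" if "x \<E> V \<delta>" for x using Lim_V_ex[OF lim that] .
  have Oe: "Ord a" if "a \<E> \<delta>" for a using Ord_elem[OF \<delta> that] .
  have sub: "sub_in E ?D x y \<longleftrightarrow> Sub x y" if "x \<E> V \<delta>" for x y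
    using tr[OF that] unfolding sub_in_def Sub_iff el_ball by blast
  have up: "upair x y \<E> V \<delta>" if xy: "x \<E> V \<delta>" "y \<E> V \<delta>" for x y
  proof -
    obtain b where b: "b \<E> \<delta>" "x \<E> V b" "y \<E> V b" by (rule V_max[OF \<delta> xy lim])
    then show ?thesis by (intro bd[OF b(1)]) (auto simp: Sub_iff)
  qed
  have upi: "is_upair_in E ?D x y z \<longleftrightarrow> z = upair x y" if "x \<E> V \<delta>" "y \<E> V \<delta>" "z \<E> V \<delta>" for x y z
  proof
    assume "is_upair_in E ?D x y z"
    then have "w \<E> V \<delta> ==> w \<E> z \<longleftrightarrow> w = x | w = y" for w by (simp add: is_upair_in_def el_ball)
    then show "z = upair x y" using that tr[OF that(3)] by (intro ext) auto
  qed (simp add: is_upair_in_def)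
  have opi: "is_opair_in E ?D x y p \<longleftrightarrow> p = pr x y" if "x \<E> V \<delta>" "y \<E> V \<delta>" "p \<E> V \<delta>" for x y p
  proof -
    have "is_opair_in E ?D x y p \<longleftrightarrow> (EX s. s \<E> V \<delta> & (EX t. t \<E> V \<delta> & s = upair x x & t = upair x y & p = upair s t))"
      unfolding is_opair_in_def el_bex using upi that by (auto cong: conj_cong)
    then show ?thesis using up that by (auto simp: pr_eq)
  qed
  have mt: "maps_to_in E ?D f x y \<longleftrightarrow> pr x y \<E> f" if "f \<E> V \<delta>" "x \<E> V \<delta>" "y \<E> V \<delta>" for f x y
    unfolding maps_to_in_def el_bex using opi[OF that(2,3)] tr[OF that(1)] by blast
  have prD: "x \<E> V \<delta>" "y \<E> V \<delta>" if "f \<E> V \<delta>" "pr x y \<E> f" for f x y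
    using tr[OF that] Lim_pr[OF lim] by blast+
  have fn: "is_function_in E ?D f a" if f: "fnc f a" "f \<E> V \<delta>" "a \<E> V \<delta>" for f a
  proof -
    have "EX x:?D. EX y:?D. x \<E> a & is_opair_in E ?D x y p" if p: "p \<E> f" for p
    proof -
      obtain x where x: "x \<E> a" "p = pr x (ap f x)" using fnc_mem[OF f(1)] p by blast
      then have "x \<E> V \<delta>" "ap f x \<E> V \<delta>" "p \<E> V \<delta>" using prD[OF f(2)] p tr[OF f(2) p] by auto
      then show ?thesis using x opi by auto
    qed
    moreover have "EX! y. y \<in> ?D & maps_to_in E ?D f x y" if "x \<E> a" for x
    proof (rule ex1I[of _ "ap f x"])
      have x: "pr x (ap f x) \<E> f" using fnc_ap[OF f(1) that] .
      then show "ap f x \<in> ?D & maps_to_in E ?D f x (ap f x)" using prD[OF f(2) x] mt[OF f(2)] by simp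
      fix y assume "y \<in> ?D & maps_to_in E ?D f x y"
      then show "y = ap f x" using mt[OF f(2)] prD[OF f(2) x] ap_eq[OF f(1)] by auto
    qed
    ultimately show ?thesis unfolding is_function_in_def el_ball by simp
  qed
  have ordi: "is_ordinal_in E ?D a \<longleftrightarrow> Ord a" if "a \<E> V \<delta>" for a
    using tr[OF that] sub unfolding is_ordinal_in_def Ord_iff el_ball Sub_iff by blast
  have VD: "Df (%C e. V (e 0))" by (intro dfn)
  have Vs: "lam a V \<E> V \<delta> & is_Vseq_in E ?D a (lam a V) & is_V_in E ?D a (V a) & V a \<E> V \<delta>" if a: "a \<E> \<delta>" for a
  proof -
    have oa: "Ord a" using Oe[OF a] .
    have aV: "a \<E> V \<delta>" "V a \<E> V \<delta>" using Ord_V[OF \<delta> oa] a V_mem_V[OF \<delta> a] by auto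
    \<comment> \<open>Arguments and values lie in level \<open>sc a\<close>, the pairs two levels
      higher.\<close>
    have "Sub (lam a V) (V (sc (sc (sc a))))"
      unfolding Sub_iff
    proof (intro allI impI)
      fix p assume "p \<E> lam a V"
      then obtain b where b: "b \<E> a" "p = pr b (V b)" by (auto simp: mem_lam[OF VD])
      have "b \<E> V (sc a)" "V b \<E> V (sc a)"
        using b(1) oa Ord_V[of "sc a" b] Ord_elem[OF oa] V_mem_V[of "sc a" b] by auto
      then show "p \<E> V (sc (sc (sc a)))" using pr_rank[of "sc a" b "V b"] oa b by simp
    qed
    then have L: "lam a V \<E> V \<delta>" using bd[OF st[OF st[OF st[OF a]]]] by blast
    have L1: "fnc (lam a V) a" "!!b. b \<E> a ==> ap (lam a V) b = V b" using fnc_lam[OF VD] ap_lam[OF VD] by auto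
    have stg: "is_Vstage_in E ?D (lam a V) b (V b)" if b: "b \<E> a | b = a" for b
    proof -
      have bo: "Ord b" "b \<E> V \<delta>" "V b \<E> V \<delta>"
        using b oa Ord_elem[OF oa] aV Ord_V[OF \<delta>] Ord_trans[OF \<delta> a] V_mem_V[OF \<delta>] a by blast+
      have "(EX c:?D. c \<E> b & (EX w:?D. maps_to_in E ?D (lam a V) c w & sub_in E ?D x w)) \<longleftrightarrow> x \<E> V b"
        if x: "x \<E> V \<delta>" for x
      proof -
        have "c \<E> b ==> c \<E> a & c \<E> V \<delta> & V c \<E> V \<delta>" for c
          using b Ord_trans[OF oa] tr[OF bo(2)] V_mem_V[OF \<delta>] Ord_trans[OF \<delta> a] by blast
        moreover have "maps_to_in E ?D (lam a V) c w \<longleftrightarrow> w = V c" if "c \<E> a" "c \<E> V \<delta>" "w \<E> V \<delta>" for c w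
          using mt[OF L that(2,3)] fnc_pr[OF L1(1)] L1(2) that(1) by simp
        ultimately show ?thesis unfolding mem_V[OF bo(1)] el_bex using sub[OF x] by metis
      qed
      then show ?thesis unfolding is_Vstage_in_def el_ball by blast
    qed
    have "is_Vseq_in E ?D a (lam a V)"
      unfolding is_Vseq_in_def el_ball
    proof (intro conjI fn[OF L1(1) L aV(1)] allI impI)
      fix b v assume b: "b \<E> V \<delta>" "b \<E> a" "v \<E> V \<delta>" "maps_to_in E ?D (lam a V) b v"
      then have "v = V b" using mt[OF L b(1,3)] ap_eq[OF L1(1)] L1(2) by auto
      then show "is_Vstage_in E ?D (lam a V) b v" using stg b by blast
    qed
    then show ?thesis using L stg[of a] aV unfolding is_V_in_def by auto
  qed
  show ?thesis
    unfolding RLb_def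
  proof (intro conjI ballI impI)
    have e: "emp \<E> V \<delta>" using bd[of emp emp] lim by (simp add: Lim_def Sub_iff)
    then show "EX z:?D. is_empty_in E ?D z" by (intro bexI[of _ emp]) (simp_all add: is_empty_in_def)
    show "extensionality_in E ?D" unfolding extensionality_in_def el_ball using tr ext by blast
    show "foundation_in E ?D" unfolding foundation_in_def el_ball el_bex using foundation tr by metis
    show "pairing_in E ?D" unfolding pairing_in_def el_ball el_bex using upi up by blast
    show "union_in E ?D"
      unfolding union_in_def el_ball el_bex
    proof (intro allI impI)
      fix x assume x: "x \<E> V \<delta>"
      obtain b where b: "b \<E> \<delta>" "x \<E> V b" using lv[OF x] by blast
      have "Uni x \<E> V \<delta>" using bd[OF b(1), of "Uni x"] V_trans[OF Oe[OF b(1)]] b(2) by (auto simp: Sub_iff)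
      then show "EX u. u \<E> V \<delta> & (ALL z. z \<E> V \<delta> --> (z \<E> u \<longleftrightarrow> (EX y. y \<E> V \<delta> & y \<E> x & z \<E> y)))"
        using tr[OF x] by (intro exI[of _ "Uni x"]) auto
    qed
    show "power_set_in E ?D"
      unfolding power_set_in_def el_ball el_bex
    proof (intro allI impI)
      fix x assume x: "x \<E> V \<delta>"
      obtain b where b: "b \<E> \<delta>" "x \<E> V b" using lv[OF x] by blast
      have "Pw x \<E> V \<delta>" using bd[OF b(1), of "Pw x"] V_sub[OF Oe[OF b(1)] b(2)] by (auto simp: Sub_iff)
      then show "EX p. p \<E> V \<delta> & (ALL z. z \<E> V \<delta> --> (z \<E> p \<longleftrightarrow> sub_in E ?D z x))"
        using sub by (intro exI[of _ "Pw x"]) auto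
    qed
    fix a assume "a \<in> ?D" "is_ordinal_in E ?D a"
    then have a: "Ord a" "a \<E> \<delta>" using ordi Ord_V[OF \<delta>] by auto
    have "sc a \<E> V \<delta>" using Ord_V[OF \<delta>, of "sc a"] a st by simp
    then show "EX s:?D. is_succ_in E ?D a s" by (intro bexI[of _ "sc a"]) (simp_all add: is_succ_in_def)
    show "EX x:?D. is_V_in E ?D a x" "EX f:?D. is_Vseq_in E ?D a f" using Vs[OF a(2)] by auto
  next
    fix x assume "x \<in> ?D"
    then obtain a where a: "a \<E> \<delta>" "x \<E> V a" using lv by auto
    then show "EX \<alpha>:?D. EX y:?D. is_ordinal_in E ?D \<alpha> & is_V_in E ?D \<alpha> y & x \<E> y"
      using Vs[OF a(1)] ordi[of a] Ord_V[OF \<delta> Oe[OF a(1)]] Oe[OF a(1)]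
      by (intro bexI[of _ a] bexI[of _ "V a"]) auto
  qed
qed

end

section \<open>An embedding of the universe and its restriction to a suitable level\<close>

locale embedding = zf2 E P for E :: "'v => 'v => bool" (infix \<open>\<E>\<close> 50) and P +
  fixes M J \<kappa>
  assumes MJ: "M \<in> P" "J \<in> P" "transitive_class E M" "class_elementary E P J M"
    and crit: "critical_point E (class_app E J) UNIV \<kappa>"
    and pc: "proper_class_wLS E"
begin

abbreviation "h \<equiv> class_app E J"

lemma J_ex1: "EX! y. pr x y \<in> J" and h_M: "h x \<in> M"
  using MJ(4) by (auto simp: class_elementary_def class_maps_def)

lemma h_iff: "pr x y \<in> J \<longleftrightarrow> y = h x"
  unfolding class_app_def using theI'[OF J_ex1] J_ex1 by blast

sublocale pres_map E P h UNIV
proof unfold_locales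
  show "Df (%C e. h (e 0))"
    by (rule Df_rel[of "%C e y. pr (e 0) y \<in> J"]) (intro dfn MJ, simp add: h_iff)
  obtain S T where ST: "S \<in> P" "T \<in> P" "truth E UNIV S" "truth E M T"
    "ALL \<phi> s t. is_fm E \<phi> & assignment E UNIV s & assignment E M t & pointwise_image E h s t -->
       (pr \<phi> s \<in> S \<longleftrightarrow> pr \<phi> t \<in> T)" using MJ(4) unfolding class_elementary_def truth_iff by blast
  show "pres h UNIV"
  proof (rule pres_truth[OF ST(3,4) _ _ MJ(3)])
    fix \<phi> s t assume a: "is_Delta0 E \<phi>" "assignment E UNIV s" "assignment E M t" "ALL n:el om. ap t n = h (ap s n)"
    then have "pointwise_image E h s t"
      using ap_app[OF asgD(1)[OF a(2)]] ap_app[OF asgD(1)[OF a(3)]] by (simp add: pointwise_image_def el_ball)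
    then show "pr \<phi> s \<in> S \<longleftrightarrow> pr \<phi> t \<in> T" using ST(5) a Sigma1_fm[OF Delta0_Sigma1] by blast
  qed (auto simp: transitive_class_def h_M)
qed (auto simp: transitive_class_def)

lemma \<kappa>: "Ord \<kappa>" "h \<kappa> ~= \<kappa>" "!!\<alpha>. \<alpha> \<E> \<kappa> ==> h \<alpha> = \<alpha>"
  using crit by (auto simp: critical_point_def)

text \<open>No ordinal is moved down, for the least such \<open>b\<close> would give
  \<open>h (h b)\<close> below \<open>h b\<close>.\<close>

lemma \<kappa>_h: "\<kappa> \<E> h \<kappa>"
proof -
  have "ALL \<alpha>. Ord \<alpha> --> ~ h \<alpha> \<E> \<alpha>"
  proof (rule ccontr)
    assume "~ ?thesis"
    then obtain a where a: "Ord a" "h a \<E> a" by blast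
    have "D (%C e. h (e 0) \<E> e 0)" by (intro dfn Df_fun1[OF Dh])
    from Ord_least[OF this a] obtain b where b: "Ord b" "h b \<E> b" "!!c. c \<E> b ==> ~ h c \<E> c" by blast
    have "h (h b) \<E> h b" using h_mem[of "h b" b] b(2) by simp
    then show False using b(2,3) by blast
  qed
  then show ?thesis using \<kappa> Ord_linear[of \<kappa> "h \<kappa>"] h_Ord[of \<kappa>] by auto
qed

lemma \<kappa>_Lim: "Lim \<kappa>" and om_\<kappa>: "om \<E> \<kappa>"
proof -
  have "~ \<kappa> \<E> om" "\<kappa> ~= om" using h_om_elem h_om \<kappa>(2) by auto
  then show om: "om \<E> \<kappa>" using Ord_linear[OF \<kappa>(1) Ord_om] by blast
  have "sc a \<E> \<kappa>" if a: "a \<E> \<kappa>" for a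
  proof -
    have "sc a ~= \<kappa>" using h_sc[of a] \<kappa>(2,3) a by auto
    moreover have "Sub (sc a) \<kappa>" using a Ord_trans[OF \<kappa>(1)] by (auto simp: Sub_iff)
    ultimately show ?thesis using Ord_sub_le[of "sc a" \<kappa>] Ord_elem[OF \<kappa>(1) a] \<kappa>(1) by simp
  qed
  then show "Lim \<kappa>" using \<kappa>(1) Ord_trans[OF \<kappa>(1) om om_0] by (simp add: Lim_def)
qed

text \<open>Cofinality of a map written through its pairs, so that it is visibly bounded.\<close>

definition cofr where "cofr f a k \<longleftrightarrow> (ALL x:el k. EX y:el a. EX v. pr y v \<E> f & (x \<E> v | x = v))"

lemma D0_cofr [d0]: "D0 (%e. cofr (e a) (e b) (e c))"
  unfolding cofr_def by (intro d0)

lemma cofr_iff: "fnc f a ==> cofr f a k \<longleftrightarrow> (ALL x:el k. EX y:el a. ord_le E x (ap f y))"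
  unfolding cofr_def ord_le_iff by (simp add: fnc_pr el_ball el_bex)

text \<open>The image of a map from \<open>om\<close> to \<kappa> has the same values, all below
  \<kappa>, but it would have to be cofinal in \<open>h \<kappa>\<close>, which has \<kappa> as an
  element.\<close>

lemma \<kappa>_cof: "~ cofmap f om \<kappa>"
proof
  assume f: "cofmap f om \<kappa>"
  then have fn: "fnc f om" "!!n. n \<E> om ==> ap f n \<E> \<kappa>" "cofr f om \<kappa>"
    by (auto simp: cofmap_def maps_iff cofr_iff)
  have "cofr (h f) om (h \<kappa>)"
    using pres3[OF pres, of cofr f om \<kappa>] D0_cofr fn(3) h_om by simp
  then have "EX y:el om. EX v. pr y v \<E> h f & (\<kappa> \<E> v | \<kappa> = v)" using \<kappa>_h unfolding cofr_def by simp
  then obtain n where n: "n \<E> om" "\<kappa> \<E> ap (h f) n | \<kappa> = ap (h f) n"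
    using h_fnc(1)[OF fn(1)] h_om by (auto simp: fnc_pr)
  have "ap (h f) n = ap f n" using h_fnc(2)[OF fn(1) _ _ n(1)] h_om_elem[OF n(1)] \<kappa>(3)[OF fn(2)[OF n(1)]] by simp
  then show False using n fn(2)[OF n(1)] mem_asym by auto
qed

definition limr where "limr a \<longleftrightarrow> (EX x:el a. x = emp) & (ALL x:el a. EX y:el a. y = sc x)"

lemma D0_limr [d0]: "D0 (%e. limr (e a))"
  unfolding limr_def by (intro d0)

lemma limr_iff: "Ord a ==> limr a \<longleftrightarrow> Lim a"
  by (simp add: limr_def Lim_def el_ball el_bex)

text \<open>Below \<^term>\<open>\<kappa>\<close> there is a limit of uncountable cofinality, since \<^term>\<open>\<kappa>\<close> itself is one below
  its image.\<close>

lemma ex_mu: "EX \<mu>. \<mu> \<E> \<kappa> & Lim \<mu> & (ALL f. ~ cofmap f om \<mu>)"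
proof (rule ccontr)
  assume no: "~ ?thesis"
  \<comment> \<open>A set containing all candidate maps turns the existential quantifier into a
    bounded one.\<close>
  let ?H = "Pw (prod om \<kappa>)"
  define Q where "Q k H w \<longleftrightarrow> (ALL m:el k. limr m --> (EX f:el H. fnc f w &
     (ALL x:el w. EX v. pr x v \<E> f & v \<E> m) & cofr f w m))" for k H w
  have "Q \<kappa> ?H om"
    unfolding Q_def
  proof (intro ballI impI)
    fix m assume m: "m \<in> el \<kappa>" "limr m"
    then have "Ord m" using Ord_elem[OF \<kappa>(1)] by simp
    then obtain f where f: "cofmap f om m" using no m limr_iff[of m] by auto
    then have fn: "fnc f om" "!!n. n \<E> om ==> ap f n \<E> m" "cofr f om m"
      by (auto simp: cofmap_def maps_iff cofr_iff)
    have "f \<E> ?H" using fn(1,2) fnc_mem[OF fn(1)] m Ord_trans[OF \<kappa>(1)] by (auto simp: Sub_iff mem_prod)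
    moreover have "ALL x:el om. EX v. pr x v \<E> f & v \<E> m" using fn by (auto simp: fnc_pr)
    ultimately show "EX f:el ?H. fnc f om & (ALL x:el om. EX v. pr x v \<E> f & v \<E> m) & cofr f om m"
      using fn by (intro bexI[of _ f]) auto
  qed
  moreover have "D0 (%e. Q (e 0) (e 1) (e 2))" unfolding Q_def by (intro d0)
  ultimately have "Q (h \<kappa>) (h ?H) om" using pres3[OF pres, of Q \<kappa> ?H om] h_om by simp
  \<comment> \<open>The transported statement is applied to \<kappa> itself, as an element of
    \<open>h \<kappa>\<close>; the map it yields contradicts \<open>\<kappa>_cof\<close>.\<close>
  moreover have "limr \<kappa>" using limr_iff \<kappa>(1) \<kappa>_Lim by simp
  ultimately have "EX f:el (h ?H). fnc f om & (ALL x:el om. EX v. pr x v \<E> f & v \<E> \<kappa>) & cofr f om \<kappa>"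
    using \<kappa>_h unfolding Q_def by simp
  then obtain f where "fnc f om" "ALL x:el om. EX v. pr x v \<E> f & v \<E> \<kappa>" "cofr f om \<kappa>" by blast
  then have "cofmap f om \<kappa>" by (auto simp: cofmap_def maps_iff cofr_iff fnc_pr)
  then show False using \<kappa>_cof by blast
qed

text \<open>Taking the least wLS cardinal above \<kappa> and above all earlier values avoids choice.
  Ranks of earlier values are used because the recursion step must make sense for an arbitrary
  \<open>f\<close>; on the values themselves rank is the identity.\<close>

lemma wLS_seq:
  obtains F where "Df (%C e. F (e 0))" "!!x. wLS E (F x)" "!!x. \<kappa> \<E> F x" "!!x y. y \<E> x ==> F y \<E> F x"
proof -
  define Q where "Q x f d \<longleftrightarrow> wLS E d & \<kappa> \<E> d & (ALL y:el x. rk (ap f y) \<E> d)" for x f d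
  have DQ: "D (%C e. Q (s C e) (t C e) (u C e))" if "Df s" "Df t" "Df u" for s t u
    unfolding Q_def by (intro dfn that[THEN Df_ren])
  have ex: "EX! d. Ord d & Q x f d & (ALL c:el d. ~ Q x f c)" for x f
  proof -
    have Da: "Df (%C e. ap f (e 0))" by (intro dfn)
    let ?S = "un2 (img (ap f) x) (upair \<kappa> \<kappa>)"
    obtain d where d: "rk ?S \<E> d" "wLS E d" using pc Ord_rk unfolding proper_class_wLS_def by blast
    have od: "Ord d" using wLS_Ord[OF d(2)] .
    have r: "rk z \<E> d" if "z \<E> ?S" for z using rk_mem[OF that] d(1) Ord_trans[OF od] by blast
    have "rk (ap f y) \<E> d" if "y \<E> x" for y using r[of "ap f y"] that by (auto simp: mem_img[OF Da])
    moreover have "\<kappa> \<E> d" using r[of \<kappa>] rk_Ord[OF \<kappa>(1)] by simp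
    ultimately have "Q x f d" using d(2) by (simp add: Q_def el_ball)
    moreover have "D (%C e. Q x f (e 0))" by (intro DQ dfn)
    ultimately obtain b where b: "Ord b" "Q x f b" "!!c. c \<E> b ==> ~ Q x f c"
      using Ord_least[of "Q x f", OF _ od] by blast
    show ?thesis
    proof (rule ex1I[of _ b])
      fix d assume "Ord d & Q x f d & (ALL c:el d. ~ Q x f c)"
      then show "d = b" using b Ord_linear[of d b] by auto
    qed (use b in auto)
  qed
  define H where "H x f = (THE d. Ord d & Q x f d & (ALL c:el d. ~ Q x f c))" for x f
  have H: "Ord (H x f) & Q x f (H x f) & (ALL c:el (H x f). ~ Q x f c)" for x f
    unfolding H_def by (rule theI'[OF ex])
  have "Df (%C e. H (e 0) (e 1))"
  proof (rule Df_rel)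
    show "D (%C e. Ord (e 0) & Q (e (Suc 0)) (e (Suc 1)) (e 0) & (ALL c:el (e 0). ~ Q (e (Suc 0)) (e (Suc 1)) c))"
      by (intro dfn DQ)
    show "(Ord y & Q (e 0) (e 1) y & (ALL c:el y. ~ Q (e 0) (e 1) c)) \<longleftrightarrow> y = H (e 0) (e 1)" for e y
      using ex[of "e 0" "e 1"] H[of "e 0" "e 1"] by blast
  qed
  then obtain F where F: "Df (%C e. F (e 0))" "!!x. F x = H x (lam x F)" by (rule eps_recursion) blast
  have QF: "Q x (lam x F) (F x)" for x using H F(2) by simp
  show thesis
  proof (rule that[OF F(1)])
    show "wLS E (F x)" "\<kappa> \<E> F x" for x using QF[of x] by (auto simp: Q_def)
    then have "Ord (F x)" for x using wLS_Ord by blast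
    then show "F y \<E> F x" if "y \<E> x" for x y
      using QF[of x] that by (simp add: Q_def ap_lam[OF F(1)] rk_Ord)
  qed
qed

text \<open>The length \<mu> of the sequence lies below \<kappa>, so its indices are not moved and
  \<open>h\<close> is continuous at the supremum \<delta>. Hence \<open>h (V \<delta>)\<close>
  serves as the target, and \<delta> inherits uncountable cofinality from \<mu>.\<close>

lemma pre_witness_ex: "EX \<delta> N j. pre_witness E \<kappa> \<delta> N j & om \<E> cof E \<delta>"
proof -
  obtain \<mu> where \<mu>: "\<mu> \<E> \<kappa>" "Lim \<mu>" "!!f. ~ cofmap f om \<mu>" using ex_mu by blast
  have o\<mu>: "Ord \<mu>" using \<mu>(2) by (rule Lim_Ord)
  obtain F where F: "Df (%C e. F (e 0))" "!!x. wLS E (F x)" "!!x. \<kappa> \<E> F x" "!!x y. y \<E> x ==> F y \<E> F x"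
    by (rule wLS_seq) blast
  have oF: "Ord (F x)" for x using wLS_Ord[OF F(2)] .
  define \<delta> where "\<delta> = Uni (img F \<mu>)"
  have m\<delta>: "b \<E> \<delta> \<longleftrightarrow> (EX i. i \<E> \<mu> & b \<E> F i)" for b by (auto simp: \<delta>_def mem_img[OF F(1)])
  have \<delta>: "Ord \<delta>" unfolding \<delta>_def by (rule Ord_Uni) (auto simp: mem_img[OF F(1)] oF)
  have F\<delta>: "F i \<E> \<delta>" if "i \<E> \<mu>" for i
    unfolding m\<delta> using that \<mu>(2) F(4)[of i "sc i"] by (intro exI[of _ "sc i"]) (simp add: Lim_def)
  have w\<delta>: "wLS E \<delta>" by (rule wLS_limit[OF \<delta>]) (use m\<delta> F\<delta> F(2) in blast)
  have e0: "emp \<E> \<mu>" using \<mu>(2) by (simp add: Lim_def)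
  have \<kappa>\<delta>: "\<kappa> \<E> \<delta>" unfolding m\<delta> using F(3) e0 by blast
  have lim: "Lim \<delta>"
    unfolding Lim_def
  proof (intro conjI allI impI \<delta>)
    show "emp \<E> \<delta>" using \<kappa>_Lim \<kappa>\<delta> Ord_trans[OF \<delta>] unfolding Lim_def by blast
    fix b assume "b \<E> \<delta>"
    then obtain i where i: "i \<E> \<mu>" "b \<E> F i" unfolding m\<delta> by blast
    have "Sub (sc b) (F i)" using i(2) Ord_trans[OF oF] by (auto simp: Sub_iff)
    then have "sc b \<E> F i | sc b = F i" using Ord_sub_le[of "sc b" "F i"] oF Ord_elem[OF oF i(2)] by simp
    then show "sc b \<E> \<delta>" using F\<delta>[OF i(1)] Ord_trans[OF \<delta> F\<delta>[OF i(1)]] by auto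
  qed
  have nocof: "~ cofmap f om \<delta>" for f
  proof
    assume f: "cofmap f om \<delta>"
    then have f\<delta>: "!!n. n \<E> om ==> ap f n \<E> \<delta>" and fc: "!!x. x \<E> \<delta> ==> EX n. n \<E> om & (x \<E> ap f n | x = ap f n)"
      by (auto simp: cofmap_def maps_iff el_ball el_bex ord_le_iff)
    \<comment> \<open>\<open>g n\<close> is the least index \<open>i\<close> with
      \<open>ap f n\<close> below \<open>F i\<close>, written as the initial segment of the smaller
      indices. A cofinal map into \<delta> thus induces one into \<mu>.\<close>
    define g where "g n = so (%i. i \<E> \<mu> & ~ ap f n \<E> F i)" for n
    have gex: "EX z. ALL i. i \<E> z \<longleftrightarrow> i \<E> \<mu> & ~ ap f n \<E> F i" for n
      by (rule separation, intro dfn Df_fun1[OF F(1)])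
    have mg: "i \<E> g n \<longleftrightarrow> i \<E> \<mu> & ~ ap f n \<E> F i" for i n unfolding g_def by (rule setof_mem[OF gex])
    have Dg: "Df (%C e. g (e 0))"
      unfolding g_def by (rule Df_setof, intro dfn Df_fun1[OF F(1)], rule set_ex1[OF gex])
    have "g n \<E> \<mu>" if n: "n \<E> om" for n
    proof (rule Ord_sub_elem[OF o\<mu>])
      fix x y assume xy: "x \<E> g n" "y \<E> x"
      have "~ ap f n \<E> F y" using xy(1) F(4)[OF xy(2)] Ord_trans[OF oF] unfolding mg by blast
      then show "y \<E> g n" using xy Ord_trans[OF o\<mu>] unfolding mg by blast
    next
      obtain i where "i \<E> \<mu>" "ap f n \<E> F i" using f\<delta>[OF n] unfolding m\<delta> by blast
      then show "g n ~= \<mu>" using mg by metis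
    qed (simp add: mg)
    moreover have "EX n. n \<E> om & x \<E> g n" if x: "x \<E> \<mu>" for x
    proof -
      obtain n where "n \<E> om" "F x \<E> ap f n | F x = ap f n" using fc[OF F\<delta>[OF x]] by blast
      then show ?thesis using x mem_asym unfolding mg by auto
    qed
    ultimately have "cofmap (lam om g) om \<mu>"
      unfolding cofmap_def maps_iff el_ball el_bex ord_le_iff
      using fnc_lam[OF Dg] ap_lam[OF Dg] by (metis)
    then show False using \<mu>(3) by blast
  qed
  let ?N = "h (V \<delta>)"
  let ?j = "lam (V \<delta>) h"
  have j: "fnc ?j (V \<delta>)" "!!x. x \<E> V \<delta> ==> ap ?j x = h x" using fnc_lam[OF Dh] ap_lam[OF Dh] by auto
  have jx: "app E ?j x = h x" if "x \<E> V \<delta>" for x using ap_app[OF j(1) that] j(2)[OF that] by simp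
  have e0V: "emp \<E> V \<delta>" using lim Ord_V[OF \<delta> Ord_emp] by (simp add: Lim_def)
  define A where "A = asg (V \<delta>)"
  define T where "T = Tr (V \<delta>)"
  have FmF: "\<phi> \<E> h Fm" if "is_fm E \<phi>" for \<phi> using h_mem[of \<phi> Fm] h_fm[OF that] that by simp
  have Tk: "Tarski ?N (h T) (h A) (h Fm) om"
    using pres5[OF pres, of Tarski "V \<delta>" T A Fm om] D0_Tarski Tarski_Tr[OF e0V] h_om by (simp add: A_def T_def)
  \<comment> \<open>Continuity: \<mu> and the indices below it are fixed, so the union of the levels
    \<open>V (F i)\<close> is mapped to the union of their images.\<close>
  have cof: "EX x. x \<E> V \<delta> & y \<E> h x" if y: "y \<E> ?N" for y
  proof -
    have Dw: "Df (%C e. V (F (e 0)))" by (intro dfn Df_fun1[OF F(1)])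
    let ?w = "lam \<mu> (%i. V (F i))"
    have w: "fnc ?w \<mu>" "!!i. i \<E> \<mu> ==> ap ?w i = V (F i)" using fnc_lam[OF Dw] ap_lam[OF Dw] by auto
    define Q where "Q w m v \<longleftrightarrow> (ALL y:el v. EX i:el m. EX u. pr i u \<E> w & y \<E> u)" for w m v
    have "Q ?w \<mu> (V \<delta>)"
      unfolding Q_def el_ball el_bex
    proof (intro allI impI)
      fix y assume "y \<E> V \<delta>"
      then obtain b where b: "b \<E> \<delta>" "y \<E> V b" using Lim_V_ex[OF lim] by blast
      then obtain i where i: "i \<E> \<mu>" "b \<E> F i" using m\<delta> by blast
      then have "y \<E> V (F i)" using V_mono[OF oF, of b i y] b by blast
      then show "EX i. i \<E> \<mu> & (EX u. pr i u \<E> ?w & y \<E> u)" using i fnc_pr[OF w(1)] w(2) by auto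
    qed
    moreover have "D0 (%e. Q (e 0) (e 1) (e 2))" unfolding Q_def by (intro d0)
    ultimately have "Q (h ?w) \<mu> ?N" using pres3[OF pres, of Q ?w \<mu> "V \<delta>"] \<kappa>(3)[OF \<mu>(1)] by simp
    then obtain i u where i: "i \<E> \<mu>" "pr i u \<E> h ?w" "y \<E> u" using y unfolding Q_def el_ball el_bex by blast
    have "h i = i" using \<kappa>(3) Ord_trans[OF \<kappa>(1) \<mu>(1) i(1)] by blast
    then have "u = h (V (F i))"
      using h_fnc(1)[OF w(1)] h_fnc(2)[OF w(1) _ _ i(1)] \<kappa>(3)[OF \<mu>(1)] i w(2)[OF i(1)] by (simp add: fnc_pr)
    then show ?thesis using i(3) V_mem_V[OF \<delta> F\<delta>[OF i(1)]] by blast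
  qed
  have hs: "h s \<E> h A & (ALL n:el om. ap (h s) n = h (ap s n))" if s: "assignment E (el (V \<delta>)) s" for s
    using h_mem[of s A] s h_fnc[OF asgD(1)[OF s]] h_om_elem by (auto simp: A_def)
  have mT: "models E (V \<delta>) \<phi> s \<longleftrightarrow> models E ?N \<phi> (h s)" if "is_fm E \<phi>" "assignment E (el (V \<delta>)) s" for \<phi> s
  proof -
    have "models E (V \<delta>) \<phi> s \<longleftrightarrow> pr \<phi> s \<E> T" unfolding T_def by (rule models_Tr[OF that])
    also have "\<dots> \<longleftrightarrow> pr \<phi> (h s) \<E> h T" using h_mem[of "pr \<phi> s" T] h_pr[of \<phi> s] h_fm[OF that(1)] by simp
    also have "\<dots> \<longleftrightarrow> models E ?N \<phi> (h s)"
      using Tarski_models(3)[OF Tk FmF _ that(1)] hs[OF that(2)] by blast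
    finally show ?thesis .
  qed
  have RLs: "EX b:el ?N. ALL x:el ?N. x \<E> b \<longleftrightarrow> x \<E> a &
           (EX t. assignment E (el ?N) t & variant E i s t & app E t i = x & models E ?N \<phi> t)"
    if i: "i \<E> om" and a: "a \<E> ?N" and \<phi>: "is_fm E \<phi>" and s: "assignment E (el ?N) s" for \<phi> s i a
  proof -
    \<comment> \<open>Separation as a bounded statement about the sets of truths, assignments and
      codes.\<close>
    define Q where "Q v T A F w \<longleftrightarrow> (ALL \<phi>:el F. ALL s:el A. ALL i:el w. ALL a:el v. EX b:el v. ALL x:el v. x \<E> b \<longleftrightarrow> x \<E> a &
      (EX t:el A. pr i x \<E> t & (ALL n:el w. n ~= i --> (ALL u. pr n u \<E> s --> pr n u \<E> t)) & pr \<phi> t \<E> T))" for v T A F w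
    have "Q (V \<delta>) T A Fm om"
      unfolding Q_def
    proof (intro ballI)
      fix \<phi> s i a assume a: "a \<in> el (V \<delta>)"
      let ?R = "%x. EX t:el A. pr i x \<E> t & (ALL n:el om. n ~= i --> (ALL u. pr n u \<E> s --> pr n u \<E> t)) & pr \<phi> t \<E> T"
      have "EX b. ALL x. x \<E> b \<longleftrightarrow> x \<E> a & ?R x" by (rule separation, intro dfn)
      then obtain b where b: "ALL x. x \<E> b \<longleftrightarrow> x \<E> a & ?R x" by blast
      then have "Sub b a" by (simp add: Sub_iff)
      then have "b \<E> V \<delta>" using V_sub[OF \<delta>] a by simp
      then show "EX b:el (V \<delta>). ALL x:el (V \<delta>). x \<E> b \<longleftrightarrow> x \<E> a & ?R x" using b by (intro bexI[of _ b]) simp_all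
    qed
    moreover have "D0 (%e. Q (e 0) (e 1) (e 2) (e 3) (e 4))" unfolding Q_def by (intro d0)
    ultimately have QN: "Q ?N (h T) (h A) (h Fm) om"
      using pres5[OF pres, of Q "V \<delta>" T A Fm om] h_om by simp
    note TM = Tarski_models[OF Tk FmF]
    obtain n where n: "n \<E> om" "ALL s s'. assignment E (el ?N) s & assignment E (el ?N) s' &
        (ALL k. k \<E> n --> ap s k = ap s' k) --> (pr \<phi> s \<E> Tr ?N \<longleftrightarrow> pr \<phi> s' \<E> Tr ?N)"
      using fm_support[OF \<phi>, of ?N] by blast
    \<comment> \<open>An arbitrary assignment into the target need not belong to \<open>h A\<close>.
      One that agrees with it on the support of the formula is built value by value, by induction
      inside the structure.\<close>
    have "EX s'. s' \<E> h A & (ALL k. k \<E> n --> ap s k = ap s' k)"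
    proof (rule om_induct[of "%n. EX s'. s' \<E> h A & (ALL k. k \<E> n --> ap s k = ap s' k)", OF _ n(1)], goal_cases)
      case 1 show ?case by (intro dfn)
    next
      case 2 show ?case using Tk unfolding Tarski_def el_bex by auto
    next
      case (3 n)
      then obtain s' where s': "s' \<E> h A" "ALL k. k \<E> n --> ap s k = ap s' k" by blast
      have "upd s' n (ap s n) \<E> h A" using TM(2)[OF _ s'(1) \<phi> 3(1)] asgD(2)[OF s 3(1)] by simp
      moreover have "ALL k. k \<E> sc n --> ap s k = ap (upd s' n (ap s n)) k"
        using s'(2) 3(1) om_elem[OF 3(1)] by (auto simp: ap_upd)
      ultimately show ?case by blast
    qed
    then obtain s' where s': "s' \<E> h A" "ALL k. k \<E> n --> ap s k = ap s' k" by blast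
    have as': "assignment E (el ?N) s'" using TM(1)[OF _ s'(1) \<phi>] by simp
    have eq: "(EX t. assignment E (el ?N) t & variant E i s t & app E t i = x & models E ?N \<phi> t) \<longleftrightarrow>
       (EX t:el (h A). pr i x \<E> t & (ALL n:el om. n ~= i --> (ALL u. pr n u \<E> s' --> pr n u \<E> t)) & pr \<phi> t \<E> h T)"
      if x: "x \<E> ?N" for x
    proof -
      let ?t = "upd s i x" and ?t' = "upd s' i x"
      have t: "assignment E (el ?N) ?t" "assignment E (el ?N) ?t'" using asg_upd s as' x by simp_all
      have t'A: "?t' \<E> h A" using TM(2)[OF _ s'(1) \<phi> i x] by simp
      have "(EX t. assignment E (el ?N) t & variant E i s t & app E t i = x & models E ?N \<phi> t) \<longleftrightarrow> models E ?N \<phi> ?t"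
      proof
        assume "EX t. assignment E (el ?N) t & variant E i s t & app E t i = x & models E ?N \<phi> t"
        then obtain u where u: "assignment E (el ?N) u" "variant E i s u" "app E u i = x" "models E ?N \<phi> u" by blast
        then have "u = upd s i (ap u i)" using vr_eq_upd[OF s u(1) i] variant_iff[OF s u(1)] by blast
        then show "models E ?N \<phi> ?t" using u ap_app[OF asgD(1)[OF u(1)] i] by simp
      next
        assume "models E ?N \<phi> ?t"
        then show "EX t. assignment E (el ?N) t & variant E i s t & app E t i = x & models E ?N \<phi> t"
          using t(1) variant_iff[OF s t(1)] vr_upd ap_app[OF fnc_upd i] ap_upd[OF i] by (intro exI[of _ ?t]) simp
      qed
      also have "\<dots> \<longleftrightarrow> models E ?N \<phi> ?t'"
        using n(2)[rule_format, of ?t ?t'] t s'(2) om_elem[OF n(1)] by (simp add: models_Tr[OF \<phi>] ap_upd)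
      also have "\<dots> \<longleftrightarrow> pr \<phi> ?t' \<E> h T" using TM(3)[OF _ t'A \<phi>] by simp
      also have "\<dots> \<longleftrightarrow> (EX t:el (h A). pr i x \<E> t & (ALL n:el om. n ~= i --> (ALL u. pr n u \<E> s' --> pr n u \<E> t)) & pr \<phi> t \<E> h T)"
      proof
        assume "pr \<phi> ?t' \<E> h T"
        moreover have "ALL n:el om. n ~= i --> (ALL u. pr n u \<E> s' --> pr n u \<E> ?t')"
          by (simp add: fnc_pr[OF asgD(1)[OF as']] fnc_pr[OF fnc_upd] ap_upd el_ball)
        ultimately show "EX t:el (h A). pr i x \<E> t & (ALL n:el om. n ~= i --> (ALL u. pr n u \<E> s' --> pr n u \<E> t)) & pr \<phi> t \<E> h T"
          using t'A i by (intro bexI[of _ ?t']) (simp_all add: fnc_pr[OF fnc_upd] ap_upd)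
      next
        assume "EX t:el (h A). pr i x \<E> t & (ALL n:el om. n ~= i --> (ALL u. pr n u \<E> s' --> pr n u \<E> t)) & pr \<phi> t \<E> h T"
        then obtain u where u: "u \<E> h A" "pr i x \<E> u" "ALL n:el om. n ~= i --> (ALL v. pr n v \<E> s' --> pr n v \<E> u)" "pr \<phi> u \<E> h T"
          unfolding el_bex by blast
        have au: "fnc u om" using asgD(1)[OF TM(1)[OF _ u(1) \<phi>]] by simp
        have "u = upd s' i (ap u i)" using updr_upd[OF asgD(1)[OF as'] au i] u(3) by blast
        then show "pr \<phi> ?t' \<E> h T" using u ap_eq[OF au u(2)] by simp
      qed
      finally show ?thesis .
    qed
    from QN FmF[OF \<phi>] s'(1) i a have "EX b:el ?N. ALL x:el ?N. x \<E> b \<longleftrightarrow> x \<E> a &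
      (EX t:el (h A). pr i x \<E> t & (ALL n:el om. n ~= i --> (ALL u. pr n u \<E> s' --> pr n u \<E> t)) & pr \<phi> t \<E> h T)"
      unfolding Q_def by simp
    then show ?thesis using eq by (simp add: el_ball)
  qed
  have "pre_witness E \<kappa> \<delta> ?N ?j"
    unfolding pre_witness_def
  proof (intro conjI w\<delta>)
    define Q where "Q v \<longleftrightarrow> (ALL x:el v. ALL y:el x. y \<E> v)" for v
    have "D0 (%e. Q (e 0))" unfolding Q_def by (intro d0)
    moreover have "Q (V \<delta>)" using V_trans[OF \<delta>] by (auto simp: Q_def)
    ultimately have "Q ?N" using pres1[OF pres, of Q "V \<delta>"] by simp
    then show "transitive_class E (el ?N)" by (auto simp: Q_def transitive_class_def)
    have "RLb ?N" using pres1[OF pres, of RLb "V \<delta>"] D0_RLb RLb_V[OF lim] by simp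
    then show "RL_model E ?N" unfolding RLb_def RL_model_def using RLs by simp
    show "ALL y:el ?N. EX x:el (VV \<delta>). y \<E> app E ?j x"
      using cof jx unfolding VV_eq[OF \<delta>] el_ball el_bex by metis
    show "Sigma1_elementary E ?j (VV \<delta>) ?N"
      unfolding Sigma1_elementary_def VV_eq[OF \<delta>] maps_iff
    proof (intro conjI ballI allI impI j(1))
      show "ap ?j x \<E> ?N" if "x \<in> el (V \<delta>)" for x using that j(2) h_mem[of x "V \<delta>"] by simp
      fix \<phi> s t assume a: "is_Sigma1 E \<phi> & assignment E (el (V \<delta>)) s & assignment E (el ?N) t & pointwise_image E (app E ?j) s t"
      then have s: "assignment E (el (V \<delta>)) s" and t: "assignment E (el ?N) t" by auto
      have "ap t n = h (ap s n)" if n: "n \<E> om" for n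
        using a n jx asgD(2)[OF s n] ap_app[OF asgD(1)[OF s] n] ap_app[OF asgD(1)[OF t] n]
        by (simp add: pointwise_image_def)
      then have "t = h s" using hs[OF s] h_fnc(1)[OF asgD(1)[OF s]] h_om by (intro fnc_ext[OF asgD(1)[OF t]]) auto
      then show "models E (V \<delta>) \<phi> s \<longleftrightarrow> models E ?N \<phi> t" using mT[OF Sigma1_fm s] a by blast
    qed
    have "\<kappa> \<E> V \<delta>" using Ord_V[OF \<delta> \<kappa>(1)] \<kappa>\<delta> by simp
    moreover have "\<alpha> \<E> V \<delta>" if "\<alpha> \<E> \<kappa>" for \<alpha> using V_trans[OF \<delta> calculation that] .
    ultimately show "critical_point E (app E ?j) (el (VV \<delta>)) \<kappa>"
      unfolding critical_point_def VV_eq[OF \<delta>] using \<kappa> jx by simp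
  qed
  moreover have "om \<E> cof E \<delta>" using om_cof[OF \<delta>] lim nocof by (auto simp: Lim_def)
  ultimately show ?thesis by blast
qed

end

section \<open>Pre-witnesses\<close>

locale pre_wit = zf2 E P for E :: "'v => 'v => bool" (infix \<open>\<E>\<close> 50) and P +
  fixes \<kappa> \<delta> N j
  assumes pw: "pre_witness E \<kappa> \<delta> N j"
begin

lemma w\<delta>: "wLS E \<delta>" and trN: "transitive_class E (el N)" and RL: "RL_model E N"
  using pw by (auto simp: pre_witness_def)

lemma o\<delta>: "Ord \<delta>" using wLS_Ord[OF w\<delta>] .

lemma N_elem: "x \<E> N ==> y \<E> x ==> y \<E> N"
  using trN unfolding transitive_class_def elts_def by blast

abbreviation "hj \<equiv> ap j"

lemma j_fnc: "fnc j (V \<delta>)" and j_N: "x \<E> V \<delta> ==> hj x \<E> N"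
  using pw VV_eq[OF o\<delta>] by (auto simp: pre_witness_def Sigma1_elementary_def maps_iff)

lemma j_app: "x \<E> V \<delta> ==> app E j x = hj x"
  by (rule ap_app[OF j_fnc])

lemma j_cof: "y \<E> N ==> EX x. x \<E> V \<delta> & y \<E> hj x"
  using pw j_app VV_eq[OF o\<delta>] unfolding pre_witness_def el_ball el_bex by metis

lemma \<kappa>: "Ord \<kappa>" "\<kappa> \<E> V \<delta>" "hj \<kappa> ~= \<kappa>" "!!\<alpha>. \<alpha> \<E> \<kappa> ==> hj \<alpha> = \<alpha>"
proof -
  have c: "critical_point E (app E j) (el (V \<delta>)) \<kappa>" using pw VV_eq[OF o\<delta>] by (simp add: pre_witness_def)
  then show k: "Ord \<kappa>" "\<kappa> \<E> V \<delta>" "hj \<kappa> ~= \<kappa>" using j_app by (auto simp: critical_point_def)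
  show "hj \<alpha> = \<alpha>" if "\<alpha> \<E> \<kappa>" for \<alpha>
    using c j_app[OF V_trans[OF o\<delta> k(2) that]] that by (simp add: critical_point_def)
qed

lemma \<kappa>\<delta>: "\<kappa> \<E> \<delta>" using Ord_V[OF o\<delta> \<kappa>(1)] \<kappa>(2) by simp

lemma pres_j: "pres hj (el (V \<delta>))"
proof (rule pres_truth[OF truth_Tr truth_Tr])
  show "ALL x:el (V \<delta>). hj x \<in> el N" using j_N by simp
  show "transitive_class E (el (V \<delta>))" "transitive_class E (el N)" using V_transitive[OF o\<delta>] trN by auto
  fix \<phi> s t assume a: "is_Delta0 E \<phi>" "assignment E (el (V \<delta>)) s" "assignment E (el N) t"
    "ALL n:el om. ap t n = hj (ap s n)"
  then have S: "is_Sigma1 E \<phi>" and f: "is_fm E \<phi>" using Delta0_Sigma1 Sigma1_fm by blast+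
  have "app E t n = app E j (app E s n)" if "n \<E> om" for n
    using a(4) that ap_app[OF asgD(1)[OF a(2)] that] ap_app[OF asgD(1)[OF a(3)] that] j_app asgD(2)[OF a(2) that]
    by simp
  then have "pointwise_image E (app E j) s t" by (simp add: pointwise_image_def el_ball)
  then have "models E (V \<delta>) \<phi> s \<longleftrightarrow> models E N \<phi> t"
    using pw S a(2,3) VV_eq[OF o\<delta>] unfolding pre_witness_def Sigma1_elementary_def by metis
  then show "pr \<phi> s \<in> el (Tr (V \<delta>)) \<longleftrightarrow> pr \<phi> t \<in> el (Tr N)" using models_Tr[OF f a(2)] models_Tr[OF f a(3)] by simp
qed

text \<open>If \<delta> were the successor of \<beta>, the model would contain a successor
  \<open>s\<close> of the image of \<beta>, and cofinality would put \<open>s\<close> into the image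
  of some \<open>x\<close> in \<open>V \<delta>\<close>. But no element of such an \<open>x\<close>
  has \<beta> as an element, and this is bounded.\<close>

lemma \<delta>_Lim: "Lim \<delta>"
  unfolding Lim_def
proof (intro conjI allI impI o\<delta>)
  show "emp \<E> \<delta>" using Ord_linear[OF Ord_emp o\<delta>] \<kappa>\<delta> by auto
  fix \<beta> assume \<beta>: "\<beta> \<E> \<delta>"
  then have o\<beta>: "Ord \<beta>" using Ord_elem[OF o\<delta>] by blast
  show "sc \<beta> \<E> \<delta>"
  proof (rule ccontr)
    assume "~ sc \<beta> \<E> \<delta>"
    moreover have "Sub (sc \<beta>) \<delta>" using \<beta> Ord_trans[OF o\<delta>] by (auto simp: Sub_iff)
    ultimately have d: "\<delta> = sc \<beta>" using Ord_sub_le[of "sc \<beta>" \<delta>] o\<beta> o\<delta> by simp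
    have \<beta>V: "\<beta> \<E> V \<delta>" using Ord_V[OF o\<delta> o\<beta>] \<beta> by simp
    have "Ord (hj \<beta>)" using pres1[OF pres_j, of "%x. Ord x" \<beta>] D0_Ord o\<beta> \<beta>V by simp
    then have "is_ordinal_in E (el N) (hj \<beta>)"
      unfolding is_ordinal_in_def Ord_iff sub_in_def el_ball by blast
    moreover have "ALL \<alpha>:el N. is_ordinal_in E (el N) \<alpha> --> (EX s:el N. is_succ_in E (el N) \<alpha> s)"
      using RL by (simp add: RL_model_def)
    ultimately obtain s where s: "s \<E> N" "is_succ_in E (el N) (hj \<beta>) s"
      using j_N[OF \<beta>V] unfolding el_ball el_bex by blast
    then have "hj \<beta> \<E> s" using j_N[OF \<beta>V] by (simp add: is_succ_in_def)
    obtain x where x: "x \<E> V \<delta>" "s \<E> hj x" using j_cof[OF s(1)] by blast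
    have "ALL z:el x. ~ \<beta> \<E> z"
    proof (intro ballI notI)
      fix z assume "z \<in> el x" "\<beta> \<E> z"
      then have "z \<E> V \<beta>" using x(1) V_sc[OF o\<beta>, of x] d by (simp add: Sub_iff)
      then have "\<beta> \<E> V \<beta>" using V_trans[OF o\<beta>] \<open>\<beta> \<E> z\<close> by blast
      then show False using Ord_V[OF o\<beta> o\<beta>] by simp
    qed
    moreover have "D0 (%e. ALL z:el (e 0). ~ e 1 \<E> z)" by (intro d0)
    ultimately have "ALL z:el (hj x). ~ hj \<beta> \<E> z"
      using pres2[OF pres_j, of "%x b. ALL z:el x. ~ b \<E> z" x \<beta>] x(1) \<beta>V by simp
    then show False using x(2) \<open>hj \<beta> \<E> s\<close> by simp
  qed
qed

lemma om_sub: "n \<E> om ==> n \<E> V \<delta>"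
proof -
  assume n: "n \<E> om"
  have "n \<E> \<delta>"
    by (rule om_induct[of "%n. n \<E> \<delta>", OF _ n]) (intro dfn, use \<delta>_Lim in \<open>auto simp: Lim_def\<close>)
  then show ?thesis using Ord_V[OF o\<delta> om_Ord[OF n]] by simp
qed

lemma hj_om0: "n \<E> om ==> hj n = n"
proof (rule om_induct[of "%n. hj n = n"], goal_cases)
  case 1 show ?case by (intro dfn)
next
  case 3 show ?case using pres1[OF pres_j, of "%x. x = emp" emp] D0_empty om_sub[OF om_0] by simp
next
  case (4 n) then show ?case
    using pres2[OF pres_j, of "%x y. y = sc x" n "sc n"] D0_sc om_sub om_sub[OF om_sc] by simp
qed

lemma om_\<delta>: "om \<E> \<delta>"
proof -
  have "~ \<kappa> \<E> om" using hj_om0 \<kappa>(3) by blast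
  then have "om \<E> \<kappa> | om = \<kappa>" using Ord_linear[OF \<kappa>(1) Ord_om] by blast
  then show ?thesis using \<kappa>\<delta> Ord_trans[OF o\<delta>] by blast
qed

sublocale pres_map E P hj "el (V \<delta>)"
proof unfold_locales
  show "pres hj (el (V \<delta>))" by (rule pres_j)
  show "transitive_class E (el (V \<delta>))" by (rule V_transitive[OF o\<delta>])
  show "om \<in> el (V \<delta>)" using Ord_V[OF o\<delta> Ord_om] om_\<delta> by simp
  show "V om \<in> el (V \<delta>)" using V_mem_V[OF o\<delta> om_\<delta>] by simp
  show "Df (%C e. hj (e 0))" by (intro dfn)
qed

lemma V\<delta>: "\<alpha> \<E> \<delta> ==> V \<alpha> \<E> V \<delta>" by (rule V_mem_V[OF o\<delta>])

lemma V\<delta>_bd: "\<alpha> \<E> \<delta> ==> Sub x (V \<alpha>) ==> x \<E> V \<delta>" using mem_V[OF o\<delta>] by blast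

lemma V\<delta>_ex: "x \<E> V \<delta> ==> EX \<alpha>. \<alpha> \<E> \<delta> & x \<E> V \<alpha>" using Lim_V_ex[OF \<delta>_Lim] .

lemma hj_Sub: "x \<E> V \<delta> ==> y \<E> V \<delta> ==> Sub x y ==> Sub (hj x) (hj y)"
  using pres2[OF pres_j, of Sub x y] D0_Sub by simp

lemma hj_V_mono: assumes "\<beta> \<E> \<delta>" "\<alpha> \<E> \<beta> | \<alpha> = \<beta>" "y \<E> hj (V \<alpha>)" shows "y \<E> hj (V \<beta>)"
proof -
  have "\<alpha> \<E> \<delta>" using assms Ord_trans[OF o\<delta>] by blast
  moreover have "Sub (V \<alpha>) (V \<beta>)" using V_mono[OF Ord_elem[OF o\<delta> assms(1)] assms(2)] by (simp add: Sub_iff)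
  ultimately show ?thesis using hj_Sub[OF V\<delta> V\<delta>] assms by (simp add: Sub_iff)
qed

lemma N_level: assumes "y \<E> N" shows "EX \<alpha>. \<alpha> \<E> \<delta> & y \<E> hj (V \<alpha>)"
proof -
  obtain x where x: "x \<E> V \<delta>" "y \<E> hj x" using j_cof[OF assms] by blast
  then obtain \<alpha> where \<alpha>: "\<alpha> \<E> \<delta>" "x \<E> V \<alpha>" using V\<delta>_ex by blast
  then have "Sub x (V \<alpha>)" using V_trans[OF Ord_elem[OF o\<delta> \<alpha>(1)]] by (auto simp: Sub_iff)
  then show ?thesis using hj_Sub[OF x(1) V\<delta>[OF \<alpha>(1)]] \<alpha> x(2) by (auto simp: Sub_iff)
qed

lemma hj_V_N: "\<alpha> \<E> \<delta> ==> y \<E> hj (V \<alpha>) ==> y \<E> N"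
  using N_elem[OF j_N[OF V\<delta>]] .

lemma N_level2: assumes "y \<E> N" "z \<E> N" shows "EX \<alpha>. \<alpha> \<E> \<delta> & y \<E> hj (V \<alpha>) & z \<E> hj (V \<alpha>)"
proof -
  obtain a where a: "a \<E> \<delta>" "y \<E> hj (V a)" using N_level[OF assms(1)] by blast
  obtain b where b: "b \<E> \<delta>" "z \<E> hj (V b)" using N_level[OF assms(2)] by blast
  show ?thesis
  proof (cases "a \<E> b | a = b")
    case True then show ?thesis using hj_V_mono[OF b(1) True a(2)] b by blast
  next
    case False
    then have "b \<E> a" using Ord_linear[OF Ord_elem[OF o\<delta> a(1)] Ord_elem[OF o\<delta> b(1)]] by blast
    then show ?thesis using hj_V_mono[OF a(1) _ b(2)] a by blast
  qed
qed

lemma N_level3: assumes "x \<E> N" "y \<E> N" "z \<E> N"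
  shows "EX \<alpha>. \<alpha> \<E> \<delta> & x \<E> hj (V \<alpha>) & y \<E> hj (V \<alpha>) & z \<E> hj (V \<alpha>)"
proof -
  obtain a where a: "a \<E> \<delta>" "x \<E> hj (V a)" "y \<E> hj (V a)" using N_level2[OF assms(1,2)] by blast
  obtain b where b: "b \<E> \<delta>" "z \<E> hj (V b)" using N_level[OF assms(3)] by blast
  show ?thesis
  proof (cases "a \<E> b | a = b")
    case True then show ?thesis using hj_V_mono[OF b(1) True a(2)] hj_V_mono[OF b(1) True a(3)] b by blast
  next
    case False
    then have "b \<E> a" using Ord_linear[OF Ord_elem[OF o\<delta> a(1)] Ord_elem[OF o\<delta> b(1)]] by blast
    then show ?thesis using hj_V_mono[OF a(1) _ b(2)] a by blast
  qed
qed

lemma RL_pu: "pairing_in E (el N)" "union_in E (el N)"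
  using RL by (simp_all add: RL_model_def)

lemma N_upair: assumes "x \<E> N" "y \<E> N" shows "upair x y \<E> N"
proof -
  obtain z where z: "z \<E> N" "is_upair_in E (el N) x y z"
    using RL_pu(1) assms unfolding pairing_in_def el_ball el_bex by blast
  have "z = upair x y" using z N_elem[OF z(1)] assms by (intro ext) (auto simp: is_upair_in_def el_ball)
  then show ?thesis using z by simp
qed

lemma N_un2: assumes "x \<E> N" "y \<E> N" shows "un2 x y \<E> N"
proof -
  obtain z where z: "z \<E> N" "ALL w. w \<E> N --> (w \<E> z \<longleftrightarrow> (EX v. v \<E> N & v \<E> upair x y & w \<E> v))"
    using RL_pu(2) N_upair[OF assms] unfolding union_in_def el_ball el_bex by blast
  have "w \<E> z \<longleftrightarrow> w \<E> un2 x y" for w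
  proof
    assume w: "w \<E> z"
    then show "w \<E> un2 x y" using z(2) N_elem[OF z(1) w] by auto
  next
    assume "w \<E> un2 x y"
    then have "w \<E> N" "EX v. v \<E> N & v \<E> upair x y & w \<E> v"
      using N_elem[OF assms(1)] N_elem[OF assms(2)] assms by auto
    then show "w \<E> z" using z(2) by blast
  qed
  then have "z = un2 x y" by (rule ext)
  then show ?thesis using z by simp
qed

lemma N_pr: "pr x y \<E> N \<longleftrightarrow> x \<E> N & y \<E> N"
proof
  assume p: "pr x y \<E> N"
  have "upair x y \<E> N" by (rule N_elem[OF p]) (simp add: pr_eq)
  then show "x \<E> N & y \<E> N" using N_elem by auto
qed (auto simp: pr_eq N_upair)

text \<open>The extension of \<open>j\<close> to subclasses of \<^term>\<open>V \<delta>\<close>, applied to a predicate.\<close>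

definition sp where "sp \<alpha> Q = so (%x. x \<E> V \<alpha> & Q x)"

definition J :: "('v => bool) => 'v => bool" where
  "J Q y \<longleftrightarrow> (EX \<alpha>. \<alpha> \<E> \<delta> & y \<E> hj (sp \<alpha> Q))"

lemma mem_sp: assumes "D (%C e. Q (e 0))" shows "x \<E> sp \<alpha> Q \<longleftrightarrow> x \<E> V \<alpha> & Q x"
  unfolding sp_def by (rule setof_mem, rule separation[OF assms])

lemma sp_V: assumes "D (%C e. Q (e 0))" "\<alpha> \<E> \<delta>" shows "sp \<alpha> Q \<E> V \<delta>"
  by (rule V\<delta>_bd[OF assms(2)]) (simp add: Sub_iff mem_sp[OF assms(1)])

text \<open>Any level that covers \<open>y\<close> decides: the statement that two cuts agree on a
  common level is bounded.\<close>

lemma J_iff: assumes Q: "D (%C e. Q (e 0))" and \<alpha>: "\<alpha> \<E> \<delta>" "y \<E> hj (V \<alpha>)"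
  shows "J Q y \<longleftrightarrow> y \<E> hj (sp \<alpha> Q)"
proof
  assume "J Q y"
  then obtain \<beta> where \<beta>: "\<beta> \<E> \<delta>" "y \<E> hj (sp \<beta> Q)" by (auto simp: J_def)
  define R where "R a b c \<longleftrightarrow> (ALL x:el a. x \<E> b --> x \<E> c)" for a b c
  have "D0 (%e. R (e 0) (e 1) (e 2))" unfolding R_def by (intro d0)
  moreover have "R (sp \<beta> Q) (V \<alpha>) (sp \<alpha> Q)" by (simp add: R_def el_ball mem_sp[OF Q])
  ultimately have "R (hj (sp \<beta> Q)) (hj (V \<alpha>)) (hj (sp \<alpha> Q))"
    using pres3[OF pres_j, of R] sp_V[OF Q] V\<delta> \<alpha>(1) \<beta>(1) by simp
  then show "y \<E> hj (sp \<alpha> Q)" using \<beta>(2) \<alpha>(2) by (simp add: R_def)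
qed (use \<alpha> in \<open>auto simp: J_def\<close>)

lemma J_N: assumes "J Q y" "D (%C e. Q (e 0))" shows "y \<E> N"
proof -
  obtain \<alpha> where \<alpha>: "\<alpha> \<E> \<delta>" "y \<E> hj (sp \<alpha> Q)" using assms by (auto simp: J_def)
  then show ?thesis using N_elem[OF j_N[OF sp_V[OF assms(2)]]] by blast
qed

text \<open>All transfer arguments for \<^const>\<open>J\<close> are instances of the following principle.\<close>

lemma J_imp3:
  assumes D: "D (%C e. Q1 (e 0))" "D (%C e. Q2 (e 0))" "D (%C e. Q3 (e 0))"
    and R: "D0 (%e. R (e 0) (e 1) (e 2) (e 3) (e 4))" and ab: "a \<E> V \<delta>" "b \<E> V \<delta>"
    and imp: "!!u v w. u \<E> V \<delta> ==> v \<E> V \<delta> ==> w \<E> V \<delta> ==> R u v w a b ==> Q1 u ==> Q2 v ==> Q3 w"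
    and y: "R x y z (hj a) (hj b)" "J Q1 x" "J Q2 y" "z \<E> N"
  shows "J Q3 z"
proof -
  have N: "x \<E> N" "y \<E> N" using J_N[OF y(2) D(1)] J_N[OF y(3) D(2)] .
  \<comment> \<open>A common level for all three seeds reduces the implication to a bounded
    statement about three cuts.\<close>
  obtain \<alpha> where \<alpha>: "\<alpha> \<E> \<delta>" "x \<E> hj (V \<alpha>)" "y \<E> hj (V \<alpha>)" "z \<E> hj (V \<alpha>)" using N_level3[OF N y(4)] by blast
  define S where "S v s1 s2 s3 a b \<longleftrightarrow> (ALL u:el s1. ALL y:el s2. ALL w:el v. R u y w a b --> w \<E> s3)" for v s1 s2 s3 a b
  have R': "D0 (%e. R (e i) (e k) (e l) (e m) (e n))" for i k l m n
    using D0_ren[OF R, of "case_nat i (case_nat k (case_nat l (case_nat m (%_. n))))"] by (simp add: numeral_eq_Suc)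
  have "D0 (%e. S (e 0) (e 1) (e 2) (e 3) (e 4) (e 5))" unfolding S_def by (intro d0 R')
  moreover have "S (V \<alpha>) (sp \<alpha> Q1) (sp \<alpha> Q2) (sp \<alpha> Q3) a b"
    unfolding S_def el_ball mem_sp[OF D(1)] mem_sp[OF D(2)] mem_sp[OF D(3)]
    using imp V_mono[OF o\<delta>, of \<alpha>] \<alpha>(1) by blast
  ultimately have "S (hj (V \<alpha>)) (hj (sp \<alpha> Q1)) (hj (sp \<alpha> Q2)) (hj (sp \<alpha> Q3)) (hj a) (hj b)"
    using pres6[OF pres_j, of S "V \<alpha>" "sp \<alpha> Q1" "sp \<alpha> Q2" "sp \<alpha> Q3" a b] V\<delta> \<alpha>(1) sp_V D ab by simp
  then show ?thesis
    using J_iff[OF D(1) \<alpha>(1,2)] J_iff[OF D(2) \<alpha>(1,3)] J_iff[OF D(3) \<alpha>(1,4)] y \<alpha> by (simp add: S_def el_ball)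
qed

lemma J_True: "y \<E> N ==> J (%x. True) y"
proof -
  assume "y \<E> N"
  then obtain \<alpha> where \<alpha>: "\<alpha> \<E> \<delta>" "y \<E> hj (V \<alpha>)" using N_level by blast
  have "sp \<alpha> (%x. True) = V \<alpha>" unfolding sp_def by simp
  then show ?thesis using \<alpha> by (auto simp: J_def)
qed

lemma DT: "D (%C e. True)" by (intro dfn)

lemma emp_V: "emp \<E> V \<delta>" using om_sub om_0 by blast

lemma J_imp2:
  assumes "D (%C e. Q1 (e 0))" "D (%C e. Q3 (e 0))"
    and R: "D0 (%e. R (e 0) (e 1) (e 2) (e 3))" and ab: "a \<E> V \<delta>" "b \<E> V \<delta>"
    and imp: "!!u w. u \<E> V \<delta> ==> w \<E> V \<delta> ==> R u w a b ==> Q1 u ==> Q3 w"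
    and y: "R x z (hj a) (hj b)" "J Q1 x" "z \<E> N"
  shows "J Q3 z"
proof (rule J_imp3[OF assms(1) DT assms(2), of "%u v w. R u w" a b x z])
  show "D0 (%e. R (e 0) (e 2) (e 3) (e 4))"
    using D0_ren[OF R, of "case_nat 0 (case_nat 2 (case_nat 3 (%_. 4)))"] by (simp add: numeral_eq_Suc)
qed (use assms J_True in auto)

lemma J_mono:
  assumes "D (%C e. Q (e 0))" "D (%C e. R (e 0))" "!!x. x \<E> V \<delta> ==> Q x ==> R x" "J Q y"
  shows "J R y"
  by (rule J_imp2[OF assms(1,2), of "%u w a b. u = w" emp emp y])
    (use assms emp_V J_N in \<open>auto intro: d0\<close>)

lemma J_and:
  assumes D: "D (%C e. Q (e 0))" "D (%C e. R (e 0))"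
  shows "J (%x. Q x & R x) y \<longleftrightarrow> J Q y & J R y"
proof
  have D2: "D (%C e. Q (e 0) & R (e 0))" by (intro dfn D)
  show "J Q y & J R y" if "J (%x. Q x & R x) y"
    using J_mono[OF D2 D(1) _ that] J_mono[OF D2 D(2) _ that] by blast
  assume "J Q y & J R y"
  then show "J (%x. Q x & R x) y"
    by (intro J_imp3[OF D D2, of "%u v w a b. u = w & v = w" emp emp y y])
      (use emp_V J_N D in \<open>auto intro: d0\<close>)
qed

text \<open>Together with \<open>J_mono\<close> and \<open>J_and\<close>: for fixed \<open>y\<close>
  in \<open>N\<close> the predicates with \<open>J Q y\<close> form an ultrafilter.\<close>

lemma J_not:
  assumes D: "D (%C e. Q (e 0))" and y: "y \<E> N"
  shows "J (%x. ~ Q x) y \<longleftrightarrow> ~ J Q y"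
proof -
  have Dn: "D (%C e. ~ Q (e 0))" by (intro dfn D)
  obtain \<alpha> where \<alpha>: "\<alpha> \<E> \<delta>" "y \<E> hj (V \<alpha>)" using N_level[OF y] by blast
  define S where "S v s t \<longleftrightarrow> (ALL x:el v. x \<E> s \<longleftrightarrow> ~ x \<E> t)" for v s t
  have "D0 (%e. S (e 0) (e 1) (e 2))" unfolding S_def by (intro d0)
  moreover have "S (V \<alpha>) (sp \<alpha> (%x. ~ Q x)) (sp \<alpha> Q)" by (simp add: S_def mem_sp[OF D] mem_sp[OF Dn])
  ultimately have "S (hj (V \<alpha>)) (hj (sp \<alpha> (%x. ~ Q x))) (hj (sp \<alpha> Q))"
    using pres3[OF pres_j, of S] V\<delta> \<alpha>(1) sp_V D Dn by simp
  then show ?thesis using J_iff[OF D \<alpha>] J_iff[OF Dn \<alpha>] \<alpha> by (simp add: S_def)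
qed

lemma J_const: "y \<E> N ==> J (%x. b) y \<longleftrightarrow> b"
  using J_True[of y] J_not[OF DT, of y] by (cases b) simp_all

text \<open>For a seed in the range of the embedding the ultrafilter is principal.\<close>

lemma J_hj: assumes D: "D (%C e. Q (e 0))" and x: "x \<E> V \<delta>" shows "J Q (hj x) \<longleftrightarrow> Q x"
proof -
  obtain \<alpha> where \<alpha>: "\<alpha> \<E> \<delta>" "x \<E> V \<alpha>" using V\<delta>_ex[OF x] by blast
  have "hj x \<E> hj (V \<alpha>)" using h_mem[of x "V \<alpha>"] x V\<delta>[OF \<alpha>(1)] \<alpha>(2) by simp
  then have "J Q (hj x) \<longleftrightarrow> hj x \<E> hj (sp \<alpha> Q)" by (rule J_iff[OF D \<alpha>(1)])
  also have "\<dots> \<longleftrightarrow> x \<E> sp \<alpha> Q" using h_mem[of x "sp \<alpha> Q"] x sp_V[OF D \<alpha>(1)] by simp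
  finally show ?thesis using \<alpha>(2) by (simp add: mem_sp[OF D])
qed

text \<open>The bound \<open>B\<close> in \<open>V \<delta>\<close> makes the existence of a partner
  a bounded statement; in \<open>select\<close> it is the collapse of a hull. Two more levels make
  room for the pairs.\<close>

lemma J_ex:
  assumes D: "D (%C e. Q (e 0))" "D (%C e. R (e 0))" and B: "B \<E> V \<delta>"
    and ex: "!!u. u \<E> V \<delta> ==> Q u ==> EX v. v \<E> B & R (pr u v)" and y: "J Q y"
  obtains z where "z \<E> hj B" "J R (pr y z)"
proof -
  obtain a where a: "a \<E> \<delta>" "y \<E> hj (V a)" using N_level[OF J_N[OF y D(1)]] by blast
  obtain b where b: "b \<E> \<delta>" "B \<E> V b" using V\<delta>_ex[OF B] by blast
  obtain \<alpha> where \<alpha>: "\<alpha> \<E> \<delta>" "y \<E> hj (V \<alpha>)" "B \<E> V \<alpha>"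
  proof (cases "a \<E> b | a = b")
    case True then show thesis using that[OF b(1) hj_V_mono[OF b(1) True a(2)] b(2)] by blast
  next
    case False
    then have "b \<E> a" using Ord_linear[OF Ord_elem[OF o\<delta> a(1)] Ord_elem[OF o\<delta> b(1)]] by blast
    then show thesis using that[OF a] V_mono[OF Ord_elem[OF o\<delta> a(1)] _ b(2)] by blast
  qed
  let ?\<beta> = "sc (sc \<alpha>)"
  have \<beta>: "?\<beta> \<E> \<delta>" using \<delta>_Lim \<alpha>(1) by (simp add: Lim_def)
  have o\<alpha>: "Ord \<alpha>" using Ord_elem[OF o\<delta> \<alpha>(1)] .
  define S where "S s B t \<longleftrightarrow> (ALL u:el s. EX v:el B. pr u v \<E> t)" for s B t
  have "D0 (%e. S (e 0) (e 1) (e 2))" unfolding S_def by (intro d0)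
  moreover have "S (sp \<alpha> Q) B (sp ?\<beta> R)"
    unfolding S_def el_ball el_bex mem_sp[OF D(1)] mem_sp[OF D(2)]
  proof (intro allI impI)
    fix u assume u: "u \<E> V \<alpha> & Q u"
    then have "u \<E> V \<delta>" using V_mono[OF o\<delta>] \<alpha>(1) by blast
    then obtain v where v: "v \<E> B" "R (pr u v)" using ex u by blast
    have "v \<E> V \<alpha>" using V_trans[OF o\<alpha> \<alpha>(3) v(1)] .
    then show "EX v. v \<E> B & pr u v \<E> V ?\<beta> & R (pr u v)" using v pr_rank[OF o\<alpha>] u by blast
  qed
  ultimately have "S (hj (sp \<alpha> Q)) (hj B) (hj (sp ?\<beta> R))"
    using pres3[OF pres_j, of S] sp_V D \<alpha>(1) \<beta> B by simp
  then obtain z where "z \<E> hj B" "pr y z \<E> hj (sp ?\<beta> R)"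
    using y J_iff[OF D(1) \<alpha>(1,2)] unfolding S_def el_ball el_bex by blast
  then show thesis using that \<beta> by (auto simp: J_def)
qed

end

section \<open>Indices\<close>

context zf2
begin

lemma bijD:
  assumes "bijection E f a b"
  shows "fnc f a" "!!x. x \<E> a ==> ap f x \<E> b" "!!y. y \<E> b ==> EX x. x \<E> a & ap f x = y"
    "!!x y. x \<E> a ==> y \<E> a ==> ap f x = ap f y ==> x = y"
  using assms unfolding bijection_iff maps_iff el_ball by blast+

lemma bijI:
  assumes "fnc f a" "!!x. x \<E> a ==> ap f x \<E> b" "!!y. y \<E> b ==> EX x. x \<E> a & ap f x = y"
    "!!x y. x \<E> a ==> y \<E> a ==> ap f x = ap f y ==> x = y"
  shows "bijection E f a b"
  unfolding bijection_iff maps_iff el_ball using assms by blast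

lemma bij_lam:
  assumes t: "Df (%C e. t (e 0))" and "!!x. x \<E> a ==> t x \<E> b" "!!y. y \<E> b ==> EX x. x \<E> a & t x = y"
    "!!x y. x \<E> a ==> y \<E> a ==> t x = t y ==> x = y"
  shows "bijection E (lam a t) a b"
proof (rule bijI[OF fnc_lam[OF t]])
  show "EX x. x \<E> a & ap (lam a t) x = y" if "y \<E> b" for y
    using assms(3)[OF that] ap_lam[OF t] by auto
qed (use assms ap_lam[OF t] in auto)

lemma finite_emp: "finite_set E emp"
proof -
  have "bijection E (lam emp (%x. x)) emp emp" by (rule bij_lam) (intro dfn, auto)
  then show ?thesis unfolding finite_set_def el_bex using om_0 by blast
qed

lemma finite_insert: assumes "finite_set E c" shows "finite_set E (un2 c (upair y y))"
proof (cases "y \<E> c")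
  case True
  then have "un2 c (upair y y) = c" by (intro ext) auto
  then show ?thesis using assms by simp
next
  case False
  obtain n f where n: "n \<E> om" "bijection E f n c" using assms unfolding finite_set_def el_bex by blast
  note b = bijD[OF n(2)]
  have nn: "~ n \<E> n" by simp
  have "bijection E (lam (sc n) (%k. if k = n then y else ap f k)) (sc n) (un2 c (upair y y))"
  proof (rule bij_lam)
    show "Df (%C e. if e 0 = n then y else ap f (e 0))" by (intro dfn)
    fix z assume "z \<E> un2 c (upair y y)"
    then consider "z = y" | "z \<E> c" by auto
    then show "EX x. x \<E> sc n & (if x = n then y else ap f x) = z"
    proof cases
      case 2
      then obtain x where "x \<E> n" "ap f x = z" using b(3) by blast
      then show ?thesis using nn by (intro exI[of _ x]) auto
    qed auto
  qed (use b False in \<open>auto split: if_splits\<close>)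
  then show ?thesis unfolding finite_set_def el_bex using om_sc[OF n(1)] by blast
qed

lemma D_finite_set [dfn]: assumes "Df s" shows "D (%w e. finite_set E (s w e))"
  unfolding finite_set_def by (intro dfn assms[THEN Df_ren])

lemma D_is_index [dfn]: assumes "Df s" shows "D (%w e. is_index E (s w e))"
  unfolding is_index_def by (intro dfn assms[THEN Df_ren])

definition iiso where "iiso a b q \<longleftrightarrow> bijection E q a b & (ALL x:el a. ALL y:el a.
   (x \<E> y \<longleftrightarrow> ap q x \<E> ap q y) & (ord_le E (rk x) (rk y) \<longleftrightarrow> ord_le E (rk (ap q x)) (rk (ap q y))))"

lemma iiso_iff: "index_iso E a b q \<longleftrightarrow> iiso a b q"
proof (cases "bijection E q a b")
  case True
  have "app E q x = ap q x" if "x \<E> a" for x using ap_app[OF bijD(1)[OF True] that] .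
  then show ?thesis by (simp add: index_iso_def iiso_def el_ball)
qed (simp add: index_iso_def iiso_def)

lemma D_iiso [dfn]: assumes "Df s" "Df t" "Df u" shows "D (%w e. iiso (s w e) (t w e) (u w e))"
  unfolding iiso_def by (intro dfn assms[THEN Df_ren])

lemma mem_indices [simp]: "r \<E> indices E X \<longleftrightarrow> is_index E r & Sub r X"
  unfolding indices_def by (rule mem_comp[of _ "Pw X"], intro dfn) simp

lemma is_index_iff: "is_index E r \<longleftrightarrow> finite_set E r &
    (ALL x y. x \<E> r --> y \<E> r --> x ~= y --> rk x = rk y --> (EX z. z \<E> r & ~ (z \<E> x \<longleftrightarrow> z \<E> y)))"
  unfolding is_index_def el_ball el_bex by blast

lemma iisoD: assumes "iiso a b q"
  shows "fnc q a" "!!x. x \<E> a ==> ap q x \<E> b" "!!y. y \<E> b ==> EX x. x \<E> a & ap q x = y"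
    "!!x y. x \<E> a ==> y \<E> a ==> ap q x = ap q y ==> x = y"
    "!!x y. x \<E> a ==> y \<E> a ==> x \<E> y \<longleftrightarrow> ap q x \<E> ap q y"
    "!!x y. x \<E> a ==> y \<E> a ==> (rk x \<E> rk y | rk x = rk y) \<longleftrightarrow> (rk (ap q x) \<E> rk (ap q y) | rk (ap q x) = rk (ap q y))"
  using assms bijD unfolding iiso_def el_ball ord_le_iff by blast+

lemma iiso_rk: assumes "iiso a b q" "x \<E> a" "y \<E> a"
  shows "rk x \<E> rk y \<longleftrightarrow> rk (ap q x) \<E> rk (ap q y)" "rk x = rk y \<longleftrightarrow> rk (ap q x) = rk (ap q y)"
proof -
  have o: "~ u \<E> v \<longleftrightarrow> v \<E> u | v = u" if "Ord u" "Ord v" for u v using Ord_not_mem[OF that] .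
  show "rk x \<E> rk y \<longleftrightarrow> rk (ap q x) \<E> rk (ap q y)"
    using iisoD(6)[OF assms(1,3,2)] o[of "rk x" "rk y"] o[of "rk (ap q x)" "rk (ap q y)"] by (simp, blast)
  show "rk x = rk y \<longleftrightarrow> rk (ap q x) = rk (ap q y)"
    using iisoD(6)[OF assms(1,3,2)] iisoD(6)[OF assms(1,2,3)] mem_asym mem_irrefl by metis
qed

text \<open>Isomorphisms between indices are unique: by induction on rank they agree first on the ranks of
  the values, then on the values, which are determined by their members in the index.\<close>

lemma iiso_unique:
  assumes q: "iiso c u q" and q': "iiso c u q'" and u: "is_index E u"
  shows "q = q'"
proof (rule fnc_ext[OF iisoD(1)[OF q] iisoD(1)[OF q']])
  have le: "~ rk (ap q x) \<E> rk (ap q' x)"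
    if q: "iiso c u q" and q': "iiso c u q'" and x: "x \<E> c"
      and IH: "!!y. y \<E> c ==> rk y \<E> rk x ==> rk (ap q y) = rk (ap q' y)" for q q' x
  proof
    assume l: "rk (ap q x) \<E> rk (ap q' x)"
    obtain y where y: "y \<E> c" "ap q' y = ap q x" using iisoD(3)[OF q' iisoD(2)[OF q x]] by blast
    then have yx: "rk y \<E> rk x" using l iiso_rk(1)[OF q' y(1) x] by simp
    then have "rk (ap q y) = rk (ap q x)" using IH[OF y(1)] y(2) by simp
    then show False using iiso_rk(2)[OF q y(1) x] yx by simp
  qed
  have rkeq: "ALL x. rk x = \<xi> --> x \<E> c --> rk (ap q x) = rk (ap q' x)" if "Ord \<xi>" for \<xi>
  proof (rule Ord_induct[of "%\<xi>. ALL x. rk x = \<xi> --> x \<E> c --> rk (ap q x) = rk (ap q' x)", OF _ that], intro dfn, intro allI impI)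
    fix \<xi> x assume IH: "!!b. b \<E> \<xi> ==> ALL x. rk x = b --> x \<E> c --> rk (ap q x) = rk (ap q' x)" and x: "rk x = \<xi>" "x \<E> c"
    then show "rk (ap q x) = rk (ap q' x)"
      using le[OF q q' x(2)] le[OF q' q x(2)] Ord_linear[OF Ord_rk Ord_rk, of "ap q x" "ap q' x"] by metis
  qed
  have "ALL x. rk x = \<xi> --> x \<E> c --> ap q x = ap q' x" if "Ord \<xi>" for \<xi>
  proof (rule Ord_induct[of "%\<xi>. ALL x. rk x = \<xi> --> x \<E> c --> ap q x = ap q' x", OF _ that], intro dfn, intro allI impI)
    fix \<xi> x assume IH0: "!!b. b \<E> \<xi> ==> ALL x. rk x = b --> x \<E> c --> ap q x = ap q' x" and x: "rk x = \<xi>" "x \<E> c"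
    then have IH: "ap q y = ap q' y" if "y \<E> c" "y \<E> x" for y using that rk_mem[OF that(2)] by blast
    show "ap q x = ap q' x"
    proof (rule ccontr)
      assume "ap q x ~= ap q' x"
      moreover have "rk (ap q x) = rk (ap q' x)" using rkeq[OF Ord_rk] x(2) by blast
      ultimately obtain z where z: "z \<E> u" "~ (z \<E> ap q x \<longleftrightarrow> z \<E> ap q' x)"
        using u iisoD(2)[OF q x(2)] iisoD(2)[OF q' x(2)] unfolding is_index_iff by blast
      obtain y where y: "y \<E> c" "ap q y = z" using iisoD(3)[OF q z(1)] by blast
      obtain y' where y': "y' \<E> c" "ap q' y' = z" using iisoD(3)[OF q' z(1)] by blast
      have 1: "z \<E> ap q x \<longleftrightarrow> y \<E> x" using iisoD(5)[OF q y(1) x(2)] y(2) by simp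
      have 2: "z \<E> ap q' x \<longleftrightarrow> y' \<E> x" using iisoD(5)[OF q' y'(1) x(2)] y'(2) by simp
      show False
      proof (cases "y \<E> x")
        case True
        then have "ap q' y = z" using IH[OF y(1)] y(2) by simp
        then have "y = y'" using iisoD(4)[OF q' y(1) y'(1)] y'(2) by simp
        then show False using z 1 2 True by simp
      next
        case False
        then have "y' \<E> x" using z 1 2 by blast
        then have "ap q y' = z" using IH[OF y'(1)] y'(2) by simp
        then have "y = y'" using iisoD(4)[OF q y(1) y'(1)] y(2) by simp
        then show False using False \<open>y' \<E> x\<close> by simp
      qed
    qed
  qed
  then show "ap q x = ap q' x" if "x \<E> c" for x using that Ord_rk by blast
qed

lemma index_map_eq: assumes "iiso c u q" "is_index E u" shows "index_map E c u = q"
  unfolding index_map_def iiso_iff using iiso_unique[OF _ assms(1,2)] assms(1) by blast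

lemma iiso_inv: assumes q: "iiso a b q" shows "EX q'. iiso b a q'"
proof -
  \<comment> \<open>The preimage of \<open>y\<close> is described by its elements, so that
    \<open>Df_setof\<close> applies; injectivity makes it unambiguous.\<close>
  define t where "t y = so (%z. EX x. x \<E> a & ap q x = y & z \<E> x)" for y
  have ex: "EX s. ALL z. z \<E> s \<longleftrightarrow> (EX x. x \<E> a & ap q x = y & z \<E> x)" for y
    by (rule comp_ex[of _ "Uni a"], intro dfn) auto
  have t: "t (ap q x) = x" if "x \<E> a" for x
  proof (rule ext)
    fix z
    have "z \<E> t (ap q x) \<longleftrightarrow> (EX x'. x' \<E> a & ap q x' = ap q x & z \<E> x')" unfolding t_def by (rule setof_mem[OF ex])
    then show "z \<E> t (ap q x) \<longleftrightarrow> z \<E> x" using iisoD(4)[OF q _ that] that by blast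
  qed
  have Dt: "Df (%C e. t (e 0))" unfolding t_def by (rule Df_setof, intro dfn, rule set_ex1[OF ex])
  have tb: "t y \<E> a" "ap q (t y) = y" if "y \<E> b" for y
    using iisoD(3)[OF q that] t by auto
  have "iiso b a (lam b t)"
    unfolding iiso_def
  proof (intro conjI ballI)
    show "bijection E (lam b t) b a"
    proof (rule bij_lam[OF Dt])
      show "EX x. x \<E> b & t x = y" if "y \<E> a" for y using t[OF that] iisoD(2)[OF q that] by blast
    qed (use tb in auto, metis tb)
    fix x y assume xy: "x \<in> el b" "y \<in> el b"
    then show "x \<E> y \<longleftrightarrow> ap (lam b t) x \<E> ap (lam b t) y"
      using iisoD(5)[OF q tb(1) tb(1)] tb(2) by (simp add: ap_lam[OF Dt])
    show "ord_le E (rk x) (rk y) \<longleftrightarrow> ord_le E (rk (ap (lam b t) x)) (rk (ap (lam b t) y))"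
      using iisoD(6)[OF q tb(1) tb(1)] tb(2) xy by (simp add: ap_lam[OF Dt] ord_le_iff)
  qed
  then show ?thesis by blast
qed

lemma index_equiv_iff: "index_equiv E u c \<longleftrightarrow> (EX q. iiso c u q)"
  unfolding index_equiv_def iiso_iff using iiso_inv by blast

lemma index_add:
  assumes c: "is_index E c" and y: "!!z. z \<E> c ==> z ~= y ==> rk z = rk y ==> EX w. w \<E> c & ~ (w \<E> z \<longleftrightarrow> w \<E> y)"
  shows "is_index E (un2 c (upair y y))"
  unfolding is_index_iff
proof (intro conjI allI impI finite_insert)
  show "finite_set E c" using c by (simp add: is_index_iff)
  fix u v assume uv: "u \<E> un2 c (upair y y)" "v \<E> un2 c (upair y y)" "u ~= v" "rk u = rk v"
  have "EX z. z \<E> c & ~ (z \<E> u \<longleftrightarrow> z \<E> v)"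
  proof (cases "u \<E> c & v \<E> c")
    case True then show ?thesis using c uv unfolding is_index_iff by blast
  next
    case False
    then have "(u = y & v \<E> c) | (v = y & u \<E> c)" using uv by auto
    then show ?thesis using y uv by metis
  qed
  then show "EX z. z \<E> un2 c (upair y y) & ~ (z \<E> u \<longleftrightarrow> z \<E> v)" by auto
qed

end

section \<open>Indices contained in the target model\<close>

context pre_wit
begin

text \<open>Adding \<open>y\<close> can only fail because of a \<open>z\<close> of the same rank
  that has the same members in \<open>c\<close>. A set \<open>w\<close> separating them has smaller
  rank and is added first, by induction; the rank clause ensures that no new element of the rank of
  \<open>y\<close> comes in with it.\<close>

lemma index_extend1:
  assumes "y \<E> N" "is_index E c" "Sub c N"
  shows "EX c'. is_index E c' & Sub c' N & Sub c c' & y \<E> c' & (ALL x. x \<E> c' --> x \<E> c | ord_le E (rk x) (rk y))"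
proof -
  let ?Q = "%y c. EX c'. is_index E c' & Sub c' N & Sub c c' & y \<E> c' & (ALL x. x \<E> c' --> x \<E> c | ord_le E (rk x) (rk y))"
  have "ALL y c. rk y = \<xi> --> y \<E> N --> is_index E c --> Sub c N --> ?Q y c" if "Ord \<xi>" for \<xi>
  proof (rule Ord_induct[of "%\<xi>. ALL y c. rk y = \<xi> --> y \<E> N --> is_index E c --> Sub c N --> ?Q y c", OF _ that],
      intro dfn, intro allI impI)
    fix \<xi> y c assume IH: "!!b. b \<E> \<xi> ==> ALL y c. rk y = b --> y \<E> N --> is_index E c --> Sub c N --> ?Q y c"
      and y: "rk y = \<xi>" "y \<E> N" and c: "is_index E c" "Sub c N"
    show "?Q y c"
    proof (cases "y \<E> c")
      case True then show ?thesis using c by (intro exI[of _ c]) (auto simp: Sub_iff)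
    next
      case False
      have "EX c1. is_index E c1 & Sub c1 N & Sub c c1 & (ALL x. x \<E> c1 --> x \<E> c | rk x \<E> rk y) &
        (ALL z. z \<E> c --> rk z = rk y --> (EX w. w \<E> c1 & ~ (w \<E> z \<longleftrightarrow> w \<E> y)))"
      proof (cases "EX z. z \<E> c & rk z = rk y & (ALL w. w \<E> c --> (w \<E> z \<longleftrightarrow> w \<E> y))")
        case True
        then obtain z where z: "z \<E> c" "rk z = rk y" "ALL w. w \<E> c --> (w \<E> z \<longleftrightarrow> w \<E> y)" by blast
        have "z ~= y" using z(1) False by blast
        then obtain w where w: "~ (w \<E> z \<longleftrightarrow> w \<E> y)" using ext by blast
        then have wN: "w \<E> N" "rk w \<E> rk y"
          using rk_mem[of w z] rk_mem[of w y] z N_elem[of z w] N_elem[OF y(2)] c(2) by (auto simp: Sub_iff)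
        then obtain c1 where c1: "is_index E c1" "Sub c1 N" "Sub c c1" "w \<E> c1"
          "ALL x. x \<E> c1 --> x \<E> c | ord_le E (rk x) (rk w)" using IH[of "rk w"] y(1) c by blast
        \<comment> \<open>Any other candidate is already separated from \<open>z\<close> within
          \<open>c\<close>, and there \<open>z\<close> and \<open>y\<close> have the same
          members.\<close>
        have "EX w. w \<E> c1 & ~ (w \<E> z' \<longleftrightarrow> w \<E> y)" if z': "z' \<E> c" "rk z' = rk y" for z'
        proof (cases "z' = z")
          case True then show ?thesis using w c1(4) by blast
        next
          case False
          then obtain v where "v \<E> c" "~ (v \<E> z' \<longleftrightarrow> v \<E> z)" using c(1) z z' unfolding is_index_iff by metis
          then show ?thesis using z(3) c1(3) unfolding Sub_iff by blast
        qed
        moreover have "x \<E> c | rk x \<E> rk y" if "x \<E> c1" for x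
          using c1(5) that wN(2) Ord_trans[OF Ord_rk wN(2)] by (auto simp: ord_le_iff)
        ultimately show ?thesis using c1 by blast
      next
        case False then show ?thesis using c by (intro exI[of _ c]) (auto simp: Sub_iff)
      qed
      then obtain c1 where c1: "is_index E c1" "Sub c1 N" "Sub c c1" "ALL x. x \<E> c1 --> x \<E> c | rk x \<E> rk y"
        "ALL z. z \<E> c --> rk z = rk y --> (EX w. w \<E> c1 & ~ (w \<E> z \<longleftrightarrow> w \<E> y))" by blast
      have "is_index E (un2 c1 (upair y y))"
      proof (rule index_add[OF c1(1)])
        fix z assume "z \<E> c1" "z ~= y" "rk z = rk y"
        then have "z \<E> c" using c1(4) by (metis mem_irrefl)
        then show "EX w. w \<E> c1 & ~ (w \<E> z \<longleftrightarrow> w \<E> y)" using c1(5) \<open>rk z = rk y\<close> by blast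
      qed
      then show ?thesis using c1 y
        by (intro exI[of _ "un2 c1 (upair y y)"]) (auto simp: Sub_iff ord_le_iff)
    qed
  qed
  then show ?thesis using assms Ord_rk by blast
qed

lemma index_extend:
  assumes a: "is_index E a" "Sub a N" and b: "finite_set E b" "Sub b N"
  shows "EX c. is_index E c & Sub c N & Sub a c & Sub b c"
proof -
  obtain n f where n: "n \<E> om" "bijection E f n b" using b(1) unfolding finite_set_def el_bex by blast
  note bf = bijD[OF n(2)]
  let ?Q = "%m. EX c. is_index E c & Sub c N & Sub a c & (ALL k. k \<E> m & k \<E> n --> ap f k \<E> c)"
  have "?Q n"
  proof (rule om_induct[of ?Q, OF _ n(1)], goal_cases)
    case 1 show ?case by (intro dfn)
  next
    case 2 show ?case using a by (intro exI[of _ a]) (simp add: Sub_iff)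
  next
    case (3 m)
    then obtain c where c: "is_index E c" "Sub c N" "Sub a c" "ALL k. k \<E> m & k \<E> n --> ap f k \<E> c" by blast
    show ?case
    proof (cases "m \<E> n")
      case True
      then have "ap f m \<E> N" using bf(2) b(2) by (simp add: Sub_iff)
      then obtain c' where "is_index E c'" "Sub c' N" "Sub c c'" "ap f m \<E> c'"
        using index_extend1[OF _ c(1,2)] by blast
      then show ?thesis using c by (intro exI[of _ c']) (auto simp: Sub_iff)
    next
      case False then show ?thesis using c by (intro exI[of _ c]) auto
    qed
  qed
  then obtain c where c: "is_index E c" "Sub c N" "Sub a c" "ALL k. k \<E> n & k \<E> n --> ap f k \<E> c" by blast
  then have "Sub b c" using bf(3) unfolding Sub_iff by blast
  then show ?thesis using c by blast
qed

lemma index_emp: "is_index E emp"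
  by (simp add: is_index_iff finite_emp)

lemma fix_sub: assumes "Sub X om" shows "X \<E> V \<delta>" "hj X = X"
proof -
  have "Sub X (V om)" using assms om_V by (simp add: Sub_iff)
  then show X: "X \<E> V \<delta>" using V\<delta>_bd[OF om_\<delta>] by blast
  have "Sub (hj X) om" using hj_Sub[OF X, of om] omA assms h_om by simp
  then have s: "y \<E> om" if "y \<E> hj X" for y using that by (simp add: Sub_iff)
  have "y \<E> X \<longleftrightarrow> y \<E> hj X" if "y \<E> om" for y using h_mem[of y X] X om_sub[OF that] h_om_elem[OF that] by simp
  then show "hj X = X" using s assms unfolding Sub_iff by (intro ext) blast
qed

text \<open>The isomorphism type of a finite index is recorded by relations on a natural number;
  they can be used as parameters because the embedding does not move them.\<close>

lemma fix_rel: assumes "Sub X (prod om om)" shows "X \<E> V \<delta>" "hj X = X"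
proof -
  have el: "EX k l. k \<E> om & l \<E> om & x = pr k l" if "x \<E> X" for x
    using assms that by (auto simp: Sub_iff mem_prod)
  then have pV: "pr k l \<E> V om" if "k \<E> om" "l \<E> om" for k l using that by (simp add: Lim_pr[OF Lim_om] om_V)
  have "Sub X (V om)" using el pV by (auto simp: Sub_iff)
  then show X: "X \<E> V \<delta>" using V\<delta>_bd[OF om_\<delta>] by blast
  define Q where "Q X w \<longleftrightarrow> (ALL x:el X. EX k:el w. EX l:el w. x = pr k l)" for X w
  have "D0 (%e. Q (e 0) (e 1))" unfolding Q_def by (intro d0)
  moreover have "Q X om" unfolding Q_def el_ball el_bex using el by blast
  ultimately have "Q (hj X) om" using pres2[OF pres_j, of Q X om] X omA h_om by simp
  then have s: "EX k l. k \<E> om & l \<E> om & y = pr k l" if "y \<E> hj X" for y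
    using that unfolding Q_def el_ball el_bex by blast
  have "pr k l \<E> X \<longleftrightarrow> pr k l \<E> hj X" if "k \<E> om" "l \<E> om" for k l
  proof -
    have v: "pr k l \<in> el (V \<delta>)" using pV[OF that] A_elem[OF VomA] by blast
    have "hj (pr k l) = pr k l" using h_pr[OF v] h_om_elem that by simp
    then show ?thesis using h_mem[OF v, of X] X by simp
  qed
  then show "hj X = X" using s el by (intro ext) metis
qed

text \<open>Rank enters bounded statements as a parameter, namely its restriction to a level. The
  image of that function satisfies the recursion for rank on the image of the level, hence is again
  rank.\<close>

lemma hj_rk:
  assumes \<alpha>: "\<alpha> \<E> \<delta>"
  shows "lam (V \<alpha>) rk \<E> V \<delta>" "fnc (hj (lam (V \<alpha>) rk)) (hj (V \<alpha>))"
    "!!y. y \<E> hj (V \<alpha>) ==> ap (hj (lam (V \<alpha>) rk)) y = rk y"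
proof -
  let ?r = "lam (V \<alpha>) rk"
  have Dr: "Df (%C e. rk (e 0))" by (intro dfn)
  have o\<alpha>: "Ord \<alpha>" using Ord_elem[OF o\<delta> \<alpha>] .
  have r: "fnc ?r (V \<alpha>)" "!!x. x \<E> V \<alpha> ==> ap ?r x = rk x" using fnc_lam[OF Dr] ap_lam[OF Dr] by auto
  have "Sub ?r (V (sc (sc \<alpha>)))"
    unfolding Sub_iff
  proof (intro allI impI)
    fix p assume "p \<E> ?r"
    then obtain x where x: "x \<E> V \<alpha>" "p = pr x (rk x)" by (auto simp: mem_lam[OF Dr])
    then have "rk x \<E> V \<alpha>" using mem_V_rk[OF o\<alpha>] rk_Ord[OF Ord_rk] by simp
    then show "p \<E> V (sc (sc \<alpha>))" using pr_rank[OF o\<alpha>] x by simp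
  qed
  then show rV: "?r \<E> V \<delta>" using V\<delta>_bd[of "sc (sc \<alpha>)"] \<delta>_Lim \<alpha> by (simp add: Lim_def)
  show f: "fnc (hj ?r) (hj (V \<alpha>))" using h_fnc(1)[OF r(1)] rV V\<delta>[OF \<alpha>] by simp
  \<comment> \<open>The recursion for rank in bounded form; the last clause says that the value is
    the least ordinal above those of the elements.\<close>
  define Q where "Q r v \<longleftrightarrow> (ALL x:el v. Sub x v & (ALL \<xi>. pr x \<xi> \<E> r --> Ord \<xi> & (ALL y:el x. ALL \<zeta>. pr y \<zeta> \<E> r --> \<zeta> \<E> \<xi>) &
     (ALL \<zeta>:el \<xi>. EX y:el x. EX \<theta>. pr y \<theta> \<E> r & (\<zeta> \<E> \<theta> | \<zeta> = \<theta>))))" for r v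
  have "D0 (%e. Q (e 0) (e 1))" unfolding Q_def by (intro d0)
  moreover have "Q ?r (V \<alpha>)"
    unfolding Q_def
  proof (intro ballI conjI allI impI)
    fix x assume x: "x \<in> el (V \<alpha>)"
    then show "Sub x (V \<alpha>)" using V_trans[OF o\<alpha>] by (auto simp: Sub_iff)
    fix \<xi> assume "pr x \<xi> \<E> ?r"
    then have \<xi>: "\<xi> = rk x" using fnc_pr[OF r(1)] r(2) by auto
    then show "Ord \<xi>" by simp
    have yV: "y \<E> V \<alpha>" if "y \<E> x" for y using V_trans[OF o\<alpha>] x that by auto
    fix y \<zeta> assume "y \<in> el x" "pr y \<zeta> \<E> ?r"
    then show "\<zeta> \<E> \<xi>" using \<xi> fnc_pr[OF r(1)] r(2) rk_mem by auto
  next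
    fix x \<xi> \<zeta> assume x: "x \<in> el (V \<alpha>)" and "pr x \<xi> \<E> ?r" "\<zeta> \<in> el \<xi>"
    then have \<zeta>: "\<zeta> \<E> rk x" using fnc_pr[OF r(1)] r(2) by auto
    have yV: "y \<E> V \<alpha>" if "y \<E> x" for y using V_trans[OF o\<alpha>] x that by auto
    have o\<zeta>: "Ord \<zeta>" using Ord_elem[OF Ord_rk \<zeta>] .
    have "EX y. y \<E> x & (\<zeta> \<E> rk y | \<zeta> = rk y)"
    proof (rule ccontr)
      assume "~ ?thesis"
      then have "rk y \<E> \<zeta>" if "y \<E> x" for y using Ord_linear[OF o\<zeta> Ord_rk[of y]] that by blast
      then have "rk x \<E> \<zeta> | rk x = \<zeta>" by (rule rk_le[OF o\<zeta>])
      then show False using \<zeta> mem_asym by auto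
    qed
    then obtain y where y: "y \<E> x" "\<zeta> \<E> rk y | \<zeta> = rk y" by blast
    have "pr y (rk y) \<E> ?r" using fnc_pr[OF r(1)] r(2) yV[OF y(1)] by simp
    then show "EX y:el x. EX \<theta>. pr y \<theta> \<E> ?r & (\<zeta> \<E> \<theta> | \<zeta> = \<theta>)" using y by (intro bexI[of _ y]) auto
  qed
  ultimately have QQ: "Q (hj ?r) (hj (V \<alpha>))" using pres2[OF pres_j, of Q ?r "V \<alpha>"] rV V\<delta>[OF \<alpha>] by simp
  have q0: "Sub x (hj (V \<alpha>)) & (ALL \<xi>. pr x \<xi> \<E> hj ?r --> Ord \<xi> & (ALL y:el x. ALL \<zeta>. pr y \<zeta> \<E> hj ?r --> \<zeta> \<E> \<xi>) &
     (ALL \<zeta>:el \<xi>. EX y:el x. EX \<theta>. pr y \<theta> \<E> hj ?r & (\<zeta> \<E> \<theta> | \<zeta> = \<theta>)))" if "x \<E> hj (V \<alpha>)" for x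
    by (rule QQ[unfolded Q_def, THEN bspec]) (simp add: that)
  have q1: "z \<E> hj (V \<alpha>)" if "x \<E> hj (V \<alpha>)" "z \<E> x" for x z using q0[OF that(1), THEN conjunct1] that(2) by (simp add: Sub_iff)
  have q2: "Ord (ap (hj ?r) x) & (ALL y:el x. ALL \<zeta>. pr y \<zeta> \<E> hj ?r --> \<zeta> \<E> ap (hj ?r) x) &
     (ALL \<zeta>:el (ap (hj ?r) x). EX y:el x. EX \<theta>. pr y \<theta> \<E> hj ?r & (\<zeta> \<E> \<theta> | \<zeta> = \<theta>))" if "x \<E> hj (V \<alpha>)" for x
    by (rule q0[OF that, THEN conjunct2, THEN spec, THEN mp, OF fnc_ap[OF f that]])
  have q: "!!x. x \<E> hj (V \<alpha>) ==> Ord (ap (hj ?r) x)" using q2 by blast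
  have q3: "ap (hj ?r) y \<E> ap (hj ?r) x" if "x \<E> hj (V \<alpha>)" "y \<E> x" for x y
    by (rule q2[OF that(1), THEN conjunct2, THEN conjunct1, THEN bspec, THEN spec, THEN mp, OF _ fnc_ap[OF f q1[OF that]]])
      (simp add: that(2))
  have q4: "EX y. y \<E> x & (\<zeta> \<E> ap (hj ?r) y | \<zeta> = ap (hj ?r) y)" if x: "x \<E> hj (V \<alpha>)" "\<zeta> \<E> ap (hj ?r) x" for x \<zeta>
  proof -
    obtain y \<theta> where "y \<E> x" "pr y \<theta> \<E> hj ?r" "\<zeta> \<E> \<theta> | \<zeta> = \<theta>" using q2[OF x(1), THEN conjunct2, THEN conjunct2] x(2) unfolding el_ball el_bex by blast
    then show ?thesis using ap_eq[OF f] by blast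
  qed
  have "y \<E> hj (V \<alpha>) --> ap (hj ?r) y = rk y" for y
  proof (rule eps_induct[of "%y. y \<E> hj (V \<alpha>) --> ap (hj ?r) y = rk y"], intro dfn, intro impI)
    fix y assume IH: "!!z. z \<E> y ==> z \<E> hj (V \<alpha>) --> ap (hj ?r) z = rk z" and y: "y \<E> hj (V \<alpha>)"
    have z: "ap (hj ?r) z = rk z" if "z \<E> y" for z using IH[OF that] q1[OF y that] by blast
    have "rk y \<E> ap (hj ?r) y | rk y = ap (hj ?r) y"
      by (rule rk_le[OF q[OF y]]) (use q3[OF y] z in auto)
    moreover have "~ rk y \<E> ap (hj ?r) y"
    proof
      assume "rk y \<E> ap (hj ?r) y"
      then obtain w where w: "w \<E> y" "rk y \<E> rk w | rk y = rk w" using q4[OF y] z by metis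
      then show False using rk_mem[OF w(1)] mem_asym by auto
    qed
    ultimately show "ap (hj ?r) y = rk y" by auto
  qed
  then show "!!y. y \<E> hj (V \<alpha>) ==> ap (hj ?r) y = rk y" by blast
qed

lemma N_finite_fnc:
  assumes n: "n \<E> om" and f: "fnc f n" "!!k. k \<E> n ==> ap f k \<E> N"
  shows "f \<E> N"
proof -
  have omN: "k \<E> N" if "k \<E> om" for k using j_N[OF om_sub[OF that]] h_om_elem[OF that] by simp
  let ?Q = "%m. EX g. g \<E> N & (ALL p. p \<E> g \<longleftrightarrow> (EX k. k \<E> m & k \<E> n & p = pr k (ap f k)))"
  have "?Q n"
  proof (rule om_induct[of ?Q, OF _ n], goal_cases)
    case 1 show ?case by (intro dfn)
  next
    case 2 show ?case using omN[OF om_0] by (intro exI[of _ emp]) simp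
  next
    case (3 m)
    then obtain g where g: "g \<E> N" "ALL p. p \<E> g \<longleftrightarrow> (EX k. k \<E> m & k \<E> n & p = pr k (ap f k))" by blast
    show ?case
    proof (cases "m \<E> n")
      case True
      let ?p = "pr m (ap f m)"
      have "?p \<E> N" using N_pr omN[OF 3(1)] f(2)[OF True] by simp
      then have "un2 g (upair ?p ?p) \<E> N" using N_un2[OF g(1)] N_upair by blast
      then show ?thesis using g(2) True by (intro exI[of _ "un2 g (upair ?p ?p)"]) auto
    next
      case False then show ?thesis using g by (intro exI[of _ g]) auto
    qed
  qed
  then obtain g where g: "g \<E> N" "ALL p. p \<E> g \<longleftrightarrow> (EX k. k \<E> n & k \<E> n & p = pr k (ap f k))" by blast
  have "g = f" using g(2) fnc_mem[OF f(1)] by (intro ext) simp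
  then show ?thesis using g(1) by simp
qed

end

context zf2
begin

lemma mem_img_ap [simp]: "y \<E> img (ap q) a \<longleftrightarrow> (EX x. x \<E> a & y = ap q x)"
  by (rule mem_img) (intro dfn)

lemma Df_img_ap [dfn]: assumes "Df s" "Df t" shows "Df (%w e. img (ap (s w e)) (t w e))"
  unfolding img_def
  by (rule Df_setof, intro dfn assms[THEN Df_ren]) (rule set_ex1, rule replacement, intro dfn)

lemma index_image:
  assumes q: "iiso c u q" and a: "Sub a c" "is_index E a"
  shows "is_index E (img (ap q) a)"
  unfolding is_index_iff
proof (intro conjI allI impI)
  obtain m g where m: "m \<E> om" "bijection E g m a" using a(2) unfolding is_index_iff finite_set_def el_bex by blast
  note g = bijD[OF m(2)]
  have "bijection E (lam m (%i. ap q (ap g i))) m (img (ap q) a)"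
  proof (rule bij_lam)
    show "Df (%C e. ap q (ap g (e 0)))" by (intro dfn)
    show "EX x. x \<E> m & ap q (ap g x) = y" if y: "y \<E> img (ap q) a" for y
    proof -
      obtain z where z: "z \<E> a" "y = ap q z" using y by auto
      then show ?thesis using g(3)[OF z(1)] by auto
    qed
    show "x = y" if "x \<E> m" "y \<E> m" "ap q (ap g x) = ap q (ap g y)" for x y
    proof -
      have "ap g x \<E> c" "ap g y \<E> c" using g(2)[OF that(1)] g(2)[OF that(2)] a(1) by (auto simp: Sub_iff)
      then have "ap g x = ap g y" using iisoD(4)[OF q] that(3) by blast
      then show ?thesis by (rule g(4)[OF that(1,2)])
    qed
    show "ap q (ap g x) \<E> img (ap q) a" if "x \<E> m" for x using g(2)[OF that] by auto
  qed
  then show "finite_set E (img (ap q) a)" unfolding finite_set_def el_bex using m(1) by blast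
  fix x y assume xy: "x \<E> img (ap q) a" "y \<E> img (ap q) a" "x ~= y" "rk x = rk y"
  then obtain x' y' where x': "x' \<E> a" "x = ap q x'" "y' \<E> a" "y = ap q y'" by auto
  then have c: "x' \<E> c" "y' \<E> c" using a(1) by (auto simp: Sub_iff)
  then have "rk x' = rk y'" "x' ~= y'" using xy x' iiso_rk(2)[OF q c] by auto
  then obtain z where z: "z \<E> a" "~ (z \<E> x' \<longleftrightarrow> z \<E> y')" using a(2) x' unfolding is_index_iff by blast
  then have "z \<E> c" using a(1) by (simp add: Sub_iff)
  then have "~ (ap q z \<E> x \<longleftrightarrow> ap q z \<E> y)"
    using z(2) iisoD(5)[OF q \<open>z \<E> c\<close> c(1)] iisoD(5)[OF q \<open>z \<E> c\<close> c(2)] x'(2,4) by simp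
  then show "EX z. z \<E> img (ap q) a & ~ (z \<E> x \<longleftrightarrow> z \<E> y)" using z(1) by auto
qed

lemma iiso_img: assumes "iiso c u q" shows "img (ap q) c = u"
proof (rule ext)
  show "z \<E> img (ap q) c \<longleftrightarrow> z \<E> u" for z unfolding mem_img_ap using iisoD(2,3)[OF assms] by metis
qed

text \<open>\<open>lift_val\<close> as a relation without descriptions, so that predicates
  containing it are definable.\<close>

definition liftr where
  "liftr f a c u y \<longleftrightarrow> (EX q. iiso c u q & y = ap f (img (ap q) a)) | (~ (EX q. iiso c u q) & y = emp)"

lemma D_liftr [dfn]: assumes "Df s" "Df t" shows "D (%w e. liftr f a c (s w e) (t w e))"
  unfolding liftr_def by (intro dfn assms[THEN Df_ren])

lemma lift_iso:
  assumes u: "u \<E> indices E X" and a: "Sub a c" "is_index E a" and f: "fnc f (indices E X)" and q: "iiso c u q"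
  shows "lift_val E f a c u = ap f (img (ap q) a)"
proof -
  have "index_map E c u = q" using index_map_eq[OF q] u by simp
  moreover have "(EX x:el a. y = app E q x) \<longleftrightarrow> (EX x. x \<E> a & y = ap q x)" for y
    using ap_app[OF iisoD(1)[OF q]] a(1) unfolding el_bex Sub_iff by metis
  ultimately have "index_proj E u c a = img (ap q) a" by (simp add: index_proj_def img_def)
  moreover have "img (ap q) a \<E> indices E X"
    using index_image[OF q a] u iisoD(2)[OF q] a(1) by (auto simp: Sub_iff)
  ultimately show ?thesis using q ap_app[OF f] unfolding lift_val_def index_equiv_iff by auto
qed

lemma lift_iff:
  assumes u: "u \<E> indices E X" and a: "Sub a c" "is_index E a" and f: "fnc f (indices E X)"
  shows "y = lift_val E f a c u \<longleftrightarrow> liftr f a c u y"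
proof (cases "EX q. iiso c u q")
  case True
  then obtain q where q: "iiso c u q" by blast
  have "q' = q" if "iiso c u q'" for q' using iiso_unique[OF that q] u by simp
  then have "liftr f a c u y \<longleftrightarrow> y = ap f (img (ap q) a)" using q unfolding liftr_def by blast
  then show ?thesis using lift_iso[OF u a f q] by simp
next
  case False then show ?thesis by (simp add: liftr_def lift_val_def index_equiv_iff)
qed

end

lemma (in pre_wit) finite_V:
  assumes n: "n \<E> om" "bijection E p n c" and c: "!!x. x \<E> c ==> x \<E> V \<delta>"
  shows "c \<E> V \<delta>"
proof -
  note b = bijD[OF n(2)]
  let ?Q = "%m. EX \<alpha>. \<alpha> \<E> \<delta> & (ALL k. k \<E> m & k \<E> n --> ap p k \<E> V \<alpha>)"
  have "?Q n"
  proof (rule om_induct[of ?Q, OF _ n(1)], goal_cases)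
    case 1 show ?case by (intro dfn)
  next
    case 2 show ?case using om_\<delta> by auto
  next
    case (3 m)
    then obtain \<alpha> where \<alpha>: "\<alpha> \<E> \<delta>" "ALL k. k \<E> m & k \<E> n --> ap p k \<E> V \<alpha>" by blast
    show ?case
    proof (cases "m \<E> n")
      case True
      then obtain \<beta> where \<beta>: "\<beta> \<E> \<delta>" "ap p m \<E> V \<beta>" using V\<delta>_ex[OF c[OF b(2)]] by blast
      obtain \<gamma> where \<gamma>: "\<gamma> \<E> \<delta>" "Sub \<alpha> \<gamma>" "Sub \<beta> \<gamma>" using Ord_max[OF o\<delta> \<alpha>(1) \<beta>(1)] by blast
      have "ap p m \<E> V \<gamma>" using V_mono_Sub[OF _ _ \<gamma>(3) \<beta>(2)] Ord_elem[OF o\<delta>] \<gamma>(1) \<beta>(1) by blast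
      moreover have "ap p k \<E> V \<gamma>" if "k \<E> m" "k \<E> n" for k
        using V_mono_Sub[OF _ _ \<gamma>(2)] Ord_elem[OF o\<delta>] \<gamma>(1) \<alpha> that by blast
      ultimately show ?thesis using \<gamma>(1) by auto
    next
      case False then show ?thesis using \<alpha> by auto
    qed
  qed
  then obtain \<alpha> where \<alpha>: "\<alpha> \<E> \<delta>" "ALL k. k \<E> n & k \<E> n --> ap p k \<E> V \<alpha>" by blast
  then have "Sub c (V \<alpha>)" using b(3) unfolding Sub_iff by blast
  then show ?thesis by (rule V\<delta>_bd[OF \<alpha>(1)])
qed

text \<open>An index with an enumeration by a number \<open>n\<close>. As \<open>n\<close> is not
  moved, the sequence \<open>p\<close> in the target can be compared with sequences of length
  \<open>n\<close> in \<open>V \<delta>\<close>.\<close>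

locale enum_index = pre_wit E P \<kappa> \<delta> N j for E :: "'v => 'v => bool" (infix \<open>\<E>\<close> 50) and P \<kappa> \<delta> N j +
  fixes c n p
  assumes c: "is_index E c" "Sub c N" and n: "n \<E> om" "bijection E p n c"
begin

lemmas p = bijD[OF n(2)]

lemma pN: "p \<E> N"
  by (rule N_finite_fnc[OF n(1) p(1)]) (use p(2) c(2) in \<open>simp add: Sub_iff\<close>)

lemma n_om: "k \<E> n ==> k \<E> om" using om_elem[OF n(1)] by blast

text \<open>In effect, \<open>s\<close> enumerates an isomorphic copy of \<open>c\<close> in the
  order of \<open>p\<close>; see \<open>IsoV_iso\<close>.\<close>

definition IsoV where
  "IsoV s \<longleftrightarrow> fnc s n & (ALL k:el n. ALL l:el n. (ap s k \<E> ap s l \<longleftrightarrow> ap p k \<E> ap p l) & (ap s k = ap s l --> k = l) &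
     (ord_le E (rk (ap s k)) (rk (ap s l)) \<longleftrightarrow> ord_le E (rk (ap p k)) (rk (ap p l))))"

lemma D_IsoV [dfn]: assumes "Df s" shows "D (%w e. IsoV (s w e))"
  unfolding IsoV_def by (intro dfn assms[THEN Df_ren])

text \<open>Bounded form of \<open>IsoV\<close>: the type of the index is coded by the relations
  \<open>Em\<close> and \<open>Rm\<close>, and the rank function is a parameter.\<close>

definition IsoD where
  "IsoD s m Em Rm r \<longleftrightarrow> fnc s m & (ALL k:el m. ALL l:el m. ALL x. pr k x \<E> s --> (ALL y. pr l y \<E> s -->
     (x \<E> y \<longleftrightarrow> pr k l \<E> Em) & (x = y --> k = l) &
     (EX \<xi>. pr x \<xi> \<E> r & (EX \<zeta>. pr y \<zeta> \<E> r & (\<xi> \<E> \<zeta> | \<xi> = \<zeta> \<longleftrightarrow> pr k l \<E> Rm)))))"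

lemma D0_IsoD [d0]: "D0 (%e. IsoD (e a) (e b) (e f) (e g) (e k))"
  unfolding IsoD_def by (intro d0)

text \<open>The relations coding the type are not moved and the rank function goes to rank, so
  \<open>p\<close> satisfies the image of the condition that defines enumerations of copies of
  \<open>c\<close>.\<close>

lemma J_IsoV: "J IsoV p"
proof -
  obtain \<alpha> where \<alpha>: "\<alpha> \<E> \<delta>" "p \<E> hj (V \<alpha>)" using N_level[OF pN] by blast
  have o\<alpha>: "Ord \<alpha>" using Ord_elem[OF o\<delta> \<alpha>(1)] .
  let ?r = "lam (V \<alpha>) rk"
  have Dr: "Df (%C e. rk (e 0))" by (intro dfn)
  have r: "fnc ?r (V \<alpha>)" "!!x. x \<E> V \<alpha> ==> ap ?r x = rk x" using fnc_lam[OF Dr] ap_lam[OF Dr] by auto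
  have DI: "D (%C e. IsoV (e 0))" by (intro dfn)
  define Em where "Em = so (%q. EX k l. k \<E> n & l \<E> n & q = pr k l & ap p k \<E> ap p l)"
  define Rm where "Rm = so (%q. EX k l. k \<E> n & l \<E> n & q = pr k l & ord_le E (rk (ap p k)) (rk (ap p l)))"
  have Em: "q \<E> Em \<longleftrightarrow> (EX k l. k \<E> n & l \<E> n & q = pr k l & ap p k \<E> ap p l)" for q
    unfolding Em_def by (rule mem_comp[of _ "prod n n"], intro dfn) (auto simp: mem_prod)
  have Rm: "q \<E> Rm \<longleftrightarrow> (EX k l. k \<E> n & l \<E> n & q = pr k l & ord_le E (rk (ap p k)) (rk (ap p l)))" for q
    unfolding Rm_def by (rule mem_comp[of _ "prod n n"], intro dfn) (auto simp: mem_prod)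
  have "Sub Em (prod om om)" "Sub Rm (prod om om)" using n_om by (auto simp: Sub_iff Em Rm mem_prod)
  note fEm = fix_rel[OF this(1)] and fRm = fix_rel[OF this(2)]
  define S where "S v t m d d' r \<longleftrightarrow> (ALL s:el v. IsoD s m d d' r --> s \<E> t)" for v t m d d' r
  have "D0 (%e. S (e 0) (e 1) (e 2) (e 3) (e 4) (e 5))" unfolding S_def by (intro d0)
  moreover have "S (V \<alpha>) (sp \<alpha> IsoV) n Em Rm ?r"
    unfolding S_def el_ball mem_sp[OF DI]
  proof (intro allI impI conjI)
    fix s assume s: "s \<E> V \<alpha>" "IsoD s n Em Rm ?r"
    then have fs: "fnc s n" by (simp add: IsoD_def)
    have sV: "ap s k \<E> V \<alpha>" if "k \<E> n" for k
    proof -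
      have 1: "pr k (ap s k) \<E> V \<alpha>" using V_trans[OF o\<alpha> s(1) fnc_ap[OF fs that]] .
      have "upair k (ap s k) \<E> V \<alpha>" by (rule V_trans[OF o\<alpha> 1]) (simp add: pr_eq)
      then show ?thesis by (rule V_trans[OF o\<alpha>]) simp
    qed
    show "IsoV s"
      unfolding IsoV_def el_ball
    proof (intro conjI fs allI impI)
      fix k l assume kl: "k \<E> n" "l \<E> n"
      have I: "(ap s k \<E> ap s l \<longleftrightarrow> pr k l \<E> Em) & (ap s k = ap s l --> k = l) &
        (EX \<xi>. pr (ap s k) \<xi> \<E> ?r & (EX \<zeta>. pr (ap s l) \<zeta> \<E> ?r & (\<xi> \<E> \<zeta> | \<xi> = \<zeta> \<longleftrightarrow> pr k l \<E> Rm)))"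
        using s(2)[unfolded IsoD_def, THEN conjunct2, THEN bspec[of _ _ k], THEN bspec[of _ _ l], THEN spec[of _ "ap s k"], THEN mp,
            THEN spec[of _ "ap s l"], THEN mp] kl fnc_ap[OF fs] by simp
      then show "ap s k \<E> ap s l \<longleftrightarrow> ap p k \<E> ap p l" using kl by (auto simp: Em)
      show "ap s k = ap s l ==> k = l" using I by blast
      have "rk (ap s k) \<E> rk (ap s l) | rk (ap s k) = rk (ap s l) \<longleftrightarrow> pr k l \<E> Rm"
        using I fnc_pr[OF r(1)] r(2) sV kl by auto
      then show "ord_le E (rk (ap s k)) (rk (ap s l)) \<longleftrightarrow> ord_le E (rk (ap p k)) (rk (ap p l))"
        using kl by (auto simp: Rm ord_le_iff)
    qed
  qed
  ultimately have "S (hj (V \<alpha>)) (hj (sp \<alpha> IsoV)) (hj n) (hj Em) (hj Rm) (hj ?r)"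
    using pres6[OF pres_j, of S "V \<alpha>" "sp \<alpha> IsoV" n Em Rm ?r] V\<delta> \<alpha>(1) sp_V[OF DI] om_sub[OF n(1)] fEm fRm
      hj_rk(1)[OF \<alpha>(1)] by simp
  then have "S (hj (V \<alpha>)) (hj (sp \<alpha> IsoV)) n Em Rm (hj ?r)" using h_om_elem[OF n(1)] fEm fRm by simp
  moreover have "IsoD p n Em Rm (hj ?r)"
    unfolding IsoD_def
  proof (intro conjI p(1) ballI allI impI)
    have tr: "y \<E> hj (V \<alpha>)" if "x \<E> hj (V \<alpha>)" "y \<E> x" for x y
    proof -
      define Q where "Q v \<longleftrightarrow> (ALL x:el v. Sub x v)" for v
      have "D0 (%e. Q (e 0))" unfolding Q_def by (intro d0)
      moreover have "Q (V \<alpha>)" using V_trans[OF o\<alpha>] by (auto simp: Q_def Sub_iff)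
      ultimately have "Q (hj (V \<alpha>))" using pres1[OF pres_j, of Q "V \<alpha>"] V\<delta>[OF \<alpha>(1)] by simp
      then show ?thesis using that by (simp add: Q_def Sub_iff)
    qed
    have pV: "ap p k \<E> hj (V \<alpha>)" if "k \<E> n" for k
    proof -
      have 1: "pr k (ap p k) \<E> hj (V \<alpha>)" using tr[OF \<alpha>(2) fnc_ap[OF p(1) that]] .
      have "upair k (ap p k) \<E> hj (V \<alpha>)" by (rule tr[OF 1]) (simp add: pr_eq)
      then show ?thesis by (rule tr) simp
    qed
    fix k l x y assume "k \<in> el n" "l \<in> el n" "pr k x \<E> p" "pr l y \<E> p"
    then have kl: "k \<E> n" "l \<E> n" and xy: "x = ap p k" "y = ap p l" using fnc_pr[OF p(1)] by auto
    show "x \<E> y \<longleftrightarrow> pr k l \<E> Em" using kl xy by (auto simp: Em)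
    show "x = y ==> k = l" using p(4) kl xy by blast
    have "pr x (rk x) \<E> hj ?r" "pr y (rk y) \<E> hj ?r"
      using fnc_pr[OF hj_rk(2)[OF \<alpha>(1)]] hj_rk(3)[OF \<alpha>(1)] pV kl xy by auto
    moreover have "rk x \<E> rk y | rk x = rk y \<longleftrightarrow> pr k l \<E> Rm" using kl xy by (auto simp: Rm ord_le_iff)
    ultimately show "EX \<xi>. pr x \<xi> \<E> hj ?r & (EX \<zeta>. pr y \<zeta> \<E> hj ?r & (\<xi> \<E> \<zeta> | \<xi> = \<zeta> \<longleftrightarrow> pr k l \<E> Rm))" by blast
  qed
  ultimately have "p \<E> hj (sp \<alpha> IsoV)" using \<alpha>(2) by (simp add: S_def el_ball)
  then show ?thesis using \<alpha>(1) by (auto simp: J_def)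
qed

lemma IsoV_iso:
  assumes s: "IsoV s"
  obtains q where "iiso c (img (ap s) n) q" "!!k. k \<E> n ==> ap q (ap p k) = ap s k"
proof -
  define t where "t x = so (%z. EX k. k \<E> n & ap p k = x & z \<E> ap s k)" for x
  have ex: "EX w. ALL z. z \<E> w \<longleftrightarrow> (EX k. k \<E> n & ap p k = x & z \<E> ap s k)" for x
    by (rule comp_ex[of _ "Uni (img (ap s) n)"], intro dfn) auto
  have t: "t (ap p k) = ap s k" if "k \<E> n" for k
  proof (rule ext)
    fix z
    have "z \<E> t (ap p k) \<longleftrightarrow> (EX l. l \<E> n & ap p l = ap p k & z \<E> ap s l)" unfolding t_def by (rule setof_mem[OF ex])
    then show "z \<E> t (ap p k) \<longleftrightarrow> z \<E> ap s k" using p(4)[OF _ that] that by blast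
  qed
  have Dt: "Df (%C e. t (e 0))" unfolding t_def by (rule Df_setof, intro dfn, rule set_ex1[OF ex])
  have s': "!!k l. k \<E> n ==> l \<E> n ==> ap s k \<E> ap s l \<longleftrightarrow> ap p k \<E> ap p l"
    "!!k l. k \<E> n ==> l \<E> n ==> ap s k = ap s l ==> k = l"
    "!!k l. k \<E> n ==> l \<E> n ==> ord_le E (rk (ap s k)) (rk (ap s l)) \<longleftrightarrow> ord_le E (rk (ap p k)) (rk (ap p l))"
    using s unfolding IsoV_def el_ball by blast+
  show thesis
  proof (rule that[of "lam c t"])
    show "ap (lam c t) (ap p k) = ap s k" if "k \<E> n" for k using ap_lam[OF Dt p(2)[OF that]] t[OF that] by simp
    show "iiso c (img (ap s) n) (lam c t)"
      unfolding iiso_def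
    proof (intro conjI ballI)
      show "bijection E (lam c t) c (img (ap s) n)"
      proof (rule bij_lam[OF Dt])
        show "t x \<E> img (ap s) n" if "x \<E> c" for x using p(3)[OF that] t by auto
        show "EX x. x \<E> c & t x = y" if "y \<E> img (ap s) n" for y using that t p(2) by auto
        show "x = y" if xy: "x \<E> c" "y \<E> c" "t x = t y" for x y
        proof -
          obtain k l where kl: "k \<E> n" "ap p k = x" "l \<E> n" "ap p l = y" using p(3)[OF xy(1)] p(3)[OF xy(2)] by blast
          then have "ap s k = ap s l" using t xy(3) by metis
          then show ?thesis using s'(2) kl by blast
        qed
      qed
      fix x y assume "x \<in> el c" "y \<in> el c"
      then obtain k l where kl: "k \<E> n" "ap p k = x" "l \<E> n" "ap p l = y" using p(3) by (metis el_iff)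
      then have a: "ap (lam c t) x = ap s k" "ap (lam c t) y = ap s l"
        using ap_lam[OF Dt] t p(2) by metis+
      show "x \<E> y \<longleftrightarrow> ap (lam c t) x \<E> ap (lam c t) y" using a s'(1) kl by metis
      show "ord_le E (rk x) (rk y) \<longleftrightarrow> ord_le E (rk (ap (lam c t) x)) (rk (ap (lam c t) y))"
        using a s'(3) kl by metis
    qed
  qed
qed

text \<open>The positions of the elements of \<open>a\<close> in the enumeration. This set of
  numbers is fixed by the embedding, so the sub-index belonging to \<open>a\<close> can be read off
  uniformly from every enumeration \<open>s\<close>.\<close>

definition dm where "dm a = so (%k. k \<E> n & ap p k \<E> a)"

lemma mem_dm: "k \<E> dm a \<longleftrightarrow> k \<E> n & ap p k \<E> a"
  unfolding dm_def by (rule mem_comp[of _ n], intro dfn) simp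

lemma p_dm: "Sub a c ==> img (ap p) (dm a) = a"
  using p(3) unfolding Sub_iff by (intro ext) (simp add: mem_dm, metis)

lemma dm_fix: "dm a \<E> V \<delta>" "hj (dm a) = dm a"
  using fix_sub[of "dm a"] n_om by (auto simp: Sub_iff mem_dm)

lemma IsoV_proj:
  assumes "!!k. k \<E> n ==> ap q (ap p k) = ap s k" "Sub a c"
  shows "img (ap q) a = img (ap s) (dm a)"
proof (rule ext)
  fix y
  show "y \<E> img (ap q) a \<longleftrightarrow> y \<E> img (ap s) (dm a)"
    using assms p(3) unfolding Sub_iff mem_img_ap mem_dm by metis
qed

lemma N_sub: assumes "Sub x c" shows "x \<E> N"
proof -
  let ?Q = "%m. EX g. g \<E> N & (ALL z. z \<E> g \<longleftrightarrow> (EX k. k \<E> m & k \<E> n & ap p k \<E> x & z = ap p k))"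
  have "?Q n"
  proof (rule om_induct[of ?Q, OF _ n(1)], goal_cases)
    case 1 show ?case by (intro dfn)
  next
    case 2 show ?case using j_N[OF emp_V] h_om_elem[OF om_0] by (intro exI[of _ emp]) simp
  next
    case (3 m)
    then obtain g where g: "g \<E> N" "ALL z. z \<E> g \<longleftrightarrow> (EX k. k \<E> m & k \<E> n & ap p k \<E> x & z = ap p k)" by blast
    show ?case
    proof (cases "m \<E> n & ap p m \<E> x")
      case True
      then have "ap p m \<E> N" using p(2) c(2) by (simp add: Sub_iff)
      then have "un2 g (upair (ap p m) (ap p m)) \<E> N" using N_un2[OF g(1)] N_upair by blast
      then show ?thesis using g(2) True by (intro exI[of _ "un2 g (upair (ap p m) (ap p m))"]) auto
    next
      case False then show ?thesis using g by (intro exI[of _ g]) auto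
    qed
  qed
  then obtain g where g: "g \<E> N" "ALL z. z \<E> g \<longleftrightarrow> (EX k. k \<E> n & k \<E> n & ap p k \<E> x & z = ap p k)" by blast
  have "g = x" using g(2) p(3) assms unfolding Sub_iff by (intro ext) metis
  then show ?thesis using g(1) by simp
qed

definition Ran where "Ran s u \<longleftrightarrow> (ALL x:el u. EX k v. pr k v \<E> s & v = x) & (ALL k v. pr k v \<E> s --> v \<E> u)"

definition Im where "Im s d x \<longleftrightarrow> (ALL v:el x. EX k:el d. pr k v \<E> s) & (ALL k:el d. EX v. pr k v \<E> s & v \<E> x)"

lemma D0_Ran [d0]: "D0 (%e. Ran (e a) (e b))"
  unfolding Ran_def by (intro d0)

lemma D0_Im [d0]: "D0 (%e. Im (e a) (e b) (e f))"
  unfolding Im_def by (intro d0)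

lemma Ran_iff: assumes "fnc s n" shows "Ran s u \<longleftrightarrow> u = img (ap s) n"
proof
  assume "Ran s u"
  then show "u = img (ap s) n"
    unfolding Ran_def el_ball fnc_pr[OF assms] by (intro ext) (simp, metis)
qed (auto simp: Ran_def el_ball fnc_pr[OF assms])

lemma Im_iff: assumes "fnc s n" "!!k. k \<E> d ==> k \<E> n" shows "Im s d x \<longleftrightarrow> x = img (ap s) d"
proof
  assume "Im s d x"
  then show "x = img (ap s) d"
    unfolding Im_def el_ball el_bex fnc_pr[OF assms(1)] by (intro ext) (simp, metis)
qed (use assms(2) in \<open>auto simp: Im_def el_ball el_bex fnc_pr[OF assms(1)]\<close>)

lemma pc: "img (ap p) n = c"
  using p(2,3) by (intro ext) (simp, metis)

lemma s_sub: assumes "s \<E> V \<delta>" "fnc s n" "k \<E> n" shows "ap s k \<E> V \<delta>"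
  using A_pr(2)[of k "ap s k"] A_elem[of s] fnc_ap[OF assms(2,3)] assms(1) by auto

text \<open>Both \<open>c\<close> and \<open>pr a b\<close> are obtained from the seed
  \<open>p\<close> by bounded relations, and for almost every \<open>s\<close> the same relations
  yield the copy \<open>u\<close> and its two sub-indices. This matches indices with seeds.\<close>

lemma ext_ult:
  assumes a: "Sub a c" "is_index E a" "fnc f (indices E (V \<delta>))" and b: "Sub b c" "is_index E b" "fnc g (indices E (V \<delta>))"
    and R: "D (%C e. R (e 0) (e 1))"
  shows "J (%u. u \<E> indices E (V \<delta>) & R (lift_val E f a c u) (lift_val E g b c u)) c \<longleftrightarrow>
    J (%q. EX u v. q = pr u v & R (ap f u) (ap g v)) (pr a b)" (is "J ?Q1 c \<longleftrightarrow> J ?Q2 (pr a b)")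
proof -
  have D1: "D (%C e. ?Q1 (e 0))"
  proof (rule D_cong)
    show "D (%C e. e 0 \<E> indices E (V \<delta>) & (EX y z. liftr f a c (e 0) y & liftr g b c (e 0) z & R y z))"
      by (intro dfn D_pred2[OF R])
    show "(e 0 \<E> indices E (V \<delta>) & (EX y z. liftr f a c (e 0) y & liftr g b c (e 0) z & R y z)) \<longleftrightarrow> ?Q1 (e 0)" for e
      using lift_iff[OF _ a, of "e 0"] lift_iff[OF _ b, of "e 0"] by metis
  qed
  have D2: "D (%C e. ?Q2 (e 0))" by (intro dfn D_pred2[OF R])
  have DI: "D (%C e. IsoV (e 0))" by (intro dfn)
  have cN: "c \<E> N" by (rule N_sub) (simp add: Sub_iff)
  have abN: "pr a b \<E> N" using N_pr N_sub[OF a(1)] N_sub[OF b(1)] by simp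
  define Rl where "Rl s u q d d' \<longleftrightarrow> Ran s u & (EX x y. q = pr x y & Im s d x & Im s d' y)" for s u q d d'
  have Rl0: "D0 (%e. Rl (e i) (e k) (e l) (e m) (e r))" for i k l m r
    unfolding Rl_def by (intro d0 D0_pr_comp)
  \<comment> \<open>For the enumeration of a copy both predicates evaluate \<open>f\<close> and
    \<open>g\<close> at the same two sub-indices.\<close>
  have key: "?Q1 u \<longleftrightarrow> ?Q2 q" if "s \<E> V \<delta>" "u \<E> V \<delta>" "Rl s u q (dm a) (dm b)" "IsoV s" for s u q
  proof -
    have I: "IsoV s" using that(4) .
    have fs: "fnc s n" using that(4) by (simp add: IsoV_def)
    have Im': "Im s (dm x) y \<longleftrightarrow> y = img (ap s) (dm x)" for x y using Im_iff[OF fs, of "dm x" y] by (simp add: mem_dm)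
    have u: "u = img (ap s) n" and q: "q = pr (img (ap s) (dm a)) (img (ap s) (dm b))"
      using that(3) Ran_iff[OF fs] Im' unfolding Rl_def by auto
    obtain \<theta> where \<theta>: "iiso c u \<theta>" "!!k. k \<E> n ==> ap \<theta> (ap p k) = ap s k" using IsoV_iso[OF I] u by metis
    have "is_index E u" using index_image[OF \<theta>(1) _ c(1)] iiso_img[OF \<theta>(1)] by (simp add: Sub_iff)
    moreover have "Sub u (V \<delta>)" using s_sub[OF that(1) fs] u by (auto simp: Sub_iff)
    ultimately have ui: "u \<E> indices E (V \<delta>)" by simp
    have "lift_val E f a c u = ap f (img (ap s) (dm a))" "lift_val E g b c u = ap g (img (ap s) (dm b))"
      using lift_iso[OF ui a \<theta>(1)] lift_iso[OF ui b \<theta>(1)] IsoV_proj[OF \<theta>(2) a(1)] IsoV_proj[OF \<theta>(2) b(1)] by simp_all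
    then show ?thesis using ui q by simp
  qed
  have RlN: "Rl p c (pr a b) (hj (dm a)) (hj (dm b))"
    unfolding Rl_def using Ran_iff[OF p(1)] pc Im_iff[OF p(1), of "dm a" a] Im_iff[OF p(1), of "dm b" b]
      p_dm[OF a(1)] p_dm[OF b(1)] dm_fix by (simp add: mem_dm)
  show ?thesis
  proof
    assume J1: "J ?Q1 c"
    show "J ?Q2 (pr a b)"
      by (rule J_imp3[of IsoV ?Q1 ?Q2 Rl "dm a" "dm b" p c "pr a b", OF DI D1 D2 Rl0 dm_fix(1) dm_fix(1) _ RlN J_IsoV J1 abN])
        (use key in blast)
  next
    assume J2: "J ?Q2 (pr a b)"
    show "J ?Q1 c"
      by (rule J_imp3[of IsoV ?Q2 ?Q1 "%s q u. Rl s u q" "dm a" "dm b" p "pr a b" c,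
            OF DI D2 D1 Rl0 dm_fix(1) dm_fix(1) _ RlN J_IsoV J2 cN])
        (use key in blast)
  qed
qed

text \<open>A seed inside an index needs no index of its own: \<open>f\<close> sends a copy
  \<open>u\<close> of \<open>c\<close> to the value of \<open>F\<close> at the element of
  \<open>u\<close> corresponding to \<open>y\<close>. Uniqueness of isomorphisms makes this well
  defined.\<close>

lemma ext_elem:
  assumes y: "y \<E> c"
  obtains f where "fnc f (indices E (V \<delta>))" "J (%q. EX u v. q = pr u v & ap f u = ap F v) (pr c y)"
proof -
  define t where "t u = so (%z. EX q. is_index E u & iiso c u q & z \<E> ap F (ap q y))" for u
  have ex: "EX w. ALL z. z \<E> w \<longleftrightarrow> (EX q. is_index E u & iiso c u q & z \<E> ap F (ap q y))" for u
  proof (cases "EX q. is_index E u & iiso c u q")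
    case True
    then obtain q where q: "is_index E u" "iiso c u q" by blast
    then have "(EX q. is_index E u & iiso c u q & z \<E> ap F (ap q y)) \<longleftrightarrow> z \<E> ap F (ap q y)" for z
      using iiso_unique[OF _ q(2,1)] by blast
    then show ?thesis by (intro exI[of _ "ap F (ap q y)"]) blast
  next
    case False then show ?thesis by (intro exI[of _ emp]) auto
  qed
  have Dt: "Df (%C e. t (e 0))" unfolding t_def by (rule Df_setof, intro dfn, rule set_ex1[OF ex])
  have t: "t u = ap F (ap q y)" if q: "is_index E u" "iiso c u q" for u q
  proof (rule ext)
    fix z
    have "z \<E> t u \<longleftrightarrow> (EX q. is_index E u & iiso c u q & z \<E> ap F (ap q y))" unfolding t_def by (rule setof_mem[OF ex])
    then show "z \<E> t u \<longleftrightarrow> z \<E> ap F (ap q y)" using iiso_unique[OF _ q(2,1)] q by blast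
  qed
  let ?f = "lam (indices E (V \<delta>)) t"
  obtain k where k: "k \<E> n" "ap p k = y" using p(3)[OF y] by blast
  have DI: "D (%C e. IsoV (e 0))" by (intro dfn)
  have D2: "D (%C e. EX u v. e 0 = pr u v & ap ?f u = ap F v)" by (intro dfn)
  have ko: "k \<E> om" using n_om[OF k(1)] .
  have cN: "c \<E> N" by (rule N_sub) (simp add: Sub_iff)
  have cy: "pr c y \<E> N" using N_pr cN N_elem[OF cN y] by simp
  show thesis
  proof (rule that[OF fnc_lam[OF Dt]])
    show "J (%q. EX u v. q = pr u v & ap ?f u = ap F v) (pr c y)"
    proof (rule J_imp2[OF DI D2, of "%s q k b. EX x y. q = pr x y & Ran s x & pr k y \<E> s" k emp p])
      show "D0 (%e. EX x y. e 1 = pr x y & Ran (e 0) x & pr (e 2) y \<E> e 0)" by (intro d0 D0_pr_comp)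
      show "k \<E> V \<delta>" "emp \<E> V \<delta>" using om_sub[OF ko] emp_V by auto
      show "EX x y'. pr c y = pr x y' & Ran p x & pr (hj k) y' \<E> p"
        using Ran_iff[OF p(1)] pc h_om_elem[OF ko] fnc_ap[OF p(1) k(1)] k(2) by auto
      fix s q assume s: "s \<E> V \<delta>" "q \<E> V \<delta>" "EX x y. q = pr x y & Ran s x & pr k y \<E> s" "IsoV s"
      have fs: "fnc s n" using s(4) by (simp add: IsoV_def)
      then have q: "q = pr (img (ap s) n) (ap s k)" using s(3) Ran_iff[OF fs] fnc_pr[OF fs] by auto
      obtain \<theta> where \<theta>: "iiso c (img (ap s) n) \<theta>" "!!k. k \<E> n ==> ap \<theta> (ap p k) = ap s k"
        using IsoV_iso[OF s(4)] by metis
      have "img (ap \<theta>) c = img (ap s) n" by (rule iiso_img[OF \<theta>(1)])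
      then have ui: "is_index E (img (ap s) n)" using index_image[OF \<theta>(1) _ c(1)] by (simp add: Sub_iff)
      moreover have "Sub (img (ap s) n) (V \<delta>)" using s_sub[OF s(1) fs] by (auto simp: Sub_iff)
      ultimately have "ap ?f (img (ap s) n) = t (img (ap s) n)" using ap_lam[OF Dt] by simp
      also have "\<dots> = ap F (ap s k)" using t[OF ui \<theta>(1)] \<theta>(2)[OF k(1)] k(2) by simp
      finally show "EX u v. q = pr u v & ap ?f u = ap F v" using q by blast
    qed (use J_IsoV cy in auto)
  qed
qed

end

section \<open>Translation between indices and seeds\<close>

context pre_wit
begin

definition hold :: "('v => 'v => bool) => 'v => 'v => 'v => 'v => bool" where
  "hold R y F z G \<longleftrightarrow> J (%q. EX u v. q = pr u v & R (ap F u) (ap G v)) (pr y z)"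

lemma D_Jmem [dfn]: assumes "Df s" "Df t" shows "D (%C e. J (%x. x \<E> s C e) (t C e))"
proof -
  have ex: "EX z. ALL x. x \<E> z \<longleftrightarrow> x \<E> V \<alpha> & x \<E> A" for \<alpha> A by (rule separation, intro dfn)
  have "Df (%C e. so (%x. x \<E> V (e 0) & x \<E> s C (%n. e (Suc n))))"
    by (rule Df_setof, intro dfn assms[THEN Df_ren], rule set_ex1[OF ex])
  then show ?thesis unfolding J_def sp_def by (intro dfn assms[THEN Df_ren])
qed

abbreviation "Ej \<equiv> derived_extender E \<delta> N j"

lemma ext_mem:
  assumes A: "Sub A (V \<delta>)"
  shows "pr A c \<E> Ej \<longleftrightarrow> c \<E> indices E N & J (%x. x \<E> A) c"
proof -
  have JA: "(EX \<alpha>:el \<delta>. a \<E> app E j (so (%x. x \<E> A & x \<E> VV \<alpha>))) \<longleftrightarrow> J (%x. x \<E> A) a" if "Sub A (V \<delta>)" for A a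
  proof -
    have DA: "D (%C e. e 0 \<E> A)" by (intro dfn)
    have "app E j (so (%x. x \<E> A & x \<E> VV \<alpha>)) = hj (sp \<alpha> (%x. x \<E> A))" if a: "\<alpha> \<E> \<delta>" for \<alpha>
      using j_app[OF sp_V[OF DA a]] VV_eq[OF Ord_elem[OF o\<delta> a]] unfolding sp_def by (simp add: conj_commute)
    then show ?thesis unfolding J_def el_bex by auto
  qed
  have "EX z. ALL p. p \<E> z \<longleftrightarrow> (EX A a. p = pr A a & a \<E> indices E N & Sub A (V \<delta>) & J (%x. x \<E> A) a)"
    by (rule comp_ex[of _ "prod (Pw (V \<delta>)) (indices E N)"], intro dfn) (auto simp: mem_prod)
  moreover have "(EX A a. p = pr A a & a \<E> indices E N & Sub A (VV \<delta>) &
      (EX \<alpha>:el \<delta>. a \<E> app E j (so (%x. x \<E> A & x \<E> VV \<alpha>)))) \<longleftrightarrow>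
    (EX A a. p = pr A a & a \<E> indices E N & Sub A (V \<delta>) & J (%x. x \<E> A) a)" for p
    unfolding VV_eq[OF o\<delta>] using JA by blast
  ultimately have "p \<E> Ej \<longleftrightarrow> (EX A a. p = pr A a & a \<E> indices E N & Sub A (V \<delta>) & J (%x. x \<E> A) a)" for p
    unfolding derived_extender_def by (simp add: setof_mem)
  then show ?thesis using A by auto
qed

lemma ult_pair_iff: "ult_pair E \<delta> N a f \<longleftrightarrow> is_index E a & Sub a N & fnc f (indices E (V \<delta>))"
  by (simp add: ult_pair_def VV_eq[OF o\<delta>])

text \<open>Any index \<open>c\<close> containing both \<open>a\<close> and \<open>b\<close> gives
  the same answer, since by \<open>ext_ult\<close> it is the one for the seeds;
  \<open>index_extend\<close> provides such a \<open>c\<close>.\<close>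

lemma ult_iff:
  assumes a: "ult_pair E \<delta> N a f" and b: "ult_pair E \<delta> N b g" and R: "D (%C e. R (e 0) (e 1))"
  shows "ult_holds E R \<delta> N Ej a f b g \<longleftrightarrow> hold R a f b g"
proof -
  have a': "is_index E a" "Sub a N" "fnc f (indices E (V \<delta>))" and b': "is_index E b" "Sub b N" "fnc g (indices E (V \<delta>))"
    using a b by (auto simp: ult_pair_iff)
  have *: "pr (so (%u. u \<E> indices E (VV \<delta>) & R (lift_val E f a c u) (lift_val E g b c u))) c \<E> Ej \<longleftrightarrow> hold R a f b g"
    if cc: "is_index E c" "Sub c N" "Sub a c" "Sub b c" for c
  proof -
    obtain n p where nn: "n \<E> om" "bijection E p n c"
      using cc(1) unfolding is_index_iff finite_set_def el_bex by blast
    interpret enum_index E P \<kappa> \<delta> N j c n p by unfold_locales (use cc nn in auto)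
    let ?Q = "%u. u \<E> indices E (V \<delta>) & R (lift_val E f a c u) (lift_val E g b c u)"
    have "D (%C e. ?Q (e 0))"
    proof (rule D_cong)
      show "D (%C e. e 0 \<E> indices E (V \<delta>) & (EX y z. liftr f a c (e 0) y & liftr g b c (e 0) z & R y z))"
        by (intro dfn D_pred2[OF R])
      show "(e 0 \<E> indices E (V \<delta>) & (EX y z. liftr f a c (e 0) y & liftr g b c (e 0) z & R y z)) \<longleftrightarrow> ?Q (e 0)" for e
        using lift_iff[OF _ cc(3) a'(1,3), of "e 0"] lift_iff[OF _ cc(4) b'(1,3), of "e 0"] by metis
    qed
    then have ex: "EX z. ALL u. u \<E> z \<longleftrightarrow> ?Q u" by (rule comp_ex[of _ "indices E (V \<delta>)"]) blast
    let ?A = "so ?Q"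
    have A: "u \<E> ?A \<longleftrightarrow> ?Q u" for u by (rule setof_mem[OF ex])
    have "Sub ?A (V \<delta>)"
      unfolding Sub_iff A
    proof (intro allI impI)
      fix u assume u: "?Q u"
      obtain m g where m: "m \<E> om" "bijection E g m u"
        using u unfolding mem_indices is_index_iff finite_set_def el_bex by blast
      show "u \<E> V \<delta>"
        using finite_V[OF m] u by (simp add: Sub_iff)
    qed
    moreover have "(%x. x \<E> ?A) = ?Q" using A by blast
    ultimately show ?thesis
      using ext_mem[of ?A c] cc ext_ult[OF cc(3) a'(1,3) cc(4) b'(1,3) R] VV_eq[OF o\<delta>] unfolding hold_def by simp
  qed
  obtain c where "is_index E c" "Sub c N" "Sub a c" "Sub b c"
    using index_extend[OF a'(1,2) _ b'(2)] b'(1) unfolding is_index_iff by metis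
  then show ?thesis unfolding ult_holds_def using * by (auto simp del: mem_indices simp: mem_indices)
qed

lemma rep_index:
  assumes "y \<E> N"
  obtains a f where "ult_pair E \<delta> N a f" "hold (=) a f y F"
proof -
  obtain c where cc: "is_index E c" "Sub c N" "y \<E> c"
    using index_extend1[OF assms index_emp] by (auto simp: Sub_iff)
  obtain n p where nn: "n \<E> om" "bijection E p n c"
    using cc(1) unfolding is_index_iff finite_set_def el_bex by blast
  interpret enum_index E P \<kappa> \<delta> N j c n p by unfold_locales (use cc nn in auto)
  obtain f where "fnc f (indices E (V \<delta>))" "J (%q. EX u v. q = pr u v & ap f u = ap F v) (pr c y)"
    by (rule ext_elem[OF cc(3), of F])
  then show thesis using that[of c f] cc by (simp add: ult_pair_iff hold_def)
qed

end

section \<open>The ultrapower\<close>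

context zf2
begin

text \<open>Iterate \<open>g\<close> through \<open>om\<close>, each time passing to the successor
  of the maximum of the last value and its image. Uncountable cofinality keeps the supremum below
  \<delta>, and monotonicity makes it closed.\<close>

lemma cof_closure:
  assumes \<delta>: "Lim \<delta>" "om \<E> cof E \<delta>" and g: "Df (%C e. g (e 0))" "!!\<beta>. \<beta> \<E> \<delta> ==> g \<beta> \<E> \<delta>"
    and mono: "!!\<beta> \<gamma>. \<gamma> \<E> \<delta> ==> \<beta> \<E> \<gamma> ==> Sub (g \<beta>) (g \<gamma>)" and \<beta>0: "\<beta>0 \<E> \<delta>"
  shows "EX b. b \<E> \<delta> & \<beta>0 \<E> b & (ALL \<beta>. \<beta> \<E> b --> g \<beta> \<E> b)"
proof -
  have o\<delta>: "Ord \<delta>" using \<delta>(1) by (rule Lim_Ord)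
  have "Df (%C e. sc (un2 (e 0) (g (e 0))))" by (intro dfn Df_fun1[OF g(1)])
  from om_recursion[OF this, of "sc \<beta>0"] obtain s where s: "Df (%C e. s (e 0))" "s emp = sc \<beta>0"
    "!!n. n \<E> om ==> s (sc n) = sc (un2 (s n) (g (s n)))" by blast
  have mx: "un2 a b \<E> \<delta>" if ab: "a \<E> \<delta>" "b \<E> \<delta>" for a b
  proof -
    obtain d where d: "d \<E> \<delta>" "Sub a d" "Sub b d" using Ord_max[OF o\<delta> ab] by blast
    have "un2 a b = Uni (upair a b)" by (rule ext) auto
    then have "Ord (un2 a b)" using Ord_Uni[of "upair a b"] Ord_elem[OF o\<delta>] ab by auto
    moreover have "Sub (un2 a b) d" using d by (auto simp: Sub_iff)
    ultimately show ?thesis using Ord_sub_le[of "un2 a b" d] Ord_elem[OF o\<delta> d(1)] d(1) Ord_trans[OF o\<delta> d(1)] by auto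
  qed
  have s\<delta>: "s n \<E> \<delta>" if "n \<E> om" for n
  proof (rule om_induct[of "%n. s n \<E> \<delta>", OF _ that], goal_cases)
    case 1 show ?case by (intro dfn Df_fun1[OF s(1)])
  next
    case 2 show ?case using s(2) \<beta>0 \<delta>(1) by (simp add: Lim_def)
  next
    case (3 n) then show ?case using s(3) mx[OF 3(2) g(2)[OF 3(2)]] \<delta>(1) by (simp add: Lim_def)
  qed
  let ?b = "Uni (img s om)"
  have b: "x \<E> ?b \<longleftrightarrow> (EX n. n \<E> om & x \<E> s n)" for x by (auto simp: mem_img[OF s(1)])
  have ob: "Ord ?b" by (rule Ord_Uni) (use s\<delta> Ord_elem[OF o\<delta>] in \<open>auto simp: mem_img[OF s(1)]\<close>)
  have "~ cofmap (lam om s) om \<delta>" using om_cof[OF o\<delta>] \<delta> by (auto simp: Lim_def)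
  then have "EX x. x \<E> \<delta> & (ALL n. n \<E> om --> ~ (x \<E> s n | x = s n))"
    using fnc_lam[OF s(1), of om] s\<delta> unfolding cofmap_def maps_iff el_ball el_bex ord_le_iff
    by (simp add: ap_lam[OF s(1)] cong: conj_cong)
  then obtain x where x: "x \<E> \<delta>" "ALL n. n \<E> om --> ~ (x \<E> s n | x = s n)" by blast
  then have "s n \<E> x" if "n \<E> om" for n
    using Ord_linear[OF Ord_elem[OF o\<delta> x(1)] Ord_elem[OF o\<delta> s\<delta>[OF that]]] that by blast
  then have "Sub ?b x" unfolding Sub_iff b using Ord_trans[OF Ord_elem[OF o\<delta> x(1)]] by blast
  then have "?b \<E> x | ?b = x" using Ord_sub_le[OF ob Ord_elem[OF o\<delta> x(1)]] by blast
  then have "?b \<E> \<delta>"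
  proof
    show "?b \<E> \<delta>" if "?b \<E> x" using Ord_trans[OF o\<delta> x(1) that] .
    show "?b \<E> \<delta>" if "?b = x" using x(1) by (simp only: that)
  qed
  moreover have "\<beta>0 \<E> ?b" unfolding b using s(2) by (intro exI[of _ emp]) simp
  moreover have "g \<beta> \<E> ?b" if \<beta>b: "\<beta> \<E> ?b" for \<beta>
  proof -
    obtain n where n: "n \<E> om" "\<beta> \<E> s n" using \<beta>b unfolding b by blast
    have "Sub (g \<beta>) (un2 (s n) (g (s n)))" using mono[OF s\<delta>[OF n(1)] n(2)] by (auto simp: Sub_iff)
    moreover have "Ord (g \<beta>)" using g(2)[of \<beta>] Ord_elem[OF o\<delta>] Ord_trans[OF o\<delta> s\<delta>[OF n(1)] n(2)] by blast
    moreover have "Ord (un2 (s n) (g (s n)))" using mx[OF s\<delta>[OF n(1)] g(2)[OF s\<delta>[OF n(1)]]] Ord_elem[OF o\<delta>] by blast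
    ultimately have "g \<beta> \<E> s (sc n)" using Ord_sub_le[of "g \<beta>" "un2 (s n) (g (s n))"] s(3)[OF n(1)] by auto
    then show ?thesis unfolding b using om_sc[OF n(1)] by blast
  qed
  ultimately show ?thesis by blast
qed

text \<open>The components are described by their elements; both are empty off pairs, so
  \<open>fs\<close> and \<open>sn\<close> are definable everywhere.\<close>

definition fs where "fs p = so (%v. EX a f. p = pr a f & v \<E> a)"
definition sn where "sn p = so (%v. EX a f. p = pr a f & v \<E> f)"

lemma fs_sn_ex: "EX z. ALL v. v \<E> z \<longleftrightarrow> (EX a f. p = pr a f & v \<E> a)" "EX z. ALL v. v \<E> z \<longleftrightarrow> (EX a f. p = pr a f & v \<E> f)"
proof -
  consider a f where "p = pr a f" | "\<nexists>a f. p = pr a f" by blast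
  then show "EX z. ALL v. v \<E> z \<longleftrightarrow> (EX a f. p = pr a f & v \<E> a)"
    by cases (auto intro: exI[of _ emp])
  consider a f where "p = pr a f" | "\<nexists>a f. p = pr a f" by blast
  then show "EX z. ALL v. v \<E> z \<longleftrightarrow> (EX a f. p = pr a f & v \<E> f)"
    by cases (auto intro: exI[of _ emp])
qed

lemma fs_pr [simp]: "fs (pr a f) = a" and sn_pr [simp]: "sn (pr a f) = f"
  unfolding fs_def sn_def by (rule setof_eq, simp)+

lemma Df_fs [dfn]: assumes "Df s" shows "Df (%w e. fs (s w e))"
  unfolding fs_def by (rule Df_setof, intro dfn assms[THEN Df_ren], rule set_ex1[OF fs_sn_ex(1)])

lemma Df_sn [dfn]: assumes "Df s" shows "Df (%w e. sn (s w e))"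
  unfolding sn_def by (rule Df_setof, intro dfn assms[THEN Df_ren], rule set_ex1[OF fs_sn_ex(2)])

text \<open>The transitive collapse of a set of ordinals: \<open>F x\<close> collects the values at
  the elements of \<open>x\<close> in \<open>S\<close>. It is defined on all sets so that
  \<open>eps_recursion\<close> applies.\<close>

lemma order_type:
  assumes S: "!!x. x \<E> S ==> Ord x"
  obtains F where "Df (%C e. F (e 0))" "!!x y. y \<E> x ==> y \<E> S ==> F y \<E> F x" "!!x. Ord x ==> Ord (F x)" "Ord (img F S)"
proof -
  have ex: "EX w. ALL z. z \<E> w \<longleftrightarrow> (EX y. y \<E> x & y \<E> S & z = ap f y)" for x f
    by (rule comp_ex[of _ "img (ap f) x"], intro dfn) auto
  have "Df (%C e. so (%z. EX y. y \<E> e 0 & y \<E> S & z = ap (e 1) y))"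
    by (rule Df_setof, intro dfn, rule set_ex1[OF ex])
  from eps_recursion[of "%x f. so (%z. EX y. y \<E> x & y \<E> S & z = ap f y)", OF this] obtain F where
    F: "Df (%C e. F (e 0))" "!!x. F x = so (%z. EX y. y \<E> x & y \<E> S & z = ap (lam x F) y)" by blast
  have m: "z \<E> F x \<longleftrightarrow> (EX y. y \<E> x & y \<E> S & z = F y)" for x z
    by (subst F(2), subst setof_mem[OF ex]) (auto simp: ap_lam[OF F(1)])
  have oF: "Ord (F x)" if "Ord x" for x
  proof (rule Ord_induct[of "%x. Ord (F x)", OF _ that], intro dfn Df_fun1[OF F(1)])
    fix x assume x: "Ord x" and IH: "!!y. y \<E> x ==> Ord (F y)"
    show "Ord (F x)"
    proof (rule Ord_transI)
      show "Ord z" if "z \<E> F x" for z using that IH m by auto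
      show "w \<E> F x" if "z \<E> F x" "w \<E> z" for z w using that m Ord_trans[OF x] by metis
    qed
  qed
  show thesis
  proof (rule that[OF F(1) _ oF])
    show "F y \<E> F x" if "y \<E> x" "y \<E> S" for x y using that m by blast
    show "Ord (img F S)"
    proof (rule Ord_transI)
      show "Ord z" if "z \<E> img F S" for z using that oF S by (auto simp: mem_img[OF F(1)])
      show "w \<E> img F S" if "z \<E> img F S" "w \<E> z" for z w using that m by (auto simp: mem_img[OF F(1)])
    qed
  qed
qed

end

section \<open>Relations between pairs of a seed and a function\<close>

context pre_wit
begin

lemma D_holdQ: assumes "D (%C e. R (e 0) (e 1))"
  shows "D (%C e. EX u v. e 0 = pr u v & R (ap F u) (ap G v))"
  by (intro dfn D_pred2[OF assms])

lemma D_hold: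
  assumes R: "D (%C e. R (e 0) (e 1))" and "Df s" "Df t" "Df u" "Df v"
  shows "D (%C e. hold R (s C e) (t C e) (u C e) (v C e))"
proof -
  have ex: "EX z. ALL x. x \<E> z \<longleftrightarrow> x \<E> V \<alpha> & (EX u v. x = pr u v & R (ap F u) (ap G v))" for \<alpha> F G
    by (rule separation, rule D_holdQ[OF R])
  have "Df (%C e. so (%x. x \<E> V (e 0) & (EX y z. x = pr y z &
      R (ap (t C (%n. e (Suc n))) y) (ap (v C (%n. e (Suc n))) z))))"
    by (rule Df_setof, intro dfn D_pred2[OF R] assms(2-)[THEN Df_ren], rule set_ex1[OF ex])
  then show ?thesis unfolding hold_def J_def sp_def by (intro dfn assms(2-)[THEN Df_ren])
qed

lemma hold_N: assumes "hold R y F z G" "D (%C e. R (e 0) (e 1))" shows "y \<E> N" "z \<E> N"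
  using J_N[OF assms(1)[unfolded hold_def] D_holdQ[OF assms(2)]] N_pr by auto

text \<open>Over a common seed a relation between two elements is a predicate of one variable; the
  two seeds \<open>y\<close> and \<open>pr y y\<close> determine each other by a bounded
  relation.\<close>

lemma hold_diag:
  assumes R: "D (%C e. R (e 0) (e 1))"
  shows "y \<E> N ==> J (%u. R (ap F u) (ap G u)) y \<longleftrightarrow> hold R y F y G"
proof -
  assume y: "y \<E> N"
  have D1: "D (%C e. R (ap F (e 0)) (ap G (e 0)))" by (intro D_pred2[OF R] dfn)
  show ?thesis
  proof
    assume J: "J (%u. R (ap F u) (ap G u)) y"
    show "hold R y F y G" unfolding hold_def
      by (rule J_imp2[OF D1 D_holdQ[OF R, of F G], of "%u w a b. w = pr u u" emp emp y])
        (use J y emp_V N_pr in \<open>auto intro: d0\<close>)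
  next
    assume J: "hold R y F y G"
    show "J (%u. R (ap F u) (ap G u)) y"
      by (rule J_imp2[OF D_holdQ[OF R, of F G] D1, of "%w u a b. w = pr u u" emp emp "pr y y"])
        (use J[unfolded hold_def] y emp_V N_pr in \<open>auto intro: d0\<close>)
  qed
qed

lemma hold_sym:
  assumes R: "D (%C e. R (e 0) (e 1))" and h: "hold R y F z G"
  shows "hold (%x y. R y x) z G y F"
proof -
  have D2: "D (%C e. EX u v. e 0 = pr u v & R (ap F v) (ap G u))" by (intro dfn D_pred2[OF R])
  have Rl: "D0 (%e. EX u v. e 0 = pr u v & e 1 = pr v u)" by (intro D0_pr_comp d0)
  show ?thesis unfolding hold_def
    by (rule J_imp2[OF D_holdQ[OF R, of F G] D2, of "%p q a b. EX u v. p = pr u v & q = pr v u" emp emp "pr y z"])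
      (use h hold_N[OF h R] emp_V N_pr Rl in \<open>auto simp: hold_def\<close>)
qed

lemma hold_trans:
  assumes R: "D (%C e. R (e 0) (e 1))" "D (%C e. S (e 0) (e 1))" "D (%C e. T (e 0) (e 1))"
    and h: "hold R x F y G" "hold S y G z H" and imp: "!!a b c. R a b ==> S b c ==> T a c"
  shows "hold T x F z H"
proof -
  have Rl: "D0 (%e. EX u v. e 0 = pr u v & (EX v' w. e 1 = pr v' w & v' = v & e 2 = pr u w))" by (intro D0_pr_comp d0)
  show ?thesis unfolding hold_def
    by (rule J_imp3[OF D_holdQ[OF R(1), of F G] D_holdQ[OF R(2), of G H] D_holdQ[OF R(3), of F H],
          of "%p q r a b. EX u v. p = pr u v & (EX v' w. q = pr v' w & v' = v & r = pr u w)" emp emp "pr x y" "pr y z"])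
      (use h hold_N(1)[OF h(1) R(1)] hold_N(2)[OF h(2) R(2)] emp_V N_pr Rl imp in \<open>auto simp: hold_def\<close>)
qed

lemma DE: "D (%C e. e 0 = e 1)" and DM: "D (%C e. e 0 \<E> e 1)" and DR: "D (%C e. rk (e 0) \<E> rk (e 1))"
  and DRle: "D (%C e. ~ rk (e 1) \<E> rk (e 0))"
  by (intro dfn)+

lemma hold_refl: "y \<E> N ==> hold (=) y F y F"
  using hold_diag[OF DE, of y F F] J_True by simp

lemma hold_eq_sym: "hold (=) y F z G ==> hold (=) z G y F"
  using hold_sym[OF DE, of y F z G] by (simp add: eq_commute[of _ "_::'v"])

lemma hold_eq_trans: "hold (=) x F y G ==> hold (=) y G z H ==> hold (=) x F z H"
  by (rule hold_trans[OF DE DE DE]) auto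

lemma hold_mem_cong: "hold (=) x F x' F' ==> hold (\<E>) x' F' y' G' ==> hold (=) y' G' y G ==> hold (\<E>) x F y G"
  by (rule hold_trans[OF DE DM DM, of x F x' F' y G], assumption, rule hold_trans[OF DM DE DM]) auto

definition Cl where "Cl a f p \<longleftrightarrow> (EX b g. p = pr b g & ult_pair E \<delta> N b g & hold (=) a f b g)"

lemma D_Cl [dfn]: assumes "Df s" shows "D (%C e. Cl a f (s C e))"
  unfolding Cl_def ult_pair_iff by (intro dfn D_hold[OF DE] assms[THEN Df_ren])

lemma pair_N: "ult_pair E \<delta> N a f ==> a \<E> N"
proof -
  assume "ult_pair E \<delta> N a f"
  then have a: "is_index E a" "Sub a N" by (auto simp: ult_pair_iff)
  then obtain n p where n: "n \<E> om" "bijection E p n a" unfolding is_index_iff finite_set_def el_bex by blast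
  interpret enum_index E P \<kappa> \<delta> N j a n p by unfold_locales (use a n in auto)
  show "a \<E> N" by (rule N_sub) (simp add: Sub_iff)
qed

lemma mem_ult_class:
  assumes a: "ult_pair E \<delta> N a f"
  shows "p \<E> ult_class E \<delta> N Ej a f \<longleftrightarrow> Cl a f p & (ALL p'. Cl a f p' --> ord_le E (rk p) (rk p'))"
    "EX p. p \<E> ult_class E \<delta> N Ej a f"
proof -
  have eq: "((EX b g. p = pr b g & ult_pair E \<delta> N b g & ult_holds E (=) \<delta> N Ej a f b g) &
     (ALL b g. ult_pair E \<delta> N b g & ult_holds E (=) \<delta> N Ej a f b g --> ord_le E (rk p) (rk (pr b g)))) \<longleftrightarrow>
     Cl a f p & (ALL p'. Cl a f p' --> ord_le E (rk p) (rk p'))" for p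
    unfolding Cl_def using ult_iff[OF a _ DE] by blast
  let ?M = "%x. EX p. Cl a f p & rk p = x"
  have "Cl a f (pr a f)" using a hold_refl[OF pair_N[OF a]] by (auto simp: Cl_def)
  then have M0: "?M (rk (pr a f))" by blast
  have DM0: "D (%C e. ?M (e 0))" by (intro dfn)
  obtain \<rho> where \<rho>: "Ord \<rho>" "?M \<rho>" "!!c. c \<E> \<rho> ==> ~ ?M c"
    by (rule Ord_least[of ?M, OF DM0 Ord_rk M0]) blast
  obtain p0 where p0: "Cl a f p0" "rk p0 = \<rho>" using \<rho>(2) by blast
  have min: "ALL p'. Cl a f p' --> ord_le E (rk p0) (rk p')"
    using p0 \<rho>(3) Ord_linear[OF \<rho>(1) Ord_rk] unfolding ord_le_iff by blast
  have ex: "EX z. ALL p. p \<E> z \<longleftrightarrow> Cl a f p & (ALL p'. Cl a f p' --> ord_le E (rk p) (rk p'))"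
  proof (rule comp_ex[of _ "V (sc \<rho>)"], intro dfn)
    fix p assume "Cl a f p & (ALL p'. Cl a f p' --> ord_le E (rk p) (rk p'))"
    then show "p \<E> V (sc \<rho>)" using p0 \<rho>(1) mem_V_rk[of "sc \<rho>" p] by (auto simp: ord_le_iff)
  qed
  show *: "p \<E> ult_class E \<delta> N Ej a f \<longleftrightarrow> Cl a f p & (ALL p'. Cl a f p' --> ord_le E (rk p) (rk p'))" for p
    unfolding ult_class_def eq by (rule setof_mem[OF ex])
  show "EX p. p \<E> ult_class E \<delta> N Ej a f" using * p0 min by blast
qed

lemma ult_class_eq:
  assumes a: "ult_pair E \<delta> N a f" and b: "ult_pair E \<delta> N b g"
  shows "ult_class E \<delta> N Ej a f = ult_class E \<delta> N Ej b g \<longleftrightarrow> hold (=) a f b g"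
proof
  assume eq: "ult_class E \<delta> N Ej a f = ult_class E \<delta> N Ej b g"
  obtain p where "p \<E> ult_class E \<delta> N Ej a f" using mem_ult_class(2)[OF a] by blast
  then have "Cl a f p" "Cl b g p" using mem_ult_class(1)[OF a, of p] mem_ult_class(1)[OF b, of p] eq by auto
  then show "hold (=) a f b g" unfolding Cl_def using hold_eq_sym hold_eq_trans by (metis pr_inject)
next
  assume "hold (=) a f b g"
  then have "Cl a f p \<longleftrightarrow> Cl b g p" for p unfolding Cl_def using hold_eq_sym hold_eq_trans by blast
  then show "ult_class E \<delta> N Ej a f = ult_class E \<delta> N Ej b g"
    by (intro ext) (simp add: mem_ult_class(1)[OF a] mem_ult_class(1)[OF b])
qed

lemma ult_class_rep:
  assumes a: "ult_pair E \<delta> N a f" and "p \<E> ult_class E \<delta> N Ej a f"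
  obtains b g where "p = pr b g" "ult_pair E \<delta> N b g" "hold (=) a f b g"
  using assms mem_ult_class(1)[OF a, of p] unfolding Cl_def by blast

lemma Ult0_mem_iff:
  assumes a: "ult_pair E \<delta> N a f" and b: "ult_pair E \<delta> N b g"
  shows "Ult0_mem E \<delta> N Ej (ult_class E \<delta> N Ej a f) (ult_class E \<delta> N Ej b g) \<longleftrightarrow> hold (\<E>) a f b g"
proof
  assume "Ult0_mem E \<delta> N Ej (ult_class E \<delta> N Ej a f) (ult_class E \<delta> N Ej b g)"
  then obtain a' f' b' g' where *: "ult_pair E \<delta> N a' f'" "ult_pair E \<delta> N b' g'"
    "ult_class E \<delta> N Ej a f = ult_class E \<delta> N Ej a' f'" "ult_class E \<delta> N Ej b g = ult_class E \<delta> N Ej b' g'"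
    "ult_holds E (\<E>) \<delta> N Ej a' f' b' g'" unfolding Ult0_mem_def by blast
  then have "hold (=) a f a' f'" "hold (=) b' g' b g" "hold (\<E>) a' f' b' g'"
    using ult_class_eq[OF a *(1)] ult_class_eq[OF b *(2)] hold_eq_sym ult_iff[OF *(1,2) DM] by auto
  then show "hold (\<E>) a f b g" using hold_mem_cong by blast
next
  assume "hold (\<E>) a f b g"
  then show "Ult0_mem E \<delta> N Ej (ult_class E \<delta> N Ej a f) (ult_class E \<delta> N Ej b g)"
    unfolding Ult0_mem_def using a b ult_iff[OF a b DM] by blast
qed

end

section \<open>Uncountable cofinality implies wellfoundedness\<close>

context pre_wit
begin

lemma hold_mono:
  assumes "D (%C e. R (e 0) (e 1))" "D (%C e. S (e 0) (e 1))" "!!x y. R x y ==> S x y" "hold R y F z G"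
  shows "hold S y F z G"
  unfolding hold_def
  by (rule J_mono[OF D_holdQ[OF assms(1)] D_holdQ[OF assms(2)] _ assms(4)[unfolded hold_def]]) (use assms(3) in blast)

text \<open>The plain negation of the predicate also covers sets that are not pairs. These drop out
  because the seed is a pair, a bounded fact that is carried along.\<close>

lemma hold_not:
  assumes R: "D (%C e. R (e 0) (e 1))" and N: "y \<E> N" "z \<E> N"
  shows "hold (%x y. ~ R x y) y F z G \<longleftrightarrow> ~ hold R y F z G"
proof -
  let ?Q = "%q. EX u v. q = pr u v & R (ap F u) (ap G v)"
  have DQ: "D (%C e. ?Q (e 0))" by (rule D_holdQ[OF R])
  have DnQ: "D (%C e. ~ ?Q (e 0))" by (rule D_not, rule DQ)
  have DR': "D (%C e. ~ R (e 0) (e 1))" by (rule D_not, rule R)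
  have Dn: "D (%C e. EX u v. e 0 = pr u v & ~ R (ap F u) (ap G v))" using D_holdQ[of "%x y. ~ R x y", OF DR'] .
  have N': "pr y z \<E> N" using N N_pr by simp
  have "J (%q. ~ ?Q q) (pr y z) \<longleftrightarrow> hold (%x y. ~ R x y) y F z G"
    unfolding hold_def
  proof
    assume J: "J (%q. ~ ?Q q) (pr y z)"
    have Rl: "D0 (%e. e 0 = e 1 & (EX u v. e 0 = pr u v & True))" by (intro d0 D0_pr_comp)
    show "J (%q. EX u v. q = pr u v & ~ R (ap F u) (ap G v)) (pr y z)"
      by (rule J_imp2[of "%q. ~ ?Q q" "%q. EX u v. q = pr u v & ~ R (ap F u) (ap G v)"
            "%p q a b. p = q & (EX u v. p = pr u v & True)" emp emp "pr y z" "pr y z", OF DnQ Dn Rl emp_V emp_V _ _ J N'])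
        blast+
  next
    assume J: "J (%q. EX u v. q = pr u v & ~ R (ap F u) (ap G v)) (pr y z)"
    show "J (%q. ~ ?Q q) (pr y z)" by (rule J_mono[OF Dn DnQ _ J]) auto
  qed
  then show ?thesis using J_not[OF DQ N'] by (simp add: hold_def)
qed

text \<open>Ranks are compared because this order is total up to ties: by \<open>hold_not\<close>,
  whatever is below a minimal element of a set is below all its elements.\<close>

definition less where "less p q \<longleftrightarrow> hold (%x y. rk x \<E> rk y) (fs p) (sn p) (fs q) (sn q)"

lemma D_less [dfn]: assumes "Df s" "Df t" shows "D (%w e. less (s w e) (t w e))"
  unfolding less_def by (intro D_hold[OF DR] dfn assms)

text \<open>The ranks of all values on \<open>V \<beta>\<close> of functions from the hull are
  indexed by the set \<open>?P\<close> in \<open>V \<delta>\<close>. Their order type is below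
  \<delta> by \<open>wLS_no_surj\<close>, so the normalized evaluation \<open>?r\<close> lies in
  \<open>V \<delta>\<close>. Its image attaches to each pair an ordinal that decreases along
  \<open>less\<close>.\<close>

lemma less_wf:
  assumes X: "fnc \<pi> X" "!!z. z \<E> c \<longleftrightarrow> (EX x. x \<E> X & z = ap \<pi> x)" "c \<E> V \<delta>"
    "!!x y. x \<E> X ==> y \<E> X ==> ap \<pi> x = ap \<pi> y ==> x = y"
    and \<beta>: "\<beta> \<E> \<delta>" and Z: "!!p. p \<E> Z ==> p \<E> X & fs p \<E> hj (V \<beta>)" and ne: "p0 \<E> Z"
  shows "EX m. m \<E> Z & (ALL p. p \<E> Z --> ~ less p m)"
proof -
  \<comment> \<open>The inverse of the collapsing map, described by elements.\<close>
  define H where "H z = so (%v. EX x. x \<E> X & ap \<pi> x = z & v \<E> x)" for z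
  have Hex: "EX s. ALL v. v \<E> s \<longleftrightarrow> (EX x. x \<E> X & ap \<pi> x = z & v \<E> x)" for z
    by (rule comp_ex[of _ "Uni X"], intro dfn) auto
  have H: "H (ap \<pi> x) = x" if "x \<E> X" for x
  proof (rule ext)
    fix v
    have "v \<E> H (ap \<pi> x) \<longleftrightarrow> (EX x'. x' \<E> X & ap \<pi> x' = ap \<pi> x & v \<E> x')" unfolding H_def by (rule setof_mem[OF Hex])
    then show "v \<E> H (ap \<pi> x) \<longleftrightarrow> v \<E> x" using X(4)[OF _ that] that by blast
  qed
  have DH: "Df (%C e. H (e 0))" unfolding H_def by (rule Df_setof, intro dfn, rule set_ex1[OF Hex])
  \<comment> \<open>\<open>sn q\<close> is the collapse of a pair in the hull, and the function of
    that pair is evaluated at \<open>fs q\<close>.\<close>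
  define ev where "ev q = rk (ap (sn (H (sn q))) (fs q))" for q
  have De: "Df (%C e. ev (e 0))" unfolding ev_def by (intro dfn Df_fun1[OF DH])
  let ?P = "prod (V \<beta>) c"
  let ?S = "img ev ?P"
  have oS: "Ord x" if "x \<E> ?S" for x using that by (auto simp: mem_img[OF De] ev_def)
  obtain F where F: "Df (%C e. F (e 0))" "!!x y. y \<E> x ==> y \<E> ?S ==> F y \<E> F x" "!!x. Ord x ==> Ord (F x)"
    "Ord (img F ?S)" by (rule order_type[of ?S], rule oS, assumption, rule that)
  define t where "t q = F (ev q)" for q
  have Dt: "Df (%C e. t (e 0))" unfolding t_def by (intro Df_fun1[OF F(1)] De)
  have o\<beta>: "Ord \<beta>" using Ord_elem[OF o\<delta> \<beta>] .
  obtain b where b: "b \<E> \<delta>" "c \<E> V b" using V\<delta>_ex[OF X(3)] by blast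
  obtain d where d: "d \<E> \<delta>" "Sub \<beta> d" "Sub b d" using Ord_max[OF o\<delta> \<beta> b(1)] by blast
  have od: "Ord d" using Ord_elem[OF o\<delta> d(1)] .
  let ?\<gamma> = "sc (sc d)"
  have \<gamma>: "?\<gamma> \<E> \<delta>" using \<delta>_Lim d(1) by (simp add: Lim_def)
  have PV: "q \<E> V ?\<gamma>" if q: "q \<E> ?P" for q
  proof -
    obtain u z where uz: "u \<E> V \<beta>" "z \<E> c" "q = pr u z" using q by (auto simp: mem_prod)
    have "u \<E> V d" using V_mono_Sub[OF o\<beta> od d(2) uz(1)] .
    moreover have "z \<E> V d" using V_mono_Sub[OF Ord_elem[OF o\<delta> b(1)] od d(3)] V_trans[OF Ord_elem[OF o\<delta> b(1)] b(2) uz(2)] by blast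
    ultimately show ?thesis using pr_rank[OF od] uz(3) by simp
  qed
  have P_V: "?P \<E> V \<delta>" by (rule V\<delta>_bd[OF \<gamma>]) (simp add: Sub_iff PV)
  let ?\<eta> = "img F ?S"
  have t\<eta>: "t q \<E> ?\<eta>" if "q \<E> ?P" for q using that by (auto simp: mem_img[OF F(1)] mem_img[OF De] t_def)
  have \<eta>\<delta>: "?\<eta> \<E> \<delta>"
  proof (rule ccontr)
    assume "~ ?\<eta> \<E> \<delta>"
    then have "\<delta> \<E> ?\<eta> | \<delta> = ?\<eta>" using Ord_not_mem[OF F(4) o\<delta>] by blast
    then have sub: "\<xi> \<E> ?\<eta>" if "\<xi> \<E> \<delta>" for \<xi> using that Ord_trans[OF F(4)] by metis
    show False
    proof (rule wLS_no_surj[OF w\<delta> \<gamma> Dt])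
      fix \<xi> assume "\<xi> \<E> \<delta>"
      then obtain s where s: "s \<E> ?S" "\<xi> = F s" using sub by (auto simp: mem_img[OF F(1)])
      then obtain q where q: "q \<E> ?P" "s = ev q" by (auto simp: mem_img[OF De])
      then show "EX x. x \<E> V ?\<gamma> & t x = \<xi>" using PV s(2) t_def by auto
    qed
  qed
  let ?r = "lam ?P t"
  have r: "fnc ?r ?P" "!!q. q \<E> ?P ==> ap ?r q = t q" using fnc_lam[OF Dt] ap_lam[OF Dt] by auto
  obtain g where g: "g \<E> \<delta>" "Sub ?\<gamma> g" "Sub ?\<eta> g" using Ord_max[OF o\<delta> \<gamma> \<eta>\<delta>] by blast
  have og: "Ord g" using Ord_elem[OF o\<delta> g(1)] .
  have rV: "?r \<E> V \<delta>"
  proof (rule V\<delta>_bd[of "sc (sc g)"])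
    show "sc (sc g) \<E> \<delta>" using \<delta>_Lim g(1) by (simp add: Lim_def)
    show "Sub ?r (V (sc (sc g)))"
      unfolding Sub_iff
    proof (intro allI impI)
      fix x assume "x \<E> ?r"
      then obtain q where q: "q \<E> ?P" "x = pr q (t q)" by (auto simp: mem_lam[OF Dt])
      have "q \<E> V g" using V_mono_Sub[OF _ og g(2) PV[OF q(1)]] od by simp
      moreover have "t q \<E> g" using t\<eta>[OF q(1)] g(3) by (simp add: Sub_iff)
      then have "t q \<E> V g" using Ord_V[OF og Ord_elem[OF og]] by blast
      ultimately show "x \<E> V (sc (sc g))" using pr_rank[OF og] q(2) by simp
    qed
  qed
  have fr: "fnc (hj ?r) (hj ?P)" using h_fnc(1)[OF r(1)] rV P_V by simp
  \<comment> \<open>The ordinal of \<open>p\<close>: the image of \<open>?r\<close>, taken at the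
    seed of \<open>p\<close> and at the image of its code in \<open>c\<close>.\<close>
  define \<xi> where "\<xi> p = ap (hj ?r) (pr (fs p) (hj (ap \<pi> p)))" for p
  have D\<xi>: "Df (%C e. \<xi> (e 0))" unfolding \<xi>_def by (intro dfn)
  have zc: "ap \<pi> p \<E> c" "ap \<pi> p \<E> V \<delta>" if "p \<E> Z" for p
  proof -
    show c: "ap \<pi> p \<E> c" using X(2) Z[OF that] by blast
    then show "ap \<pi> p \<E> V \<delta>" using V_trans[OF o\<delta> X(3)] by blast
  qed
  have inP: "pr (fs p) (hj (ap \<pi> p)) \<E> hj ?P" if "p \<E> Z" for p
  proof -
    define Q where "Q v c q \<longleftrightarrow> (ALL u:el v. ALL z:el c. pr u z \<E> q)" for v c q
    have "D0 (%e. Q (e 0) (e 1) (e 2))" unfolding Q_def by (intro d0)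
    moreover have "Q (V \<beta>) c ?P" by (auto simp: Q_def mem_prod)
    ultimately have "Q (hj (V \<beta>)) (hj c) (hj ?P)" using pres3[OF pres_j, of Q "V \<beta>" c ?P] V\<delta>[OF \<beta>] X(3) P_V by simp
    moreover have "hj (ap \<pi> p) \<E> hj c" using h_mem[of "ap \<pi> p" c] zc[OF that] X(3) by simp
    ultimately show ?thesis using Z[OF that] by (simp add: Q_def)
  qed
  have lt: "\<xi> p' \<E> \<xi> p" if p: "p \<E> Z" "p' \<E> Z" "less p' p" for p p'
  proof -
    let ?Q = "%q. EX u v. q = pr u v & rk (ap (sn p') u) \<E> rk (ap (sn p) v)"
    have DQ: "D (%C e. ?Q (e 0))" by (intro dfn)
    have J: "J ?Q (pr (fs p') (fs p))" using p(3) unfolding less_def hold_def .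
    obtain \<alpha> where \<alpha>: "\<alpha> \<E> \<delta>" "pr (fs p') (fs p) \<E> hj (V \<alpha>)" using N_level[OF J_N[OF J DQ]] by blast
    define Q where "Q s v z' z r \<longleftrightarrow> (ALL q:el s. ALL u:el v. ALL w:el v. q = pr u w -->
      (EX k x. pr k x \<E> r & k = pr u z' & (EX l y. pr l y \<E> r & l = pr w z & x \<E> y)))" for s v z' z r
    have "D0 (%e. Q (e 0) (e 1) (e 2) (e 3) (e 4))" unfolding Q_def by (intro d0)
    moreover have "Q (sp \<alpha> ?Q) (V \<beta>) (ap \<pi> p') (ap \<pi> p) ?r"
      unfolding Q_def
    proof (intro ballI impI)
      fix q u w assume q: "q \<in> el (sp \<alpha> ?Q)" "u \<in> el (V \<beta>)" "w \<in> el (V \<beta>)" "q = pr u w"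
      then have rk: "rk (ap (sn p') u) \<E> rk (ap (sn p) w)" using mem_sp[OF DQ, of q \<alpha>] by auto
      let ?k = "pr u (ap \<pi> p')" and ?l = "pr w (ap \<pi> p)"
      have kl: "?k \<E> ?P" "?l \<E> ?P" using q zc p by (auto simp: mem_prod)
      have e: "ev ?k = rk (ap (sn p') u)" "ev ?l = rk (ap (sn p) w)" using H Z p by (auto simp: ev_def)
      have "ev ?k \<E> ?S" using kl(1) by (auto simp: mem_img[OF De])
      then have "t ?k \<E> t ?l" unfolding t_def using F(2) rk e by simp
      moreover have "pr ?k (t ?k) \<E> ?r" "pr ?l (t ?l) \<E> ?r" using fnc_pr[OF r(1)] r(2) kl by auto
      ultimately show "EX k x. pr k x \<E> ?r & k = pr u (ap \<pi> p') & (EX l y. pr l y \<E> ?r & l = pr w (ap \<pi> p) & x \<E> y)" by blast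
    qed
    ultimately have "Q (hj (sp \<alpha> ?Q)) (hj (V \<beta>)) (hj (ap \<pi> p')) (hj (ap \<pi> p)) (hj ?r)"
      using pres5[OF pres_j, of Q "sp \<alpha> ?Q" "V \<beta>" "ap \<pi> p'" "ap \<pi> p" ?r] sp_V[OF DQ \<alpha>(1)] V\<delta>[OF \<beta>] zc p rV by simp
    moreover have "pr (fs p') (fs p) \<E> hj (sp \<alpha> ?Q)" using J J_iff[OF DQ \<alpha>] by blast
    ultimately obtain k x l y where "pr k x \<E> hj ?r" "k = pr (fs p') (hj (ap \<pi> p'))" "pr l y \<E> hj ?r"
      "l = pr (fs p) (hj (ap \<pi> p))" "x \<E> y" using Z p unfolding Q_def el_ball by blast
    then show ?thesis using ap_eq[OF fr] by (auto simp: \<xi>_def)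
  qed
  have "\<xi> p0 \<E> img \<xi> Z" using ne by (auto simp: mem_img[OF D\<xi>])
  then obtain x where x: "x \<E> img \<xi> Z" "ALL z. z \<E> x --> ~ z \<E> img \<xi> Z" using foundation by blast
  then obtain m where m: "m \<E> Z" "x = \<xi> m" by (auto simp: mem_img[OF D\<xi>])
  have "~ less p m" if "p \<E> Z" for p
    using lt[OF m(1) that] x(2) m(2) that by (auto simp: mem_img[OF D\<xi>])
  then show ?thesis using m(1) by blast
qed

text \<open>Let \<open>g \<beta>\<close> be the least level containing a member of the hull that
  lies below all its members of level \<beta>. Such a member exists by \<open>less_wf\<close> and
  totality of the order. At a closure point of \<open>g\<close>, which uncountable cofinality
  provides, the members of smaller levels have no minimal one, against
  \<open>less_wf\<close>.\<close>

lemma uncountable_cof_wf: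
  assumes cof: "om \<E> cof E \<delta>"
  shows "Ult0_wellfounded E \<delta> N Ej"
  unfolding Ult0_wellfounded_def
proof (intro allI impI, rule ccontr)
  fix B assume B: "el B ~= {} & el B \<subseteq> Ult0 E \<delta> N Ej"
    and no: "~ (EX w:el B. ALL w':el B. ~ Ult0_mem E \<delta> N Ej w' w)"
  have cls: "EX a f. ult_pair E \<delta> N a f & w = ult_class E \<delta> N Ej a f" if "w \<E> B" for w
    using B that by (auto simp: Ult0_def)
  let ?B = "Uni B"
  have mB: "EX a f. p = pr a f & ult_pair E \<delta> N a f & ult_class E \<delta> N Ej a f \<E> B" if p: "p \<E> ?B" for p
  proof -
    obtain w where w: "w \<E> B" "p \<E> w" using p by auto
    obtain a f where a: "ult_pair E \<delta> N a f" "w = ult_class E \<delta> N Ej a f" using cls[OF w(1)] by blast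
    obtain b g where b: "p = pr b g" "ult_pair E \<delta> N b g" "hold (=) a f b g"
      using ult_class_rep[OF a(1), of p] w(2) a(2) by blast
    then have "ult_class E \<delta> N Ej b g = w" using ult_class_eq[OF a(1) b(2)] a(2) by simp
    then show ?thesis using b w(1) by blast
  qed
  have pick: "EX b g. pr b g \<E> ?B & ult_pair E \<delta> N b g & hold (=) a f b g"
    if a: "ult_pair E \<delta> N a f" "ult_class E \<delta> N Ej a f \<E> B" for a f
  proof -
    obtain q where q: "q \<E> ult_class E \<delta> N Ej a f" using mem_ult_class(2)[OF a(1)] by blast
    obtain b g where "q = pr b g" "ult_pair E \<delta> N b g" "hold (=) a f b g" using ult_class_rep[OF a(1) q] by blast
    then show ?thesis using q a(2) by auto
  qed
  have nxt: "EX q. q \<E> ?B & hold (\<E>) (fs q) (sn q) (fs p) (sn p)" if p: "p \<E> ?B" for p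
  proof -
    obtain a f where a: "p = pr a f" "ult_pair E \<delta> N a f" "ult_class E \<delta> N Ej a f \<E> B" using mB[OF p] by blast
    obtain w where w: "w \<E> B" "Ult0_mem E \<delta> N Ej w (ult_class E \<delta> N Ej a f)" using no a(3) unfolding el_ball el_bex by blast
    obtain b g where b: "ult_pair E \<delta> N b g" "w = ult_class E \<delta> N Ej b g" using cls[OF w(1)] by blast
    have h: "hold (\<E>) b g a f" using w(2) b Ult0_mem_iff[OF b(1) a(2)] by simp
    obtain b' g' where b': "pr b' g' \<E> ?B" "hold (=) b g b' g'" using pick[of b g] b w(1) by blast
    have "hold (\<E>) b' g' a f" using hold_mem_cong[OF hold_eq_sym[OF b'(2)] h hold_refl[OF pair_N[OF a(2)]]] .
    then show ?thesis using b'(1) a(1) by (intro exI[of _ "pr b' g'"]) simp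
  qed
  obtain w where "w \<E> B" using B by auto
  then have Bne: "EX p. p \<E> ?B" using cls pick by blast
  have BN: "fs p \<E> N" if "p \<E> ?B" for p using mB[OF that] pair_N by auto
  have pne: "p ~= emp" if p: "p \<E> ?B" for p
  proof -
    obtain a f where "p = pr a f" using mB[OF p] by blast
    moreover have "upair a a \<E> pr a f" by (simp add: pr_eq)
    ultimately show ?thesis using mem_emp by auto
  qed
  \<comment> \<open>The pairs with first component \<open>emp\<close> start the process: they force
    the hull to meet \<open>?B\<close>. No member of \<open>?B\<close> is itself empty.\<close>
  let ?U = "so (%r. EX p q. r = pr p q & q \<E> ?B & (p = emp | p \<E> ?B & hold (\<E>) (fs q) (sn q) (fs p) (sn p)))"
  have U: "r \<E> ?U \<longleftrightarrow> (EX p q. r = pr p q & q \<E> ?B & (p = emp | p \<E> ?B & hold (\<E>) (fs q) (sn q) (fs p) (sn p)))" for r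
    by (rule mem_comp[of _ "prod (un2 ?B (upair emp emp)) ?B"], intro dfn D_hold[OF DM]) (auto simp: mem_prod)
  obtain X \<pi> c where X: "Sub (V om) X" "!!u y. u \<E> X ==> pr u y \<E> ?U ==> EX y. y \<E> X & pr u y \<E> ?U"
    "fnc \<pi> X" "!!z. z \<E> c \<longleftrightarrow> (EX x. x \<E> X & z = ap \<pi> x)" "c \<E> V \<delta>"
    "!!x y. x \<E> X ==> y \<E> X ==> ap \<pi> x = ap \<pi> y ==> x = y"
    by (rule wLS_hull[OF w\<delta> om_\<delta>, of ?U]) blast
  define Y where "Y p \<longleftrightarrow> p \<E> X & p \<E> ?B" for p
  have DY: "D (%C e. Y (s C e))" if "Df s" for s unfolding Y_def by (intro dfn that)
  have Yne: "EX p. Y p"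
  proof -
    obtain p where "p \<E> ?B" using Bne by blast
    then have "pr emp p \<E> ?U" unfolding U by blast
    moreover have "emp \<E> X" using X(1) om_V[OF om_0] by (simp add: Sub_iff)
    ultimately obtain q where "q \<E> X" "pr emp q \<E> ?U" using X(2) by blast
    then show ?thesis unfolding U Y_def by auto
  qed
  have Ynxt: "EX q. Y q & less q p" if p: "Y p" for p
  proof -
    obtain q where "q \<E> ?B" "hold (\<E>) (fs q) (sn q) (fs p) (sn p)" using nxt p by (auto simp: Y_def)
    then have "pr p q \<E> ?U" unfolding U using p by (auto simp: Y_def)
    then obtain q where q: "q \<E> X" "pr p q \<E> ?U" using X(2) p unfolding Y_def by blast
    then have "q \<E> ?B" "hold (\<E>) (fs q) (sn q) (fs p) (sn p)" using pne p unfolding U Y_def by auto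
    moreover have "less q p" unfolding less_def by (rule hold_mono[OF DM DR rk_mem calculation(2)])
    ultimately show ?thesis using q(1) unfolding Y_def by blast
  qed
  define Zb where "Zb \<beta> p \<longleftrightarrow> Y p & fs p \<E> hj (V \<beta>)" for \<beta> p
  have DZ: "D (%C e. Zb (s C e) (t C e))" if "Df s" "Df t" for s t unfolding Zb_def by (intro dfn DY that)
  have Zmono: "Zb \<gamma> p" if "\<gamma> \<E> \<delta>" "\<beta> \<E> \<gamma>" "Zb \<beta> p" for \<beta> \<gamma> p
    using hj_V_mono[OF that(1) _, of \<beta> "fs p"] that by (simp add: Zb_def)
  have wf: "EX m. m \<E> Z & (ALL p. p \<E> Z --> ~ less p m)" if "\<beta> \<E> \<delta>" "!!p. p \<E> Z ==> Zb \<beta> p" "p0 \<E> Z" for \<beta> Z p0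
    by (rule less_wf[OF X(3-6) that(1) _ that(3)]) (use that(2) in \<open>auto simp: Zb_def Y_def\<close>)
  \<comment> \<open>Level \<open>x\<close> contains a member strictly below everything of level
    \<beta>.\<close>
  define T where "T \<beta> x \<longleftrightarrow> x \<E> \<delta> & (EX q. Zb x q & (ALL p. Zb \<beta> p --> less q p))" for \<beta> x
  have DT: "D (%C e. T (s C e) (t C e))" if "Df s" "Df t" for s t
    unfolding T_def by (intro dfn DZ that[THEN Df_ren])
  have lev: "EX x. x \<E> \<delta> & Zb x q" if "Y q" for q
    using N_level[OF BN[of q]] that unfolding Zb_def Y_def by blast
  have Tex: "EX x. T \<beta> x" if \<beta>: "\<beta> \<E> \<delta>" for \<beta>
  proof (cases "EX p. Zb \<beta> p")
    case True
    then obtain p0 where p0: "Zb \<beta> p0" by blast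
    have "EX Z. ALL p. p \<E> Z \<longleftrightarrow> p \<E> X & Zb \<beta> p" by (rule separation, intro DZ dfn)
    then obtain Z where "ALL p. p \<E> Z \<longleftrightarrow> p \<E> X & Zb \<beta> p" by blast
    then have Z: "p \<E> Z \<longleftrightarrow> Zb \<beta> p" for p by (auto simp: Zb_def Y_def)
    \<comment> \<open>A minimal member of level \<beta>: anything below it is below all members of
      that level.\<close>
    obtain m where m: "Zb \<beta> m" "ALL p. Zb \<beta> p --> ~ less p m" using wf[OF \<beta>, of Z p0] Z p0 by blast
    obtain q where q: "Y q" "less q m" using Ynxt m(1) unfolding Zb_def by blast
    have "less q p" if p: "Zb \<beta> p" for p
    proof -
      have N: "fs p \<E> N" "fs m \<E> N" using p m(1) BN by (auto simp: Zb_def Y_def)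
      have "~ less p m" using m(2) p by blast
      then have "hold (%x y. ~ rk x \<E> rk y) (fs p) (sn p) (fs m) (sn m)"
        using hold_not[OF DR N] unfolding less_def by blast
      then have 1: "hold (%x y. ~ rk y \<E> rk x) (fs m) (sn m) (fs p) (sn p)"
        using hold_sym[of "%x y. ~ rk x \<E> rk y"] D_not[OF DR] by blast
      show ?thesis unfolding less_def
      proof (rule hold_trans[OF DR DRle DR q(2)[unfolded less_def] 1])
        fix a b c assume "rk a \<E> rk b" "~ rk c \<E> rk b"
        then show "rk a \<E> rk c" using Ord_linear[OF Ord_rk Ord_rk, of b c] Ord_trans[OF Ord_rk, of "rk b" c "rk a"] by metis
      qed
    qed
    moreover obtain x where "x \<E> \<delta>" "Zb x q" using lev[OF q(1)] by blast
    ultimately show ?thesis unfolding T_def by blast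
  next
    case False
    obtain q where "Y q" using Yne by blast
    then obtain x where "x \<E> \<delta>" "Zb x q" using lev by blast
    then show ?thesis using False unfolding T_def by blast
  qed
  define \<Phi> where "\<Phi> \<beta> x \<longleftrightarrow> Ord x & T \<beta> x & (ALL c:el x. ~ T \<beta> c)" for \<beta> x
  have D\<Phi>: "D (%C e. \<Phi> (s C e) (t C e))" if "Df s" "Df t" for s t
    unfolding \<Phi>_def by (intro dfn DT that[THEN Df_ren])
  have \<Phi>ex: "EX! x. \<Phi> \<beta> x" if \<beta>: "\<beta> \<E> \<delta>" for \<beta>
  proof -
    obtain x where x: "T \<beta> x" using Tex[OF \<beta>] by blast
    then have "Ord x" using Ord_elem[OF o\<delta>] by (simp add: T_def)
    moreover have "D (%C e. T \<beta> (e 0))" by (intro DT dfn)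
    ultimately obtain y where y: "Ord y" "T \<beta> y" "!!c. c \<E> y ==> ~ T \<beta> c"
      using Ord_least[of "T \<beta>" x] x by blast
    show ?thesis
    proof (rule ex1I[of _ y])
      show "\<Phi> \<beta> y" using y by (simp add: \<Phi>_def)
      fix z assume "\<Phi> \<beta> z"
      then show "z = y" using y Ord_linear[of z y] by (auto simp: \<Phi>_def)
    qed
  qed
  define g where "g \<beta> = (if EX! x. \<Phi> \<beta> x then The (\<Phi> \<beta>) else emp)" for \<beta>
  have Dg: "Df (%C e. g (e 0))"
  proof (rule Df_rel)
    show "D (%C e. if (EX! y. \<Phi> (e (Suc 0)) y) then \<Phi> (e (Suc 0)) (e 0) else e 0 = emp)"
      unfolding if_bool_eq_conj by (intro dfn D\<Phi>)
    show "(if (EX! y. \<Phi> (e 0) y) then \<Phi> (e 0) y else y = emp) \<longleftrightarrow> y = g (e 0)" for e y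
      unfolding g_def by (rule if_The_iff)
  qed
  have g\<Phi>: "\<Phi> \<beta> (g \<beta>)" if "\<beta> \<E> \<delta>" for \<beta> using theI'[OF \<Phi>ex[OF that]] \<Phi>ex[OF that] by (simp add: g_def)
  have g\<delta>: "g \<beta> \<E> \<delta>" if "\<beta> \<E> \<delta>" for \<beta> using g\<Phi>[OF that] by (simp add: \<Phi>_def T_def)
  have gm: "Sub (g \<beta>) (g \<gamma>)" if \<gamma>: "\<gamma> \<E> \<delta>" "\<beta> \<E> \<gamma>" for \<beta> \<gamma>
  proof -
    have \<beta>: "\<beta> \<E> \<delta>" using Ord_trans[OF o\<delta> \<gamma>] .
    have "T \<beta> (g \<gamma>)" using g\<Phi>[OF \<gamma>(1)] Zmono[OF \<gamma>] unfolding \<Phi>_def T_def by blast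
    then have "~ g \<gamma> \<E> g \<beta>" using g\<Phi>[OF \<beta>] by (auto simp: \<Phi>_def)
    then show ?thesis
      using Ord_linear[of "g \<beta>" "g \<gamma>"] g\<Phi>[OF \<beta>] g\<Phi>[OF \<gamma>(1)] Ord_sub_le[of "g \<beta>" "g \<gamma>"] unfolding \<Phi>_def by blast
  qed
  have e0: "emp \<E> \<delta>" using \<delta>_Lim by (simp add: Lim_def)
  obtain b where b: "b \<E> \<delta>" "emp \<E> b" "ALL \<beta>. \<beta> \<E> b --> g \<beta> \<E> b"
    using cof_closure[OF \<delta>_Lim cof Dg g\<delta> gm e0] by blast
  have b\<delta>: "\<beta> \<E> \<delta>" if "\<beta> \<E> b" for \<beta> using Ord_trans[OF o\<delta> b(1) that] .
  have "EX Z. ALL p. p \<E> Z \<longleftrightarrow> p \<E> X & (EX \<beta>. \<beta> \<E> b & Zb \<beta> p)" by (rule separation, intro dfn DZ)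
  then obtain Z where "ALL p. p \<E> Z \<longleftrightarrow> p \<E> X & (EX \<beta>. \<beta> \<E> b & Zb \<beta> p)" by blast
  then have Z: "p \<E> Z \<longleftrightarrow> (EX \<beta>. \<beta> \<E> b & Zb \<beta> p)" for p by (auto simp: Zb_def Y_def)
  have Tg: "EX q. q \<E> Z & (ALL p. Zb \<beta> p --> less q p)" if "\<beta> \<E> b" for \<beta>
    using g\<Phi>[OF b\<delta>[OF that]] b(3) that unfolding Z \<Phi>_def T_def by blast
  obtain q0 where "q0 \<E> Z" using Tg[OF b(2)] by blast
  moreover have "Zb b p" if "p \<E> Z" for p using that Zmono[OF b(1)] unfolding Z by blast
  ultimately obtain m where m: "m \<E> Z" "ALL p. p \<E> Z --> ~ less p m" using wf[OF b(1)] by blast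
  then obtain \<beta> where "\<beta> \<E> b" "Zb \<beta> m" unfolding Z by blast
  then show False using Tg m by blast
qed

end

section \<open>The transitive collapse of a wellfounded ultrapower\<close>

context pre_wit
begin

lemma J_V: assumes "\<alpha> \<E> \<delta>" "y \<E> hj (V \<alpha>)" shows "J (%x. x \<E> V \<alpha>) y"
proof -
  have D: "D (%C e. e 0 \<E> V \<alpha>)" by (intro dfn)
  have "sp \<alpha> (%x. x \<E> V \<alpha>) = V \<alpha>" by (rule ext) (simp add: mem_sp[OF D])
  then show ?thesis using J_iff[OF D assms] assms by simp
qed

lemma J_fs:
  assumes D: "D (%C e. Q (e 0))" and N: "y \<E> N" "b \<E> N"
  shows "J (%w. Q (fs w)) (pr y b) \<longleftrightarrow> J Q y"
proof -
  have R1: "D0 (%e. EX u v. e 0 = pr u v & u = e 1)" by (intro D0_pr_comp d0)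
  have R2: "D0 (%e. EX u v. e 1 = pr u v & u = e 0)" by (intro D0_pr_comp d0)
  have D2: "D (%C e. Q (fs (e 0)))" by (intro D_pred1[OF D] dfn)
  show ?thesis
  proof
    assume h: "J (%w. Q (fs w)) (pr y b)"
    show "J Q y"
      by (rule J_imp2[OF D2 D, of "%w u a b. EX x v. w = pr x v & x = u" emp emp "pr y b" y])
        (use h N emp_V R1 in auto)
  next
    assume h: "J Q y"
    show "J (%w. Q (fs w)) (pr y b)"
      by (rule J_imp2[OF D D2, of "%u w a b. EX x v. w = pr x v & x = u" emp emp y "pr y b"])
        (use h N emp_V R2 N_pr in auto)
  qed
qed

text \<open>That all elements of a cut satisfy a bounded predicate is again bounded, so it passes to
  the image of the cut; the converse uses the negation.\<close>

lemma J_D0: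
  assumes R: "D0 (%e. R (e 0))" and D: "D (%C e. R (e 0))" and y: "y \<E> N"
  shows "J R y \<longleftrightarrow> R y"
proof -
  have imp: "Q y" if D0: "D0 (%e. Q (e 0))" and DQ: "D (%C e. Q (e 0))" and J: "J Q y" for Q
  proof -
    obtain \<alpha> where \<alpha>: "\<alpha> \<E> \<delta>" "y \<E> hj (sp \<alpha> Q)" using J by (auto simp: J_def)
    define S where "S a \<longleftrightarrow> (ALL x:el a. Q x)" for a
    have "D0 (%e. S (e 0))" unfolding S_def by (intro d0 D0_ren[OF D0, of "%_. 0"])
    moreover have "S (sp \<alpha> Q)" unfolding S_def el_ball mem_sp[OF DQ] by blast
    ultimately have "S (hj (sp \<alpha> Q))" using pres1[OF pres_j, of S] sp_V[OF DQ \<alpha>(1)] by simp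
    then show ?thesis using \<alpha>(2) by (simp add: S_def)
  qed
  have "~ R y" if "~ J R y"
  proof -
    have "J (%x. ~ R x) y" using J_not[OF D y] that by simp
    then show ?thesis using imp[of "%x. ~ R x"] D0_not[OF R] D_not[OF D] by blast
  qed
  then show ?thesis using imp[OF R D] by blast
qed

lemma hold_all:
  assumes R: "D (%C e. R (e 0) (e 1))" and N: "y \<E> N" "z \<E> N"
    and imp: "!!u v. u \<E> V \<delta> ==> v \<E> V \<delta> ==> R (ap F u) (ap G v)"
  shows "hold R y F z G"
  unfolding hold_def
  by (rule J_imp3[OF DT DT D_holdQ[OF R, of F G], of "%u v w a b. w = pr u v" emp emp y z])
    (use N N_pr emp_V J_True imp in \<open>auto intro: d0\<close>)

text \<open>Functions of one component of a seed. With \<open>hold_cf\<close> and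
  \<open>hold_cs\<close> elements with different seeds are rewritten over a common seed.\<close>

definition cf where "cf F = lam (V \<delta>) (%w. ap F (fs w))"
definition cs where "cs F = lam (V \<delta>) (%w. ap F (sn w))"

lemma ap_cf: "w \<E> V \<delta> ==> ap (cf F) w = ap F (fs w)" and ap_cs: "w \<E> V \<delta> ==> ap (cs F) w = ap F (sn w)"
proof -
  have "Df (%C e. ap F (fs (e 0)))" "Df (%C e. ap F (sn (e 0)))" by (intro dfn)+
  then show "w \<E> V \<delta> ==> ap (cf F) w = ap F (fs w)" "w \<E> V \<delta> ==> ap (cs F) w = ap F (sn w)"
    unfolding cf_def cs_def using ap_lam[of "%w. ap F (fs w)" w] ap_lam[of "%w. ap F (sn w)" w] by auto
qed

lemma hold_cf: assumes N: "y \<E> N" "b \<E> N" shows "hold (=) y F (pr y b) (cf F)"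
proof -
  have R: "D0 (%e. EX u v. e 0 = pr u v & e 1 = pr u (e 0))" by (intro D0_pr_comp d0)
  show ?thesis unfolding hold_def
    by (rule J_imp2[OF DT D_holdQ[OF DE, of F "cf F"], of "%w q a b. EX u v. w = pr u v & q = pr u w" emp emp "pr y b"])
      (use N N_pr emp_V J_True R ap_cf in auto)
qed

lemma hold_cs: assumes N: "z \<E> N" "b \<E> N" shows "hold (=) z F (pr b z) (cs F)"
proof -
  have R: "D0 (%e. EX u v. e 0 = pr u v & e 1 = pr v (e 0))" by (intro D0_pr_comp d0)
  show ?thesis unfolding hold_def
    by (rule J_imp2[OF DT D_holdQ[OF DE, of F "cs F"], of "%w q a b. EX u v. w = pr u v & q = pr v w" emp emp "pr b z"])
      (use N N_pr emp_V J_True R ap_cs in auto)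
qed

text \<open>Replaces choice in the proof of Los' theorem: the witnesses can be sought in a hull that contains
  \<open>V\<^sub>\<alpha>\<close> and whose collapse lies in \<open>V\<^sub>\<delta>\<close>, and the collapsed witness becomes part of the seed.\<close>

lemma select:
  assumes Q: "D (%C e. Q (e 0))" and S: "D (%C e. S (e 0) (e 1))"
    and ex: "!!q. q \<E> V \<delta> ==> Q q ==> EX x. S q x" and y: "J Q y"
  obtains b H where "b \<E> N" "J (%w. S (fs w) (ap H w)) (pr y b)"
proof -
  have yN: "y \<E> N" using J_N[OF y Q] .
  obtain \<alpha> where \<alpha>: "\<alpha> \<E> \<delta>" "y \<E> hj (V \<alpha>)" using N_level[OF yN] by blast
  obtain vq where vq: "!!q. q \<E> vq \<longleftrightarrow> q \<E> V \<delta> & Q q" using separation[OF Q, of "V \<delta>"] by blast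
  \<comment> \<open>Collection yields a set of candidates but no choice among them; that is left to
    the hull.\<close>
  have "EX bb. ALL q. q \<E> vq --> (EX x. x \<E> bb & S q x)" by (rule collection[OF S]) (use vq ex in blast)
  then obtain bb where bb: "!!q. q \<E> vq ==> EX x. x \<E> bb & S q x" by blast
  have "EX U. ALL p. p \<E> U \<longleftrightarrow> (EX q x. p = pr q x & q \<E> vq & x \<E> bb & S q x)"
    by (rule comp_ex[of _ "prod vq bb"], intro dfn D_pred2[OF S]) (auto simp: mem_prod)
  then obtain U where U': "!!p. p \<E> U \<longleftrightarrow> (EX q x. p = pr q x & q \<E> vq & x \<E> bb & S q x)" by blast
  have U: "pr q x \<E> U \<longleftrightarrow> q \<E> vq & x \<E> bb & S q x" for q x by (simp add: U')
  obtain X p c where X: "Sub (V \<alpha>) X" "!!u y. u \<E> X ==> pr u y \<E> U ==> EX y. y \<E> X & pr u y \<E> U"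
    "fnc p X" "!!z. z \<E> c \<longleftrightarrow> (EX x. x \<E> X & z = ap p x)" "c \<E> V \<delta>"
    "!!x y. x \<E> X ==> y \<E> X ==> ap p x = ap p y ==> x = y"
    by (rule wLS_hull[OF w\<delta> \<alpha>(1), of U]) (rule that)
  \<comment> \<open>Inverse of the collapse: it turns a collapsed witness, the second component of
    the new seed, back into a value.\<close>
  define G where "G z = so (%v. EX x. x \<E> X & ap p x = z & v \<E> x)" for z
  have Gex: "EX s. ALL v. v \<E> s \<longleftrightarrow> (EX x. x \<E> X & ap p x = z & v \<E> x)" for z
    by (rule comp_ex[of _ "Uni X"], intro dfn) auto
  have G: "G (ap p x) = x" if "x \<E> X" for x
  proof (rule ext)
    fix v
    have "v \<E> G (ap p x) \<longleftrightarrow> (EX x'. x' \<E> X & ap p x' = ap p x & v \<E> x')" unfolding G_def by (rule setof_mem[OF Gex])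
    then show "v \<E> G (ap p x) \<longleftrightarrow> v \<E> x" using X(6)[OF _ that] that by blast
  qed
  have DG: "Df (%C e. G (e 0))" unfolding G_def by (rule Df_setof, intro dfn, rule set_ex1[OF Gex])
  have DG': "Df (%C e. G (sn (e 0)))" by (intro Df_fun1[OF DG] dfn)
  define H where "H = lam (V \<delta>) (%w. G (sn w))"
  have H: "ap H w = G (sn w)" if "w \<E> V \<delta>" for w unfolding H_def by (rule ap_lam[OF DG' that])
  have DV: "D (%C e. e 0 \<E> V \<alpha>)" by (intro dfn)
  have DQ: "D (%C e. Q (e 0) & e 0 \<E> V \<alpha>)" by (intro dfn Q)
  have DR: "D (%C e. S (fs (e 0)) (G (sn (e 0))))" by (intro D_pred2[OF S] dfn DG')
  have DR': "D (%C e. S (fs (e 0)) (ap H (e 0)))" by (intro D_pred2[OF S] dfn)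
  have y': "J (%q. Q q & q \<E> V \<alpha>) y" using J_and[OF Q DV] y J_V[OF \<alpha>] by simp
  have "EX v. v \<E> c & S (fs (pr u v)) (G (sn (pr u v)))" if u: "u \<E> V \<delta>" "Q u & u \<E> V \<alpha>" for u
  proof -
    have uq: "u \<E> vq" using vq u by blast
    then obtain x where "pr u x \<E> U" using bb U by blast
    moreover have "u \<E> X" using X(1) u by (auto simp: Sub_iff)
    ultimately obtain x' where x': "x' \<E> X" "pr u x' \<E> U" using X(2) by blast
    then have "S u x'" using U by blast
    then show ?thesis using x' X(4) G by (intro exI[of _ "ap p x'"]) auto
  qed
  then obtain b where b: "b \<E> hj c" "J (%w. S (fs w) (G (sn w))) (pr y b)"
    using J_ex[of "%q. Q q & q \<E> V \<alpha>" "%w. S (fs w) (G (sn w))" c y, OF DQ DR X(5) _ y'] by blast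
  have "J (%w. S (fs w) (ap H w)) (pr y b)" by (rule J_mono[OF DR DR' _ b(2)]) (simp add: H)
  moreover have "b \<E> N" using N_elem[OF j_N[OF X(5)] b(1)] .
  ultimately show thesis using that by blast
qed

text \<open>Three unions descend from a set of pairs to the elements of the values;
  \<open>emp\<close> is the default value needed in \<open>below_rep\<close>.\<close>

definition Bd where "Bd F = un2 (Uni (Uni (Uni F))) (upair emp emp)"

lemma Df_Bd [dfn]: assumes "Df s" shows "Df (%w e. Bd (s w e))"
  unfolding Bd_def by (intro dfn assms)

lemma ap_mem: assumes "x \<E> ap F v" shows "pr v (ap F v) \<E> F"
proof (cases "EX! y. maps_to_in E UNIV F v y")
  case True
  then have "ap F v = (THE y. maps_to_in E UNIV F v y)" by (simp add: tapp_def app_def)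
  then show ?thesis using theI'[OF True] by (simp add: maps_to_iff)
next
  case False then show ?thesis using assms unfolding tapp_def if_not_P[OF False] by simp
qed

lemma Bd_mem: assumes "x \<E> ap F v" shows "x \<E> Bd F"
proof -
  have "upair v (ap F v) \<E> pr v (ap F v)" by (simp add: pr_eq)
  then have "upair v (ap F v) \<E> Uni F" using ap_mem[OF assms] by auto
  then have "ap F v \<E> Uni (Uni F)" by (metis mem_Uni mem_upair)
  then show ?thesis unfolding Bd_def using assms by (metis mem_Uni mem_un2)
qed

text \<open>Membership in the ultrapower, restricted to functions on \<open>V \<delta>\<close> with
  values in a fixed set. The restriction makes the relation set-like, and by
  \<open>below_rep\<close> no element of the ultrapower is lost.\<close>

definition below where "below q p \<longleftrightarrow> (EX z G. q = pr z G & z \<E> N & fnc G (V \<delta>) &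
  (ALL u. u \<E> V \<delta> --> ap G u \<E> Bd (sn p)) & hold (\<E>) z G (fs p) (sn p))"

lemma D_below [dfn]: assumes "Df s" "Df t" shows "D (%w e. below (s w e) (t w e))"
  unfolding below_def by (intro dfn D_hold[OF DM] assms[THEN Df_ren])

lemma below_set: "EX z. ALL q. q \<E> z \<longleftrightarrow> below q p"
proof (rule comp_ex[of _ "prod N (Pw (prod (V \<delta>) (Bd (sn p))))"], intro dfn)
  fix q assume "below q p"
  then obtain z G where z: "q = pr z G" "z \<E> N" "fnc G (V \<delta>)" "ALL u. u \<E> V \<delta> --> ap G u \<E> Bd (sn p)"
    unfolding below_def by blast
  have "Sub G (prod (V \<delta>) (Bd (sn p)))" unfolding Sub_iff fnc_mem[OF z(3)] mem_prod using z(4) by blast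
  then show "q \<E> prod N (Pw (prod (V \<delta>) (Bd (sn p))))" using z by (auto simp: mem_prod)
qed

lemma belowD: "below q p ==> hold (\<E>) (fs q) (sn q) (fs p) (sn p)" "below q p ==> fs q \<E> N" "below q p ==> fs p \<E> N"
proof -
  assume "below q p"
  then show "hold (\<E>) (fs q) (sn q) (fs p) (sn p)" "fs q \<E> N" unfolding below_def by auto
  then show "fs p \<E> N" using hold_N(2)[OF _ DM] by blast
qed

text \<open>Almost all values of \<open>G\<close> are elements of values of the larger function,
  hence lie in \<open>Bd\<close>; the remaining ones are replaced by \<open>emp\<close>, which does
  not affect the class.\<close>

lemma below_rep:
  assumes h: "hold (\<E>) z G (fs p) (sn p)"
  obtains q where "below q p" "hold (=) z G (fs q) (sn q)"
proof -
  let ?y = "fs p" and ?F = "sn p"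
  have N: "z \<E> N" "?y \<E> N" using hold_N[OF h DM] by auto
  have D1: "D (%C e. Sub (e 0) (Bd ?F))" and D2: "D (%C e. e 0 \<E> Bd ?F)" by (intro dfn)+
  have k1: "hold (%a b. Sub a (Bd ?F)) ?y ?F ?y ?F"
    by (rule hold_all[OF D1 N(2) N(2)]) (auto simp: Sub_iff intro: Bd_mem)
  have k2: "hold (%a b. a \<E> Bd ?F) z G ?y ?F"
    by (rule hold_trans[of "(\<E>)" "%a b. Sub a (Bd ?F)" "%a b. a \<E> Bd ?F", OF DM D1 D2 h k1]) (auto simp: Sub_iff)
  have "hold (%a b. b \<E> Bd ?F) ?y ?F z G" using hold_sym[OF D2 k2] .
  then have "hold (%a b. a \<E> Bd ?F) z G z G"
    using hold_trans[of "%a b. a \<E> Bd ?F" "%a b. b \<E> Bd ?F" "%a b. a \<E> Bd ?F", OF D2 _ D2 k2]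
      D_ren[OF D2, of "%_. 1"] by simp
  then have J: "J (%u. ap G u \<E> Bd ?F) z" using hold_diag[of "%a b. a \<E> Bd ?F", OF D2 N(1), of G G] by simp
  define t where "t u = (if ap G u \<E> Bd ?F then ap G u else emp)" for u
  have Dt: "Df (%C e. t (e 0))" unfolding t_def by (intro dfn)
  let ?G = "lam (V \<delta>) t"
  have "J (%u. ap G u = ap ?G u) z"
    by (rule J_mono[of "%u. ap G u \<E> Bd ?F", OF _ _ _ J], (intro dfn)+) (simp add: ap_lam[OF Dt] t_def)
  then have eq: "hold (=) z G z ?G" using hold_diag[OF DE N(1)] by simp
  have "hold (\<E>) z ?G ?y ?F" using hold_mem_cong[OF hold_eq_sym[OF eq] h hold_refl[OF N(2)]] .
  moreover have "ap ?G u \<E> Bd ?F" if "u \<E> V \<delta>" for u using that by (auto simp: ap_lam[OF Dt] t_def Bd_def)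
  ultimately have "below (pr z ?G) p" unfolding below_def using N(1) fnc_lam[OF Dt] by blast
  then show thesis using that[of "pr z ?G"] eq by simp
qed

end

section \<open>Collapse of a wellfounded ultrapower\<close>

locale ult_wit = pre_wit E P \<kappa> \<delta> N j for E :: "'v => 'v => bool" (infix \<open>\<E>\<close> 50) and P \<kappa> \<delta> N j +
  assumes wf: "Ult0_wellfounded E \<delta> N (derived_extender E \<delta> N j)"
begin

text \<open>The assumption on \<open>Ult0\<close> concerns sets of equivalence classes. Each pair
  with seed in \<open>N\<close> has such a class by \<open>rep_index\<close>, and Collection gathers
  the classes into a set. A pair whose seed is not in \<open>N\<close> has nothing below it.\<close>

lemma below_wf:
  assumes x: "x \<E> B" shows "EX m. m \<E> B & (ALL q. q \<E> B --> ~ below q m)"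
proof (cases "ALL p. p \<E> B --> fs p \<E> N")
  case False
  then obtain p where "p \<E> B" "~ fs p \<E> N" by blast
  then show ?thesis using belowD(3) by blast
next
  case BN: True
  define Q where "Q p w \<longleftrightarrow> (EX a f. ult_pair E \<delta> N a f & hold (=) a f (fs p) (sn p) & (ALL q. q \<E> w \<longleftrightarrow>
    Cl a f q & (ALL q'. Cl a f q' --> ord_le E (rk q) (rk q'))))" for p w
  have Qu: "w = ult_class E \<delta> N Ej a f"
    if "ult_pair E \<delta> N a f" "ALL q. q \<E> w \<longleftrightarrow> Cl a f q & (ALL q'. Cl a f q' --> ord_le E (rk q) (rk q'))" for w a f
    by (rule ext) (simp add: mem_ult_class(1)[OF that(1)] that(2))
  have Q: "Q p w \<longleftrightarrow> (EX a f. ult_pair E \<delta> N a f & hold (=) a f (fs p) (sn p) & w = ult_class E \<delta> N Ej a f)" for p w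
    unfolding Q_def using Qu mem_ult_class(1) by metis
  have DQ: "D (%C e. Q (e 0) (e 1))"
    unfolding Q_def Cl_def ult_pair_iff by (intro dfn D_hold[OF DE])
  have Qex: "EX w. Q p w" if "p \<E> B" for p
  proof -
    have "fs p \<E> N" using BN that by blast
    then obtain a f where "ult_pair E \<delta> N a f" "hold (=) a f (fs p) (sn p)" by (rule rep_index)
    then show ?thesis using Q by blast
  qed
  obtain b where b: "!!p. p \<E> B ==> EX w. w \<E> b & Q p w" using collection[OF DQ Qex] by blast
  have "EX B'. ALL w. w \<E> B' \<longleftrightarrow> w \<E> b & (EX p. p \<E> B & Q p w)" by (rule separation, intro dfn D_pred2[OF DQ])
  then obtain B' where B': "!!w. w \<E> B' \<longleftrightarrow> w \<E> b & (EX p. p \<E> B & Q p w)" by blast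
  have "el B' ~= {} & el B' \<subseteq> Ult0 E \<delta> N Ej"
  proof
    obtain w where "w \<E> B'" using b[OF x] B' x by blast
    then show "el B' ~= {}" using el_iff by blast
    show "el B' \<subseteq> Ult0 E \<delta> N Ej"
    proof
      fix w assume "w \<in> el B'"
      then obtain p where "Q p w" using B' el_iff by blast
      then show "w \<in> Ult0 E \<delta> N Ej" unfolding Ult0_def mem_Collect_eq using Q by blast
    qed
  qed
  then obtain w where w: "w \<E> B'" "!!w'. w' \<E> B' ==> ~ Ult0_mem E \<delta> N Ej w' w"
    using wf unfolding Ult0_wellfounded_def el_ball el_bex by blast
  obtain p where p: "p \<E> B" "Q p w" using B' w(1) by blast
  obtain a f where a: "ult_pair E \<delta> N a f" "hold (=) a f (fs p) (sn p)" "w = ult_class E \<delta> N Ej a f" using p(2) Q by blast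
  have "~ below q p" if q: "q \<E> B" for q
  proof
    assume "below q p"
    then have h: "hold (\<E>) (fs q) (sn q) (fs p) (sn p)" by (rule belowD)
    obtain w' where w': "w' \<E> b" "Q q w'" using b[OF q] by blast
    then have B1: "w' \<E> B'" using B' q by blast
    obtain a' f' where a': "ult_pair E \<delta> N a' f'" "hold (=) a' f' (fs q) (sn q)" "w' = ult_class E \<delta> N Ej a' f'" using w'(2) Q by blast
    have "hold (\<E>) a' f' a f" using hold_mem_cong[OF a'(2) h hold_eq_sym[OF a(2)]] .
    then have "Ult0_mem E \<delta> N Ej w' w" using Ult0_mem_iff[OF a'(1) a(1)] a(3) a'(3) by simp
    then show False using w(2)[OF B1] by blast
  qed
  then show ?thesis using p(1) by blast
qed

lemma below_induct:
  assumes "D (%C e. Q (e 0))" "!!x. (!!y. below y x ==> Q y) ==> Q x"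
  shows "Q x"
proof (rule wf_class_induct[of below Q])
  show "D (%C e. below (e 0) (e 1))" by (intro dfn)
qed (use below_set below_wf assms in blast)+

lemma collapse_ex: "EX F. Df (%C e. F (e 0)) & (ALL p z. z \<E> F p \<longleftrightarrow> (EX q. below q p & z = F q))"
proof -
  have ex: "EX w. ALL z. z \<E> w \<longleftrightarrow> (EX q. below q p & z = ap f q)" for p f
  proof -
    obtain s where s: "!!q. q \<E> s \<longleftrightarrow> below q p" using below_set by blast
    have "Df (%C e. ap f (e 0))" by (intro dfn)
    then show ?thesis using mem_img[of "ap f" _ s] s by blast
  qed
  have D1: "D (%C e. below (e 0) (e 1))" by (intro dfn)
  have DH: "Df (%C e. so (%z. EX q. below q (e 0) & z = ap (e 1) q))"
    by (rule Df_setof, intro dfn, rule set_ex1[OF ex])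
  have "EX F. Df (%C e. F (e 0)) & (ALL p. F p = so (%z. EX q. below q p & z = ap (lam (so (%y. below y p)) F) q))"
  proof (rule wf_recursion[of below "%p f. so (%z. EX q. below q p & z = ap f q)"])
    show "Q x" if "D (%C e. Q (e 0))" "!!x. (!!y. below y x ==> Q y) ==> Q x" for Q x
      by (rule below_induct[of Q, OF that])
  qed (rule D1 DH below_set | blast)+
  then obtain F where F: "Df (%C e. F (e 0))" "!!p. F p = so (%z. EX q. below q p & z = ap (lam (so (%y. below y p)) F) q)"
    by blast
  have "z \<E> F p \<longleftrightarrow> (EX q. below q p & z = F q)" for p z
  proof -
    have "ap (lam (so (%y. below y p)) F) q = F q" if "below q p" for q
      by (rule ap_lam[OF F(1)]) (simp add: setof_mem[OF below_set] that)
    then show ?thesis by (subst F(2), subst setof_mem[OF ex]) auto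
  qed
  then show ?thesis using F(1) by blast
qed

text \<open>The choice takes place in HOL; as definability is part of the specification,
  \<open>col\<close> may be used inside the structure.\<close>

definition col where "col = (SOME F. Df (%C e. F (e 0)) & (ALL p z. z \<E> F p \<longleftrightarrow> (EX q. below q p & z = F q)))"

lemma Dcol: "Df (%C e. col (e 0))" and mem_col: "z \<E> col p \<longleftrightarrow> (EX q. below q p & z = col q)"
  using someI_ex[OF collapse_ex] unfolding col_def by blast+

lemmas Df_col [dfn] = Df_fun1[OF Dcol]

lemma col_eq1: "ALL q. hold (=) (fs p) (sn p) (fs q) (sn q) --> col p = col q"
proof (rule below_induct[of "%p. ALL q. hold (=) (fs p) (sn p) (fs q) (sn q) --> col p = col q"])
  show "D (%C e. ALL q. hold (=) (fs (e 0)) (sn (e 0)) (fs q) (sn q) --> col (e 0) = col q)"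
    by (intro dfn D_hold[OF DE])
next
  fix p assume IH: "!!r. below r p ==> ALL q. hold (=) (fs r) (sn r) (fs q) (sn q) --> col r = col q"
  show "ALL q. hold (=) (fs p) (sn p) (fs q) (sn q) --> col p = col q"
  proof (intro allI impI ext)
    fix q z assume h: "hold (=) (fs p) (sn p) (fs q) (sn q)"
    show "z \<E> col p \<longleftrightarrow> z \<E> col q"
    proof
      assume "z \<E> col p"
      then obtain r where r: "below r p" "z = col r" using mem_col by blast
      have "hold (\<E>) (fs r) (sn r) (fs q) (sn q)" using hold_mem_cong[OF hold_refl[OF belowD(2)[OF r(1)]] belowD(1)[OF r(1)] h] .
      then obtain r' where r': "below r' q" "hold (=) (fs r) (sn r) (fs r') (sn r')" by (rule below_rep)
      then show "z \<E> col q" using IH[OF r(1)] r(2) mem_col by blast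
    next
      assume "z \<E> col q"
      then obtain r where r: "below r q" "z = col r" using mem_col by blast
      have "hold (\<E>) (fs r) (sn r) (fs p) (sn p)"
        using hold_mem_cong[OF hold_refl[OF belowD(2)[OF r(1)]] belowD(1)[OF r(1)] hold_eq_sym[OF h]] .
      then obtain r' where r': "below r' p" "hold (=) (fs r) (sn r) (fs r') (sn r')" by (rule below_rep)
      then have "col r' = col r" using IH[OF r'(1)] hold_eq_sym by blast
      then show "z \<E> col p" using r(2) r'(1) mem_col by metis
    qed
  qed
qed

lemma col_mem1: assumes "hold (\<E>) (fs q) (sn q) (fs p) (sn p)" shows "col q \<E> col p"
proof -
  obtain r where "below r p" "hold (=) (fs q) (sn q) (fs r) (sn r)" using assms by (rule below_rep)
  then show ?thesis using col_eq1 mem_col by blast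
qed

text \<open>Extensionality of the ultrapower. If the functions differ almost everywhere,
  \<open>select\<close> produces a function that picks an element of exactly one of the two values,
  and its class lies in exactly one of the two elements.\<close>

lemma col_eq2: "ALL q. fs p \<E> N & fs q \<E> N & col p = col q --> hold (=) (fs p) (sn p) (fs q) (sn q)"
proof (rule below_induct[of "%p. ALL q. fs p \<E> N & fs q \<E> N & col p = col q --> hold (=) (fs p) (sn p) (fs q) (sn q)"])
  show "D (%C e. ALL q. fs (e 0) \<E> N & fs q \<E> N & col (e 0) = col q --> hold (=) (fs (e 0)) (sn (e 0)) (fs q) (sn q))"
    by (intro dfn D_hold[OF DE])
next
  fix p assume IH: "!!r. below r p ==> ALL q. fs r \<E> N & fs q \<E> N & col r = col q --> hold (=) (fs r) (sn r) (fs q) (sn q)"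
  show "ALL q. fs p \<E> N & fs q \<E> N & col p = col q --> hold (=) (fs p) (sn p) (fs q) (sn q)"
  proof (intro allI impI, rule ccontr)
    fix q assume q: "fs p \<E> N & fs q \<E> N & col p = col q" and no: "~ hold (=) (fs p) (sn p) (fs q) (sn q)"
    \<comment> \<open>Both elements are brought over a common seed, so that they can be compared
      value by value.\<close>
    let ?y = "pr (fs p) (fs q)" and ?F = "cf (sn p)" and ?G = "cs (sn q)"
    have yN: "?y \<E> N" using q N_pr by blast
    have F: "hold (=) (fs p) (sn p) ?y ?F" and G: "hold (=) (fs q) (sn q) ?y ?G" using hold_cf hold_cs q by auto
    have "~ hold (=) ?y ?F ?y ?G" using no hold_eq_trans[OF F hold_eq_trans[OF _ hold_eq_sym[OF G]]] by blast
    then have "~ J (%u. ap ?F u = ap ?G u) ?y" using hold_diag[OF DE yN] by simp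
    moreover have D1: "D (%C e. ap ?F (e 0) = ap ?G (e 0))" by (intro dfn)
    ultimately have J: "J (%u. ap ?F u ~= ap ?G u) ?y" using J_not[OF D1 yN] by simp
    obtain b H where b: "b \<E> N" "J (%w. ~ (ap H w \<E> ap ?F (fs w) \<longleftrightarrow> ap H w \<E> ap ?G (fs w))) (pr ?y b)"
    proof (rule select[of "%u. ap ?F u ~= ap ?G u" "%u x. ~ (x \<E> ap ?F u \<longleftrightarrow> x \<E> ap ?G u)" ?y])
      show "J (%u. ap ?F u ~= ap ?G u) ?y" by (rule J)
      show "EX x. ~ (x \<E> ap ?F u \<longleftrightarrow> x \<E> ap ?G u)" if "ap ?F u ~= ap ?G u" for u using that ext by blast
    qed (intro dfn | rule that, assumption+)+
    let ?s = "pr ?y b"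
    have sN: "?s \<E> N" using b(1) yN N_pr by blast
    have D2: "D (%C e. ap H (e 0) \<E> ap (cf ?F) (e 0))" "D (%C e. ap H (e 0) \<E> ap (cf ?G) (e 0))" by (intro dfn)+
    have J1: "J (%w. ~ (ap H w \<E> ap (cf ?F) w \<longleftrightarrow> ap H w \<E> ap (cf ?G) w)) ?s"
      by (rule J_mono[OF _ _ _ b(2)], (intro dfn)+) (simp add: ap_cf)
    \<comment> \<open>If \<open>H\<close> were almost everywhere in both values or in neither,
      intersecting with \<open>J1\<close> would leave the empty predicate.\<close>
    have "~ (J (%w. ap H w \<E> ap (cf ?F) w) ?s \<longleftrightarrow> J (%w. ap H w \<E> ap (cf ?G) w) ?s)"
    proof
      assume eq: "J (%w. ap H w \<E> ap (cf ?F) w) ?s \<longleftrightarrow> J (%w. ap H w \<E> ap (cf ?G) w) ?s"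
      have "J (%w. False) ?s"
      proof (cases "J (%w. ap H w \<E> ap (cf ?F) w) ?s")
        case True
        then have "J (%w. ap H w \<E> ap (cf ?F) w & ap H w \<E> ap (cf ?G) w) ?s" using eq J_and[OF D2] by simp
        then have "J (%w. ~ (ap H w \<E> ap (cf ?F) w \<longleftrightarrow> ap H w \<E> ap (cf ?G) w) &
           ap H w \<E> ap (cf ?F) w & ap H w \<E> ap (cf ?G) w) ?s" by (subst J_and) (intro dfn D2 conjI J1 | assumption)+
        then show ?thesis by (rule J_mono[rotated 3]) (intro dfn D2 | blast)+
      next
        case False
        then have "J (%w. ~ ap H w \<E> ap (cf ?F) w) ?s" "J (%w. ~ ap H w \<E> ap (cf ?G) w) ?s"
          using eq J_not[OF D2(1) sN] J_not[OF D2(2) sN] by auto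
        then have "J (%w. ~ ap H w \<E> ap (cf ?F) w & ~ ap H w \<E> ap (cf ?G) w) ?s"
          using J_and[OF D_not[OF D2(1)] D_not[OF D2(2)]] by simp
        then have "J (%w. ~ (ap H w \<E> ap (cf ?F) w \<longleftrightarrow> ap H w \<E> ap (cf ?G) w) &
           ~ ap H w \<E> ap (cf ?F) w & ~ ap H w \<E> ap (cf ?G) w) ?s" by (subst J_and) (intro dfn D2 conjI J1 | assumption)+
        then show ?thesis by (rule J_mono[rotated 3]) (intro dfn D2 | blast)+
      qed
      then show False using J_const[OF sN] by blast
    qed
    moreover have Fs: "hold (=) ?s (cf ?F) (fs p) (sn p)" and Gs: "hold (=) ?s (cf ?G) (fs q) (sn q)"
      using hold_eq_trans[OF hold_eq_sym[OF hold_cf[OF yN b(1)]] hold_eq_sym[OF F]]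
        hold_eq_trans[OF hold_eq_sym[OF hold_cf[OF yN b(1)]] hold_eq_sym[OF G]] by auto
    ultimately have ne: "~ (hold (\<E>) ?s H (fs p) (sn p) \<longleftrightarrow> hold (\<E>) ?s H (fs q) (sn q))"
      unfolding hold_diag[OF DM sN]
      using hold_mem_cong[OF hold_refl[OF sN] _ Fs, of H] hold_mem_cong[OF hold_refl[OF sN] _ hold_eq_sym[OF Fs], of H]
        hold_mem_cong[OF hold_refl[OF sN] _ Gs, of H] hold_mem_cong[OF hold_refl[OF sN] _ hold_eq_sym[OF Gs], of H] by blast
    show False
    proof (cases "hold (\<E>) ?s H (fs p) (sn p)")
      case True
      obtain r' where r': "below r' p" "hold (=) ?s H (fs r') (sn r')" using True by (rule below_rep)
      have "col r' \<E> col p" using r'(1) mem_col by blast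
      then have "col r' \<E> col q" using q by simp
      then obtain r where r: "below r q" "col r' = col r" using mem_col by blast
      have "hold (=) (fs r') (sn r') (fs r) (sn r)" using IH[OF r'(1)] belowD(2)[OF r'(1)] belowD(2)[OF r(1)] r(2) by blast
      then have "hold (\<E>) ?s H (fs q) (sn q)"
        using hold_mem_cong[OF hold_eq_trans[OF r'(2)] belowD(1)[OF r(1)] hold_refl] q by blast
      then show False using ne True by blast
    next
      case False
      then have h: "hold (\<E>) ?s H (fs q) (sn q)" using ne by blast
      then have "col (pr ?s H) \<E> col p" using col_mem1[of "pr ?s H" q] q by simp
      then obtain r where r: "below r p" "col (pr ?s H) = col r" using mem_col by blast
      have "hold (=) (fs r) (sn r) ?s H" using IH[OF r(1)] belowD(2)[OF r(1)] sN r(2) by (metis fs_pr sn_pr)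
      then have "hold (\<E>) ?s H (fs p) (sn p)" using hold_mem_cong[OF hold_eq_sym belowD(1)[OF r(1)] hold_refl] q by blast
      then show False using False by blast
    qed
  qed
qed

definition kk where "kk y F = col (pr y F)"

lemma kk_eq: assumes "y \<E> N" "z \<E> N" shows "kk y F = kk z G \<longleftrightarrow> hold (=) y F z G"
  unfolding kk_def using col_eq1[of "pr y F"] col_eq2[of "pr y F"] assms by (metis fs_pr sn_pr)

lemma kk_mem: assumes "y \<E> N" "z \<E> N" shows "kk y F \<E> kk z G \<longleftrightarrow> hold (\<E>) y F z G"
proof
  assume "kk y F \<E> kk z G"
  then obtain r where r: "below r (pr z G)" "kk y F = col r" unfolding kk_def using mem_col by blast
  then have "hold (=) y F (fs r) (sn r)" using col_eq2[of "pr y F"] assms(1) belowD(2) unfolding kk_def by (metis fs_pr sn_pr)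
  then show "hold (\<E>) y F z G" using hold_mem_cong[OF _ belowD(1)[OF r(1)]] hold_refl[OF assms(2)] by simp
next
  assume "hold (\<E>) y F z G"
  then show "kk y F \<E> kk z G" unfolding kk_def using col_mem1[of "pr y F" "pr z G"] by simp
qed

lemma kk_cf: "y \<E> N ==> b \<E> N ==> kk (pr y b) (cf F) = kk y F"
  using kk_eq[of y "pr y b"] N_pr hold_cf by metis

lemma kk_elem: assumes "x \<E> kk y F" obtains z G where "z \<E> N" "x = kk z G"
  using assms mem_col unfolding kk_def below_def by metis

end

section \<open>Cofinal embeddings that preserve \<open>\<Delta>\<^sub>0\<close>-formulas\<close>

locale cofinal_emb = zf2 E P for E :: "'v => 'v => bool" (infix \<open>\<E>\<close> 50) and P +
  fixes i :: "'v => 'v" and M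
  assumes pres_i: "pres i UNIV" and Di: "Df (%C e. i (e 0))" and MP: "M \<in> P" and trM: "transitive_class E M"
    and iM: "i x \<in> M" and cofM: "x \<in> M ==> EX \<alpha>. Ord \<alpha> & x \<E> i (V \<alpha>)"
begin

sublocale pres_map E P i UNIV
  by unfold_locales (auto simp: transitive_class_def pres_i Di)

lemma M_elem: "x \<in> M ==> y \<E> x ==> y \<in> M"
  using trM el_iff unfolding transitive_class_def by blast

lemma M_pr: assumes "pr x y \<in> M" shows "x \<in> M" "y \<in> M"
proof -
  have "upair x y \<in> M" by (rule M_elem[OF assms]) (simp add: pr_eq)
  then show "x \<in> M" "y \<in> M" using M_elem mem_upair by blast+
qed

lemma M_asg: assumes "s \<in> M" "fnc s om" shows "assignment E M s"
  unfolding assignment_iff el_ball using assms M_pr(2)[OF M_elem[OF assms(1) fnc_ap[OF assms(2)]]] by blast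

definition cut where "cut \<alpha> Q = so (%x. x \<E> V \<alpha> & Q x)"
text \<open>The image under \<open>i\<close> of the class defined by \<open>Q\<close>, the analogue
  of \<open>J\<close> for a class embedding. Taken for truth of a formula in the universe it becomes
  truth in \<open>M\<close>, see \<open>K_truth\<close>.\<close>

definition K where "K Q s \<longleftrightarrow> (EX \<alpha>. Ord \<alpha> & s \<E> i (cut \<alpha> Q))"

lemma mem_cut: assumes "D (%C e. Q (e 0))" shows "x \<E> cut \<alpha> Q \<longleftrightarrow> x \<E> V \<alpha> & Q x"
  unfolding cut_def by (rule setof_mem[OF separation[OF assms]])

lemma i_Sub: "Sub x y ==> Sub (i x) (i y)"
  using pres2[OF pres_i, of Sub x y] d0 by auto

lemma cut_V: assumes "D (%C e. Q (e 0))" "s \<E> i (cut \<alpha> Q)" shows "s \<E> i (V \<alpha>)" "s \<in> M"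
proof -
  have "Sub (cut \<alpha> Q) (V \<alpha>)" by (simp add: Sub_iff mem_cut[OF assms(1)])
  then show "s \<E> i (V \<alpha>)" using i_Sub assms(2) by (auto simp: Sub_iff)
  show "s \<in> M" using M_elem[OF iM assms(2)] .
qed

lemma K_iff: assumes Q: "D (%C e. Q (e 0))" and \<alpha>: "Ord \<alpha>" "s \<E> i (V \<alpha>)"
  shows "K Q s \<longleftrightarrow> s \<E> i (cut \<alpha> Q)"
proof
  assume "K Q s"
  then obtain \<beta> where \<beta>: "s \<E> i (cut \<beta> Q)" by (auto simp: K_def)
  define S where "S a b c d \<longleftrightarrow> (ALL x:el a. x \<E> b --> (x \<E> c \<longleftrightarrow> x \<E> d))" for a b c d
  have "D0 (%e. S (e 0) (e 1) (e 2) (e 3))" unfolding S_def by (intro d0)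
  moreover have "S (V \<alpha>) (V \<beta>) (cut \<alpha> Q) (cut \<beta> Q)" unfolding S_def el_ball mem_cut[OF Q] by blast
  ultimately have "S (i (V \<alpha>)) (i (V \<beta>)) (i (cut \<alpha> Q)) (i (cut \<beta> Q))" by (rule iffD1[OF pres4[OF pres_i _ UNIV_I UNIV_I UNIV_I UNIV_I]])
  then show "s \<E> i (cut \<alpha> Q)" unfolding S_def el_ball using \<alpha>(2) \<beta> cut_V(1)[OF Q \<beta>] by blast
qed (use \<alpha> K_def in blast)

lemma K_D0:
  assumes R: "D0 (%e. R (e 0) (e 1) (e 2))" and D: "D (%C e. R (e 0) a b)" and s: "s \<in> M"
  shows "K (%x. R x a b) s \<longleftrightarrow> R s (i a) (i b)"
proof -
  obtain \<alpha> where \<alpha>: "Ord \<alpha>" "s \<E> i (V \<alpha>)" using cofM[OF s] by blast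
  define S where "S v t a b \<longleftrightarrow> (ALL x:el v. x \<E> t \<longleftrightarrow> R x a b)" for v t a b
  have R': "D0 (%e. R (e 0) (e (Suc 2)) (e (Suc 3)))"
    using D0_ren[OF R, of "%n. if n = 0 then 0 else n + 2"] by (simp add: eval_nat_numeral)
  have "D0 (%e. S (e 0) (e 1) (e 2) (e 3))" unfolding S_def by (intro d0 R')
  moreover have "S (V \<alpha>) (cut \<alpha> (%x. R x a b)) a b" unfolding S_def el_ball mem_cut[of "%x. R x a b", OF D] by blast
  ultimately have "S (i (V \<alpha>)) (i (cut \<alpha> (%x. R x a b))) (i a) (i b)" by (rule iffD1[OF pres4[OF pres_i _ UNIV_I UNIV_I UNIV_I UNIV_I]])
  then show ?thesis unfolding S_def el_ball using \<alpha> K_iff[of "%x. R x a b", OF D \<alpha>] by blast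
qed

lemma K_not: assumes Q: "D (%C e. Q (e 0))" and s: "s \<in> M" shows "K (%x. ~ Q x) s \<longleftrightarrow> ~ K Q s"
proof -
  obtain \<alpha> where \<alpha>: "Ord \<alpha>" "s \<E> i (V \<alpha>)" using cofM[OF s] by blast
  note Q' = D_not[OF Q]
  define S where "S v a b \<longleftrightarrow> (ALL x:el v. x \<E> b \<longleftrightarrow> ~ x \<E> a)" for v a b
  have "D0 (%e. S (e 0) (e 1) (e 2))" unfolding S_def by (intro d0)
  moreover have "S (V \<alpha>) (cut \<alpha> Q) (cut \<alpha> (%x. ~ Q x))"
    unfolding S_def el_ball mem_cut[OF Q] mem_cut[of "%x. ~ Q x", OF Q'] by blast
  ultimately have "S (i (V \<alpha>)) (i (cut \<alpha> Q)) (i (cut \<alpha> (%x. ~ Q x)))" by (rule iffD1[OF pres3[OF pres_i _ UNIV_I UNIV_I UNIV_I]])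
  then show ?thesis unfolding S_def el_ball K_iff[OF Q \<alpha>] K_iff[of "%x. ~ Q x", OF Q' \<alpha>] using \<alpha> by blast
qed

lemma K_and: assumes Q: "D (%C e. Q (e 0))" "D (%C e. R (e 0))" and s: "s \<in> M"
  shows "K (%x. Q x & R x) s \<longleftrightarrow> K Q s & K R s"
proof -
  obtain \<alpha> where \<alpha>: "Ord \<alpha>" "s \<E> i (V \<alpha>)" using cofM[OF s] by blast
  note Q' = D_and[OF Q]
  define S where "S v a b c \<longleftrightarrow> (ALL x:el v. x \<E> c \<longleftrightarrow> x \<E> a & x \<E> b)" for v a b c
  have "D0 (%e. S (e 0) (e 1) (e 2) (e 3))" unfolding S_def by (intro d0)
  moreover have "S (V \<alpha>) (cut \<alpha> Q) (cut \<alpha> R) (cut \<alpha> (%x. Q x & R x))"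
    unfolding S_def el_ball mem_cut[OF Q(1)] mem_cut[OF Q(2)] mem_cut[of "%x. Q x & R x", OF Q'] by blast
  ultimately have "S (i (V \<alpha>)) (i (cut \<alpha> Q)) (i (cut \<alpha> R)) (i (cut \<alpha> (%x. Q x & R x)))" by (rule iffD1[OF pres4[OF pres_i _ UNIV_I UNIV_I UNIV_I UNIV_I]])
  then show ?thesis
    unfolding S_def el_ball K_iff[OF Q(1) \<alpha>] K_iff[OF Q(2) \<alpha>] K_iff[of "%x. Q x & R x", OF Q' \<alpha>] using \<alpha> by blast
qed

text \<open>The Tarski clauses hold for assignments only, so predicates are compared just on
  functions with domain \<open>om\<close>.\<close>

lemma K_cong:
  assumes Q: "D (%C e. Q (e 0))" "D (%C e. R (e 0))" and eq: "!!x. fnc x om ==> Q x \<longleftrightarrow> R x" and s: "s \<in> M" "fnc s om"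
  shows "K Q s \<longleftrightarrow> K R s"
proof -
  obtain \<alpha> where \<alpha>: "Ord \<alpha>" "s \<E> i (V \<alpha>)" using cofM[OF s(1)] by blast
  define S where "S v a b c \<longleftrightarrow> (ALL x:el v. fnc x c --> (x \<E> a \<longleftrightarrow> x \<E> b))" for v a b c
  have "D0 (%e. S (e 0) (e 1) (e 2) (e 3))" unfolding S_def by (intro d0)
  moreover have "S (V \<alpha>) (cut \<alpha> Q) (cut \<alpha> R) om"
    unfolding S_def el_ball mem_cut[OF Q(1)] mem_cut[OF Q(2)] using eq by blast
  ultimately have "S (i (V \<alpha>)) (i (cut \<alpha> Q)) (i (cut \<alpha> R)) (i om)" by (rule iffD1[OF pres4[OF pres_i _ UNIV_I UNIV_I UNIV_I UNIV_I]])
  then show ?thesis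
    unfolding S_def el_ball K_iff[OF Q(1) \<alpha>] K_iff[OF Q(2) \<alpha>] h_om using \<alpha> s(2) by blast
qed

definition varr where "varr a s t o' \<longleftrightarrow> (ALL n:el o'. n ~= a --> (EX x. pr n x \<E> s & pr n x \<E> t))"

lemma D0_varr [d0]: "D0 (%e. varr (e a) (e b) (e c) (e d))"
  unfolding varr_def by (intro d0)

lemma varr_iff: assumes "fnc s om" "fnc t om" "a \<E> om" shows "varr a s t om \<longleftrightarrow> t = upd s a (ap t a)"
proof
  assume v: "varr a s t om"
  show "t = upd s a (ap t a)"
  proof (rule fnc_ext[OF assms(2) fnc_upd])
    fix n assume n: "n \<E> om"
    then show "ap t n = ap (upd s a (ap t a)) n"
      using v unfolding varr_def el_ball fnc_pr[OF assms(1)] fnc_pr[OF assms(2)] ap_upd[OF n] by auto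
  qed
next
  assume eq: "t = upd s a (ap t a)"
  have "ap t n = ap s n" if "n \<E> om" "n ~= a" for n
  proof -
    have "ap t n = ap (upd s a (ap t a)) n" using eq by simp
    then show ?thesis using ap_upd[OF that(1)] that(2) by simp
  qed
  then show "varr a s t om" unfolding varr_def el_ball fnc_pr[OF assms(1)] fnc_pr[OF assms(2)] by auto
qed

text \<open>Nothing is known yet about the theory of \<open>M\<close>. All modifications of
  functions in a level form a set \<open>?B\<close> in the universe, and its image, contained in
  \<open>M\<close>, has the required function as an element.\<close>

lemma M_upd: assumes s: "s \<in> M" "fnc s om" and x: "x \<in> M" and a: "a \<E> om" shows "upd s a x \<in> M"
proof -
  obtain \<alpha>1 \<alpha>2 where a12: "Ord \<alpha>1" "s \<E> i (V \<alpha>1)" "Ord \<alpha>2" "x \<E> i (V \<alpha>2)" using cofM s(1) x by meson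
  have "EX \<alpha>. Ord \<alpha> & Sub (V \<alpha>1) (V \<alpha>) & Sub (V \<alpha>2) (V \<alpha>)"
    using Ord_linear[OF a12(1,3)] V_mono[OF a12(1)] V_mono[OF a12(3)] a12 unfolding Sub_iff by meson
  then obtain \<alpha> where \<alpha>: "s \<E> i (V \<alpha>)" "x \<E> i (V \<alpha>)" using i_Sub a12 unfolding Sub_iff by meson
  define t where "t p = upd (fs p) a (sn p)" for p
  have Dt: "Df (%C e. t (e 0))" unfolding t_def by (intro dfn)
  let ?B = "img t (prod (V \<alpha>) (V \<alpha>))"
  define S where "S v B a o' \<longleftrightarrow> (ALL s:el v. ALL x:el v. fnc s o' --> (EX t:el B. fnc t o' & varr a s t o' & pr a x \<E> t))" for v B a o'
  have "D0 (%e. S (e 0) (e 1) (e 2) (e 3))" unfolding S_def by (intro d0)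
  moreover have "S (V \<alpha>) ?B a om" unfolding S_def el_ball el_bex
  proof (intro allI impI)
    fix s x assume h: "s \<E> V \<alpha>" "x \<E> V \<alpha>" "fnc s om"
    have "upd s a x \<E> ?B" unfolding mem_img[OF Dt] t_def mem_prod using h by (intro exI[of _ "pr s x"]) auto
    moreover have "varr a s (upd s a x) om" using varr_iff[OF h(3) fnc_upd a] ap_upd[OF a] by simp
    moreover have "pr a x \<E> upd s a x" using fnc_pr[OF fnc_upd] ap_upd[OF a] a by simp
    ultimately show "EX t. t \<E> ?B & fnc t om & varr a s t om & pr a x \<E> t" using fnc_upd by blast
  qed
  ultimately have "S (i (V \<alpha>)) (i ?B) (i a) (i om)" by (rule iffD1[OF pres4[OF pres_i _ UNIV_I UNIV_I UNIV_I UNIV_I]])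
  then obtain t' where t': "t' \<E> i ?B" "fnc t' om" "varr a s t' om" "pr a x \<E> t'"
    using \<alpha> s(2) unfolding S_def el_ball el_bex h_om h_om_elem[OF a] by blast
  then have "t' = upd s a x" using varr_iff[OF s(2) t'(2) a] ap_eq[OF t'(2,4)] by simp
  then show ?thesis using M_elem[OF iM t'(1)] by simp
qed

context
  fixes S T assumes S: "S \<in> P" "truth E UNIV S" and T: "T \<in> P" "truth E M T"
begin

lemma S_asg: "fnc s om ==> assignment E UNIV s" by (simp add: assignment_iff)

lemma DS1: "D (%C e. pr \<phi> (e 0) \<in> S)" by (intro dfn S)

text \<open>Here Collection of the universe gives elementarity: witnesses for all assignments in one
  cut lie in a single level, which makes their existence a bounded statement about two cuts. The
  converse direction is bounded as it stands.\<close>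

lemma K_Ex:
  assumes a: "a \<E> om" and \<phi>: "is_fm E \<phi>" and s: "s \<in> M" "fnc s om"
  shows "K (%s. pr (cEx E a \<phi>) s \<in> S) s \<longleftrightarrow> (EX x:M. K (%s. pr \<phi> s \<in> S) (upd s a x))"
proof
  let ?q = "%s. pr (cEx E a \<phi>) s \<in> S" and ?r = "%s. pr \<phi> s \<in> S"
  assume "K ?q s"
  then obtain \<alpha> where \<alpha>: "s \<E> i (cut \<alpha> ?q)" by (auto simp: K_def)
  have D\<Phi>: "D (%C e. fnc (e 0) om --> (EX x. e 1 = upd (e 0) a x) & pr \<phi> (e 1) \<in> S)" by (intro dfn S)
  have "EX t. fnc s om --> (EX x. t = upd s a x) & pr \<phi> t \<in> S" if "s \<E> cut \<alpha> ?q" for s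
    using that mem_cut[of ?q, OF DS1] truthD(5)[OF S(2) S_asg a \<phi>] by blast
  then obtain b where b: "!!s. s \<E> cut \<alpha> ?q ==> EX t. t \<E> b & (fnc s om --> (EX x. t = upd s a x) & pr \<phi> t \<in> S)"
    using collection[OF D\<Phi>, of "cut \<alpha> ?q"] by blast
  obtain \<beta> where \<beta>: "Ord \<beta>" "b \<E> V \<beta>" using in_V by blast
  define U where "U c d a o' \<longleftrightarrow> (ALL s:el c. fnc s o' --> (EX t:el d. fnc t o' & varr a s t o'))" for c d a o'
  have "D0 (%e. U (e 0) (e 1) (e 2) (e 3))" unfolding U_def by (intro d0)
  moreover have "U (cut \<alpha> ?q) (cut \<beta> ?r) a om" unfolding U_def el_ball el_bex
  proof (intro allI impI)
    fix s assume h: "s \<E> cut \<alpha> ?q" "fnc s om"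
    then obtain x t where t: "t \<E> b" "t = upd s a x" "pr \<phi> t \<in> S" using b by blast
    have "t \<E> cut \<beta> ?r" using t V_trans[OF \<beta>] mem_cut[of ?r, OF DS1] by blast
    moreover have "varr a s t om" using t varr_iff[OF h(2) fnc_upd a] ap_upd[OF a] by simp
    ultimately show "EX t. t \<E> cut \<beta> ?r & fnc t om & varr a s t om" using t fnc_upd by blast
  qed
  ultimately have "U (i (cut \<alpha> ?q)) (i (cut \<beta> ?r)) (i a) (i om)" by (rule iffD1[OF pres4[OF pres_i _ UNIV_I UNIV_I UNIV_I UNIV_I]])
  then obtain t where t: "t \<E> i (cut \<beta> ?r)" "fnc t om" "varr a s t om"
    using \<alpha> s(2) unfolding U_def el_ball el_bex h_om h_om_elem[OF a] by blast
  have "t \<in> M" using cut_V(2)[of ?r, OF DS1 t(1)] .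
  then have "ap t a \<in> M" using M_pr(2)[OF M_elem[OF _ fnc_ap[OF t(2) a]]] by blast
  moreover have "t = upd s a (ap t a)" using varr_iff[OF s(2) t(2) a] t(3) by blast
  ultimately show "EX x:M. K ?r (upd s a x)" using t(1) \<beta>(1) unfolding K_def by metis
next
  let ?q = "%s. pr (cEx E a \<phi>) s \<in> S" and ?r = "%s. pr \<phi> s \<in> S"
  assume "EX x:M. K ?r (upd s a x)"
  then obtain x where x: "x \<in> M" "K ?r (upd s a x)" by blast
  then obtain \<beta> where \<beta>: "upd s a x \<E> i (cut \<beta> ?r)" by (auto simp: K_def)
  obtain \<alpha> where \<alpha>: "Ord \<alpha>" "s \<E> i (V \<alpha>)" using cofM[OF s(1)] by blast
  define U where "U v c d a o' \<longleftrightarrow> (ALL s:el v. ALL t:el c. fnc s o' & fnc t o' & varr a s t o' --> s \<E> d)" for v c d a o'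
  have "D0 (%e. U (e 0) (e 1) (e 2) (e 3) (e 4))" unfolding U_def by (intro d0)
  moreover have "U (V \<alpha>) (cut \<beta> ?r) (cut \<alpha> ?q) a om"
    unfolding U_def el_ball mem_cut[of ?r, OF DS1] mem_cut[of ?q, OF DS1]
  proof (intro allI impI)
    fix s t assume h: "s \<E> V \<alpha>" "t \<E> V \<beta> & pr \<phi> t \<in> S" "fnc s om & fnc t om & varr a s t om"
    then have "t = upd s a (ap t a)" using varr_iff a by blast
    then have "EX x:UNIV. pr \<phi> (upd s a x) \<in> S" using h(2) by (metis UNIV_I)
    then show "s \<E> V \<alpha> & pr (cEx E a \<phi>) s \<in> S" using truthD(5)[OF S(2) S_asg a \<phi>] h by blast
  qed
  ultimately have "U (i (V \<alpha>)) (i (cut \<beta> ?r)) (i (cut \<alpha> ?q)) (i a) (i om)" by (rule iffD1[OF pres5[OF pres_i _ UNIV_I UNIV_I UNIV_I UNIV_I UNIV_I]])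
  moreover have "varr a s (upd s a x) om" using varr_iff[OF s(2) fnc_upd a] ap_upd[OF a] by simp
  ultimately have "s \<E> i (cut \<alpha> ?q)"
    unfolding U_def el_ball h_om h_om_elem[OF a] using \<alpha>(2) \<beta> s(2) fnc_upd by blast
  then show "K ?q s" using \<alpha>(1) by (auto simp: K_def)
qed

lemma K_truth:
  assumes \<phi>: "is_fm E \<phi>"
  shows "ALL s. s \<in> M & fnc s om --> (pr \<phi> s \<in> T \<longleftrightarrow> K (%s. pr \<phi> s \<in> S) s)"
proof (rule fm_induct[of "%\<phi>. ALL s. s \<in> M & fnc s om --> (pr \<phi> s \<in> T \<longleftrightarrow> K (%s. pr \<phi> s \<in> S) s)", OF _ \<phi>], goal_cases)
  case 1
  \<comment> \<open>For the induction predicate to be definable, \<open>cut\<close> must be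
    definable with the code and the level as variables.\<close>
  have ex: "EX z. ALL x. x \<E> z \<longleftrightarrow> x \<E> V \<alpha> & pr \<phi> x \<in> S" for \<alpha> \<phi> by (rule separation, rule DS1)
  have "Df (%C e. so (%x. x \<E> V (e 0) & pr (e (Suc (Suc 0))) x \<in> S))"
    by (rule Df_setof, intro dfn S, rule set_ex1[OF ex])
  then show ?case
    unfolding K_def cut_def by (intro dfn MP T Df_fun1[OF Di])
next
  case (2 a b) note Mem = 2
  define R where "R s a b \<longleftrightarrow> (EX x. pr a x \<E> s & (EX y. pr b y \<E> s & x \<E> y))" for s a b
  have D0R: "D0 (%e. R (e 0) (e 1) (e 2))" unfolding R_def by (intro d0)
  have DR: "D (%C e. R (e 0) a b)" unfolding R_def by (intro dfn)
  have R: "R s a b \<longleftrightarrow> ap s a \<E> ap s b" if "fnc s om" for s unfolding R_def fnc_pr[OF that] using Mem by auto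
  show ?case
  proof (intro allI impI)
    fix s assume s: "s \<in> M & fnc s om"
    have "K (%s. pr (cMem E a b) s \<in> S) s \<longleftrightarrow> K (%s. R s a b) s"
      by (rule K_cong[of "%s. pr (cMem E a b) s \<in> S" "%s. R s a b", OF DS1 DR])
        (use R truthD(1)[OF S(2) S_asg] Mem s in auto)
    then show "pr (cMem E a b) s \<in> T \<longleftrightarrow> K (%s. pr (cMem E a b) s \<in> S) s"
      using K_D0[of R, OF D0R DR, of s] truthD(1)[OF T(2) M_asg Mem, of s] R s h_om_elem Mem by auto
  qed
next
  case (3 a b) note Eq = 3
  define R where "R s a b \<longleftrightarrow> (EX x. pr a x \<E> s & (EX y. pr b y \<E> s & x = y))" for s a b
  have D0R: "D0 (%e. R (e 0) (e 1) (e 2))" unfolding R_def by (intro d0)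
  have DR: "D (%C e. R (e 0) a b)" unfolding R_def by (intro dfn)
  have R: "R s a b \<longleftrightarrow> ap s a = ap s b" if "fnc s om" for s unfolding R_def fnc_pr[OF that] using Eq by auto
  show ?case
  proof (intro allI impI)
    fix s assume s: "s \<in> M & fnc s om"
    have "K (%s. pr (cEq E a b) s \<in> S) s \<longleftrightarrow> K (%s. R s a b) s"
      by (rule K_cong[of "%s. pr (cEq E a b) s \<in> S" "%s. R s a b", OF DS1 DR])
        (use R truthD(2)[OF S(2) S_asg] Eq s in auto)
    then show "pr (cEq E a b) s \<in> T \<longleftrightarrow> K (%s. pr (cEq E a b) s \<in> S) s"
      using K_D0[of R, OF D0R DR, of s] truthD(2)[OF T(2) M_asg Eq, of s] R s h_om_elem Eq by auto
  qed
next
  case (4 \<phi>) note Neg = 4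
  show ?case
  proof (intro allI impI)
    fix s assume s: "s \<in> M & fnc s om"
    have "K (%s. pr (cNeg E \<phi>) s \<in> S) s \<longleftrightarrow> K (%s. ~ pr \<phi> s \<in> S) s"
      by (rule K_cong[of "%s. pr (cNeg E \<phi>) s \<in> S" "%s. ~ pr \<phi> s \<in> S", OF DS1 D_not[OF DS1]])
        (use truthD(3)[OF S(2) S_asg] Neg s in auto)
    then show "pr (cNeg E \<phi>) s \<in> T \<longleftrightarrow> K (%s. pr (cNeg E \<phi>) s \<in> S) s"
      using K_not[of "%s. pr \<phi> s \<in> S", OF DS1, of s] truthD(3)[OF T(2) M_asg Neg(1), of s] Neg(2) s by auto
  qed
next
  case (5 \<phi> \<psi>) note And = 5
  show ?case
  proof (intro allI impI)
    fix s assume s: "s \<in> M & fnc s om"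
    have "K (%s. pr (cAnd E \<phi> \<psi>) s \<in> S) s \<longleftrightarrow> K (%s. pr \<phi> s \<in> S & pr \<psi> s \<in> S) s"
      by (rule K_cong[of "%s. pr (cAnd E \<phi> \<psi>) s \<in> S" "%s. pr \<phi> s \<in> S & pr \<psi> s \<in> S", OF DS1 D_and[OF DS1 DS1]])
        (use truthD(4)[OF S(2) S_asg] And s in auto)
    then show "pr (cAnd E \<phi> \<psi>) s \<in> T \<longleftrightarrow> K (%s. pr (cAnd E \<phi> \<psi>) s \<in> S) s"
      using K_and[of "%s. pr \<phi> s \<in> S" "%s. pr \<psi> s \<in> S", OF DS1 DS1, of s] truthD(4)[OF T(2) M_asg And(1) And(3), of s]
        And(2,4) s by auto
  qed
next
  case (6 a \<phi>) note Ex = 6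
  show ?case
  proof (intro allI impI)
    fix s assume s: "s \<in> M & fnc s om"
    have "pr \<phi> (upd s a x) \<in> T \<longleftrightarrow> K (%s. pr \<phi> s \<in> S) (upd s a x)" if "x \<in> M" for x
      using Ex(3) M_upd[of s x a] s that Ex(1) fnc_upd by blast
    then show "pr (cEx E a \<phi>) s \<in> T \<longleftrightarrow> K (%s. pr (cEx E a \<phi>) s \<in> S) s"
      using K_Ex[OF Ex(1,2)] truthD(5)[OF T(2) M_asg Ex(1,2), of s] s by auto
  qed
qed

lemma i_truth:
  assumes \<phi>: "is_fm E \<phi>" and s: "fnc s om"
  shows "pr \<phi> s \<in> S \<longleftrightarrow> pr \<phi> (i s) \<in> T"
proof -
  obtain \<alpha> where \<alpha>: "Ord \<alpha>" "s \<E> V \<alpha>" using in_V by blast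
  have "pr \<phi> (i s) \<in> T \<longleftrightarrow> K (%s. pr \<phi> s \<in> S) (i s)" using K_truth[OF \<phi>] iM h_fnc(1)[OF s] h_om by auto
  also have "\<dots> \<longleftrightarrow> i s \<E> i (cut \<alpha> (%s. pr \<phi> s \<in> S))"
    by (rule K_iff[of "%s. pr \<phi> s \<in> S", OF DS1 \<alpha>(1)]) (use \<alpha>(2) h_mem[OF UNIV_I UNIV_I, of s "V \<alpha>"] in blast)
  also have "\<dots> \<longleftrightarrow> pr \<phi> s \<in> S" using h_mem[OF UNIV_I UNIV_I, of s "cut \<alpha> (%s. pr \<phi> s \<in> S)"] mem_cut[of "%s. pr \<phi> s \<in> S", OF DS1] \<alpha>(2) by blast
  finally show ?thesis by blast
qed

end

lemma V_critical:
  assumes "critical_point E i UNIV \<kappa>"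
  shows "V_critical E P \<kappa>"
proof -
  define J where "J = {p. EX x. p = pr x (i x)}"
  have JP: "J \<in> P" unfolding J_def by (rule class_comp, intro dfn Df_fun1[OF Di])
  have J: "pr x y \<in> J \<longleftrightarrow> y = i x" for x y by (auto simp: J_def)
  have app: "class_app E J = i" unfolding fun_eq_iff class_app_def J by simp
  obtain S where S: "S \<in> P" "truth E UNIV S" by (rule truth_class[OF UNIV_P])
  obtain T where T: "T \<in> P" "truth E M T" by (rule truth_class[OF MP])
  have "class_maps E J M" unfolding class_maps_def app J using iM by (auto simp: J_def)
  moreover have "pr \<phi> s \<in> S \<longleftrightarrow> pr \<phi> t \<in> T"
    if h: "is_fm E \<phi> & assignment E UNIV s & assignment E M t & pointwise_image E (class_app E J) s t" for \<phi> s t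
  proof -
    have f: "fnc s om" "fnc t om" using h by (auto dest: asgD)
    have "t = i s"
    proof (rule fnc_ext[OF f(2)])
      show "fnc (i s) om" using h_fnc(1)[OF f(1)] h_om by simp
      fix n assume n: "n \<E> om"
      have "ap t n = i (ap s n)" using h n ap_app[OF f(1) n] ap_app[OF f(2) n] unfolding pointwise_image_def app by auto
      then show "ap t n = ap (i s) n" using h_fnc(2)[OF f(1)] h_om_elem[OF n] n by (metis UNIV_I)
    qed
    then show "pr \<phi> s \<in> S \<longleftrightarrow> pr \<phi> t \<in> T" using i_truth[OF S T _ f(1)] h by blast
  qed
  ultimately have "class_elementary E P J M" unfolding class_elementary_def truth_iff using S T by blast
  then show ?thesis unfolding V_critical_def using MP JP trM assms app by auto
qed

end

section \<open>Los' theorem for \<open>\<Delta>\<^sub>0\<close>-formulas and the embedding into the ultrapower\<close>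

lemma (in zf2) D_satr:
  assumes "first_order \<phi>" "!!n. Df (t n)"
  shows "D (%C e. satr E UNIV (%n. t n C e) \<phi>)"
  using assms
proof (induction \<phi> arbitrary: t)
  case (Ex i \<phi>)
  define t' where "t' n C e = (if n = i then e 0 else t n C (%m. e (Suc m)))" for n :: nat and C :: "nat => 'v set" and e :: "nat => 'v"
  have "Df (t' n)" for n
  proof (cases "n = i")
    case True
    have "Df (%C e. e 0)" by (intro dfn)
    then show ?thesis using True by (simp add: t'_def[abs_def])
  next
    case False
    then show ?thesis using Df_ren[OF Ex(3)[of n], of Suc] by (simp add: t'_def[abs_def])
  qed
  then have "D (%C e. satr E UNIV (%n. t' n C e) \<phi>)" using Ex by simp
  then have "D (%C e. satr E UNIV ((%n. t n C (%m. e (Suc m)))(i := e 0)) \<phi>)" by (simp add: t'_def fun_upd_def)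
  then show ?case using D_ex[of "%C e x. satr E UNIV ((%n. t n C e)(i := x)) \<phi>"] by simp
qed (auto intro: dfn)

context ult_wit
begin

lemma D_Los: "delta0 \<phi> ==> D (%C e. satr E UNIV (%n. ap (F n) (e 0)) \<phi>)"
  using D_satr[OF delta0_first_order, of \<phi> "%n C e. ap (F n) (e 0)"] Df_tapp Df_param Df_var by blast

lemma kk_cs: "z \<E> N ==> b \<E> N ==> kk (pr b z) (cs F) = kk z F"
  using kk_eq[of z "pr b z"] N_pr hold_cs by metis

text \<open>Only the bounded quantifier needs an argument. A witness in the ultrapower is absorbed
  into the seed by \<open>cf\<close> and \<open>cs\<close>; conversely, witnesses on almost all
  arguments are turned into one function by \<open>select\<close>.\<close>

lemma Los:
  assumes "delta0 \<phi>" "y \<E> N"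
  shows "satr E UNIV (%n. kk y (F n)) \<phi> \<longleftrightarrow> J (%u. satr E UNIV (%n. ap (F n) u) \<phi>) y"
  using assms
proof (induction \<phi> arbitrary: y F rule: delta0.induct)
  case (delta0_Mem i k)
  then show ?case using kk_mem[of y y] hold_diag[OF DM, of y] by simp
next
  case (delta0_Eq i k)
  then show ?case using kk_eq[of y y] hold_diag[OF DE, of y] by simp
next
  case (delta0_Neg \<phi>)
  then show ?case using J_not[OF D_Los, of \<phi> y F] by simp
next
  case (delta0_And \<phi> \<psi>)
  then show ?case using J_and[OF D_Los D_Los, of \<phi> \<psi> F F y] by simp
next
  case (delta0_Bex i k \<phi>)
  define S where "S u x \<longleftrightarrow> x \<E> ap (F k) u & satr E UNIV ((%n. ap (F n) u)(i := x)) \<phi>" for u x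
  define t where "t n C e = (if n = i then e 1 else ap (F n) (e 0))" for n :: nat and C :: "nat => 'v set" and e :: "nat => 'v"
  have "Df (t n)" for n
  proof (cases "n = i")
    case True
    have "Df (%C e. e 1)" by (intro dfn)
    then show ?thesis using True by (simp add: t_def[abs_def])
  next
    case False
    have "Df (%C e. ap (F n) (e 0))" by (intro dfn)
    then show ?thesis using False by (simp add: t_def[abs_def])
  qed
  then have "D (%C e. satr E UNIV (%n. t n C e) \<phi>)" using D_satr[OF delta0_first_order[OF delta0_Bex(2)]] by blast
  then have "D (%C e. satr E UNIV ((%n. ap (F n) (e 0))(i := e 1)) \<phi>)" unfolding t_def fun_upd_def .
  then have DSS: "D (%C e. S (e 0) (e 1))" unfolding S_def by (intro dfn)
  have DS2: "D (%C e. EX x. S (e 0) x)" by (intro dfn D_pred2[OF DSS])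
  have DS3: "D (%C e. EX x. S (fs (e 0)) x)" by (intro dfn D_pred2[OF DSS])
  have JS: "J (%u. satr E UNIV (%n. ap (F n) u) (Ex i (And (Mem i k) \<phi>))) y \<longleftrightarrow> J (%u. EX x. S u x) y"
    using delta0_Bex(1) by (simp add: S_def)
  have y: "y \<E> N" by fact
  show ?case unfolding JS
  proof
    assume "satr E UNIV (%n. kk y (F n)) (Ex i (And (Mem i k) \<phi>))"
    then obtain x where x: "x \<E> kk y (F k)" "satr E UNIV ((%n. kk y (F n))(i := x)) \<phi>" using delta0_Bex(1) by auto
    obtain z G where z: "z \<E> N" "x = kk z G" using x(1) by (rule kk_elem)
    let ?s = "pr y z"
    have s: "?s \<E> N" using y z N_pr by blast
    define F' where "F' n = (if n = i then cs G else cf (F n))" for n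
    have "(%n. kk ?s (F' n)) = (%n. kk y (F n))(i := x)"
      using kk_cf[OF y z(1)] kk_cs[OF z(1) y] z(2) by (auto simp: F'_def fun_eq_iff)
    then have J1: "J (%w. satr E UNIV (%n. ap (F' n) w) \<phi>) ?s" using delta0_Bex(3)[OF s, of F'] x(2) by simp
    have "kk ?s (cs G) \<E> kk ?s (cf (F k))" using kk_cf[OF y z(1)] kk_cs[OF z(1) y] z(2) x(1) by simp
    then have J2: "J (%w. ap (cs G) w \<E> ap (cf (F k)) w) ?s" using kk_mem[OF s s] hold_diag[OF DM s] by simp
    have D2: "D (%C e. ap (cs G) (e 0) \<E> ap (cf (F k)) (e 0))" by (intro dfn)
    note D1 = D_Los[OF delta0_Bex(2), of F']
    have J3: "J (%w. satr E UNIV (%n. ap (F' n) w) \<phi> & ap (cs G) w \<E> ap (cf (F k)) w) ?s"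
      using J_and[OF D1 D2] J1 J2 by simp
    have "J (%w. EX x. S (fs w) x) ?s"
    proof (rule J_mono[OF D_and[OF D1 D2] DS3 _ J3])
      fix w assume w: "w \<E> V \<delta>" and h: "satr E UNIV (%n. ap (F' n) w) \<phi> & ap (cs G) w \<E> ap (cf (F k)) w"
      have "(%n. ap (F' n) w) = (%n. ap (F n) (fs w))(i := ap (cs G) w)"
        by (auto simp: F'_def fun_eq_iff ap_cf[OF w])
      then have "S (fs w) (ap (cs G) w)" using h ap_cf[OF w] by (simp add: S_def)
      then show "EX x. S (fs w) x" by blast
    qed
    then show "J (%u. EX x. S u x) y" using J_fs[of "%u. EX x. S u x", OF DS2 y z(1)] by blast
  next
    assume "J (%u. EX x. S u x) y"
    then obtain b H where b: "b \<E> N" "J (%w. S (fs w) (ap H w)) (pr y b)"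
      using select[of "%u. EX x. S u x" S y, OF DS2 DSS] by blast
    let ?s = "pr y b"
    have s: "?s \<E> N" using y b(1) N_pr by blast
    define F' where "F' n = (if n = i then H else cf (F n))" for n
    note D1 = D_Los[OF delta0_Bex(2), of F']
    have D2: "D (%C e. ap H (e 0) \<E> ap (cf (F k)) (e 0))" by (intro dfn)
    have D3: "D (%C e. S (fs (e 0)) (ap H (e 0)))" by (intro D_pred2[OF DSS] dfn)
    have F': "(%n. ap (F' n) w) = (%n. ap (F n) (fs w))(i := ap H w)" if "w \<E> V \<delta>" for w
      by (auto simp: F'_def fun_eq_iff ap_cf[OF that])
    have "J (%w. satr E UNIV (%n. ap (F' n) w) \<phi>) ?s" by (rule J_mono[OF D3 D1 _ b(2)]) (simp add: F' S_def)
    then have "satr E UNIV (%n. kk ?s (F' n)) \<phi>" using delta0_Bex(3)[OF s] by blast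
    moreover have "(%n. kk ?s (F' n)) = (%n. kk y (F n))(i := kk ?s H)"
      using kk_cf[OF y b(1)] by (auto simp: F'_def fun_eq_iff)
    moreover have "J (%w. ap H w \<E> ap (cf (F k)) w) ?s" by (rule J_mono[OF D3 D2 _ b(2)]) (simp add: ap_cf S_def)
    then have "kk ?s H \<E> kk ?s (cf (F k))" using kk_mem[OF s s] hold_diag[OF DM s] by blast
    then have "kk ?s H \<E> kk y (F k)" using kk_cf[OF y b(1)] by simp
    ultimately show "satr E UNIV (%n. kk y (F n)) (Ex i (And (Mem i k) \<phi>))" using delta0_Bex(1) by auto
  qed
qed

definition cst where "cst x = so (%p. EX u. u \<E> V \<delta> & p = pr u x)"

lemma cst_ex: "EX z. ALL p. p \<E> z \<longleftrightarrow> (EX u. u \<E> V \<delta> & p = pr u x)"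
  by (rule comp_ex[of _ "prod (V \<delta>) (upair x x)"], intro dfn) (auto simp: mem_prod)

lemma ap_cst: assumes "u \<E> V \<delta>" shows "ap (cst x) u = x"
proof -
  have m: "p \<E> cst x \<longleftrightarrow> (EX u. u \<E> V \<delta> & p = pr u x)" for p unfolding cst_def by (rule setof_mem[OF cst_ex])
  have "fnc (cst x) (V \<delta>)" unfolding fnc_iff m by auto
  then show ?thesis by (rule ap_eq) (use m assms in auto)
qed

lemma Df_cst [dfn]: assumes "Df s" shows "Df (%w e. cst (s w e))"
  unfolding cst_def by (rule Df_setof, intro dfn assms[THEN Df_ren], rule set_ex1[OF cst_ex])

lemma emp_N: "emp \<E> N"
  using j_N[OF emp_V] h_emp emp_V by simp

definition ii where "ii x = kk emp (cst x)"

lemma Dii: "Df (%C e. ii (e 0))"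
  unfolding ii_def kk_def by (intro dfn)

lemma kk_cst: "y \<E> N ==> kk y (cst x) = ii x"
  unfolding ii_def by (subst kk_eq[OF _ emp_N], assumption, rule hold_all[OF DE _ emp_N]) (auto simp: ap_cst)

lemma pres_ii: "pres ii UNIV"
  unfolding pres_def
proof (intro allI impI)
  fix Q e assume Q: "D0 Q"
  obtain \<phi> where \<phi>: "delta0 \<phi>" "!!e. satr E UNIV e \<phi> \<longleftrightarrow> Q e" by (rule D0_fm[OF Q]) (rule that)
  note D1 = D_Los[OF \<phi>(1), of "%n. cst (e n)"]
  have D2: "D (%C e'. Q e)" by (intro dfn)
  have eq: "satr E UNIV (%n. ap (cst (e n)) u) \<phi> \<longleftrightarrow> Q e" if "u \<E> V \<delta>" for u using ap_cst[OF that] \<phi>(2) by simp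
  have "Q (%n. ii (e n)) \<longleftrightarrow> J (%u. satr E UNIV (%n. ap (cst (e n)) u) \<phi>) emp"
    unfolding ii_def using Los[OF \<phi>(1) emp_N, of "%n. cst (e n)"] \<phi>(2) by simp
  also have "\<dots> \<longleftrightarrow> J (%u. Q e) emp" using J_mono[OF D1 D2] J_mono[OF D2 D1] eq by blast
  also have "\<dots> \<longleftrightarrow> Q e" by (rule J_const[OF emp_N])
  finally show "Q e = Q (%n. ii (e n))" by blast
qed

definition MM where "MM = {x. EX y F. y \<E> N & x = kk y F}"

lemma MM: "MM \<in> P" "transitive_class E MM" "ii x \<in> MM"
proof -
  show "MM \<in> P" unfolding MM_def kk_def by (rule class_comp, intro dfn)
  show "ii x \<in> MM" using emp_N by (auto simp: MM_def ii_def)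
  have "y \<in> MM" if "x \<in> MM" "y \<E> x" for x y
    using that kk_elem unfolding MM_def mem_Collect_eq by metis
  then show "transitive_class E MM" unfolding transitive_class_def using el_iff by blast
qed

text \<open>All values of a function lie in one level of the universe, so its class is an element of
  the image of that level.\<close>

lemma MM_cof: assumes "x \<in> MM" shows "EX \<alpha>. Ord \<alpha> & x \<E> ii (V \<alpha>)"
proof -
  obtain y F where y: "y \<E> N" "x = kk y F" using assms by (auto simp: MM_def)
  let ?Z = "un2 (Uni (Uni F)) (upair emp emp)"
  obtain \<alpha> where \<alpha>: "Ord \<alpha>" "?Z \<E> V \<alpha>" using in_V by blast
  have Z: "ap F u \<E> ?Z" for u
  proof (cases "ap F u = emp")
    case False
    then obtain x where "x \<E> ap F u" using emp_iff by blast
    then have "pr u (ap F u) \<E> F" by (rule ap_mem)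
    moreover have "upair u (ap F u) \<E> pr u (ap F u)" by (simp add: pr_eq)
    ultimately have "upair u (ap F u) \<E> Uni F" by auto
    then have "ap F u \<E> Uni (Uni F)" by (metis mem_Uni mem_upair)
    then show ?thesis by simp
  qed simp
  have "hold (\<E>) y F y (cst (V \<alpha>))" by (rule hold_all[OF DM y(1) y(1)]) (use V_trans[OF \<alpha> Z] ap_cst in simp)
  then have "kk y F \<E> kk y (cst (V \<alpha>))" using kk_mem[OF y(1) y(1)] by blast
  then have "x \<E> ii (V \<alpha>)" using kk_cst[OF y(1)] y(2) by simp
  then show ?thesis using \<alpha>(1) by blast
qed

definition idf where "idf = lam (V \<delta>) (%u. u)"

lemma ap_idf: "u \<E> V \<delta> ==> ap idf u = u"
  unfolding idf_def by (rule ap_lam) (intro dfn)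

text \<open>The values \<open>ap G u\<close> lie in the same level as the arguments \<open>v\<close>
  that contain them. So \<open>J_ex\<close> applies with that level as bound and captures the class
  of \<open>G\<close> by a seed; the witness is the value itself and nothing is chosen.\<close>

lemma seed_mem:
  assumes h: "hold (\<E>) z G y idf"
  obtains b where "b \<E> y" "b \<E> N" "hold (=) z G b idf"
proof -
  have N: "z \<E> N" "y \<E> N" using hold_N[OF h DM] by auto
  let ?s = "pr z y"
  have s: "?s \<E> N" using N N_pr by blast
  obtain \<alpha> where \<alpha>: "\<alpha> \<E> \<delta>" "?s \<E> hj (V \<alpha>)" using N_level[OF s] by blast
  have o\<alpha>: "Ord \<alpha>" using Ord_elem[OF o\<delta> \<alpha>(1)] .
  let ?Q = "%w. (EX u v. w = pr u v & ap G u \<E> ap idf v) & w \<E> V \<alpha>"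
  have DQ1: "D (%C e. EX u v. e 0 = pr u v & ap G u \<E> ap idf v)" and DV: "D (%C e. e 0 \<E> V \<alpha>)"
    and DQ: "D (%C e. (EX u v. e 0 = pr u v & ap G u \<E> ap idf v) & e 0 \<E> V \<alpha>)" by (intro dfn)+
  have JQ: "J ?Q ?s" using J_and[OF DQ1 DV] h[unfolded hold_def] J_V[OF \<alpha>] by simp
  let ?R = "%t. EX w b. t = pr w b & (EX u v. w = pr u v & b = ap G u & b \<E> v)"
  have DR: "D (%C e. EX w b. e 0 = pr w b & (EX u v. w = pr u v & b = ap G u & b \<E> v))" by (intro dfn)
  have "EX b. b \<E> V \<alpha> & ?R (pr w b)" if w: "w \<E> V \<delta>" "?Q w" for w
  proof -
    obtain u v where uv: "w = pr u v" "ap G u \<E> ap idf v" using w by blast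
    have "v \<E> V \<delta>" using w(1) uv(1) Lim_pr[OF \<delta>_Lim] by simp
    then have m: "ap G u \<E> v" using uv(2) ap_idf by simp
    have "upair u v \<E> w" using uv(1) by (simp add: pr_eq)
    then have "v \<E> V \<alpha>" using V_trans[OF o\<alpha>] w(2) by (metis mem_upair)
    then have "ap G u \<E> V \<alpha>" using V_trans[OF o\<alpha> _ m] by blast
    then show ?thesis using m uv(1) by (intro exI[of _ "ap G u"]) auto
  qed
  then obtain b where b: "b \<E> hj (V \<alpha>)" "J ?R (pr ?s b)"
    using J_ex[of ?Q ?R "V \<alpha>" ?s, OF DQ DR V\<delta>[OF \<alpha>(1)] _ JQ] by blast
  have bN: "b \<E> N" using hj_V_N[OF \<alpha>(1) b(1)] .
  have sb: "pr ?s b \<E> N" using s bN N_pr by blast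
  let ?T = "%t. EX w b. t = pr w b & (EX u v. w = pr u v & b \<E> v)"
  have DT': "D (%C e. EX w b. e 0 = pr w b & (EX u v. w = pr u v & b \<E> v))" by (intro dfn)
  have "D0 (%e. EX w b. e 0 = pr w b & (EX u v. w = pr u v & b \<E> v))" by (intro D0_pr_comp d0)
  moreover have "J ?T (pr ?s b)" by (rule J_mono[OF DR DT' _ b(2)]) blast
  ultimately have "?T (pr ?s b)" using J_D0[of ?T, OF _ DT' sb] by blast
  then have "b \<E> y" by auto
  moreover have "hold (=) z G b idf"
  proof -
    have R: "D0 (%e. EX w b. e 0 = pr w b & (EX u v. w = pr u v & e 1 = pr u b))" by (intro D0_pr_comp d0)
    show ?thesis unfolding hold_def
    proof (rule J_imp2[OF DR D_holdQ[OF DE, of G idf], of "%t q a b. EX w b. t = pr w b & (EX u v. w = pr u v & q = pr u b)" emp emp "pr ?s b"])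
      fix t q assume "t \<E> V \<delta>" "q \<E> V \<delta>" "EX w b. t = pr w b & (EX u v. w = pr u v & q = pr u b)" "?R t"
      then show "EX u v. q = pr u v & ap G u = ap idf v" using Lim_pr[OF \<delta>_Lim] ap_idf by auto
    qed (use R emp_V b(2) N bN N_pr in auto)
  qed
  ultimately show thesis using that bN by blast
qed

text \<open>With the identity as function an element of \<open>N\<close> represents itself, by
  induction along membership. Hence the collapse contains \<open>N\<close> and the canonical map can
  be compared with the given one.\<close>

lemma kk_idf: "y \<E> N --> kk y idf = y"
proof (rule eps_induct[of "%y. y \<E> N --> kk y idf = y"])
  show "D (%C e. e 0 \<E> N --> kk (e 0) idf = e 0)" unfolding kk_def by (intro dfn)
next
  fix y assume IH: "!!z. z \<E> y ==> z \<E> N --> kk z idf = z"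
  show "y \<E> N --> kk y idf = y"
  proof (intro impI ext)
    fix x assume y: "y \<E> N"
    show "x \<E> kk y idf \<longleftrightarrow> x \<E> y"
    proof
      assume x: "x \<E> kk y idf"
      obtain z G where z: "z \<E> N" "x = kk z G" using x by (rule kk_elem)
      have "hold (\<E>) z G y idf" using kk_mem[OF z(1) y] x z(2) by simp
      then obtain b where b: "b \<E> y" "b \<E> N" "hold (=) z G b idf" by (rule seed_mem)
      have "kk z G = kk b idf" using kk_eq[OF z(1) b(2)] b(3) by blast
      then have "x = b" using z(2) b(2) IH[OF b(1)] by simp
      then show "x \<E> y" using b(1) by simp
    next
      assume x: "x \<E> y"
      have xN: "x \<E> N" using N_elem[OF y x] .
      let ?T = "%t. EX u v. t = pr u v & u \<E> v"
      have DT': "D (%C e. EX u v. e 0 = pr u v & u \<E> v)" by (intro dfn)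
      have "D0 (%e. EX u v. e 0 = pr u v & u \<E> v)" by (intro D0_pr_comp d0)
      then have J1: "J ?T (pr x y)" using J_D0[of ?T "pr x y", OF _ DT'] x xN y N_pr by auto
      have "hold (\<E>) x idf y idf" unfolding hold_def
        by (rule J_mono[OF DT' D_holdQ[OF DM] _ J1]) (use Lim_pr[OF \<delta>_Lim] ap_idf in auto)
      then have "kk x idf \<E> kk y idf" using kk_mem[OF xN y] by simp
      then show "x \<E> kk y idf" using IH[OF x] xN by simp
    qed
  qed
qed

text \<open>The seed \<open>hj x\<close> is principal by \<open>J_hj\<close>, so the identity at
  this seed equals the constant function with value \<open>x\<close>; \<open>kk_idf\<close>
  evaluates the former.\<close>

lemma ii_hj: assumes x: "x \<E> V \<delta>" shows "ii x = hj x"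
proof -
  have xN: "hj x \<E> N" using j_N[OF x] .
  have p: "pr x emp \<E> V \<delta>" using x emp_V Lim_pr[OF \<delta>_Lim] by simp
  have "hj (pr x emp) = pr (hj x) emp" using h_pr[of x emp] p h_emp emp_V by simp
  then have "hold (=) (hj x) idf emp (cst x)"
    unfolding hold_def using J_hj[OF D_holdQ[OF DE, of idf "cst x"] p] ap_idf[OF x] ap_cst[OF emp_V] by auto
  then have "kk (hj x) idf = ii x" unfolding ii_def using kk_eq[OF xN emp_N] by simp
  then show ?thesis using kk_idf xN by simp
qed

lemma V_critical: "V_critical E P \<kappa>"
proof -
  interpret emb: cofinal_emb E P ii MM
    by unfold_locales (use pres_ii Dii MM MM_cof in auto)
  have "ii \<alpha> = \<alpha>" if "\<alpha> \<E> \<kappa>" for \<alpha>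
    using ii_hj[OF V_trans[OF o\<delta> \<kappa>(2) that]] \<kappa>(4)[OF that] by simp
  then have "critical_point E ii UNIV \<kappa>"
    unfolding critical_point_def using \<kappa>(1,3) ii_hj[OF \<kappa>(2)] by auto
  then show ?thesis by (rule emb.V_critical)
qed

end

section \<open>Definability of pre-witnesses\<close>

text \<open>Definite descriptions are undefined off their domain and hence not uniformly definable; here they are
  replaced by functions with a default value.\<close>

definition RLd :: "('v => 'v => bool) => 'v => bool" where
  "RLd E N \<longleftrightarrow> (EX z:elts E N. is_empty_in E (elts E N) z) &
     extensionality_in E (elts E N) & foundation_in E (elts E N) & pairing_in E (elts E N) &
     union_in E (elts E N) & power_set_in E (elts E N) &
     (ALL \<phi> s. ALL i:elts E (omega E). ALL a:elts E N. is_fm E \<phi> & assignment E (elts E N) s -->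
        (EX b:elts E N. ALL x:elts E N. E x b \<longleftrightarrow> E x a &
           (EX t. assignment E (elts E N) t & vr E i s t & tapp E t i = x & models E N \<phi> t))) &
     (ALL \<alpha>:elts E N. is_ordinal_in E (elts E N) \<alpha> -->
        (EX s:elts E N. is_succ_in E (elts E N) \<alpha> s) &
        (EX v:elts E N. is_V_in E (elts E N) \<alpha> v) &
        (EX f:elts E N. is_Vseq_in E (elts E N) \<alpha> f)) &
     (ALL x:elts E N. EX \<alpha>:elts E N. EX v:elts E N.
        is_ordinal_in E (elts E N) \<alpha> & is_V_in E (elts E N) \<alpha> v & E x v)"

definition pwd :: "('v => 'v => bool) => 'v => 'v => 'v => 'v => bool" where
  "pwd E \<kappa> \<delta> N j \<longleftrightarrow> wLS E \<delta> & (ALL x:elts E N. ALL y:elts E x. E y N) & RLd E N &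
     (ALL y:elts E N. EX x:elts E (tV E \<delta>). E y (tapp E j x)) & maps E j (tV E \<delta>) N &
     (ALL \<phi> s t. is_Sigma1 E \<phi> & assignment E (elts E (tV E \<delta>)) s & assignment E (elts E N) t &
        (ALL n:elts E (omega E). tapp E t n = tapp E j (tapp E s n)) --> (models E (tV E \<delta>) \<phi> s \<longleftrightarrow> models E N \<phi> t)) &
     ordinal E \<kappa> & E \<kappa> (tV E \<delta>) & tapp E j \<kappa> ~= \<kappa> & (ALL \<alpha>:elts E \<kappa>. tapp E j \<alpha> = \<alpha>)"

text \<open>Condition (2) serves as the defining formula, with uncountable cofinality expressed by
  the absence of a cofinal map from \<open>omega\<close> instead of the description
  \<open>cof\<close>.\<close>

definition wd :: "('v => 'v => bool) => 'v => bool" where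
  "wd E \<kappa> \<longleftrightarrow> (EX \<delta> N j. pwd E \<kappa> \<delta> N j &
     ~ (EX f. maps E f (omega E) \<delta> & (ALL x:elts E \<delta>. EX y:elts E (omega E). ord_le E x (tapp E f y))))"

context zf2
begin

lemma RL_iff: "RL_model E N \<longleftrightarrow> RLd E N"
proof -
  have "(EX t. assignment E (el N) t & variant E i s t & app E t i = x & models E N \<phi> t) \<longleftrightarrow>
      (EX t. assignment E (el N) t & vr E i s t & ap t i = x & models E N \<phi> t)"
    if "assignment E (el N) s" "i \<E> om" for s i x \<phi>
    using variant_iff[OF that(1)] ap_app[OF asgD(1) that(2)] by metis
  then have "(ALL \<phi> s. ALL i:el om. ALL a:el N. is_fm E \<phi> & assignment E (el N) s -->
        (EX b:el N. ALL x:el N. x \<E> b \<longleftrightarrow> x \<E> a &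
           (EX t. assignment E (el N) t & variant E i s t & app E t i = x & models E N \<phi> t))) \<longleftrightarrow>
      (ALL \<phi> s. ALL i:el om. ALL a:el N. is_fm E \<phi> & assignment E (el N) s -->
        (EX b:el N. ALL x:el N. x \<E> b \<longleftrightarrow> x \<E> a &
           (EX t. assignment E (el N) t & vr E i s t & ap t i = x & models E N \<phi> t)))"
    unfolding el_ball[of om] by simp
  then show ?thesis unfolding RL_model_def RLd_def by argo
qed

lemma Sigma1_iff: "Sigma1_elementary E j A N \<longleftrightarrow> maps E j A N &
     (ALL \<phi> s t. is_Sigma1 E \<phi> & assignment E (el A) s & assignment E (el N) t &
        (ALL n:el om. ap t n = ap j (ap s n)) --> (models E A \<phi> s \<longleftrightarrow> models E N \<phi> t))"
proof -
  have "pointwise_image E (app E j) s t \<longleftrightarrow> (ALL n:el om. ap t n = ap j (ap s n))"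
    if "maps E j A N" "assignment E (el A) s" "assignment E (el N) t" for s t
  proof -
    have "fnc j A" using that(1) by (simp add: maps_iff)
    then show ?thesis unfolding pointwise_image_def el_ball
      using asgD[OF that(2)] asgD[OF that(3)] ap_app el_iff by metis
  qed
  then show ?thesis unfolding Sigma1_elementary_def by blast
qed

lemma pre_witness_iff: "pre_witness E \<kappa> \<delta> N j \<longleftrightarrow> pwd E \<kappa> \<delta> N j"
proof (cases "wLS E \<delta> & maps E j (V \<delta>) N")
  case True
  then have o: "Ord \<delta>" and f: "fnc j (V \<delta>)" using wLS_Ord by (auto simp: maps_iff)
  have c: "critical_point E (app E j) (el (V \<delta>)) \<kappa> \<longleftrightarrow>
      Ord \<kappa> & \<kappa> \<E> V \<delta> & ap j \<kappa> ~= \<kappa> & (ALL \<alpha>:el \<kappa>. ap j \<alpha> = \<alpha>)"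
  proof -
    have "(app E j \<kappa> ~= \<kappa> & (ALL \<alpha>. \<alpha> \<E> \<kappa> --> app E j \<alpha> = \<alpha>)) \<longleftrightarrow> (ap j \<kappa> ~= \<kappa> & (ALL \<alpha>. \<alpha> \<E> \<kappa> --> ap j \<alpha> = \<alpha>))" if "\<kappa> \<E> V \<delta>"
      using ap_app[OF f that] ap_app[OF f V_trans[OF o that]] by auto
    then show ?thesis unfolding critical_point_def el_ball el_iff by blast
  qed
  have d: "(ALL y:el N. EX x:el (V \<delta>). y \<E> app E j x) \<longleftrightarrow> (ALL y:el N. EX x:el (V \<delta>). y \<E> ap j x)"
    by (rule ball_cong[OF refl], rule bex_cong[OF refl]) (simp add: ap_app[OF f])
  have t: "transitive_class E (el N) \<longleftrightarrow> (ALL x:el N. ALL y:el x. y \<E> N)"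
    unfolding transitive_class_def subset_iff el_ball el_iff ..
  show ?thesis unfolding pre_witness_def pwd_def RL_iff Sigma1_iff VV_eq[OF o] c d t by argo
next
  case False
  have "~ pwd E \<kappa> \<delta> N j" unfolding pwd_def using False by blast
  moreover have "~ pre_witness E \<kappa> \<delta> N j"
    unfolding pre_witness_def Sigma1_elementary_def using False VV_eq[OF wLS_Ord, of \<delta>] by auto
  ultimately show ?thesis by blast
qed

lemma wd_iff: "(EX \<delta> N j. pre_witness E \<kappa> \<delta> N j & om \<E> cof E \<delta>) \<longleftrightarrow> wd E \<kappa>"
proof -
  have "om \<E> cof E \<delta> \<longleftrightarrow> ~ (EX f. maps E f om \<delta> & (ALL x:el \<delta>. EX y:el om. ord_le E x (ap f y)))"
    if "pre_witness E \<kappa> \<delta> N j" for \<delta> N j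
  proof -
    interpret pre_wit E P \<kappa> \<delta> N j by unfold_locales (rule that)
    show ?thesis using om_cof[OF o\<delta>] \<delta>_Lim unfolding Lim_def cofmap_def by blast
  qed
  then show ?thesis unfolding wd_def pre_witness_iff[symmetric] by blast
qed

end

lemma (in definability) D_wd: "D (%w e. wd (EE w) (e 0))"
  unfolding wd_def pwd_def RLd_def by (intro dfn)

text \<open>Applying \<open>gdf\<close> to all models at once yields a single formula, where
  \<open>ldf\<close> would give one for each structure and with parameters.\<close>

lemma wd_first_order:
  obtains \<phi> where "first_order \<phi>" "!!(E :: 'v => 'v => bool) P e C. ZF2 E P ==> sat2 E P e C \<phi> \<longleftrightarrow> wd E (e 0)"
proof -
  let ?W = "{w. ZF2 (fst w) (snd w)} :: (('v => 'v => bool) \<times> 'v set set) set"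
  interpret definability ?W fst "gdf first_order ?W"
  proof unfold_locales
    show "gdf first_order ?W Q'" if "gdf first_order ?W Q" "!!w e. w \<in> ?W ==> Q w e = Q' w e" for Q Q'
      by (rule gdf_cong[OF that])
    show "gdf first_order ?W (%w e. EX y. Q w e y)" if "gdf first_order ?W (%w e. Q w (%n. e (Suc n)) (e 0))" for Q
      by (rule gdf_ex[OF _ that]) simp
    show "gdf first_order ?W (%w e. Q w (%n. e (r n)))" if "gdf first_order ?W Q" for Q r
      by (rule gdf_ren[OF that])
  qed (auto intro: gdf_Mem gdf_Eq gdf_not gdf_and)
  obtain \<phi> where "first_order \<phi>" "ALL w:?W. ALL e C. sat2 (fst w) (snd w) e C \<phi> \<longleftrightarrow> wd (fst w) (e 0)"
    using D_wd unfolding gdf_def by (elim exE conjE allE[of _ "%n. n"])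
  then show thesis using that[of \<phi>] by force
qed

lemma (in zf2) critical_imp_pre_witness:
  assumes "V_critical E P \<kappa>" "proper_class_wLS E"
  shows "EX \<delta> N j. pre_witness E \<kappa> \<delta> N j & om \<E> cof E \<delta>"
proof -
  obtain M J where "M \<in> P" "J \<in> P" "transitive_class E M" "class_elementary E P J M"
    "critical_point E (class_app E J) UNIV \<kappa>" using assms(1) unfolding V_critical_def by blast
  then interpret embedding E P M J \<kappa> by unfold_locales (use assms(2) in auto)
  show ?thesis by (rule pre_witness_ex)
qed

lemma (in zf2) uncountable_cof_imp_wellfounded:
  assumes "pre_witness E \<kappa> \<delta> N j" "om \<E> cof E \<delta>"
  shows "Ult0_wellfounded E \<delta> N (derived_extender E \<delta> N j)"
proof -
  interpret pre_wit E P \<kappa> \<delta> N j by unfold_locales (rule assms)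
  show ?thesis by (rule uncountable_cof_wf[OF assms(2)])
qed

lemma (in zf2) wellfounded_imp_critical:
  assumes "pre_witness E \<kappa> \<delta> N j" "Ult0_wellfounded E \<delta> N (derived_extender E \<delta> N j)"
  shows "V_critical E P \<kappa>"
proof -
  interpret ult_wit E P \<kappa> \<delta> N j by unfold_locales (rule assms)+
  show ?thesis by (rule V_critical)
qed

theorem theorem5p8:
  "(\<forall>(E :: 'v \<Rightarrow> 'v \<Rightarrow> bool) P \<kappa>. ZF2 E P \<and> proper_class_wLS E \<and> ordinal E \<kappa> \<longrightarrow>
      (V_critical E P \<kappa> \<longleftrightarrow>
         (\<exists>\<delta> N j. pre_witness E \<kappa> \<delta> N j \<and> E (omega E) (cof E \<delta>))) \<and>
      (V_critical E P \<kappa> \<longleftrightarrow>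
         (\<exists>\<delta> N j. pre_witness E \<kappa> \<delta> N j \<and>
            Ult0_wellfounded E \<delta> N (derived_extender E \<delta> N j)))) \<and>
   (\<exists>\<phi>. first_order \<phi> \<and>
      (\<forall>(E :: 'v \<Rightarrow> 'v \<Rightarrow> bool) P e C. ZF2 E P \<and> proper_class_wLS E \<longrightarrow>
         (V_critical E P (e 0) \<longleftrightarrow> sat2 E P e C \<phi>)))"
proof -
  have crit: "(V_critical E P \<kappa> \<longleftrightarrow> (EX \<delta> N j. pre_witness E \<kappa> \<delta> N j & E (omega E) (cof E \<delta>))) &
      (V_critical E P \<kappa> \<longleftrightarrow>
         (EX \<delta> N j. pre_witness E \<kappa> \<delta> N j & Ult0_wellfounded E \<delta> N (derived_extender E \<delta> N j)))"
    if "ZF2 E P" "proper_class_wLS E" for E :: "'v => 'v => bool" and P \<kappa>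
  proof -
    interpret zf2 E P by unfold_locales (rule that)
    show ?thesis
      using critical_imp_pre_witness[OF _ that(2)] uncountable_cof_imp_wellfounded wellfounded_imp_critical by blast
  qed
  obtain \<phi> where \<phi>: "first_order \<phi>"
    "!!(E :: 'v => 'v => bool) P e C. ZF2 E P ==> sat2 E P e C \<phi> \<longleftrightarrow> wd E (e 0)"
    by (rule wd_first_order) (rule that)
  have "V_critical E P (e 0) \<longleftrightarrow> sat2 E P e C \<phi>"
    if "ZF2 E P" "proper_class_wLS E" for E :: "'v => 'v => bool" and P e C
    using crit[OF that] zf2.wd_iff[OF zf2.intro[OF that(1)]] \<phi>(2)[OF that(1)] by blast
  then show ?thesis using crit \<phi>(1) by blast
qed

end
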